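(* Let $d=2$, $\psi(t)=t^2/2$, and let $D\subset B(0,1)\subset\mathbb{R}^2$ be a set of finite perimeter satisfying the following assumption with constants $\xi_D\in(0,1)$ and $r_0>0$: for any $A\subset\mathbb{R}^2$ admitting a variational mean curvature in $L^2(\mathbb{R}^2)$, any $x\in\mathbb{R}^2$ and any $0<r\leq r_0$, $$\int_{A\cap B(x,r)}\kappa_D^+\leq\xi_D\operatorname{Per}(B(x,r)\cap A),\qquad \int_{A\cap B(x,r)}\kappa_D^-\leq\xi_D\operatorname{Per}(B(x,r)\cap A),$$ where $\kappa_D^+=\max(\kappa_D,0)$, $\kappa_D^-=-\min(\kappa_D,0)$. Let $\eta$ satisfy $0\le\eta<2\sqrt{\pi}(1-\xi_D)$. Then there is $C_0\in(0,1)$ such that for every $\alpha>0$ and $w\in L^2(\mathbb{R}^2)$ with $\|w\|_{L^2}/\alpha\leq\eta$, denoting by $u_{\alpha,w}$ the minimizer of $u\mapsto\int_{\mathbb{R}^2}\frac12(u-1_D-w)^2\,dx+\alpha\operatorname{TV}(u)$ over $\operatorname{BV}(\mathbb{R}^2)$, for a.e. $s$ the level set $E^s_{\alpha,w}:=\{u_{\alpha,w}>s\}$ (if $s>0$), resp. $E^s_{\alpha,w}:=\{u_{\alpha,w}<s\}$ (if $s<0$), satisfies $$\frac{|E^s_{\alpha,w}\cap B(x,r)|}{|B(x,r)|}\geq C_0\quad\text{and}\quad\frac{|B(x,r)\setminus E^s_{\alpha,w}|}{|B(x,r)|}\geq C_0$$ for all $x\in\partial E^s_{\alpha,w}$ and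 all $0<r\leq r_0$.
   Context: $\operatorname{TV}$ is the total variation, $\operatorname{BV}(\mathbb{R}^2)=\{u\in L^1_{loc}:\operatorname{TV}(u)<\infty\}$, $\operatorname{Per}(E)=\operatorname{TV}(1_E)$. A set $A$ has variational mean curvature $\kappa$ if $A$ minimizes $E\mapsto\operatorname{Per}(E)-\int_E\kappa$ among subsets $E$ of the plane. Definition of $\kappa_D$ (for $D\subset B(0,1)$ of finite perimeter in $\mathbb{R}^d$): fix $g_2\in L^1(\mathbb{R}^d)$ with $g_2=1$ on $\overline{B(0,2)}$, $0<g_2\leq 1$, and such that for every compact $K$ there is $c_K>0$ with $g_2\geq c_K$ a.e. on $K$. For $\lambda>0$ consider $P_{in}(\lambda)$: $\min_{E\subset D}\operatorname{Per}(E)-\lambda\int_E g_2$, and $P_{out}(\lambda)$: $\min_{F\subset\mathbb{R}^d\setminus D}\operatorname{Per}(F)-\lambda\int_F g_2$. Then $\kappa_D(x)=\inf\{\lambda g_2(x):\lambda>0,\ x\in E^\lambda \text{ for some minimizer } E^\lambda \text{ of } P_{in}(\lambda)\}$ for $x\in D$, and $\kappa_D(x)=-\inf\{\lambda g_2(x):\lambda>0,\ x\in F^\lambda\text{ for some minimizer } F^\lambda\text{ of } P_{out}(\lambda)\}$ for $x\in\mathbb{R}^d\setminus D$. Convention: each measurable set $E$ is identified with its representative with $\partial E=\{x:0<|E\cap B(x,r)|/|B(x,r)|<1\ \forall r>0\}$. *)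

theory Defs
  imports "HOL-Analysis.Analysis"
begin

type_synonym pt = "real ^ 2"

definition divergence :: "(pt \<Rightarrow> pt) \<Rightarrow> pt \<Rightarrow> real" where
  "divergence \<phi> x = (\<Sum>i\<in>UNIV. (frechet_derivative \<phi> (at x) (axis i 1)) $ i)"

definition test_fields :: "(pt \<Rightarrow> pt) set" where
  "test_fields = {\<phi>. (\<forall>x. \<phi> differentiable at x)
      \<and> (\<forall>v. continuous_on UNIV (\<lambda>x. frechet_derivative \<phi> (at x) v))
      \<and> compact (closure {x. \<phi> x \<noteq> 0})
      \<and> (\<forall>x. norm (\<phi> x) \<le> 1)}"

definition L1_loc :: "(pt \<Rightarrow> real) \<Rightarrow> bool" where
  "L1_loc u \<longleftrightarrow> u \<in> borel_measurable lebesgue \<and>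
     (\<forall>K. compact K \<longrightarrow> set_integrable lebesgue K u)"

definition TV :: "(pt \<Rightarrow> real) \<Rightarrow> ereal" where
  "TV u = (SUP \<phi>\<in>test_fields. ereal (integral\<^sup>L lebesgue (\<lambda>x. u x * divergence \<phi> x)))"

definition BV :: "(pt \<Rightarrow> real) set" where
  "BV = {u. L1_loc u \<and> TV u < \<infinity>}"

definition Per :: "pt set \<Rightarrow> ereal" where
  "Per E = TV (indicator E)"

definition L2 :: "(pt \<Rightarrow> real) set" where
  "L2 = {w. w \<in> borel_measurable lebesgue \<and> integrable lebesgue (\<lambda>x. (w x)\<^sup>2)}"

definition L2_norm :: "(pt \<Rightarrow> real) \<Rightarrow> real" where
  "L2_norm w = sqrt (integral\<^sup>L lebesgue (\<lambda>x. (w x)\<^sup>2))"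

text \<open>Measure-theoretic boundary (the topological boundary of the normalized representative).\<close>
definition mboundary :: "pt set \<Rightarrow> pt set" where
  "mboundary E = {x. \<forall>r>0. 0 < measure lebesgue (E \<inter> ball x r) / measure lebesgue (ball x r)
                          \<and> measure lebesgue (E \<inter> ball x r) / measure lebesgue (ball x r) < 1}"

text \<open>Convention: a measurable set is represented by the representative whose topological
  boundary equals the measure-theoretic one.\<close>
definition normalized :: "pt set \<Rightarrow> bool" where
  "normalized E \<longleftrightarrow> E \<in> sets lebesgue \<and> frontier E = mboundary E"

definition has_var_mean_curv :: "pt set \<Rightarrow> (pt \<Rightarrow> real) \<Rightarrow> bool" where
  "has_var_mean_curv A \<kappa> \<longleftrightarrow> A \<in> sets lebesgue \<and> set_integrable lebesgue A \<kappa> \<and>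
     (\<forall>E\<in>sets lebesgue. set_integrable lebesgue E \<kappa> \<longrightarrow>
        Per A - ereal (LINT x:A|lebesgue. \<kappa> x) \<le> Per E - ereal (LINT x:E|lebesgue. \<kappa> x))"

definition admissible_g2 :: "(pt \<Rightarrow> real) \<Rightarrow> bool" where
  "admissible_g2 g \<longleftrightarrow> integrable lebesgue g \<and> (\<forall>x\<in>cball 0 2. g x = 1) \<and>
     (\<forall>x. 0 < g x \<and> g x \<le> 1) \<and>
     (\<forall>K. compact K \<longrightarrow> (\<exists>c>0. AE x in lebesgue. x \<in> K \<longrightarrow> c \<le> g x))"

definition constrained_min :: "(pt \<Rightarrow> real) \<Rightarrow> pt set \<Rightarrow> real \<Rightarrow> pt set \<Rightarrow> bool" where
  "constrained_min g S lam E \<longleftrightarrow> E \<in> sets lebesgue \<and> E \<subseteq> S \<and>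
     (\<forall>E'\<in>sets lebesgue. E' \<subseteq> S \<longrightarrow>
        Per E - ereal (lam * (LINT x:E|lebesgue. g x)) \<le> Per E' - ereal (lam * (LINT x:E'|lebesgue. g x)))"

definition kappa_D :: "(pt \<Rightarrow> real) \<Rightarrow> pt set \<Rightarrow> pt \<Rightarrow> ereal" where
  "kappa_D g D x =
    (if x \<in> D then
       Inf {ereal (lam * g x) | lam. lam > 0 \<and> (\<exists>E. normalized E \<and> constrained_min g D lam E \<and> x \<in> E)}
     else
       - Inf {ereal (lam * g x) | lam. lam > 0 \<and> (\<exists>F. normalized F \<and> constrained_min g (- D) lam F \<and> x \<in> F)})"

definition kappa_plus :: "(pt \<Rightarrow> real) \<Rightarrow> pt set \<Rightarrow> pt \<Rightarrow> ennreal" where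
  "kappa_plus g D x = e2ennreal (max (kappa_D g D x) 0)"

definition kappa_minus :: "(pt \<Rightarrow> real) \<Rightarrow> pt set \<Rightarrow> pt \<Rightarrow> ennreal" where
  "kappa_minus g D x = e2ennreal (- min (kappa_D g D x) 0)"

definition ROF_energy :: "real \<Rightarrow> (pt \<Rightarrow> real) \<Rightarrow> (pt \<Rightarrow> real) \<Rightarrow> ereal" where
  "ROF_energy \<alpha> f u = enn2ereal (\<integral>\<^sup>+ x. ennreal ((u x - f x)\<^sup>2 / 2) \<partial>lebesgue) + ereal \<alpha> * TV u"

definition ROF_minimizer :: "real \<Rightarrow> (pt \<Rightarrow> real) \<Rightarrow> (pt \<Rightarrow> real) \<Rightarrow> bool" where
  "ROF_minimizer \<alpha> f u \<longleftrightarrow> u \<in> BV \<and> (\<forall>v\<in>BV. ROF_energy \<alpha> f u \<le> ROF_energy \<alpha> f v)"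

definition level_set :: "(pt \<Rightarrow> real) \<Rightarrow> real \<Rightarrow> pt set" where
  "level_set u s = (if s > 0 then {x. u x > s} else {x. u x < s})"

end

theory Submission
  imports Defs
begin

text \<open>
  The minimizer u for data f is in duality with v = (f - u) / \<alpha>: the pairing of v with u is TV u, and
  the integral of v over a set of finite measure is at most its perimeter. Hence a superlevel set E of u
  (at positive height) has perimeter equal to the integral of v over E, and replacing v outside E by a
  sufficiently negative function gives a variational mean curvature of E in L2.

  By nonexpansiveness v differs in L2 by at most \<eta> from the dual variable v0 of the noiseless problem.
  The minimizers of the constrained problems that define \<kappa>_D have uniform density at their points,
  and comparison with them gives v0^+ \<le> \<kappa>_D^+ and v0^- \<le> \<kappa>_D^-. The assumption on \<kappa>_D, the
  Cauchy-Schwarz and the isoperimetric inequality then bound the integral of v over E \<inter> B(x, r) by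
  \<theta> Per (E \<inter> B(x, r)) with \<theta> = \<xi>_D + \<eta> / (2 sqrt \<pi>) < 1, so that
  Per E \<le> Per (E - B(x, r)) + \<theta> Per (E \<inter> B(x, r)). A differential inequality for the area of
  E \<inter> B(x, r) yields the density ((1 - \<theta>) / 2)^2.

  The complement of E is treated alike, provided that the negative of its curvature is integrable; this
  holds when w is truncated to a ball, and the density bounds survive the limit of large balls.
\<close>

section \<open>Total variation and perimeter\<close>

text \<open>\<open>TV\<close> is only a supremum over test fields, and every perimeter fact is
  extracted from it in one way. To bound a sum of two variations, take one field for each term and
  glue the pair into admissible fields for the right-hand side; cutting by a ball, submodularity and
  chopping at a level differ in the weights of the gluing. The weights must be regular, hence the
  mollification and the lower semicontinuity.

  The threshold \<open>2 * sqrt pi * (1 - \<xi>D)\<close> reflects the sharp isoperimetric constant: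
  the noise contributes at most \<eta> times the root of the area of a piece, that is \<eta> / (2
  sqrt pi) times its perimeter. A weaker constant would not give \<theta> < 1 on the whole range of
  \<eta>, hence the transport argument.

  \<open>kappa_D\<close> is defined pointwise, by the minimizers that contain a given point, while a
  comparison of sets holds only almost everywhere. The density of those minimizers is what makes the
  two compatible.\<close>

lemma test_fieldsI:
  assumes d: "\<And>x. (\<phi> has_derivative \<phi>' x) (at x)"
    and c: "\<And>v. continuous_on UNIV (\<lambda>x. \<phi>' x v)"
    and s: "\<And>x. R < norm x \<Longrightarrow> \<phi> x = 0"
    and n: "\<And>x. norm (\<phi> x) \<le> 1"
  shows "\<phi> \<in> test_fields"
proof -
  have "closure {x. \<phi> x \<noteq> 0} \<subseteq> cball 0 R"
    by (rule closure_minimal) (use s in force)+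
  hence "compact (closure {x. \<phi> x \<noteq> 0})"
    by (meson bounded_cball bounded_subset closed_closure compact_eq_bounded_closed)
  moreover have "frechet_derivative \<phi> (at x) = \<phi>' x" for x
    using d frechet_derivative_at by metis
  ultimately show ?thesis
    unfolding test_fields_def using c d n by (auto simp: differentiable_def)
qed

lemma divergence_eq:
  assumes "(\<phi> has_derivative \<phi>') (at x)"
  shows "divergence \<phi> x = (\<Sum>i\<in>UNIV. (\<phi>' (axis i 1)) $ i)"
  unfolding divergence_def using frechet_derivative_at[OF assms] by simp

text \<open>Fixes a derivative and a support radius for a test field, so that estimates can be
  written with \<open>\<phi>'\<close> and a ball instead of \<open>frechet_derivative\<close> and
  the closure of a support.\<close>

definition C1c_field :: "(pt \<Rightarrow> pt) \<Rightarrow> (pt \<Rightarrow> pt \<Rightarrow> pt) \<Rightarrow> real \<Rightarrow> bool" where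
  "C1c_field \<phi> \<phi>' R \<longleftrightarrow> (\<forall>x. (\<phi> has_derivative \<phi>' x) (at x)) \<and>
    (\<forall>v. continuous_on UNIV (\<lambda>x. \<phi>' x v)) \<and> (\<forall>x. norm (\<phi> x) \<le> 1) \<and> 0 < R \<and>
    (\<forall>x. R < norm x \<longrightarrow> \<phi> x = 0) \<and> (\<forall>x v. R < norm x \<longrightarrow> \<phi>' x v = 0)"

lemma C1c_fieldD:
  assumes "C1c_field \<phi> \<phi>' R"
  shows "\<And>x. (\<phi> has_derivative \<phi>' x) (at x)"
    "\<And>v. continuous_on UNIV (\<lambda>x. \<phi>' x v)" "\<And>x. norm (\<phi> x) \<le> 1" "0 < R"
    "\<And>x. R < norm x \<Longrightarrow> \<phi> x = 0" "\<And>x v. R < norm x \<Longrightarrow> \<phi>' x v = 0"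
    "\<And>x. divergence \<phi> x = (\<Sum>i\<in>UNIV. (\<phi>' x (axis i 1)) $ i)"
  using assms divergence_eq[of \<phi> "\<phi>' _"] unfolding C1c_field_def by auto

lemma test_fieldsE:
  assumes "\<phi> \<in> test_fields"
  obtains \<phi>' R where "C1c_field \<phi> \<phi>' R"
proof -
  define \<phi>' where "\<phi>' x = frechet_derivative \<phi> (at x)" for x
  have d: "(\<phi> has_derivative \<phi>' x) (at x)" for x
    using assms unfolding test_fields_def \<phi>'_def by (simp add: frechet_derivative_works)
  have c: "continuous_on UNIV (\<lambda>x. \<phi>' x v)" for v
    using assms unfolding test_fields_def \<phi>'_def by simp
  have "bounded (closure {x. \<phi> x \<noteq> 0})"
    using assms unfolding test_fields_def by (simp add: compact_imp_bounded)
  then obtain R where R: "R > 0" "\<And>x. x \<in> closure {x. \<phi> x \<noteq> 0} \<Longrightarrow> norm x \<le> R"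
    unfolding bounded_pos by blast
  have z: "\<phi> x = 0" if "R < norm x" for x
    using R(2)[of x] that closure_subset[of "{x. \<phi> x \<noteq> 0}"] by fastforce
  have "\<phi>' x v = 0" if "R < norm x" for x v
  proof -
    have op: "open {x :: pt. R < norm x}"
      by (intro open_Collect_less continuous_intros)
    have "((\<lambda>_. 0) has_derivative (\<lambda>_. 0)) (at x)" by simp
    hence "(\<phi> has_derivative (\<lambda>_. 0)) (at x)"
      by (rule has_derivative_transform_within_open[OF _ op]) (use that z in auto)
    thus ?thesis using has_derivative_unique[OF d] by metis
  qed
  with d c R z show ?thesis
    using assms by (intro that[of \<phi>' R]) (auto simp: test_fields_def C1c_field_def)
qed

lemma C1c_integrable:
  fixes f :: "pt \<Rightarrow> real"
  assumes c: "continuous_on UNIV f" and z: "\<And>x. R < norm x \<Longrightarrow> f x = 0"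
  shows "integrable lborel f" "\<exists>B\<ge>0. \<forall>x. \<bar>f x\<bar> \<le> B"
proof -
  have "integrable lborel (\<lambda>x. indicator (cball 0 R) x *\<^sub>R f x)"
    by (rule borel_integrable_compact) (auto intro: continuous_on_subset[OF c])
  moreover have "indicator (cball 0 R) x *\<^sub>R f x = f x" for x
    using z[of x] by (cases "x \<in> cball 0 R") auto
  ultimately show "integrable lborel f" by (simp only:)
  have "compact (f ` cball 0 R)"
    by (intro compact_continuous_image continuous_on_subset[OF c]) auto
  then obtain B where B: "B > 0" "\<And>x. x \<in> cball 0 R \<Longrightarrow> \<bar>f x\<bar> \<le> B"
    using compact_imp_bounded[of "f ` cball 0 R"] unfolding bounded_pos by auto
  have "\<bar>f x\<bar> \<le> B" for x
    using B(1) B(2)[of x] z[of x] by (cases "x \<in> cball 0 R") auto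
  thus "\<exists>B\<ge>0. \<forall>x. \<bar>f x\<bar> \<le> B" using B(1) by (intro exI[of _ B]) auto
qed

lemma test_fields_divergence:
  assumes "\<phi> \<in> test_fields"
  shows "\<exists>R B. continuous_on UNIV (divergence \<phi>) \<and> 0 < R \<and> 0 \<le> B \<and>
    (\<forall>x. R < norm x \<longrightarrow> divergence \<phi> x = 0 \<and> \<phi> x = 0) \<and> (\<forall>x. \<bar>divergence \<phi> x\<bar> \<le> B)"
proof -
  obtain \<phi>' R where "C1c_field \<phi> \<phi>' R"
    using test_fieldsE[OF assms] by blast
  note * = C1c_fieldD[OF this]
  have e: "divergence \<phi> = (\<lambda>x. \<Sum>i\<in>UNIV. (\<phi>' x (axis i 1)) $ i)" using *(7) by auto
  have c: "continuous_on UNIV (divergence \<phi>)"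
    unfolding e by (intro continuous_intros *(2))
  have z: "divergence \<phi> x = 0" if "R < norm x" for x
    using *(6)[OF that] *(7) by simp
  obtain B where "B \<ge> 0" "\<And>x. \<bar>divergence \<phi> x\<bar> \<le> B" using C1c_integrable(2)[OF c z] by auto
  thus ?thesis using c *(4) z *(5) by blast
qed

lemma divergence_measurable [measurable]:
  assumes "\<phi> \<in> test_fields" shows "divergence \<phi> \<in> borel_measurable borel"
  using test_fields_divergence[OF assms] borel_measurable_continuous_onI[of "divergence \<phi>"] by blast

lemma L1_loc_ball: "L1_loc u \<Longrightarrow> integrable lebesgue (\<lambda>x. indicator (cball 0 R) x * u x)"
  unfolding L1_loc_def set_integrable_def by auto

lemma L1_locI:
  assumes "u \<in> borel_measurable lebesgue"
    and "\<And>R. integrable lebesgue (\<lambda>x. indicator (cball 0 R) x * u x)"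
  shows "L1_loc u"
  unfolding L1_loc_def
proof (intro conjI allI impI assms)
  fix K :: "pt set" assume K: "compact K"
  then obtain R where R: "\<And>x. x \<in> K \<Longrightarrow> norm x \<le> R"
    using compact_imp_bounded[of K] unfolding bounded_iff by auto
  have "set_integrable lebesgue (cball 0 R) u"
    using assms(2) by (simp add: set_integrable_def)
  thus "set_integrable lebesgue K u"
    by (rule set_integrable_subset) (use K R in \<open>auto intro: lmeasurable_compact fmeasurableD\<close>)
qed

lemma L1_loc_measurable: "L1_loc u \<Longrightarrow> u \<in> borel_measurable lebesgue"
  unfolding L1_loc_def by auto

lemma L1_loc_div_integrable:
  assumes u: "L1_loc u" and p: "\<phi> \<in> test_fields"
  shows "integrable lebesgue (\<lambda>x. u x * divergence \<phi> x)"
proof -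
  obtain R B where *: "0 \<le> B" "\<forall>x. R < norm x \<longrightarrow> divergence \<phi> x = 0 \<and> \<phi> x = 0"
     "\<forall>x. \<bar>divergence \<phi> x\<bar> \<le> B"
    using test_fields_divergence[OF p] by blast
  have m[measurable]: "divergence \<phi> \<in> borel_measurable lebesgue"
    using divergence_measurable[OF p] by (intro measurable_completion) auto
  have mu[measurable]: "u \<in> borel_measurable lebesgue" using u by (rule L1_loc_measurable)
  have "integrable lebesgue (\<lambda>x. B * (indicator (cball 0 R) x * u x))"
    using L1_loc_ball[OF u] by (intro integrable_mult_right)
  thus ?thesis
  proof (rule Bochner_Integration.integrable_bound)
    show "AE x in lebesgue. norm (u x * divergence \<phi> x) \<le> norm (B * (indicator (cball 0 R) x * u x))"
      using * by (intro AE_I2) (auto simp: indicator_def abs_mult mult.commute[of B] intro!: mult_left_mono)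
  qed measurable
qed

lemma zero_test_field: "(\<lambda>_. 0) \<in> test_fields"
  by (rule test_fieldsI[where \<phi>' = "\<lambda>_ _. 0" and R = 0]) auto

lemma TV_upper: "\<phi> \<in> test_fields \<Longrightarrow> ereal (\<integral>x. u x * divergence \<phi> x \<partial>lebesgue) \<le> TV u"
  unfolding TV_def by (rule SUP_upper)

lemma TV_least: "(\<And>\<phi>. \<phi> \<in> test_fields \<Longrightarrow> ereal (\<integral>x. u x * divergence \<phi> x \<partial>lebesgue) \<le> c) \<Longrightarrow> TV u \<le> c"
  unfolding TV_def by (rule SUP_least)

lemma TV_nonneg [simp]: "0 \<le> TV u"
proof -
  have "divergence (\<lambda>_. 0) = (\<lambda>_. 0)"
    by (rule ext, subst divergence_eq[where \<phi>'="\<lambda>_. 0"]) auto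
  thus ?thesis using TV_upper[OF zero_test_field, of u] by (simp add: zero_ereal_def)
qed

lemma Per_nonneg [simp]: "0 \<le> Per E"
  by (simp add: Per_def)

lemma TV_not_MInf [simp]: "TV u \<noteq> -\<infinity>" "Per E \<noteq> -\<infinity>"
proof -
  have "\<not> 0 \<le> (-\<infinity>::ereal)" by simp
  thus "TV u \<noteq> -\<infinity>" "Per E \<noteq> -\<infinity>" by (metis TV_nonneg, metis Per_nonneg)
qed

text \<open>The two suprema run over independent fields, so a bound for all pairs bounds the sum.
  The zero field shows that each term is finite once pairs are bounded, which makes the subtractions
  in \<open>ereal\<close> legitimate.\<close>

lemma TV_add_least:
  assumes "\<And>\<phi> \<psi>. \<phi> \<in> test_fields \<Longrightarrow> \<psi> \<in> test_fields \<Longrightarrow>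
     (\<integral>x. u x * divergence \<phi> x \<partial>lebesgue) + (\<integral>x. v x * divergence \<psi> x \<partial>lebesgue) \<le> c"
  shows "TV u + TV v \<le> ereal c"
proof -
  have "TV v \<le> ereal (c - (\<integral>x. u x * divergence \<phi> x \<partial>lebesgue))" if "\<phi> \<in> test_fields" for \<phi>
    by (rule TV_least) (use assms[OF that] in force)
  hence *: "ereal (\<integral>x. u x * divergence \<phi> x \<partial>lebesgue) + TV v \<le> c" if "\<phi> \<in> test_fields" for \<phi>
    using that by (cases "TV v") (fastforce simp: algebra_simps)+
  obtain t where t: "TV v = ereal t"
    using *[OF zero_test_field] TV_not_MInf(1)[of v] by (cases "TV v") auto
  have "TV u \<le> ereal (c - t)"
    by (rule TV_least) (use * t in force)
  thus ?thesis using t by (cases "TV u") auto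
qed

lemma TV_bound_scale:
  assumes "TV u \<le> c" "0 \<le> a"
  shows "TV (\<lambda>x. a * u x) \<le> ereal a * c"
proof (rule TV_least)
  fix \<phi> assume "\<phi> \<in> test_fields"
  hence "ereal (\<integral>x. u x * divergence \<phi> x \<partial>lebesgue) \<le> c" using TV_upper assms order_trans by blast
  hence "ereal a * ereal (\<integral>x. u x * divergence \<phi> x \<partial>lebesgue) \<le> ereal a * c"
    using assms(2) by (intro ereal_mult_left_mono) auto
  thus "ereal (\<integral>x. a * u x * divergence \<phi> x \<partial>lebesgue) \<le> ereal a * c"
    by (simp add: mult.assoc)
qed

lemma minus_test_field: assumes "\<phi> \<in> test_fields"
  shows "(\<lambda>x. - \<phi> x) \<in> test_fields" "divergence (\<lambda>x. - \<phi> x) x = - divergence \<phi> x"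
proof -
  obtain \<phi>' R where "C1c_field \<phi> \<phi>' R"
    using test_fieldsE[OF assms] by blast
  note * = C1c_fieldD[OF this]
  have d: "((\<lambda>x. - \<phi> x) has_derivative (\<lambda>v. - \<phi>' x v)) (at x)" for x
    by (intro derivative_intros *(1))
  show "(\<lambda>x. - \<phi> x) \<in> test_fields"
    by (rule test_fieldsI[OF d, of R]) (use *(2,3,5) in \<open>auto intro!: continuous_intros\<close>)
  show "divergence (\<lambda>x. - \<phi> x) x = - divergence \<phi> x"
    using divergence_eq[OF d] *(7) by (simp add: sum_negf)
qed

lemma TV_minus: "TV (\<lambda>x. - u x) = TV u"
proof -
  have "TV (\<lambda>x. - u x) \<le> TV u" for u
  proof (rule TV_least)
    fix \<phi> assume p: "\<phi> \<in> test_fields"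
    show "ereal (\<integral>x. - u x * divergence \<phi> x \<partial>lebesgue) \<le> TV u"
      using TV_upper[OF minus_test_field(1)[OF p], of u] minus_test_field(2)[OF p] by simp
  qed
  from this[of u] this[of "\<lambda>x. - u x"] show ?thesis by simp
qed

lemma TV_add:
  assumes "L1_loc u" "L1_loc v"
  shows "TV (\<lambda>x. u x + v x) \<le> TV u + TV v"
proof (rule TV_least)
  fix \<phi> assume p: "\<phi> \<in> test_fields"
  have "(\<integral>x. (u x + v x) * divergence \<phi> x \<partial>lebesgue) =
    (\<integral>x. u x * divergence \<phi> x \<partial>lebesgue) + (\<integral>x. v x * divergence \<phi> x \<partial>lebesgue)"
    using L1_loc_div_integrable[OF assms(1) p] L1_loc_div_integrable[OF assms(2) p]
    by (simp add: distrib_right)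
  thus "ereal (\<integral>x. (u x + v x) * divergence \<phi> x \<partial>lebesgue) \<le> TV u + TV v"
    using TV_upper[OF p, of u] TV_upper[OF p, of v]
    using add_mono[of "ereal (\<integral>x. u x * divergence \<phi> x \<partial>lebesgue)" "TV u"
        "ereal (\<integral>x. v x * divergence \<phi> x \<partial>lebesgue)" "TV v"] by simp
qed

section \<open>Translations and integrals of derivatives\<close>

lemma integral_translation_lborel:
  fixes f :: "pt \<Rightarrow> real"
  assumes [measurable]: "f \<in> borel_measurable borel"
  shows "(\<integral>x. f (c + x) \<partial>lborel) = (\<integral>x. f x \<partial>lborel)"
proof -
  have "(\<integral>x. f x \<partial>lborel) = (\<integral>x. f x \<partial>distr lborel borel ((+) c))"
    by (simp add: lborel_distr_plus)
  also have "\<dots> = (\<integral>x. f (c + x) \<partial>lborel)"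
    by (rule integral_distr) auto
  finally show ?thesis ..
qed

lemma integrable_translation_lborel:
  fixes f :: "pt \<Rightarrow> real"
  assumes "integrable lborel f"
  shows "integrable lborel (\<lambda>x. f (c + x))"
proof -
  have "integrable (distr lborel borel ((+) c)) f"
    using assms by (simp add: lborel_distr_plus)
  thus ?thesis by (subst (asm) integrable_distr_eq) (use assms in auto)
qed

text \<open>Translation invariance makes the integral of every difference quotient zero. The
  quotients converge to the derivative, and they are dominated: by the mean value theorem inside the
  ball of radius \<open>R + norm v\<close>, and because they vanish outside it for steps of length
  at most 1.\<close>

lemma integral_derivative_zero:
  fixes f :: "pt \<Rightarrow> real"
  assumes d: "\<And>x. (f has_derivative f' x) (at x)"
    and c: "\<And>v. continuous_on UNIV (\<lambda>x. f' x v)"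
    and z: "\<And>x. R < norm x \<Longrightarrow> f x = 0"
  shows "integrable lborel (\<lambda>x. f' x v)" "(\<integral>x. f' x v \<partial>lborel) = 0"
proof -
  have cf: "continuous_on UNIV f"
    by (intro continuous_at_imp_continuous_on ballI has_derivative_continuous[OF d])
  hence [measurable]: "f \<in> borel_measurable borel" by (rule borel_measurable_continuous_onI)
  have z': "f' x v = 0" if "R < norm x" for x
  proof -
    have op: "open {x :: pt. R < norm x}"
      by (intro open_Collect_less continuous_intros)
    have "((\<lambda>_. 0) has_derivative (\<lambda>_. 0)) (at x)" by simp
    hence "(f has_derivative (\<lambda>_. 0)) (at x)"
      by (rule has_derivative_transform_within_open[OF _ op]) (use that z in auto)
    thus ?thesis using has_derivative_unique[OF d] by metis
  qed
  show "integrable lborel (\<lambda>x. f' x v)" using C1c_integrable(1)[OF c z'] .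
  obtain B where B: "B \<ge> 0" "\<And>x. \<bar>f' x v\<bar> \<le> B" using C1c_integrable(2)[OF c z'] by auto
  define t where "t n = inverse (real (Suc n))" for n
  have t: "t n > 0" "t n \<le> 1" for n unfolding t_def by (auto simp: field_simps)
  define g where "g n x = (f (t n *\<^sub>R v + x) - f x) / t n" for n x
  have int: "integrable lborel f" by (rule C1c_integrable(1)[OF cf z])
  have "(\<integral>x. g n x \<partial>lborel) = 0" for n
    unfolding g_def using integrable_translation_lborel[OF int] int
    by (simp add: integral_translation_lborel)
  moreover have "(\<lambda>n. \<integral>x. g n x \<partial>lborel) \<longlonglongrightarrow> (\<integral>x. f' x v \<partial>lborel)"
  proof (rule integral_dominated_convergence[where w="\<lambda>x. B * indicator (cball 0 (R + norm v)) x"])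
    show "(\<lambda>x. f' x v) \<in> borel_measurable lborel"
      using borel_measurable_continuous_onI[OF c] by simp
    show "g n \<in> borel_measurable lborel" for n unfolding g_def by measurable
    show "integrable lborel (\<lambda>x. B * indicator (cball 0 (R + norm v)) x :: real)"
      by (intro integrable_mult_right integrable_real_indicator) (auto simp: emeasure_bounded_finite[unfolded infinity_ennreal_def])
    show "AE x in lborel. (\<lambda>n. g n x) \<longlonglongrightarrow> f' x v"
    proof (rule AE_I2)
      fix x
      have "((\<lambda>s. f (x + s *\<^sub>R v)) has_derivative (\<lambda>s. f' x (s *\<^sub>R v))) (at 0)"
        by (rule has_derivative_compose[where g=f and f="\<lambda>s. x + s *\<^sub>R v"])
          (auto intro!: derivative_eq_intros simp: d)
      hence "((\<lambda>s. f (x + s *\<^sub>R v)) has_real_derivative f' x v) (at 0)"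
        by (rule has_derivative_imp_has_field_derivative)
          (simp add: linear_cmul[OF bounded_linear.linear[OF has_derivative_bounded_linear[OF d]]])
      hence "((\<lambda>s. (f (x + s *\<^sub>R v) - f x) / s) \<longlongrightarrow> f' x v) (at 0)"
        by (simp add: DERIV_def)
      moreover have "filterlim t (at 0) sequentially"
        unfolding filterlim_at t_def using LIMSEQ_inverse_real_of_nat by (auto intro!: always_eventually)
      ultimately have "((\<lambda>n. (f (x + t n *\<^sub>R v) - f x) / t n) \<longlonglongrightarrow> f' x v)"
        by (rule filterlim_compose)
      thus "(\<lambda>n. g n x) \<longlonglongrightarrow> f' x v" by (simp add: g_def add.commute)
    qed
    show "AE x in lborel. norm (g n x) \<le> B * indicator (cball 0 (R + norm v)) x" for n
    proof (rule AE_I2)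
      fix x
      show "norm (g n x) \<le> B * indicator (cball 0 (R + norm v)) x"
      proof (cases "x \<in> cball 0 (R + norm v)")
        case True
        have "\<exists>s. 0 < s \<and> s < t n \<and> f (x + t n *\<^sub>R v) - f (x + 0 *\<^sub>R v) = (t n - 0) * f' (x + s *\<^sub>R v) v"
        proof (rule MVT2[OF t(1)])
          fix s
          have "((\<lambda>s. f (x + s *\<^sub>R v)) has_derivative (\<lambda>h. f' (x + s *\<^sub>R v) (h *\<^sub>R v))) (at s)"
            by (rule has_derivative_compose[where g=f and f="\<lambda>s. x + s *\<^sub>R v"])
              (auto intro!: derivative_eq_intros simp: d)
          thus "((\<lambda>s. f (x + s *\<^sub>R v)) has_real_derivative f' (x + s *\<^sub>R v) v) (at s)"
            by (rule has_derivative_imp_has_field_derivative)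
              (simp add: linear_cmul[OF bounded_linear.linear[OF has_derivative_bounded_linear[OF d]]])
        qed
        then obtain s where "f (x + t n *\<^sub>R v) - f x = t n * f' (x + s *\<^sub>R v) v" by auto
        hence "g n x = f' (x + s *\<^sub>R v) v" using t(1)[of n] by (simp add: g_def add.commute)
        thus ?thesis using B True by simp
      next
        case False
        hence a: "R + norm v < norm x" by simp
        have "norm x \<le> norm (t n *\<^sub>R v + x) + norm (t n *\<^sub>R v)"
          by (metis add.commute add_diff_cancel_left' norm_triangle_sub norm_triangle_ineq4)
        also have "norm (t n *\<^sub>R v) \<le> norm v"
          using t[of n] by (simp add: mult_left_le_one_le)
        finally have "f (t n *\<^sub>R v + x) = 0" using a by (intro z) auto
        moreover have "f x = 0" using a by (intro z) (smt (verit) norm_ge_zero)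
        ultimately show ?thesis by (simp add: g_def B)
      qed
    qed
  qed
  ultimately show "(\<integral>x. f' x v \<partial>lborel) = 0" using LIMSEQ_unique[of "\<lambda>_. 0::real"] by simp
qed

lemma integral_lebesgue_lborel:
  fixes f :: "pt \<Rightarrow> real"
  assumes "f \<in> borel_measurable borel"
  shows "(\<integral>x. f x \<partial>lebesgue) = (\<integral>x. f x \<partial>lborel)" "integrable lebesgue f \<longleftrightarrow> integrable lborel f"
  using assms by (auto intro!: integral_completion integrable_completion)

lemma integral_divergence_zero:
  assumes "\<phi> \<in> test_fields"
  shows "integrable lebesgue (divergence \<phi>)" "(\<integral>x. divergence \<phi> x \<partial>lebesgue) = 0"
proof -
  obtain \<phi>' R where "C1c_field \<phi> \<phi>' R"
    using test_fieldsE[OF assms] by blast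
  note * = C1c_fieldD[OF this]
  have d: "((\<lambda>x. \<phi> x $ i) has_derivative (\<lambda>v. \<phi>' x v $ i)) (at x)" for i x
    by (rule bounded_linear.has_derivative[OF bounded_linear_vec_nth *(1)])
  have z: "integrable lborel (\<lambda>x. \<phi>' x v $ i)" "(\<integral>x. \<phi>' x v $ i \<partial>lborel) = 0" for i v
    by (rule integral_derivative_zero[OF d, where R=R]; use *(2,5) in \<open>auto intro!: continuous_intros\<close>)+
  have e: "divergence \<phi> = (\<lambda>x. \<Sum>i\<in>UNIV. (\<phi>' x (axis i 1)) $ i)" using *(7) by auto
  have "integrable lborel (divergence \<phi>)" "(\<integral>x. divergence \<phi> x \<partial>lborel) = 0"
    unfolding e using z by auto
  thus "integrable lebesgue (divergence \<phi>)" "(\<integral>x. divergence \<phi> x \<partial>lebesgue) = 0"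
    using integral_lebesgue_lborel[OF divergence_measurable[OF assms]] by auto
qed

lemma L1_loc_indicator:
  assumes [measurable]: "E \<in> sets lebesgue"
  shows "L1_loc (indicator E :: pt \<Rightarrow> real)"
proof (rule L1_locI)
  fix R
  have "cball 0 R \<inter> E \<in> lmeasurable"
    by (intro bounded_set_imp_lmeasurable sets.Int) (auto intro: bounded_subset[of "cball 0 R"])
  hence "integrable lebesgue (indicator (cball 0 R \<inter> E) :: pt \<Rightarrow> real)"
    by (intro integrable_real_indicator) (auto simp: fmeasurable_def)
  moreover have "indicator (cball 0 R \<inter> E) = (\<lambda>x::pt. indicator (cball 0 R) x * indicator E x :: real)"
    by (rule ext) (rule indicator_inter_arith)
  ultimately show "integrable lebesgue (\<lambda>x::pt. indicator (cball 0 R) x * indicator E x :: real)"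
    by (simp only:)
qed simp

lemma lebesgue_sets_Compl: "E \<in> sets lebesgue \<Longrightarrow> - E \<in> sets lebesgue"
  using sets.compl_sets[of E lebesgue] by (simp add: Compl_eq_Diff_UNIV)

text \<open>A divergence integrates to zero over the plane, so testing the complement with a field
  amounts to testing E with the negated field.\<close>

lemma Per_Compl:
  assumes "E \<in> sets lebesgue" shows "Per (- E) = Per E"
proof -
  have "Per (- E) \<le> Per E" if E: "E \<in> sets lebesgue" for E
    unfolding Per_def
  proof (rule TV_least)
    fix \<phi> assume p: "\<phi> \<in> test_fields"
    have "(\<integral>x. indicator (- E) x * divergence \<phi> x \<partial>lebesgue) =
      (\<integral>x. divergence \<phi> x - indicator E x * divergence \<phi> x \<partial>lebesgue)"
      by (rule Bochner_Integration.integral_cong) (auto simp: indicator_def)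
    also have "\<dots> = - (\<integral>x. indicator E x * divergence \<phi> x \<partial>lebesgue)"
      using integral_divergence_zero[OF p] L1_loc_div_integrable[OF L1_loc_indicator[OF E] p] by simp
    also have "\<dots> = (\<integral>x. indicator E x * divergence (\<lambda>x. - \<phi> x) x \<partial>lebesgue)"
      using minus_test_field(2)[OF p] by simp
    finally show "ereal (\<integral>x. indicator (- E) x * divergence \<phi> x \<partial>lebesgue) \<le> TV (indicator E)"
      using TV_upper[OF minus_test_field(1)[OF p], of "indicator E"] by simp
  qed
  from this[of E] this[of "- E"] assms show ?thesis by (simp add: antisym lebesgue_sets_Compl)
qed

section \<open>Lower semicontinuity and cutting by balls\<close>

text \<open>The derivative \<open>ramp' k\<close> is the trapezoid of height 1 that rises on [0, k] and falls on
  [1, 1 + k], so \<open>ramp k\<close> is a C^1 step from 0 to 1.\<close>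

definition ramp :: "real \<Rightarrow> real \<Rightarrow> real" where
  "ramp k t = ((max t 0)\<^sup>2 - (max (t - k) 0)\<^sup>2 - (max (t - 1) 0)\<^sup>2 + (max (t - 1 - k) 0)\<^sup>2) / (2 * k)"

definition ramp' :: "real \<Rightarrow> real \<Rightarrow> real" where
  "ramp' k t = (max t 0 - max (t - k) 0 - max (t - 1) 0 + max (t - 1 - k) 0) / k"

lemma DERIV_max0_square: "((\<lambda>t::real. (max t 0)\<^sup>2) has_real_derivative 2 * max t 0) (at t)"
proof (cases "t = 0")
  case True
  have "((\<lambda>h::real. ((max (0 + h) 0)\<^sup>2 - (max 0 0)\<^sup>2) / h) \<longlongrightarrow> 0) (at 0)"
  proof (rule Lim_null_comparison[where g="\<lambda>h. \<bar>h\<bar>"])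
    show "\<forall>\<^sub>F h::real in at 0. norm (((max (0 + h) 0)\<^sup>2 - (max 0 0)\<^sup>2) / h) \<le> \<bar>h\<bar>"
      by (rule always_eventually) (auto simp: max_def power2_eq_square)
    show "((\<lambda>h::real. \<bar>h\<bar>) \<longlongrightarrow> 0) (at 0)" by (rule tendsto_rabs_zero) simp
  qed
  thus ?thesis using True by (simp add: DERIV_def)
next
  case False
  consider "t > 0" | "t < 0" using False by linarith
  thus ?thesis
  proof cases
    case 1
    have "((\<lambda>t::real. t\<^sup>2) has_real_derivative 2 * t) (at t)" by (auto intro!: derivative_eq_intros)
    hence "((\<lambda>t::real. (max t 0)\<^sup>2) has_real_derivative 2 * t) (at t)"
      by (rule has_field_derivative_transform_within_open[where S="{0<..}"]) (use 1 in auto)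
    thus ?thesis using 1 by simp
  next
    case 2
    have "((\<lambda>t::real. 0) has_real_derivative 0) (at t)" by simp
    hence "((\<lambda>t::real. (max t 0)\<^sup>2) has_real_derivative 0) (at t)"
      by (rule has_field_derivative_transform_within_open[where S="{..<0}"]) (use 2 in auto)
    thus ?thesis using 2 by simp
  qed
qed

lemma DERIV_ramp: "k > 0 \<Longrightarrow> (ramp k has_real_derivative ramp' k t) (at t)"
proof -
  assume k: "k > 0"
  have d: "((\<lambda>t. (max (t - a) 0)\<^sup>2) has_real_derivative 2 * max (t - a) 0) (at t)" for a
    by (rule DERIV_cong[OF DERIV_chain2[where f="\<lambda>t. (max t 0)\<^sup>2" and g="\<lambda>t. t - a", OF DERIV_max0_square]])
      (auto intro!: derivative_eq_intros)
  have "((\<lambda>t. ((max (t-0) 0)\<^sup>2 - (max (t - k) 0)\<^sup>2 - (max (t - 1) 0)\<^sup>2 + (max (t - (1 + k)) 0)\<^sup>2) / (2 * k))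
    has_real_derivative (2 * max (t-0) 0 - 2 * max (t - k) 0 - 2 * max (t - 1) 0 + 2 * max (t - (1 + k)) 0) / (2 * k)) (at t)"
    by (intro DERIV_cdivide DERIV_add DERIV_diff d)
  moreover have "(2 * max (t-0) 0 - 2 * max (t - k) 0 - 2 * max (t - 1) 0 + 2 * max (t - (1 + k)) 0) / (2 * k) = ramp' k t"
    unfolding ramp'_def using k by (simp add: field_simps)
  ultimately show ?thesis unfolding ramp_def by (simp add: diff_diff_eq)
qed

lemma ramp'_bounds: assumes "0 < k" "k \<le> 1" shows "0 \<le> ramp' k t" "ramp' k t \<le> 1"
  using assms unfolding ramp'_def by (auto simp: max_def field_simps)

lemma ramp'_zero: assumes "0 < k" "k \<le> 1" "t \<le> 0 \<or> 1 + k \<le> t" shows "ramp' k t = 0"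
  using assms unfolding ramp'_def by (auto simp: max_def field_simps)

lemma ramp_0: assumes "0 < k" "t \<le> 0" shows "ramp k t = 0"
  using assms unfolding ramp_def by (auto simp: max_def)

lemma ramp_1: assumes "0 < k" "k \<le> 1" "1 + k \<le> t" shows "ramp k t = 1"
  using assms unfolding ramp_def by (auto simp: max_def field_simps power2_eq_square)

lemma ramp_mono: assumes "0 < k" "k \<le> 1" "s \<le> t" shows "ramp k s \<le> ramp k t"
  by (rule DERIV_nonneg_imp_nondecreasing[OF assms(3)]) (use DERIV_ramp ramp'_bounds assms in blast)

lemma ramp_bounds: assumes "0 < k" "k \<le> 1" shows "0 \<le> ramp k t" "ramp k t \<le> 1"
  using ramp_mono[OF assms, of "min 0 t" t] ramp_mono[OF assms, of t "max t (1 + k)"]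
    ramp_0[OF assms(1), of "min 0 t"] ramp_1[OF assms, of "max t (1+k)"] by auto

lemma ramp_le: assumes "0 < k" "k \<le> 1" "0 \<le> t" shows "ramp k t \<le> t"
proof -
  have "ramp k 0 - 0 \<ge> ramp k t - t"
  proof (rule DERIV_nonpos_imp_nonincreasing[OF assms(3)])
    fix x
    have "((\<lambda>t. ramp k t - t) has_real_derivative ramp' k x - 1) (at x)"
      by (intro DERIV_diff DERIV_ramp assms DERIV_ident)
    thus "\<exists>y. ((\<lambda>t. ramp k t - t) has_real_derivative y) (at x) \<and> y \<le> 0"
      using ramp'_bounds(2)[OF assms(1,2), of x] by (intro exI[of _ "ramp' k x - 1"]) auto
  qed
  thus ?thesis using ramp_0[of k 0] assms by simp
qed

lemma continuous_ramp': "continuous_on UNIV (ramp' k)"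
  unfolding ramp'_def[abs_def] by (cases "k = 0") (auto intro!: continuous_intros)

lemma continuous_ramp: "k > 0 \<Longrightarrow> continuous_on UNIV (ramp k)"
  unfolding ramp_def[abs_def] by (auto intro!: continuous_intros)

lemma sum_axis_linear:
  fixes l :: "pt \<Rightarrow> real" assumes "linear l"
  shows "(\<Sum>i\<in>UNIV. l (axis i 1) * a $ i) = l a"
proof -
  have "l a = l (\<Sum>i\<in>UNIV. (a $ i) *\<^sub>R axis i 1)"
    by (metis (no_types) basis_expansion scalar_mult_eq_scaleR)
  also have "\<dots> = (\<Sum>i\<in>UNIV. a $ i * l (axis i 1))"
    by (simp add: linear_sum[OF assms] linear_cmul[OF assms])
  finally show ?thesis by (simp add: mult.commute)
qed

lemma divergence_scaleR:
  assumes "(z has_derivative z') (at x)" "(\<phi> has_derivative \<phi>') (at x)"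
  shows "divergence (\<lambda>x. z x *\<^sub>R \<phi> x) x = z x * divergence \<phi> x + z' (\<phi> x)"
proof -
  have d: "((\<lambda>x. z x *\<^sub>R \<phi> x) has_derivative (\<lambda>v. z x *\<^sub>R \<phi>' v + z' v *\<^sub>R \<phi> x)) (at x)"
    by (rule has_derivative_scaleR[OF assms])
  have "linear z'" using assms(1) has_derivative_linear by blast
  thus ?thesis
    unfolding divergence_eq[OF d] divergence_eq[OF assms(2)]
    by (simp add: sum.distrib sum_distrib_left sum_axis_linear)
qed

lemma divergence_add:
  assumes "\<phi> differentiable at x" "\<psi> differentiable at x"
  shows "divergence (\<lambda>x. \<phi> x + \<psi> x) x = divergence \<phi> x + divergence \<psi> x"
proof -
  obtain \<phi>' \<psi>' where d: "(\<phi> has_derivative \<phi>') (at x)" "(\<psi> has_derivative \<psi>') (at x)"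
    using assms unfolding differentiable_def by blast
  show ?thesis unfolding divergence_eq[OF has_derivative_add[OF d]] divergence_eq[OF d(1)] divergence_eq[OF d(2)]
    by (simp add: sum.distrib)
qed

lemma norm_convex_comb_le_1:
  fixes a b :: "'a::real_normed_vector"
  assumes "norm a \<le> 1" "norm b \<le> 1" "0 \<le> t" "t \<le> 1"
  shows "norm (t *\<^sub>R a + (1 - t) *\<^sub>R b) \<le> 1"
proof -
  have "norm (t *\<^sub>R a + (1 - t) *\<^sub>R b) \<le> t * norm a + (1 - t) * norm b"
    using norm_triangle_ineq[of "t *\<^sub>R a" "(1 - t) *\<^sub>R b"] assms by simp
  also have "\<dots> \<le> t * 1 + (1 - t) * 1" using assms by (intro add_mono mult_left_mono) auto
  finally show ?thesis by simp
qed

text \<open>For fields \<phi> and \<psi> testing the two pieces, the convex combination z \<phi> +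
  (1 - z) \<psi> tests u. Its divergence differs from the desired integrand only by z' (\<phi> -
  \<psi>), of size at most 2 g, and this is the price of the cut.\<close>

lemma TV_cut:
  assumes u: "L1_loc u"
    and z: "\<And>x. (z has_derivative z' x) (at x)" "\<And>v. continuous_on UNIV (\<lambda>x. z' x v)"
      "\<And>x. 0 \<le> z x" "\<And>x. z x \<le> 1"
    and g: "\<And>x v. \<bar>z' x v\<bar> \<le> g x * norm v" "integrable lebesgue (\<lambda>x. \<bar>u x\<bar> * g x)"
    and c: "TV u \<le> ereal c"
  shows "TV (\<lambda>x. z x * u x) + TV (\<lambda>x. (1 - z x) * u x) \<le> ereal (c + 2 * (\<integral>x. \<bar>u x\<bar> * g x \<partial>lebesgue))"
proof (rule TV_add_least)
  fix \<phi> \<psi> assume p: "\<phi> \<in> test_fields" "\<psi> \<in> test_fields"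
  obtain \<phi>' R1 where "C1c_field \<phi> \<phi>' R1" using test_fieldsE[OF p(1)] by blast
  note P = C1c_fieldD[OF this]
  obtain \<psi>' R2 where "C1c_field \<psi> \<psi>' R2" using test_fieldsE[OF p(2)] by blast
  note Q = C1c_fieldD[OF this]
  define \<omega> where "\<omega> x = z x *\<^sub>R \<phi> x + (1 - z x) *\<^sub>R \<psi> x" for x
  define \<omega>' where "\<omega>' x v = (z x *\<^sub>R \<phi>' x v + z' x v *\<^sub>R \<phi> x) + ((1 - z x) *\<^sub>R \<psi>' x v + (0 - z' x v) *\<^sub>R \<psi> x)" for x v
  have z1: "((\<lambda>x. 1 - z x) has_derivative (\<lambda>v. 0 - z' x v)) (at x)" for x
    by (intro has_derivative_diff z) simp
  have d: "(\<omega> has_derivative \<omega>' x) (at x)" for x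
    unfolding \<omega>_def[abs_def] \<omega>'_def[abs_def]
    by (intro has_derivative_add has_derivative_scaleR z P Q z1)
  have cz: "continuous_on UNIV z"
    by (intro continuous_at_imp_continuous_on ballI has_derivative_continuous[OF z(1)])
  have cP: "continuous_on UNIV \<phi>" "continuous_on UNIV \<psi>"
    by (intro continuous_at_imp_continuous_on ballI has_derivative_continuous[OF P(1)]
        has_derivative_continuous[OF Q(1)])+
  have t: "\<omega> \<in> test_fields"
  proof (rule test_fieldsI[OF d])
    show "continuous_on UNIV (\<lambda>x. \<omega>' x v)" for v
      unfolding \<omega>'_def by (intro continuous_intros cz cP z P Q)
    show "\<omega> x = 0" if "max R1 R2 < norm x" for x
      using that P(5) Q(5) by (simp add: \<omega>_def)
    show "norm (\<omega> x) \<le> 1" for x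
      unfolding \<omega>_def using z P Q by (intro norm_convex_comb_le_1) auto
  qed
  have l: "linear (z' x)" for x using has_derivative_linear[OF z(1)] .
  have div: "divergence \<omega> x = z x * divergence \<phi> x + (1 - z x) * divergence \<psi> x + z' x (\<phi> x - \<psi> x)" for x
  proof -
    have "divergence \<omega> x = divergence (\<lambda>x. z x *\<^sub>R \<phi> x) x + divergence (\<lambda>x. (1 - z x) *\<^sub>R \<psi> x) x"
      unfolding \<omega>_def[abs_def]
      by (rule divergence_add) (use has_derivative_scaleR[OF z(1) P(1)] has_derivative_scaleR[OF z1 Q(1)] in \<open>auto simp: differentiable_def\<close>)
    hence "divergence \<omega> x = (z x * divergence \<phi> x + z' x (\<phi> x)) + ((1 - z x) * divergence \<psi> x + (0 - z' x (\<psi> x)))"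
      by (simp only: divergence_scaleR[OF z(1) P(1)] divergence_scaleR[OF z1 Q(1)])
    thus ?thesis by (simp add: linear_diff[OF l])
  qed
  have [measurable]: "u \<in> borel_measurable lebesgue" using u by (rule L1_loc_measurable)
  have zm[measurable]: "z \<in> borel_measurable lebesgue"
    using borel_measurable_continuous_onI[OF cz] by (intro measurable_completion) auto
  have i1: "integrable lebesgue (\<lambda>x. z x * u x * divergence \<phi> x)"
    using L1_loc_div_integrable[OF u p(1)]
  proof (rule Bochner_Integration.integrable_bound)
    have [measurable]: "divergence \<phi> \<in> borel_measurable lebesgue"
      using divergence_measurable[OF p(1)] by (intro measurable_completion) auto
    show "(\<lambda>x. z x * u x * divergence \<phi> x) \<in> borel_measurable lebesgue" by measurable
    show "AE x in lebesgue. norm (z x * u x * divergence \<phi> x) \<le> norm (u x * divergence \<phi> x)"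
      using z by (intro AE_I2) (simp add: abs_mult mult.assoc mult_left_le_one_le)
  qed
  have i2: "integrable lebesgue (\<lambda>x. (1 - z x) * u x * divergence \<psi> x)"
    using L1_loc_div_integrable[OF u p(2)]
  proof (rule Bochner_Integration.integrable_bound)
    have [measurable]: "divergence \<psi> \<in> borel_measurable lebesgue"
      using divergence_measurable[OF p(2)] by (intro measurable_completion) auto
    show "(\<lambda>x. (1 - z x) * u x * divergence \<psi> x) \<in> borel_measurable lebesgue" by measurable
    show "AE x in lebesgue. norm ((1 - z x) * u x * divergence \<psi> x) \<le> norm (u x * divergence \<psi> x)"
      using z by (intro AE_I2) (simp add: abs_mult mult.assoc mult_left_le_one_le)
  qed
  have i3: "integrable lebesgue (\<lambda>x. u x * divergence \<omega> x)" by (rule L1_loc_div_integrable[OF u t])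
  have "(\<integral>x. z x * u x * divergence \<phi> x \<partial>lebesgue) + (\<integral>x. (1 - z x) * u x * divergence \<psi> x \<partial>lebesgue)
     - (\<integral>x. u x * divergence \<omega> x \<partial>lebesgue) =
    (\<integral>x. z x * u x * divergence \<phi> x + (1 - z x) * u x * divergence \<psi> x - u x * divergence \<omega> x \<partial>lebesgue)"
    using i1 i2 i3 by simp
  also have "\<dots> \<le> (\<integral>x. 2 * (\<bar>u x\<bar> * g x) \<partial>lebesgue)"
  proof (rule integral_mono)
    fix x
    have "z x * u x * divergence \<phi> x + (1 - z x) * u x * divergence \<psi> x - u x * divergence \<omega> x = - (u x * z' x (\<phi> x - \<psi> x))"
      unfolding div by (simp add: algebra_simps)
    also have "\<dots> \<le> \<bar>u x\<bar> * \<bar>z' x (\<phi> x - \<psi> x)\<bar>" by (metis abs_ge_minus_self abs_mult)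
    also have "\<dots> \<le> \<bar>u x\<bar> * (g x * norm (\<phi> x - \<psi> x))" by (intro mult_left_mono g) auto
    also have "\<dots> \<le> \<bar>u x\<bar> * (g x * 2)"
    proof (intro mult_left_mono)
      show "norm (\<phi> x - \<psi> x) \<le> 2" using P(3)[of x] Q(3)[of x] norm_triangle_ineq4[of "\<phi> x" "\<psi> x"] by linarith
      \<comment> \<open>\<open>g\<close> is nonnegative because it bounds the derivative in a unit
        direction.\<close>
      have "norm (axis 1 1 :: pt) = 1" by simp
      hence "\<bar>z' x (axis 1 1)\<bar> \<le> g x" using g(1)[of x "axis 1 1"] by (simp only: mult_1_right)
      thus "0 \<le> g x" by linarith
    qed auto
    finally show "z x * u x * divergence \<phi> x + (1 - z x) * u x * divergence \<psi> x - u x * divergence \<omega> x \<le> 2 * (\<bar>u x\<bar> * g x)"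
      by (simp add: algebra_simps)
  qed (use i1 i2 i3 g in auto)
  also have "\<dots> = 2 * (\<integral>x. \<bar>u x\<bar> * g x \<partial>lebesgue)" by simp
  finally show "(\<integral>x. z x * u x * divergence \<phi> x \<partial>lebesgue) + (\<integral>x. (1 - z x) * u x * divergence \<psi> x \<partial>lebesgue)
    \<le> c + 2 * (\<integral>x. \<bar>u x\<bar> * g x \<partial>lebesgue)"
    using order_trans[OF TV_upper[OF t, of u] c] by simp
qed

section \<open>Lower semicontinuity\<close>

lemma tendsto_test_integral:
  assumes W: "L1_loc W" and m: "\<And>n. U n \<in> borel_measurable lebesgue" "u \<in> borel_measurable lebesgue"
    and l: "AE x in lebesgue. (\<lambda>n. U n x) \<longlonglongrightarrow> u x"
    and b: "\<And>n. AE x in lebesgue. \<bar>U n x\<bar> \<le> W x" and p: "\<phi> \<in> test_fields"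
  shows "(\<lambda>n. \<integral>x. U n x * divergence \<phi> x \<partial>lebesgue) \<longlonglongrightarrow> (\<integral>x. u x * divergence \<phi> x \<partial>lebesgue)"
proof (rule integral_dominated_convergence[where w="\<lambda>x. \<bar>W x * divergence \<phi> x\<bar>"])
  have d[measurable]: "divergence \<phi> \<in> borel_measurable lebesgue"
    using divergence_measurable[OF p] by (intro measurable_completion) auto
  show "(\<lambda>x. u x * divergence \<phi> x) \<in> borel_measurable lebesgue" using m(2) d by measurable
  show "(\<lambda>x. U n x * divergence \<phi> x) \<in> borel_measurable lebesgue" for n using m(1)[of n] d by measurable
  show "integrable lebesgue (\<lambda>x. \<bar>W x * divergence \<phi> x\<bar>)"
    using L1_loc_div_integrable[OF W p] by (rule integrable_abs)
  show "AE x in lebesgue. (\<lambda>n. U n x * divergence \<phi> x) \<longlonglongrightarrow> u x * divergence \<phi> x"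
    using l by eventually_elim (intro tendsto_intros)
  show "AE x in lebesgue. norm (U n x * divergence \<phi> x) \<le> \<bar>W x * divergence \<phi> x\<bar>" for n
    using b[of n] by eventually_elim (auto simp: abs_mult intro!: mult_right_mono)
qed

text \<open>\<open>TV\<close> is a supremum of integrals that are continuous under locally dominated
  convergence. The two sequences are treated jointly because only the sum of their variations is
  controlled by \<open>c n\<close>.\<close>

lemma TV_add_lsc:
  assumes W: "L1_loc W" and m: "\<And>n. U n \<in> borel_measurable lebesgue" "u \<in> borel_measurable lebesgue"
      "\<And>n. V n \<in> borel_measurable lebesgue" "v \<in> borel_measurable lebesgue"
    and l: "AE x in lebesgue. (\<lambda>n. U n x) \<longlonglongrightarrow> u x" "AE x in lebesgue. (\<lambda>n. V n x) \<longlonglongrightarrow> v x"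
    and b: "\<And>n. AE x in lebesgue. \<bar>U n x\<bar> \<le> W x" "\<And>n. AE x in lebesgue. \<bar>V n x\<bar> \<le> W x"
    and c: "\<And>n. TV (U n) + TV (V n) \<le> ereal (c n)" "c \<longlonglongrightarrow> c0"
  shows "TV u + TV v \<le> ereal c0"
proof (rule TV_add_least)
  fix \<phi> \<psi> assume p: "\<phi> \<in> test_fields" "\<psi> \<in> test_fields"
  have "(\<lambda>n. (\<integral>x. U n x * divergence \<phi> x \<partial>lebesgue) + (\<integral>x. V n x * divergence \<psi> x \<partial>lebesgue)) \<longlonglongrightarrow>
    (\<integral>x. u x * divergence \<phi> x \<partial>lebesgue) + (\<integral>x. v x * divergence \<psi> x \<partial>lebesgue)"
    by (intro tendsto_add tendsto_test_integral[OF W]) (use m l b p in auto)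
  moreover have "(\<integral>x. U n x * divergence \<phi> x \<partial>lebesgue) + (\<integral>x. V n x * divergence \<psi> x \<partial>lebesgue) \<le> c n" for n
    using order_trans[OF add_mono[OF TV_upper[OF p(1), of "U n"] TV_upper[OF p(2), of "V n"]] c(1)[of n]] by simp
  ultimately show "(\<integral>x. u x * divergence \<phi> x \<partial>lebesgue) + (\<integral>x. v x * divergence \<psi> x \<partial>lebesgue) \<le> c0"
    using c(2) by (intro LIMSEQ_le) auto
qed

lemma TV_zero: "TV (\<lambda>x. 0) = 0"
  by (rule antisym, rule TV_least) (auto simp: zero_ereal_def[symmetric])

lemma TV_lsc:
  assumes W: "L1_loc W" and m: "\<And>n. U n \<in> borel_measurable lebesgue" "u \<in> borel_measurable lebesgue"
    and l: "AE x in lebesgue. (\<lambda>n. U n x) \<longlonglongrightarrow> u x"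
    and b: "\<And>n. AE x in lebesgue. \<bar>U n x\<bar> \<le> W x"
    and c: "\<And>n. TV (U n) \<le> ereal (c n)" "c \<longlonglongrightarrow> c0"
  shows "TV u \<le> ereal c0"
proof -
  have nn: "AE x in lebesgue. \<bar>0::real\<bar> \<le> W x" using b[of 0] by eventually_elim auto
  have "TV u + TV (\<lambda>x. 0) \<le> ereal c0"
    by (rule TV_add_lsc[OF W m _ _ l _ b _ _ c(2), of "\<lambda>_ _. 0"]) (use nn c(1) in \<open>auto simp: TV_zero\<close>)
  thus ?thesis by (simp add: TV_zero)
qed

lemma lmeasurable_Int_ball: "E \<in> sets lebesgue \<Longrightarrow> E \<inter> ball (x::pt) r \<in> lmeasurable"
  by (intro bounded_set_imp_lmeasurable) auto

lemma AE_not_sphere: "AE y::pt in lebesgue. y \<notin> sphere x r"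
  using negligible_sphere[of x r] by (intro AE_not_in) (simp add: negligible_iff_null_sets)

text \<open>Each of the two pieces gains the part of the circle inside E, whose length is the
  derivative of the area of E \<inter> B(x, r) in r. The hypothesis expresses this length without
  traces: arbitrarily thin annuli outside radius r meet E in area at most c times their width. The
  cut uses smooth radial weights on these annuli, and lower semicontinuity gives the sharp
  cut.\<close>

lemma Per_cut_ball:
  assumes E: "E \<in> sets lebesgue" and r: "0 < r" and P: "Per E \<le> ereal P"
    and c: "\<And>d0. d0 > 0 \<Longrightarrow> \<exists>d>0. d < d0 \<and>
      measure lebesgue (E \<inter> ball x (r + d)) - measure lebesgue (E \<inter> ball x r) \<le> c * d"
  shows "Per (E \<inter> ball x r) + Per (E - ball x r) \<le> ereal (P + 2 * c)"
proof -
  define k where "k n = inverse (real (Suc n))" for n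
  have k: "0 < k n" "k n \<le> 1" for n unfolding k_def by (auto simp: field_simps)
  have k0: "k \<longlonglongrightarrow> 0" unfolding k_def by (rule LIMSEQ_inverse_real_of_nat)
  have "\<forall>n. \<exists>d>0. d < k n \<and> measure lebesgue (E \<inter> ball x (r + d)) - measure lebesgue (E \<inter> ball x r) \<le> c * d"
    using c k(1) by blast
  then obtain d where d: "\<And>n. d n > 0" "\<And>n. d n < k n"
    "\<And>n. measure lebesgue (E \<inter> ball x (r + d n)) - measure lebesgue (E \<inter> ball x r) \<le> c * d n" by metis
  have d0: "d \<longlonglongrightarrow> 0"
    by (rule tendsto_sandwich[OF _ _ tendsto_const k0]) (use d in \<open>auto intro!: always_eventually less_imp_le\<close>)
  \<comment> \<open>The weight depends on the squared distance, which is differentiable also at the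
    centre. \<open>L n\<close> is chosen so that \<open>s n\<close> runs from 0 at radius r to 1 + k
    n at radius r + d n, the interval on which \<open>ramp (k n)\<close> climbs. The resulting slope
    bound \<open>G n\<close> times the width \<open>d n\<close> tends to 1, so no constant is lost
    in the limit.\<close>
  define L where "L n = (1 + k n) / ((r + d n)\<^sup>2 - r\<^sup>2)" for n
  have dd: "(r + d n)\<^sup>2 - r\<^sup>2 = (2 * r + d n) * d n" for n by (simp add: power2_eq_square algebra_simps)
  have L: "L n > 0" for n unfolding L_def dd using d(1)[of n] r k(1)[of n] by (intro divide_pos_pos mult_pos_pos) auto
  define s where "s n y = ((y - x) \<bullet> (y - x) - r\<^sup>2) * L n" for n y
  define s' where "s' n y v = 2 * ((y - x) \<bullet> v) * L n" for n y v
  define z where "z n y = 1 - ramp (k n) (s n y)" for n y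
  define z' where "z' n y v = - (ramp' (k n) (s n y) * s' n y v)" for n y v
  define G where "G n = 2 * (r + d n) * L n" for n
  define g where "g n y = G n * indicator (ball x (r + d n) - ball x r) y" for n y
  have G: "G n \<ge> 0" for n using L[of n] r d(1)[of n] by (simp add: G_def)
  have ds: "(s n has_derivative s' n y) (at y)" for n y
    unfolding s_def[abs_def] s'_def[abs_def]
    by (auto intro!: derivative_eq_intros simp: inner_commute algebra_simps)
  have dz: "(z n has_derivative z' n y) (at y)" for n y
  proof -
    have "((\<lambda>y. ramp (k n) (s n y)) has_derivative (\<lambda>v. ramp' (k n) (s n y) * s' n y v)) (at y)"
      using has_derivative_compose[OF ds[of n y] DERIV_ramp[OF k(1), unfolded has_field_derivative_def]]
      by simp
    from has_derivative_diff[OF has_derivative_const[of 1] this] show ?thesis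
      unfolding z_def[abs_def] z'_def[abs_def] by simp
  qed
  have s_small: "s n y \<le> 0" if "norm (y - x) \<le> r" for n y
    unfolding s_def using that L[of n] power_mono[OF that, of 2] by (intro mult_nonpos_nonneg) (auto simp: power2_norm_eq_inner)
  have s_big: "1 + k n \<le> s n y" if "r + d n \<le> norm (y - x)" for n y
  proof -
    have "(r + d n)\<^sup>2 \<le> (y - x) \<bullet> (y - x)"
      using power_mono[OF that, of 2] r d(1)[of n] by (simp add: power2_norm_eq_inner)
    hence "((r + d n)\<^sup>2 - r\<^sup>2) * L n \<le> s n y" unfolding s_def using L[of n] by (intro mult_right_mono) auto
    moreover have "(r + d n)\<^sup>2 - r\<^sup>2 \<noteq> 0" unfolding dd using d(1)[of n] r by simp
    ultimately show ?thesis by (simp add: L_def)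
  qed
  have gb: "\<bar>z' n y v\<bar> \<le> g n y * norm v" for n y v
  proof (cases "y \<in> ball x (r + d n) - ball x r")
    case True
    have "\<bar>z' n y v\<bar> = ramp' (k n) (s n y) * (2 * \<bar>(y - x) \<bullet> v\<bar> * L n)"
      using ramp'_bounds[OF k, of n] L[of n] by (simp add: z'_def s'_def abs_mult)
    also have "\<dots> \<le> 1 * (2 * \<bar>(y - x) \<bullet> v\<bar> * L n)"
      using ramp'_bounds[OF k, of n] L[of n] by (intro mult_right_mono) auto
    also have "\<dots> \<le> 2 * (norm (y - x) * norm v) * L n"
      using L[of n] Cauchy_Schwarz_ineq2[of "y - x" v] by auto
    also have "\<dots> \<le> 2 * ((r + d n) * norm v) * L n"
      using L[of n] True by (intro mult_right_mono mult_left_mono) (auto simp: dist_norm norm_minus_commute)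
    finally show ?thesis using True by (simp add: g_def G_def algebra_simps)
  next
    case False
    hence "norm (y - x) \<le> r \<or> r + d n \<le> norm (y - x)" by (auto simp: dist_norm norm_minus_commute)
    hence "ramp' (k n) (s n y) = 0" using ramp'_zero[OF k] s_small s_big by metis
    thus ?thesis using False by (simp add: z'_def g_def)
  qed
  have E'[measurable]: "E \<in> sets lebesgue" by fact
  define m where "m t = measure lebesgue (E \<inter> ball x t)" for t
  have int: "integrable lebesgue (\<lambda>y. \<bar>indicator E y\<bar> * g n y)"
    and int': "(\<integral>y. \<bar>indicator E y\<bar> * g n y \<partial>lebesgue) = G n * (m (r + d n) - m r)" for n
  proof -
    have e: "\<bar>indicator E y\<bar> * g n y = G n * (indicator (E \<inter> ball x (r + d n)) y - indicator (E \<inter> ball x r) y)" for y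
      using d(1)[of n] by (auto simp: g_def indicator_def)
    have i: "integrable lebesgue (indicator (E \<inter> ball x t) :: pt \<Rightarrow> real)" for t
      using lmeasurable_Int_ball[OF E, of x t] by (intro integrable_real_indicator) (auto simp: fmeasurable_def)
    show "integrable lebesgue (\<lambda>y. \<bar>indicator E y\<bar> * g n y)" unfolding e using i by simp
    show "(\<integral>y. \<bar>indicator E y\<bar> * g n y \<partial>lebesgue) = G n * (m (r + d n) - m r)"
      unfolding e using i by (simp add: m_def)
  qed
  have z01: "0 \<le> z n y" "z n y \<le> 1" for n y using ramp_bounds[OF k, of n "s n y"] by (auto simp: z_def)
  define C where "C n = P + 2 * (G n * (c * d n))" for n
  have cz: "continuous_on UNIV (z n)" for n
    by (intro continuous_at_imp_continuous_on ballI has_derivative_continuous[OF dz])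
  have zm[measurable]: "z n \<in> borel_measurable lebesgue" for n
    using borel_measurable_continuous_onI[OF cz] by (intro measurable_completion) auto
  have b1: "TV (\<lambda>y. z n y * indicator E y) + TV (\<lambda>y. (1 - z n y) * indicator E y) \<le> ereal (C n)" for n
  proof -
    have "TV (\<lambda>y. z n y * indicator E y) + TV (\<lambda>y. (1 - z n y) * indicator E y)
      \<le> ereal (P + 2 * (\<integral>y. \<bar>indicator E y\<bar> * g n y \<partial>lebesgue))"
    proof (rule TV_cut[OF L1_loc_indicator[OF E] dz _ z01 gb int])
      show "continuous_on UNIV (\<lambda>y. z' n y v)" for v
        unfolding z'_def s'_def s_def
        by (intro continuous_intros continuous_on_compose2[OF continuous_ramp']) auto
      show "TV (indicator E) \<le> ereal P" using P by (simp add: Per_def)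
    qed
    also have "\<dots> \<le> ereal (C n)"
      unfolding int' C_def using d(3)[of n] G[of n] by (auto simp: m_def intro!: mult_left_mono)
    finally show ?thesis .
  qed
  have b2: "C \<longlonglongrightarrow> P + 2 * c"
  proof -
    have "G n * (c * d n) = 2 * (r + d n) * (1 + k n) / (2 * r + d n) * c" for n
    proof -
      have "L n * d n = (1 + k n) / (2 * r + d n)" unfolding L_def dd using d(1)[of n] by simp
      moreover have "G n * (c * d n) = 2 * (r + d n) * c * (L n * d n)" by (simp add: G_def)
      ultimately show ?thesis by simp
    qed
    hence C: "C n = P + 2 * (2 * (r + d n) * (1 + k n) / (2 * r + d n) * c)" for n by (simp add: C_def)
    have "C \<longlonglongrightarrow> P + 2 * (2 * (r + 0) * (1 + 0) / (2 * r + 0) * c)"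
      unfolding C[abs_def] by (intro tendsto_intros d0 k0) (use r in auto)
    thus ?thesis using r by simp
  qed
  have lim: "AE y in lebesgue. (\<lambda>n. z n y) \<longlonglongrightarrow> indicator (ball x r) y"
    using AE_not_sphere[of x r]
  proof eventually_elim
    case (elim y)
    show ?case
    proof (cases "y \<in> ball x r")
      case True
      hence "z n y = 1" for n using ramp_0[OF k(1) s_small[of y n]] by (simp add: z_def dist_norm norm_minus_commute)
      thus ?thesis using True by simp
    next
      case False
      hence "norm (y - x) > r" using elim by (auto simp: dist_norm norm_minus_commute)
      hence "\<forall>\<^sub>F n in sequentially. d n < norm (y - x) - r" using d0 by (intro order_tendstoD) auto
      hence "\<forall>\<^sub>F n in sequentially. z n y = indicator (ball x r) y"
      proof eventually_elim
        case (elim n)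
        hence "ramp (k n) (s n y) = 1" by (intro ramp_1 s_big k) auto
        thus ?case using False by (simp add: z_def)
      qed
      thus ?thesis by (rule tendsto_eventually)
    qed
  qed
  have l1: "AE y in lebesgue. (\<lambda>n. z n y * indicator E y) \<longlonglongrightarrow> indicator (E \<inter> ball x r) y"
    using lim
  proof eventually_elim
    case (elim y)
    have "(\<lambda>n. z n y * indicator E y) \<longlonglongrightarrow> indicator (ball x r) y * indicator E y"
      by (intro tendsto_intros elim)
    moreover have "indicator (ball x r) y * indicator E y = (indicator (E \<inter> ball x r) y :: real)"
      by (auto simp: indicator_def)
    ultimately show ?case by simp
  qed
  have l2: "AE y in lebesgue. (\<lambda>n. (1 - z n y) * indicator E y) \<longlonglongrightarrow> indicator (E - ball x r) y"
    using lim
  proof eventually_elim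
    case (elim y)
    have "(\<lambda>n. (1 - z n y) * indicator E y) \<longlonglongrightarrow> (1 - indicator (ball x r) y) * indicator E y"
      by (intro tendsto_intros elim)
    moreover have "(1 - indicator (ball x r) y) * indicator E y = (indicator (E - ball x r) y :: real)"
      by (auto simp: indicator_def)
    ultimately show ?case by simp
  qed
  have [measurable]: "ball x r \<in> sets lebesgue" by simp
  have w: "L1_loc (\<lambda>_. 1 :: real)" using L1_loc_indicator[of UNIV] by simp
  have "TV (indicator (E \<inter> ball x r)) + TV (indicator (E - ball x r)) \<le> ereal (P + 2 * c)"
  proof (rule TV_add_lsc[OF w _ _ _ _ l1 l2 _ _ b1 b2])
    show "AE y in lebesgue. \<bar>z n y * indicator E y\<bar> \<le> 1" for n
      using z01 by (intro AE_I2) (simp add: indicator_def)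
    show "AE y in lebesgue. \<bar>(1 - z n y) * indicator E y\<bar> \<le> 1" for n
      using z01 by (intro AE_I2) (simp add: indicator_def)
  qed (measurable)
  thus ?thesis by (simp add: Per_def)
qed

section \<open>Mollification\<close>

text \<open>Squeeze A between a compact K and an open U. A shift shorter than the distance from K to
  the complement of U keeps K inside U, so a point of A that leaves the translate of A lies in A - K
  or in the translate of U - A, both of small measure.\<close>

lemma L1_translation_indicator:
  fixes A :: "pt set" and e :: real
  assumes A: "A \<in> sets borel" "emeasure lborel A < \<infinity>" and e: "e > 0"
  shows "\<exists>d>0. \<forall>z. norm z < d \<longrightarrow> (\<integral>x. \<bar>indicat_real A (x + z) - indicat_real A x\<bar> \<partial>lborel) < e"
proof -
  have Al: "A \<in> sets lebesgue" using A by simp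
  obtain U where U: "open U" "A \<subseteq> U" "U - A \<in> lmeasurable" "emeasure lebesgue (U - A) < ennreal (e / 4)"
    using sets_lebesgue_outer_open[OF Al, of "e/4"] e by auto
  obtain T where T: "closed T" "T \<subseteq> A" "A - T \<in> lmeasurable" "emeasure lebesgue (A - T) < ennreal (e / 8)"
    using sets_lebesgue_inner_closed[OF Al, of "e/8"] e by auto
  have Am: "A \<in> lmeasurable" using A by (simp add: fmeasurable_def)
  have "(\<lambda>n. measure lebesgue (A - ball 0 (real n))) \<longlonglongrightarrow> measure lebesgue (\<Inter>n. A - ball 0 (real n))"
  proof (rule Lim_measure_decseq)
    show "range (\<lambda>n. A - ball 0 (real n)) \<subseteq> sets lebesgue" using Al by auto
    show "decseq (\<lambda>n. A - ball 0 (real n))" by (auto simp: decseq_def)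
    show "emeasure lebesgue (A - ball 0 (real i)) \<noteq> \<infinity>" for i
      using fmeasurableD2[OF fmeasurable.Diff[OF Am, of "ball 0 (real i)"]] by auto
  qed
  moreover have "(\<Inter>n. A - ball 0 (real n)) = {}"
    using reals_Archimedean2 by (force)
  ultimately have "(\<lambda>n. measure lebesgue (A - ball 0 (real n))) \<longlonglongrightarrow> 0" by (simp only: measure_empty)
  hence "\<forall>\<^sub>F n in sequentially. measure lebesgue (A - ball 0 (real n)) < e / 8"
    using e by (intro order_tendstoD) auto
  then obtain n where n: "measure lebesgue (A - ball 0 (real n)) < e / 8" by (auto simp: eventually_sequentially)
  define K where "K = T \<inter> cball 0 (real n)"
  have K: "compact K" "K \<subseteq> A" using T by (auto simp: K_def closed_Int_compact)
  have Km: "K \<in> lmeasurable" using K by (simp add: lmeasurable_compact)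
  have AK: "measure lebesgue (A - K) < e / 4"
  proof -
    have "measure lebesgue (A - K) \<le> measure lebesgue ((A - T) \<union> (A - ball 0 (real n)))"
      by (rule measure_mono_fmeasurable) (use T Am Km in \<open>auto simp: K_def intro!: fmeasurable.Un fmeasurable.Diff\<close>)
    also have "\<dots> \<le> measure lebesgue (A - T) + measure lebesgue (A - ball 0 (real n))"
      by (rule measure_Un_le) (use T Al in auto)
    also have "measure lebesgue (A - T) < e / 8"
      using T(3,4) e by (simp add: emeasure_eq_measure2 ennreal_less_iff)
    finally show ?thesis using n by simp
  qed
  have UA: "measure lebesgue (U - A) < e / 4"
    using U(3,4) e by (simp add: emeasure_eq_measure2 ennreal_less_iff)
  have "\<exists>d>0. \<forall>x\<in>K. \<forall>y\<in>- U. d \<le> dist x y"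
    by (rule separate_compact_closed) (use K U(1,2) in auto)
  then obtain d where d: "d > 0" "\<And>x y. x \<in> K \<Longrightarrow> y \<in> - U \<Longrightarrow> d \<le> dist x y" by blast
  have key: "measure lebesgue (A - (\<lambda>x. x - z) ` A) < e / 2" if z: "norm z < d" for z
  proof -
    have tr: "(\<lambda>x. x - z) ` S \<in> lmeasurable \<and> measure lebesgue ((\<lambda>x. x - z) ` S) = measure lebesgue S" if "S \<in> lmeasurable" for S :: "pt set"
      using that measurable_translation_subtract measure_translation_subtract by blast
    have "A - (\<lambda>x. x - z) ` A \<subseteq> (A - K) \<union> (\<lambda>x. x - z) ` (U - A)"
    proof
      fix x assume x: "x \<in> A - (\<lambda>x. x - z) ` A"
      show "x \<in> (A - K) \<union> (\<lambda>x. x - z) ` (U - A)"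
      proof (cases "x \<in> K")
        case True
        have "dist x (x + z) < d" using z by (simp add: dist_norm)
        hence "x + z \<in> U" using d(2)[OF True, of "x + z"] by auto
        moreover have "x + z \<notin> A" using x by (metis DiffD2 add_diff_cancel_right' imageI)
        ultimately show ?thesis by (intro UnI2) (auto intro!: image_eqI[of _ _ "x + z"])
      qed (use x in auto)
    qed
    hence "measure lebesgue (A - (\<lambda>x. x - z) ` A) \<le> measure lebesgue ((A - K) \<union> (\<lambda>x. x - z) ` (U - A))"
      by (rule measure_mono_fmeasurable) (use Am Km tr U tr[OF Am] in \<open>auto intro!: fmeasurable.Un fmeasurable.Diff sets.Diff\<close>)
    also have "\<dots> \<le> measure lebesgue (A - K) + measure lebesgue ((\<lambda>x. x - z) ` (U - A))"
      by (rule measure_Un_le) (use Al Km tr[OF U(3)] in auto)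
    also have "\<dots> < e / 2" using AK UA tr[OF U(3)] by simp
    finally have 1: "measure lebesgue (A - (\<lambda>x. x - z) ` A) < e / 2" .
    show ?thesis using 1 .
  qed
  show ?thesis
  proof (intro exI[of _ d] conjI allI impI d)
    fix z :: pt assume z: "norm z < d"
    define B where "B = (\<lambda>x. x - z) ` A"
    have B: "x \<in> B \<longleftrightarrow> x + z \<in> A" for x
      unfolding B_def by (metis (no_types, lifting) add_diff_cancel_right' diff_add_cancel image_iff)
    have Bm: "B \<in> lmeasurable" "measure lebesgue B = measure lebesgue A"
      unfolding B_def using Am measurable_translation_subtract measure_translation_subtract by blast+
    have "B = (\<lambda>x. x + z) -` A \<inter> space borel" using B by auto
    also have "\<dots> \<in> sets borel" using A by measurable
    finally have Bb: "B \<in> sets borel" .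
    have fin: "emeasure lborel A < \<infinity>" "emeasure lborel B < \<infinity>"
      using Am Bm Bb A by (auto simp: fmeasurable_def)
    have i: "integrable lborel (indicator (A - B) :: pt \<Rightarrow> real)" "integrable lborel (indicator (B - A) :: pt \<Rightarrow> real)"
      using fin A Bb emeasure_mono[of "A - B" A lborel] emeasure_mono[of "B - A" B lborel]
      by (auto intro!: integrable_real_indicator)
    have "(\<integral>x. \<bar>indicat_real A (x + z) - indicat_real A x\<bar> \<partial>lborel) = (\<integral>x. indicator (A - B) x + indicator (B - A) x \<partial>lborel)"
      by (rule Bochner_Integration.integral_cong) (auto simp: indicator_def B)
    also have "\<dots> = measure lebesgue (A - B) + measure lebesgue (B - A)"
      using i A Bb by (simp add: measure_completion)
    \<comment> \<open>A and its translate have equal measure, hence so do the two one-sided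
      differences. This is why \<open>key\<close> only needs e / 2.\<close>
    also have "measure lebesgue (B - A) = measure lebesgue (A - B)"
      using measurable_measure_Diff[OF Am, of "A \<inter> B"] measurable_measure_Diff[OF Bm(1), of "A \<inter> B"] Bm Am
      by (simp add: Diff_Int fmeasurableD sets.Int Int_absorb1 Diff_Int2)
    finally show "(\<integral>x. \<bar>indicat_real A (x + z) - indicat_real A x\<bar> \<partial>lborel) < e"
      using key[OF z] by (simp add: B_def)
  qed
qed

lemma L1_translation:
  fixes f :: "pt \<Rightarrow> real"
  assumes "integrable lborel f" "e > 0"
  shows "\<exists>d>0. \<forall>z. norm z < d \<longrightarrow> (\<integral>x. \<bar>f (x + z) - f x\<bar> \<partial>lborel) < e"
  using assms
proof (induction arbitrary: e rule: integrable_induct)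
  case (base A c)
  have A: "A \<in> sets borel" "emeasure lborel A < \<infinity>" using base by auto
  obtain d where d: "d > 0" "\<And>z. norm z < d \<Longrightarrow> (\<integral>x. \<bar>indicat_real A (x + z) - indicat_real A x\<bar> \<partial>lborel) < e / (\<bar>c\<bar> + 1)"
    using L1_translation_indicator[OF A, of "e / (\<bar>c\<bar> + 1)"] base(3) by (auto simp: add_nonneg_pos)
  show ?case
  proof (intro exI[of _ d] conjI allI impI d)
    fix z :: pt assume z: "norm z < d"
    have "(\<integral>x. \<bar>indicator A (x + z) *\<^sub>R c - indicator A x *\<^sub>R c\<bar> \<partial>lborel) = (\<integral>x. \<bar>c\<bar> * \<bar>indicat_real A (x + z) - indicat_real A x\<bar> \<partial>lborel)"
      by (rule Bochner_Integration.integral_cong) (auto simp: indicator_def)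
    also have "\<dots> \<le> \<bar>c\<bar> * (e / (\<bar>c\<bar> + 1))"
      using mult_left_mono[OF less_imp_le[OF d(2)[OF z]], of "\<bar>c\<bar>"] by simp
    also have "\<dots> < e" using base(3) by (simp add: field_simps)
    finally show "(\<integral>x. \<bar>indicator A (x + z) *\<^sub>R c - indicator A x *\<^sub>R c\<bar> \<partial>lborel) < e" .
  qed
next
  case (add f g)
  obtain d1 where d1: "d1 > 0" "\<And>z. norm z < d1 \<Longrightarrow> (\<integral>x. \<bar>f (x + z) - f x\<bar> \<partial>lborel) < e / 2" using add(3)[of "e/2"] add(5) by auto
  obtain d2 where d2: "d2 > 0" "\<And>z. norm z < d2 \<Longrightarrow> (\<integral>x. \<bar>g (x + z) - g x\<bar> \<partial>lborel) < e / 2" using add(4)[of "e/2"] add(5) by auto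
  show ?case
  proof (intro exI[of _ "min d1 d2"] conjI allI impI)
    fix z :: pt assume z: "norm z < min d1 d2"
    have i: "integrable lborel (\<lambda>x. \<bar>f (x + z) - f x\<bar>)" "integrable lborel (\<lambda>x. \<bar>g (x + z) - g x\<bar>)"
      using integrable_translation_lborel[OF add(1), of z] integrable_translation_lborel[OF add(2), of z] add(1,2)
      by (auto simp: add.commute)
    have i2: "integrable lborel (\<lambda>x. \<bar>f (x + z) + g (x + z) - (f x + g x)\<bar>)"
      using integrable_translation_lborel[OF add(1), of z] integrable_translation_lborel[OF add(2), of z] add(1,2)
      by (auto simp: add.commute)
    have "(\<integral>x. \<bar>f (x + z) + g (x + z) - (f x + g x)\<bar> \<partial>lborel) \<le> (\<integral>x. \<bar>f (x + z) - f x\<bar> + \<bar>g (x + z) - g x\<bar> \<partial>lborel)"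
      using i i2 by (intro integral_mono) auto
    also have "\<dots> < e" using d1(2)[of z] d2(2)[of z] i z by simp
    finally show "(\<integral>x. \<bar>f (x + z) + g (x + z) - (f x + g x)\<bar> \<partial>lborel) < e" .
  qed (use d1 d2 in auto)
next
  case (lim f s)
  have "(\<lambda>n. \<integral>x. \<bar>s n x - f x\<bar> \<partial>lborel) \<longlonglongrightarrow> (\<integral>x. 0 \<partial>(lborel :: pt measure))"
  proof (rule integral_dominated_convergence[where w="\<lambda>x. 3 * \<bar>f x\<bar>"])
    show "AE x in lborel. (\<lambda>n. \<bar>s n x - f x\<bar>) \<longlonglongrightarrow> 0"
      using lim(2) by (intro AE_I2 tendsto_rabs_zero LIM_zero) auto
    show "AE x in lborel. norm \<bar>s n x - f x\<bar> \<le> 3 * \<bar>f x\<bar>" for n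
      using lim(3) by (intro AE_I2) (smt (verit) UNIV_I space_lborel real_norm_def abs_triangle_ineq4)
  qed (use lim in auto)
  hence "\<forall>\<^sub>F n in sequentially. (\<integral>x. \<bar>s n x - f x\<bar> \<partial>lborel) < e / 3"
    using lim(6) by (intro order_tendstoD) auto
  then obtain n where n: "(\<integral>x. \<bar>s n x - f x\<bar> \<partial>lborel) < e / 3" by (auto simp: eventually_sequentially)
  obtain d where d: "d > 0" "\<And>z. norm z < d \<Longrightarrow> (\<integral>x. \<bar>s n (x + z) - s n x\<bar> \<partial>lborel) < e / 3" using lim(5)[of "e/3" n] lim(6) by auto
  show ?case
  proof (intro exI[of _ d] conjI allI impI d)
    fix z :: pt assume z: "norm z < d"
    note t = integrable_translation_lborel[OF lim(1)[of n], of z] integrable_translation_lborel[OF lim(4), of z] lim(1)[of n] lim(4)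
    have i: "integrable lborel (\<lambda>x. \<bar>s n (x + z) - f (x + z)\<bar>)" "integrable lborel (\<lambda>x. \<bar>s n (x + z) - s n x\<bar>)"
       "integrable lborel (\<lambda>x. \<bar>s n x - f x\<bar>)" "integrable lborel (\<lambda>x. \<bar>f (x + z) - f x\<bar>)"
      using t by (auto simp: add.commute)
    have "(\<integral>x. \<bar>f (x + z) - f x\<bar> \<partial>lborel) \<le> (\<integral>x. \<bar>s n (x + z) - f (x + z)\<bar> + \<bar>s n (x + z) - s n x\<bar> + \<bar>s n x - f x\<bar> \<partial>lborel)"
      using i by (intro integral_mono) auto
    also have "\<dots> = (\<integral>x. \<bar>s n (x + z) - f (x + z)\<bar> \<partial>lborel) + (\<integral>x. \<bar>s n (x + z) - s n x\<bar> \<partial>lborel) + (\<integral>x. \<bar>s n x - f x\<bar> \<partial>lborel)"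
      using i by simp
    also have "(\<integral>x. \<bar>s n (x + z) - f (x + z)\<bar> \<partial>lborel) = (\<integral>x. \<bar>s n x - f x\<bar> \<partial>lborel)"
      using integral_translation_lborel[of "\<lambda>x. \<bar>s n x - f x\<bar>" z] lim(1)[of n] lim(4) by (simp add: add.commute)
    finally show "(\<integral>x. \<bar>f (x + z) - f x\<bar> \<partial>lborel) < e" using n d(2)[OF z] by simp
  qed
qed

text \<open>A radial C^1 bump; the gradient of \<open>kern e\<close> at x is \<open>kernd e x\<close> times x.\<close>

definition kern_mass :: "real \<Rightarrow> real" where
  "kern_mass e = (\<integral>x. (max (e\<^sup>2 - x \<bullet> x) 0)\<^sup>2 \<partial>(lborel :: pt measure))"

definition kern :: "real \<Rightarrow> pt \<Rightarrow> real" where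
  "kern e x = (max (e\<^sup>2 - x \<bullet> x) 0)\<^sup>2 / kern_mass e"

definition kernd :: "real \<Rightarrow> pt \<Rightarrow> real" where
  "kernd e x = - 4 * max (e\<^sup>2 - x \<bullet> x) 0 / kern_mass e"

lemma max_sq_norm_zero: "0 \<le> e \<Longrightarrow> e \<le> norm (x::pt) \<Longrightarrow> max (e\<^sup>2 - x \<bullet> x) 0 = 0"
  using power_mono[of e "norm x" 2] by (simp add: power2_norm_eq_inner)

lemma kern_profile_integrable: "integrable lborel (\<lambda>x::pt. (max (e\<^sup>2 - x \<bullet> x) 0)\<^sup>2)"
proof (rule C1c_integrable(1)[where R="\<bar>e\<bar>"])
  show "(max (e\<^sup>2 - x \<bullet> x) 0)\<^sup>2 = 0" if "\<bar>e\<bar> < norm x" for x :: pt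
    using max_sq_norm_zero[of "\<bar>e\<bar>" x] that by simp
qed (auto intro!: continuous_intros)

lemma kern_mass_pos: assumes "e > 0" shows "kern_mass e > 0"
proof -
  have "0 < (3 * e\<^sup>2 / 4)\<^sup>2 * measure lborel (ball (0::pt) (e / 2))"
    using assms by (intro mult_pos_pos) (auto simp: content_ball_pos)
  also have "\<dots> = (\<integral>x. (3 * e\<^sup>2 / 4)\<^sup>2 * indicator (ball (0::pt) (e / 2)) x \<partial>lborel)"
    by simp
  also have "\<dots> \<le> kern_mass e"
    unfolding kern_mass_def
  proof (rule integral_mono[OF _ kern_profile_integrable])
    show "integrable lborel (\<lambda>x. (3 * e\<^sup>2 / 4)\<^sup>2 * indicator (ball (0::pt) (e / 2)) x)"
      using emeasure_bounded_finite[of "ball (0::pt) (e/2)"] by (intro integrable_mult_right integrable_real_indicator) auto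
    fix x :: pt
    show "(3 * e\<^sup>2 / 4)\<^sup>2 * indicator (ball 0 (e / 2)) x \<le> (max (e\<^sup>2 - x \<bullet> x) 0)\<^sup>2"
    proof (cases "x \<in> ball 0 (e/2)")
      case True
      hence "x \<bullet> x \<le> (e/2)\<^sup>2" using power_mono[of "norm x" "e/2" 2] by (simp add: power2_norm_eq_inner)
      hence "3 * e\<^sup>2 / 4 \<le> e\<^sup>2 - x \<bullet> x" by (simp add: power2_eq_square)
      hence "3 * e\<^sup>2 / 4 \<le> max (e\<^sup>2 - x \<bullet> x) 0" by linarith
      hence "(3 * e\<^sup>2 / 4)\<^sup>2 \<le> (max (e\<^sup>2 - x \<bullet> x) 0)\<^sup>2" by (intro power_mono) auto
      thus ?thesis using True by simp
    qed simp
  qed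
  finally show ?thesis .
qed

lemma kern_nonneg: "e > 0 \<Longrightarrow> 0 \<le> kern e x"
  using kern_mass_pos[of e] by (simp add: kern_def)

lemma kern_zero: "e > 0 \<Longrightarrow> e \<le> norm x \<Longrightarrow> kern e x = 0" "e > 0 \<Longrightarrow> e \<le> norm x \<Longrightarrow> kernd e x = 0"
  using max_sq_norm_zero[of e x] by (auto simp: kern_def kernd_def)

lemma kern_uminus: "kern e (- x) = kern e x" "kernd e (- x) = kernd e x"
  by (auto simp: kern_def kernd_def)

lemma kern_swap: "kern e (x - y) = kern e (y - x)" "kernd e (x - y) = kernd e (y - x)"
  using kern_uminus[of e "x - y"] by auto

lemma kern_continuous: "continuous_on UNIV (kern e)" "continuous_on UNIV (kernd e)"
  unfolding kern_def[abs_def] kernd_def[abs_def]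
  by (cases "kern_mass e = 0"; auto intro!: continuous_intros)+

lemma kern_measurable [measurable]: "kern e \<in> borel_measurable borel" "kernd e \<in> borel_measurable borel"
  using kern_continuous by (auto intro: borel_measurable_continuous_onI)

lemma kern_integral: assumes "e > 0" shows "integrable lborel (kern e)" "(\<integral>x. kern e x \<partial>lborel) = 1"
  using kern_profile_integrable[of e] kern_mass_pos[OF assms] unfolding kern_def[abs_def]
  by (auto simp: kern_mass_def)

lemma kern_has_derivative: "(kern e has_derivative (\<lambda>v. kernd e x * (x \<bullet> v))) (at x)"
proof -
  have "((\<lambda>x::pt. e\<^sup>2 - x \<bullet> x) has_derivative (\<lambda>v. - (2 * (x \<bullet> v)))) (at x)"
    by (auto intro!: derivative_eq_intros simp: inner_commute)
  from has_derivative_compose[OF this DERIV_max0_square[of "e\<^sup>2 - x \<bullet> x", unfolded has_field_derivative_def]]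
  have "((\<lambda>x. (max (e\<^sup>2 - x \<bullet> x) 0)\<^sup>2 * inverse (kern_mass e)) has_derivative
     (\<lambda>v. (2 * max (e\<^sup>2 - x \<bullet> x) 0 * - (2 * (x \<bullet> v))) * inverse (kern_mass e))) (at x)"
    by (rule has_derivative_mult_left)
  thus ?thesis unfolding kern_def[abs_def] kernd_def divide_inverse by (simp add: mult_ac)
qed

text \<open>Write p for the truncated profile. In p a a - p b b = p a (a - b) + (p a - p b) b the
  first term costs e^2 and the second 2 e times e, provided that b lies in the ball of radius e. By
  symmetry it is enough that one of the points does, and if neither does both vectors
  vanish.\<close>

lemma kernd_Lipschitz_aux:
  fixes a b :: pt assumes e: "e > 0"
  shows "norm (max (e\<^sup>2 - a \<bullet> a) 0 *\<^sub>R a - max (e\<^sup>2 - b \<bullet> b) 0 *\<^sub>R b) \<le> 3 * e\<^sup>2 * norm (a - b)"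
proof -
  define p where "p x = max (e\<^sup>2 - x \<bullet> x) 0" for x :: pt
  have pz: "p x = 0" if "e \<le> norm x" for x using max_sq_norm_zero[of e x] that e by (simp add: p_def)
  have pe: "0 \<le> p x" "p x \<le> e\<^sup>2" for x by (auto simp: p_def)
  have main: "norm (p a *\<^sub>R a - p b *\<^sub>R b) \<le> 3 * e\<^sup>2 * norm (a - b)" if b: "norm b < e" for a b
  proof -
    have d: "\<bar>p a - p b\<bar> \<le> 2 * e * norm (a - b)"
    proof (cases "norm a < e")
      case True
      have "\<bar>p a - p b\<bar> \<le> \<bar>b \<bullet> b - a \<bullet> a\<bar>" by (auto simp: p_def)
      also have "b \<bullet> b - a \<bullet> a = (b + a) \<bullet> (b - a)" by (simp add: inner_simps inner_commute)
      also have "\<bar>(b + a) \<bullet> (b - a)\<bar> \<le> norm (b + a) * norm (b - a)" by (rule Cauchy_Schwarz_ineq2)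
      also have "\<dots> \<le> (2 * e) * norm (b - a)"
        using norm_triangle_ineq[of b a] True b by (intro mult_right_mono) auto
      finally show ?thesis by (simp add: norm_minus_commute)
    next
      case False
      have "p b = (e - norm b) * (e + norm b)"
        using b e power_mono[of "norm b" e 2] by (simp add: p_def power2_norm_eq_inner[symmetric] power2_eq_square algebra_simps)
      also have "\<dots> \<le> norm (a - b) * (2 * e)"
      proof (intro mult_mono)
        show "e - norm b \<le> norm (a - b)" using False norm_triangle_ineq2[of a b] by linarith
      qed (use b e in \<open>auto intro: add_nonneg_nonneg\<close>)
      finally show ?thesis using pz[of a] False pe(1)[of b] by (simp add: mult.commute)
    qed
    have "p a *\<^sub>R a - p b *\<^sub>R b = p a *\<^sub>R (a - b) + (p a - p b) *\<^sub>R b" by (simp add: algebra_simps)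
    also have "norm \<dots> \<le> p a * norm (a - b) + \<bar>p a - p b\<bar> * norm b"
      using norm_triangle_ineq[of "p a *\<^sub>R (a - b)" "(p a - p b) *\<^sub>R b"] pe(1)[of a] by simp
    also have "\<dots> \<le> e\<^sup>2 * norm (a - b) + (2 * e * norm (a - b)) * e"
      using pe d b e by (intro add_mono mult_right_mono mult_mono) auto
    finally show ?thesis by (simp add: power2_eq_square algebra_simps)
  qed
  show ?thesis
  proof (cases "norm b < e")
    case True thus ?thesis using main[of b a] by (simp add: p_def)
  next
    case b: False
    show ?thesis
    proof (cases "norm a < e")
      case True thus ?thesis using main[of a b] by (simp add: p_def norm_minus_commute)
    next
      case False thus ?thesis using b pz[of a] pz[of b] by (simp add: p_def)
    qed
  qed
qed

text \<open>Lipschitz constant of the gradient of the kernel: the factor 4 of \<open>kernd\<close>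
  times the 3 e^2 of the preceding estimate.\<close>

definition kern_lip :: "real \<Rightarrow> real" where "kern_lip e = 12 * e\<^sup>2 / kern_mass e"

lemma kern_lip_nonneg: "e > 0 \<Longrightarrow> 0 \<le> kern_lip e"
  using kern_mass_pos[of e] by (simp add: kern_lip_def)

lemma kernd_Lipschitz:
  assumes e: "e > 0"
  shows "\<bar>kernd e a * (a \<bullet> v) - kernd e b * (b \<bullet> v)\<bar> \<le> kern_lip e * norm (a - b) * norm v"
proof -
  define q where "q x = max (e\<^sup>2 - x \<bullet> x) 0 *\<^sub>R x" for x :: pt
  have Z: "kern_mass e > 0" using kern_mass_pos[OF e] .
  have "kernd e a * (a \<bullet> v) - kernd e b * (b \<bullet> v) = - 4 / kern_mass e * ((q a - q b) \<bullet> v)"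
    using Z by (simp add: kernd_def q_def inner_diff_left field_simps)
  also have "\<bar>\<dots>\<bar> = 4 / kern_mass e * \<bar>(q a - q b) \<bullet> v\<bar>" using Z by (simp add: abs_mult)
  also have "\<dots> \<le> 4 / kern_mass e * (norm (q a - q b) * norm v)"
    using Z by (intro mult_left_mono Cauchy_Schwarz_ineq2) auto
  also have "\<dots> \<le> 4 / kern_mass e * ((3 * e\<^sup>2 * norm (a - b)) * norm v)"
    using Z kernd_Lipschitz_aux[OF e, of a b] by (intro mult_left_mono mult_right_mono) (auto simp: q_def)
  also have "\<dots> = kern_lip e * norm (a - b) * norm v" by (simp add: kern_lip_def)
  finally show ?thesis .
qed

lemma kernd_bound:
  assumes e: "e > 0"
  shows "\<bar>kernd e a * (a \<bullet> v)\<bar> \<le> kern_lip e * e * norm v"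
proof (cases "norm a \<le> e")
  case True
  have "\<bar>kernd e a * (a \<bullet> v)\<bar> \<le> kern_lip e * norm a * norm v" using kernd_Lipschitz[OF e, of a v 0] by simp
  also have "\<dots> \<le> kern_lip e * e * norm v" using True kern_lip_nonneg[OF e] by (intro mult_right_mono mult_left_mono) auto
  finally show ?thesis .
next
  case False
  thus ?thesis using kern_zero(2)[of e a] kern_lip_nonneg[OF e] e by simp
qed

lemma kern_taylor:
  assumes e: "e > 0"
  shows "\<bar>kern e (a + h) - kern e a - kernd e a * (a \<bullet> h)\<bar> \<le> kern_lip e * norm h * norm h"
proof -
  have "\<exists>s::real>0. s < 1 \<and> kern e (a + 1 *\<^sub>R h) - kern e (a + 0 *\<^sub>R h) = (1 - 0) * (kernd e (a + s *\<^sub>R h) * ((a + s *\<^sub>R h) \<bullet> h))"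
  proof (rule MVT2)
    fix s :: real
    have "((\<lambda>s. kern e (a + s *\<^sub>R h)) has_derivative (\<lambda>t. kernd e (a + s *\<^sub>R h) * ((a + s *\<^sub>R h) \<bullet> (t *\<^sub>R h)))) (at s)"
      by (rule has_derivative_compose[where g="kern e" and f="\<lambda>s. a + s *\<^sub>R h"])
        (auto intro!: derivative_eq_intros kern_has_derivative)
    thus "((\<lambda>s. kern e (a + s *\<^sub>R h)) has_real_derivative kernd e (a + s *\<^sub>R h) * ((a + s *\<^sub>R h) \<bullet> h)) (at s)"
      by (rule has_derivative_imp_has_field_derivative) simp
  qed simp
  then obtain s :: real where s: "s > 0" "s < 1"
    "kern e (a + h) - kern e a = kernd e (a + s *\<^sub>R h) * ((a + s *\<^sub>R h) \<bullet> h)" by auto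
  have "\<bar>kern e (a + h) - kern e a - kernd e a * (a \<bullet> h)\<bar> \<le> kern_lip e * norm (a + s *\<^sub>R h - a) * norm h"
    unfolding s(3) by (rule kernd_Lipschitz[OF e])
  also have "\<dots> \<le> kern_lip e * norm h * norm h"
    using s kern_lip_nonneg[OF e] by (intro mult_right_mono mult_left_mono) (auto simp: mult_left_le_one_le)
  finally show ?thesis .
qed

section \<open>Convolution of functions and fields with the bump\<close>

definition conv :: "real \<Rightarrow> (pt \<Rightarrow> 'b::euclidean_space) \<Rightarrow> pt \<Rightarrow> 'b" where
  "conv e f x = (\<integral>y. kern e (x - y) *\<^sub>R f y \<partial>lborel)"

definition conv' :: "real \<Rightarrow> (pt \<Rightarrow> 'b::euclidean_space) \<Rightarrow> pt \<Rightarrow> pt \<Rightarrow> 'b" where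
  "conv' e f x v = (\<integral>y. (kernd e (x - y) * ((x - y) \<bullet> v)) *\<^sub>R f y \<partial>lborel)"

lemma bounded_scaleR_integrable:
  fixes f :: "pt \<Rightarrow> 'b::euclidean_space"
  assumes f: "integrable lborel f" and [measurable]: "g \<in> borel_measurable borel" and B: "\<And>y. \<bar>g y\<bar> \<le> B"
  shows "integrable lborel (\<lambda>y. g y *\<^sub>R f y)" "norm (\<integral>y. g y *\<^sub>R f y \<partial>lborel) \<le> B * (\<integral>y. norm (f y) \<partial>lborel)"
proof -
  have fn: "integrable lborel (\<lambda>y. B * norm (f y))" using f by auto
  have [measurable]: "f \<in> borel_measurable borel" using f by auto
  show i: "integrable lborel (\<lambda>y. g y *\<^sub>R f y)"
    by (rule Bochner_Integration.integrable_bound[OF fn]) (use B in \<open>auto simp: abs_mult intro!: AE_I2 mult_right_mono intro: order_trans[OF B abs_ge_self]\<close>)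
  have "norm (\<integral>y. g y *\<^sub>R f y \<partial>lborel) \<le> (\<integral>y. B * norm (f y) \<partial>lborel)"
    by (rule Bochner_Integration.integral_norm_bound_integral[OF i fn]) (auto intro!: mult_right_mono B)
  thus "norm (\<integral>y. g y *\<^sub>R f y \<partial>lborel) \<le> B * (\<integral>y. norm (f y) \<partial>lborel)" by simp
qed

lemma kern_bounded: assumes "e > 0" shows "\<exists>B. \<forall>y. \<bar>kern e y\<bar> \<le> B"
  using C1c_integrable(2)[OF kern_continuous(1), of e e] kern_zero(1)[OF assms] by (meson less_imp_le)

lemma conv_integrable:
  fixes f :: "pt \<Rightarrow> 'b::euclidean_space"
  assumes e: "e > 0" and f: "integrable lborel f"
  shows "integrable lborel (\<lambda>y. kern e (x - y) *\<^sub>R f y)" "integrable lborel (\<lambda>y. (kernd e (x - y) * ((x - y) \<bullet> v)) *\<^sub>R f y)"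
proof -
  obtain B where B: "\<And>y. \<bar>kern e y\<bar> \<le> B" using kern_bounded[OF e] by auto
  show "integrable lborel (\<lambda>y. kern e (x - y) *\<^sub>R f y)"
    by (rule bounded_scaleR_integrable(1)[OF f _ B]) measurable
  show "integrable lborel (\<lambda>y. (kernd e (x - y) * ((x - y) \<bullet> v)) *\<^sub>R f y)"
    by (rule bounded_scaleR_integrable(1)[OF f _ kernd_bound[OF e]]) measurable
qed

text \<open>The Taylor remainder of the kernel is quadratic, uniformly in the integration variable,
  so the remainder of the convolution is quadratic with the L1 norm of f as a factor.\<close>

lemma conv_has_derivative:
  fixes f :: "pt \<Rightarrow> 'b::euclidean_space"
  assumes e: "e > 0" and f: "integrable lborel f"
  shows "(conv e f has_derivative conv' e f x) (at x)"
proof -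
  define I where "I = (\<integral>y. norm (f y) \<partial>lborel)"
  have I: "I \<ge> 0" by (simp add: I_def)
  have lin: "bounded_linear (conv' e f x)"
  proof (rule bounded_linear_intro)
    fix v w :: pt and r :: real
    show "conv' e f x (v + w) = conv' e f x v + conv' e f x w"
      unfolding conv'_def using conv_integrable(2)[OF e f]
      by (simp add: inner_add_right distrib_left scaleR_add_left)
    show "conv' e f x (r *\<^sub>R v) = r *\<^sub>R conv' e f x v"
      unfolding conv'_def
      by (subst integral_scaleR_right[symmetric]) (auto intro!: Bochner_Integration.integral_cong simp: mult_ac)
    have "norm (conv' e f x v) \<le> (kern_lip e * e * norm v) * I"
      unfolding conv'_def I_def by (rule bounded_scaleR_integrable(2)[OF f _ kernd_bound[OF e]]) measurable
    thus "norm (conv' e f x v) \<le> norm v * (kern_lip e * e * I)" by (simp add: mult_ac)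
  qed
  have bd: "norm (conv e f (x + h) - conv e f x - conv' e f x h) \<le> (kern_lip e * norm h * norm h) * I" for h
  proof -
    have "conv e f (x + h) - conv e f x - conv' e f x h =
      (\<integral>y. (kern e ((x - y) + h) - kern e (x - y) - kernd e (x - y) * ((x - y) \<bullet> h)) *\<^sub>R f y \<partial>lborel)"
      unfolding conv_def conv'_def using conv_integrable[OF e f]
      by (simp add: scaleR_diff_left diff_add_eq)
    also have "norm \<dots> \<le> (kern_lip e * norm h * norm h) * I"
      unfolding I_def by (rule bounded_scaleR_integrable(2)[OF f _ kern_taylor[OF e]]) measurable
    finally show ?thesis .
  qed
  show ?thesis
  proof (rule has_derivativeI_sandwich[of 1])
    show "norm (conv e f y - conv e f x - conv' e f x (y - x)) / norm (y - x) \<le> kern_lip e * I * norm (y - x)"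
      if "y \<noteq> x" for y
      using bd[of "y - x"] that by (simp add: divide_le_eq mult_ac)
    show "((\<lambda>y. kern_lip e * I * norm (y - x)) \<longlongrightarrow> 0) (at x)"
      by (auto intro!: tendsto_eq_intros)
  qed (use lin in auto)
qed

lemma conv'_continuous:
  fixes f :: "pt \<Rightarrow> 'b::euclidean_space"
  assumes e: "e > 0" and f: "integrable lborel f"
  shows "continuous_on UNIV (\<lambda>x. conv' e f x v)"
proof -
  define I where "I = (\<integral>y. norm (f y) \<partial>lborel)"
  have bd: "norm (conv' e f x v - conv' e f x' v) \<le> (kern_lip e * norm (x - x') * norm v) * I" for x x'
  proof -
    have "conv' e f x v - conv' e f x' v =
      (\<integral>y. (kernd e (x - y) * ((x - y) \<bullet> v) - kernd e (x' - y) * ((x' - y) \<bullet> v)) *\<^sub>R f y \<partial>lborel)"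
      unfolding conv'_def using conv_integrable[OF e f] by (simp add: scaleR_diff_left)
    also have "norm \<dots> \<le> (kern_lip e * norm (x - x') * norm v) * I"
      unfolding I_def
    proof (rule bounded_scaleR_integrable(2)[OF f])
      show "\<bar>kernd e (x - y) * ((x - y) \<bullet> v) - kernd e (x' - y) * ((x' - y) \<bullet> v)\<bar> \<le> kern_lip e * norm (x - x') * norm v" for y
        using kernd_Lipschitz[OF e, of "x - y" v "x' - y"] by simp
    qed measurable
    finally show ?thesis .
  qed
  have "((\<lambda>x. conv' e f x v) \<longlongrightarrow> conv' e f a v) (at a)" for a
  proof (rule LIM_zero_cancel, rule Lim_null_comparison)
    show "\<forall>\<^sub>F x in at a. norm (conv' e f x v - conv' e f a v) \<le> (kern_lip e * norm (x - a) * norm v) * I"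
      using bd by auto
    show "((\<lambda>x. kern_lip e * norm (x - a) * norm v * I) \<longlongrightarrow> 0) (at a)"
      by (auto intro!: tendsto_eq_intros)
  qed
  thus ?thesis by (simp add: continuous_on_def)
qed

text \<open>The error is an average of f (x + y) - f x with weight k; by Fubini its L1 norm is at
  most the average of the translation errors, and k lives where these are small. The kernel is
  arbitrary because the lemma serves twice: for the smooth bump, and for normalized indicators of
  discs in the density theorem below.\<close>

lemma mollify_L1:
  fixes f :: "pt \<Rightarrow> real"
  assumes f: "integrable lborel f" and d: "\<And>z. norm z < d \<Longrightarrow> (\<integral>x. \<bar>f (x + z) - f x\<bar> \<partial>lborel) \<le> \<epsilon>"
    and k: "integrable lborel k" "(\<integral>x. k x \<partial>lborel) = 1" "\<And>z. 0 \<le> k z" "\<And>z. k z \<le> B" "\<And>z. d \<le> norm z \<Longrightarrow> k z = 0"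
  shows "integrable lborel (\<lambda>x. (\<integral>y. k y * f (x + y) \<partial>lborel) - f x)"
    "(\<integral>x. \<bar>(\<integral>y. k y * f (x + y) \<partial>lborel) - f x\<bar> \<partial>lborel) \<le> \<epsilon>"
proof -
  have [measurable]: "f \<in> borel_measurable borel" "k \<in> borel_measurable borel" using f k by auto
  define F where "F y x = k y * (f (x + y) - f x)" for y x :: pt
  have ix: "integrable lborel (\<lambda>x. f (x + y) - f x)" for y
    using integrable_translation_lborel[OF f, of y] f by (simp add: add.commute)
  have i1: "integrable lborel (F y)" for y unfolding F_def[abs_def] using ix by simp
  have n1: "(\<integral>x. norm (F y x) \<partial>lborel) = k y * (\<integral>x. \<bar>f (x + y) - f x\<bar> \<partial>lborel)" for y
    unfolding F_def using k(3) by (simp add: abs_mult)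
  have n2: "k y * (\<integral>x. \<bar>f (x + y) - f x\<bar> \<partial>lborel) \<le> k y * \<epsilon>" for y
    using d[of y] k(3,5)[of y] by (cases "norm y < d") (auto intro: mult_left_mono)
  have m: "(\<lambda>y. \<integral>x. norm (F y x) \<partial>lborel) \<in> borel_measurable lborel"
    unfolding F_def by measurable
  have ike: "integrable lborel (\<lambda>y. k y * \<epsilon>)" using k(1) by simp
  have iN: "integrable lborel (\<lambda>y. \<integral>x. norm (F y x) \<partial>lborel)"
  proof (rule Bochner_Integration.integrable_bound[OF ike m])
    show "AE y in lborel. norm (\<integral>x. norm (F y x) \<partial>lborel) \<le> norm (k y * \<epsilon>)"
      unfolding n1 using n2 k(3) by (intro AE_I2) (auto simp: abs_mult intro: order_trans[OF n2 mult_left_mono[OF abs_ge_self k(3)]])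
  qed
  have P: "integrable (lborel \<Otimes>\<^sub>M lborel) (\<lambda>(y, x). F y x)"
  proof (rule lborel_pair.Fubini_integrable)
    show "(\<lambda>(y, x). F y x) \<in> borel_measurable (lborel \<Otimes>\<^sub>M lborel)" unfolding F_def by measurable
  qed (use iN i1 in auto)
  have i2: "integrable lborel (\<lambda>x. \<integral>y. F y x \<partial>lborel)"
    using lborel_pair.integrable_snd[OF P] .
  have sub: "(\<integral>y. k y * f (x + y) \<partial>lborel) - f x = (\<integral>y. F y x \<partial>lborel)" for x
  proof -
    have "integrable lborel (\<lambda>y. k y * f (x + y))"
    proof (rule Bochner_Integration.integrable_bound[where f="\<lambda>y. B * f (x + y)"])
      show "integrable lborel (\<lambda>y. B * f (x + y))" using integrable_translation_lborel[OF f, of x] by simp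
      show "AE y in lborel. norm (k y * f (x + y)) \<le> norm (B * f (x + y))"
        using k(3,4) by (intro AE_I2) (auto simp: abs_mult intro!: mult_right_mono intro: order_trans[OF k(4) abs_ge_self])
    qed measurable
    thus ?thesis unfolding F_def right_diff_distrib using k(1,2) by simp
  qed
  show "integrable lborel (\<lambda>x. (\<integral>y. k y * f (x + y) \<partial>lborel) - f x)" unfolding sub by (rule i2)
  have P': "integrable (lborel \<Otimes>\<^sub>M lborel) (\<lambda>(y, x). norm (F y x))"
    using integrable_norm[OF P] by (simp add: case_prod_unfold)
  have "(\<integral>x. \<bar>(\<integral>y. k y * f (x + y) \<partial>lborel) - f x\<bar> \<partial>lborel) \<le> (\<integral>x. (\<integral>y. norm (F y x) \<partial>lborel) \<partial>lborel)"
    unfolding sub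
  proof (rule integral_mono)
    show "integrable lborel (\<lambda>x. \<integral>y. norm (F y x) \<partial>lborel)" using lborel_pair.integrable_snd[OF P'] .
    show "\<bar>\<integral>y. F y x \<partial>lborel\<bar> \<le> (\<integral>y. norm (F y x) \<partial>lborel)" for x
      using integral_norm_bound[of lborel "\<lambda>y. F y x"] by simp
  qed (use i2 in auto)
  also have "\<dots> = (\<integral>y. (\<integral>x. norm (F y x) \<partial>lborel) \<partial>lborel)"
    using lborel_pair.Fubini_integral[OF P'] .
  also have "\<dots> \<le> (\<integral>y. k y * \<epsilon> \<partial>lborel)"
    by (rule integral_mono[OF iN ike]) (simp only: n1 n2)
  also have "\<dots> = \<epsilon>" using k(1,2) by simp
  finally show "(\<integral>x. \<bar>(\<integral>y. k y * f (x + y) \<partial>lborel) - f x\<bar> \<partial>lborel) \<le> \<epsilon>" .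
qed

lemma conv_translate:
  fixes f :: "pt \<Rightarrow> real"
  assumes [measurable]: "f \<in> borel_measurable borel"
  shows "conv e f x = (\<integral>y. kern e y * f (x + y) \<partial>lborel)"
proof -
  have "conv e f x = (\<integral>y. kern e (x - (x + y)) * f (x + y) \<partial>lborel)"
    unfolding conv_def using integral_translation_lborel[of "\<lambda>y. kern e (x - y) * f y" x] by simp
  thus ?thesis by (simp add: kern_uminus)
qed

lemma conv_L1:
  fixes f :: "pt \<Rightarrow> real"
  assumes f: "integrable lborel f" and "\<epsilon> > 0"
  shows "\<exists>d>0. \<forall>e. 0 < e \<and> e \<le> d \<longrightarrow> integrable lborel (\<lambda>x. conv e f x - f x) \<and> (\<integral>x. \<bar>conv e f x - f x\<bar> \<partial>lborel) \<le> \<epsilon>"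
proof -
  obtain d where d: "d > 0" "\<And>z. norm z < d \<Longrightarrow> (\<integral>x. \<bar>f (x + z) - f x\<bar> \<partial>lborel) < \<epsilon>"
    using L1_translation[OF assms] by auto
  show ?thesis
  proof (intro exI[of _ d] conjI allI impI d(1))
    fix e assume e: "0 < e \<and> e \<le> d"
    obtain B where B: "\<And>y. \<bar>kern e y\<bar> \<le> B" using kern_bounded[of e] e by auto
    have [measurable]: "f \<in> borel_measurable borel" using f by auto
    have *: "kern e z \<le> B" for z using B[of z] by linarith
    have z: "d \<le> norm z \<Longrightarrow> kern e z = 0" for z using kern_zero(1)[of e z] e by auto
    show "integrable lborel (\<lambda>x. conv e f x - f x)" "(\<integral>x. \<bar>conv e f x - f x\<bar> \<partial>lborel) \<le> \<epsilon>"
      using mollify_L1[OF f less_imp_le[OF d(2)] kern_integral[of e] kern_nonneg[of e] * z] e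
      by (auto simp: conv_translate)
  qed
qed

lemma kern_integral_shift: "e > 0 \<Longrightarrow> (\<integral>y. kern e (x - y) \<partial>lborel) = 1" "e > 0 \<Longrightarrow> integrable lborel (\<lambda>y. kern e (x - y))"
proof -
  assume e: "e > 0"
  have s: "kern e (x - y) = kern e (- x + y)" for y using kern_swap(1)[of e x y] by simp
  show "(\<integral>y. kern e (x - y) \<partial>lborel) = 1"
    unfolding s using integral_translation_lborel[of "kern e" "- x"] kern_integral[OF e] by simp
  show "integrable lborel (\<lambda>y. kern e (x - y))"
    unfolding s by (rule integrable_translation_lborel[OF kern_integral(1)[OF e]])
qed

lemma C0c_field_integrable:
  fixes f :: "pt \<Rightarrow> pt"
  assumes c: "continuous_on UNIV f" and z: "\<And>x. R < norm x \<Longrightarrow> f x = 0" and n: "\<And>x. norm (f x) \<le> 1"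
  shows "integrable lborel f"
proof (rule Bochner_Integration.integrable_bound[where f="indicator (cball 0 R) :: pt \<Rightarrow> real"])
  show "integrable lborel (indicator (cball 0 R) :: pt \<Rightarrow> real)"
    using emeasure_bounded_finite[of "cball (0::pt) R"] by (intro integrable_real_indicator) auto
  show "f \<in> borel_measurable lborel" using borel_measurable_continuous_onI[OF c] by simp
  show "AE x in lborel. norm (f x) \<le> norm (indicator (cball 0 R) x :: real)"
    using n z by (intro AE_I2) (auto simp: indicator_def)
qed

lemma inner_sum_axis: "(\<Sum>i\<in>UNIV. (a \<bullet> axis i 1) * b $ i) = a \<bullet> (b :: pt)"
  unfolding inner_axis by (simp add: inner_vec_def)

text \<open>The kernel has mass one, so a merely continuous field of norm at most 1 becomes a test
  field while its support grows by e; the derivative in the divergence falls on the kernel. The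
  glued fields and Knothe's field are admissible only after this step.\<close>

lemma conv_field:
  fixes F :: "pt \<Rightarrow> pt"
  assumes e: "e > 0" and c: "continuous_on UNIV F" and z: "\<And>x. R < norm x \<Longrightarrow> F x = 0" and n: "\<And>x. norm (F x) \<le> 1"
  shows "conv e F \<in> test_fields"
    "divergence (conv e F) x = (\<integral>y. kernd e (x - y) * ((x - y) \<bullet> F y) \<partial>lborel)"
    "R + e < norm x \<Longrightarrow> divergence (conv e F) x = 0"
proof -
  have i: "integrable lborel F" by (rule C0c_field_integrable[OF c z n])
  have [measurable]: "F \<in> borel_measurable borel" using i by auto
  have far: "F y = 0 \<or> e \<le> norm (x - y)" if "R + e < norm x" for x y
  proof (cases "R < norm y")
    case False
    thus ?thesis using that norm_triangle_ineq2[of x y] by auto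
  qed (use z in auto)
  show "conv e F \<in> test_fields"
  proof (rule test_fieldsI[OF conv_has_derivative[OF e i] conv'_continuous[OF e i]])
    show "conv e F x = 0" if "R + e < norm x" for x
    proof -
      have "kern e (x - y) *\<^sub>R F y = 0" for y using far[OF that, of y] kern_zero(1)[OF e, of "x - y"] by auto
      thus ?thesis unfolding conv_def by (simp only: integral_zero)
    qed
    show "norm (conv e F x) \<le> 1" for x
    proof -
      have "norm (conv e F x) \<le> (\<integral>y. kern e (x - y) \<partial>lborel)"
        unfolding conv_def
      proof (rule Bochner_Integration.integral_norm_bound_integral[OF conv_integrable(1)[OF e i] kern_integral_shift(2)[OF e]])
        show "norm (kern e (x - y) *\<^sub>R F y) \<le> kern e (x - y)" for y
          using n[of y] kern_nonneg[OF e, of "x - y"] by (simp add: mult_left_le)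
      qed
      thus ?thesis using kern_integral_shift(1)[OF e] by simp
    qed
  qed
  have "divergence (conv e F) x = (\<Sum>i\<in>UNIV. conv' e F x (axis i 1) $ i)" for x
    by (rule divergence_eq[OF conv_has_derivative[OF e i]])
  also have "(\<Sum>i\<in>UNIV. conv' e F x (axis i 1) $ i) = (\<Sum>i\<in>UNIV. (\<integral>y. (kernd e (x - y) * ((x - y) \<bullet> axis i 1)) * F y $ i \<partial>lborel))" for x
    unfolding conv'_def
    by (subst integral_bounded_linear[OF bounded_linear_vec_nth conv_integrable(2)[OF e i], symmetric]) simp
  also have "\<dots> x = (\<integral>y. (\<Sum>i\<in>UNIV. (kernd e (x - y) * ((x - y) \<bullet> axis i 1)) * F y $ i) \<partial>lborel)" for x
  proof (rule Bochner_Integration.integral_sum[symmetric])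
    show "integrable lborel (\<lambda>y. kernd e (x - y) * ((x - y) \<bullet> axis i 1) * F y $ i)" for i
      using integrable_bounded_linear[OF bounded_linear_vec_nth conv_integrable(2)[OF e i, of x "axis i 1"], of i] by simp
  qed
  finally have *: "divergence (conv e F) x = (\<integral>y. kernd e (x - y) * ((x - y) \<bullet> F y) \<partial>lborel)" for x
    by (simp add: mult.assoc sum_distrib_left[symmetric] inner_sum_axis)
  show "divergence (conv e F) x = (\<integral>y. kernd e (x - y) * ((x - y) \<bullet> F y) \<partial>lborel)" by (rule *)
  show "divergence (conv e F) x = 0" if "R + e < norm x"
  proof -
    have "kernd e (x - y) * ((x - y) \<bullet> F y) = 0" for y using far[OF that, of y] kern_zero(2)[OF e, of "x - y"] by auto
    thus ?thesis unfolding * by (simp only: integral_zero)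
  qed
qed

text \<open>By Fubini, mollifying the field amounts to mollifying the function. The kernel is even,
  so its gradient is odd, which produces the sign of an integration by parts.\<close>

lemma conv_dual:
  fixes F :: "pt \<Rightarrow> pt" and f :: "pt \<Rightarrow> real"
  assumes e: "e > 0" and c: "continuous_on UNIV F" and z: "\<And>x. R < norm x \<Longrightarrow> F x = 0" and n: "\<And>x. norm (F x) \<le> 1"
    and f: "integrable lborel f"
  shows "(\<integral>x. f x * divergence (conv e F) x \<partial>lborel) = - (\<integral>y. conv' e f y (F y) \<partial>lborel)"
proof -
  have i: "integrable lborel F" by (rule C0c_field_integrable[OF c z n])
  have [measurable]: "F \<in> borel_measurable borel" "f \<in> borel_measurable borel" using i f by auto
  define H where "H x y = f x * (kernd e (x - y) * ((x - y) \<bullet> F y))" for x y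
  define K where "K = kern_lip e * e"
  have K: "K \<ge> 0" using kern_lip_nonneg[OF e] e by (simp add: K_def)
  have Hb: "norm (H x y) \<le> \<bar>f x\<bar> * (K * norm (F y))" for x y
    using kernd_bound[OF e, of "x - y" "F y"] by (simp add: H_def abs_mult K_def mult_left_mono)
  have P1: "integrable (lborel \<Otimes>\<^sub>M lborel) (\<lambda>(x, y). \<bar>f x\<bar> * (K * norm (F y)))"
    by (rule lborel_pair.Fubini_integrable) (use f i K in \<open>auto simp: abs_mult\<close>)
  have P: "integrable (lborel \<Otimes>\<^sub>M lborel) (\<lambda>(x, y). H x y)"
  proof (rule Bochner_Integration.integrable_bound[OF P1])
    show "(\<lambda>(x, y). H x y) \<in> borel_measurable (lborel \<Otimes>\<^sub>M lborel)" unfolding H_def by measurable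
    show "AE p in lborel \<Otimes>\<^sub>M lborel. norm (case p of (x, y) \<Rightarrow> H x y) \<le> norm (case p of (x, y) \<Rightarrow> \<bar>f x\<bar> * (K * norm (F y)))"
      using Hb K by (intro AE_I2) (auto simp: abs_mult)
  qed
  have "(\<integral>x. f x * divergence (conv e F) x \<partial>lborel) = (\<integral>x. (\<integral>y. H x y \<partial>lborel) \<partial>lborel)"
    unfolding H_def by (subst conv_field(2)[OF e c z n]) auto
  also have "\<dots> = (\<integral>y. (\<integral>x. H x y \<partial>lborel) \<partial>lborel)"
    using lborel_pair.Fubini_integral[OF P] by simp
  also have "\<dots> = (\<integral>y. - conv' e f y (F y) \<partial>lborel)"
  proof (rule Bochner_Integration.integral_cong)
    fix y
    have "H x y = - ((kernd e (y - x) * ((y - x) \<bullet> F y)) *\<^sub>R f x)" for x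
      unfolding H_def using kern_swap(2)[of e x y] by (simp add: inner_diff_left algebra_simps)
    thus "(\<integral>x. H x y \<partial>lborel) = - conv' e f y (F y)" by (simp add: conv'_def)
  qed simp
  finally show ?thesis by simp
qed

lemma integral_by_parts:
  assumes z: "\<And>x. (z has_derivative z' x) (at x)" "\<And>v. continuous_on UNIV (\<lambda>x. z' x v)" and p: "\<phi> \<in> test_fields"
  shows "integrable lborel (\<lambda>x. z' x (\<phi> x))" "integrable lborel (\<lambda>x. z x * divergence \<phi> x)"
    "(\<integral>x. z x * divergence \<phi> x \<partial>lborel) = - (\<integral>x. z' x (\<phi> x) \<partial>lborel)"
proof -
  obtain \<phi>' R where "C1c_field \<phi> \<phi>' R" using test_fieldsE[OF p(1)] by blast
  note P = C1c_fieldD[OF this]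
  have cz: "continuous_on UNIV z"
    by (intro continuous_at_imp_continuous_on ballI has_derivative_continuous[OF z(1)])
  have cP: "continuous_on UNIV \<phi>"
    by (intro continuous_at_imp_continuous_on ballI has_derivative_continuous[OF P(1)])
  have dv: "divergence \<phi> = (\<lambda>x. \<Sum>i\<in>UNIV. (\<phi>' x (axis i 1)) $ i)" using P(7) by auto
  show i2: "integrable lborel (\<lambda>x. z x * divergence \<phi> x)"
    unfolding dv by (rule C1c_integrable(1)[where R=R]) (use P in \<open>auto intro!: continuous_intros cz\<close>)
  have lz: "linear (z' x)" for x using has_derivative_linear[OF z(1)] .
  have e: "z' x (\<phi> x) = (\<Sum>i\<in>UNIV. z' x (axis i 1) * \<phi> x $ i)" for x
    by (rule sum_axis_linear[OF lz, symmetric])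
  show i1: "integrable lborel (\<lambda>x. z' x (\<phi> x))"
    unfolding e by (rule C1c_integrable(1)[where R=R]) (use P z in \<open>auto intro!: continuous_intros cP\<close>)
  have d: "((\<lambda>x. z x * \<phi> x $ i) has_derivative (\<lambda>v. z x * \<phi>' x v $ i + z' x v * \<phi> x $ i)) (at x)" for i x
    by (intro has_derivative_mult z bounded_linear.has_derivative[OF bounded_linear_vec_nth P(1)])
  have zz: "integrable lborel (\<lambda>x. z x * \<phi>' x v $ i + z' x v * \<phi> x $ i)" "(\<integral>x. z x * \<phi>' x v $ i + z' x v * \<phi> x $ i \<partial>lborel) = 0" for i v
    by (rule integral_derivative_zero[OF d, where R=R]; use P(2,5) z(2) in \<open>auto intro!: continuous_intros cz cP\<close>)+
  have "(\<integral>x. z x * divergence \<phi> x + z' x (\<phi> x) \<partial>lborel) =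
     (\<integral>x. (\<Sum>i\<in>UNIV. z x * \<phi>' x (axis i 1) $ i + z' x (axis i 1) * \<phi> x $ i) \<partial>lborel)"
    unfolding e P(7) by (simp add: sum.distrib sum_distrib_left)
  also have "\<dots> = 0" using zz by simp
  finally show "(\<integral>x. z x * divergence \<phi> x \<partial>lborel) = - (\<integral>x. z' x (\<phi> x) \<partial>lborel)"
    using i1 i2 by simp
qed

section \<open>Submodularity of the perimeter\<close>

text \<open>Mollification and Fubini work with Borel functions on \<open>lborel\<close>, whereas
  \<open>TV\<close> concerns Lebesgue measurable functions; a Borel representative connects the
  two.\<close>

lemma L1_loc_borel:
  assumes "L1_loc u"
  obtains u' where "u' \<in> borel_measurable borel" "AE x in lebesgue. u x = u' x"
    "\<And>R. integrable lborel (\<lambda>x. indicator (cball 0 R) x * u' x)"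
proof -
  have "u \<in> borel_measurable (completion lborel)" using L1_loc_measurable[OF assms] .
  from completion_ex_borel_measurable_real[OF this] obtain u' where
    u': "u' \<in> borel_measurable lborel" "AE x in lborel. u x = u' x" by blast
  have ae: "AE x in lebesgue. u x = u' x" using u'(2) by (rule AE_completion)
  have "integrable lborel (\<lambda>x. indicator (cball 0 R) x * u' x)" for R
  proof -
    have [measurable]: "u' \<in> borel_measurable lebesgue" using u'(1) by (intro measurable_completion) auto
    have [measurable]: "cball (0::pt) R \<in> sets lebesgue" by simp
    have "integrable lebesgue (\<lambda>x. indicator (cball 0 R) x * u' x) \<longleftrightarrow> integrable lebesgue (\<lambda>x. indicator (cball 0 R) x * u x)"
      by (rule integrable_cong_AE) (use ae L1_loc_measurable[OF assms] in auto)
    hence "integrable lebesgue (\<lambda>x. indicator (cball 0 R) x * u' x)" using L1_loc_ball[OF assms] by blast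
    moreover have "(\<lambda>x. indicator (cball 0 R) x * u' x) \<in> borel_measurable borel"
      using u'(1) by (intro borel_measurable_times borel_measurable_indicator) auto
    ultimately show ?thesis using integral_lebesgue_lborel(2) by blast
  qed
  moreover have "u' \<in> borel_measurable borel" using u'(1) by simp
  ultimately show ?thesis using ae that by blast
qed

lemma integral_cong_local:
  assumes p: "\<phi> \<in> test_fields" and z: "\<And>x. R < norm x \<Longrightarrow> divergence \<phi> x = 0"
    and ae: "AE x in lebesgue. norm x \<le> R \<longrightarrow> f x = g x"
    and m: "f \<in> borel_measurable lebesgue" "g \<in> borel_measurable borel"
  shows "(\<integral>x. f x * divergence \<phi> x \<partial>lebesgue) = (\<integral>x. g x * divergence \<phi> x \<partial>lborel)"
proof -
  note [measurable] = divergence_measurable[OF p] m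
  have [measurable]: "divergence \<phi> \<in> borel_measurable lebesgue" "g \<in> borel_measurable lebesgue"
    by (intro measurable_completion; simp add: divergence_measurable[OF p] m)+
  have "(\<integral>x. f x * divergence \<phi> x \<partial>lebesgue) = (\<integral>x. g x * divergence \<phi> x \<partial>lebesgue)"
  proof (rule integral_cong_AE)
    show "AE x in lebesgue. f x * divergence \<phi> x = g x * divergence \<phi> x"
      using ae by eventually_elim (use z not_less in fastforce)
  qed measurable
  also have "\<dots> = (\<integral>x. g x * divergence \<phi> x \<partial>lborel)"
    by (rule integral_lebesgue_lborel) measurable
  finally show ?thesis .
qed

text \<open>For M a C^1 version of max, a + b - M a b is a C^1 version of min. After mollification the gradients
  are recombined with weights between 0 and 1, so that the two dual fields can be tested against one
  convex combination each.\<close>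

lemma TV_lattice:
  fixes M :: "real \<Rightarrow> real \<Rightarrow> real"
  assumes u: "L1_loc u" and v: "L1_loc v"
    and dM: "\<And>a b. ((\<lambda>p. M (fst p) (snd p)) has_derivative (\<lambda>q. Ma a b * fst q + Mb a b * snd q)) (at (a, b))"
    and cM: "continuous_on UNIV (\<lambda>p. Ma (fst p) (snd p))" "continuous_on UNIV (\<lambda>p. Mb (fst p) (snd p))"
    and bM: "\<And>a b. 0 \<le> Ma a b" "\<And>a b. Ma a b \<le> 1" "\<And>a b. 0 \<le> Mb a b" "\<And>a b. Mb a b \<le> 1"
    and lip: "\<And>a b a' b'. \<bar>M a b - M a' b'\<bar> \<le> \<bar>a - a'\<bar> + \<bar>b - b'\<bar>"
    and c: "TV u + TV v \<le> ereal c"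
  shows "TV (\<lambda>x. M (u x) (v x)) + TV (\<lambda>x. u x + v x - M (u x) (v x)) \<le> ereal c"
proof (rule TV_add_least)
  fix \<phi> \<psi> assume p: "\<phi> \<in> test_fields" and q: "\<psi> \<in> test_fields"
  obtain \<phi>' R1 where "C1c_field \<phi> \<phi>' R1" using test_fieldsE[OF p] by blast
  note P = C1c_fieldD[OF this]
  obtain \<psi>' R2 where "C1c_field \<psi> \<psi>' R2" using test_fieldsE[OF q] by blast
  note Q = C1c_fieldD[OF this]
  define R where "R = max R1 R2"
  have far: "\<phi> x = 0" "\<psi> x = 0" "divergence \<phi> x = 0" "divergence \<psi> x = 0" if "R < norm x" for x
    using that P(5,6,7) Q(5,6,7) by (auto simp: R_def)
  have cP: "continuous_on UNIV \<phi>" "continuous_on UNIV \<psi>"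
    by (intro continuous_at_imp_continuous_on ballI has_derivative_continuous[OF P(1)]
        has_derivative_continuous[OF Q(1)])+
  obtain B1 where B1: "B1 \<ge> 0" "\<And>x. \<bar>divergence \<phi> x\<bar> \<le> B1" using test_fields_divergence[OF p] by blast
  obtain B2 where B2: "B2 \<ge> 0" "\<And>x. \<bar>divergence \<psi> x\<bar> \<le> B2" using test_fields_divergence[OF q] by blast
  obtain u0 where u0: "u0 \<in> borel_measurable borel" "AE x in lebesgue. u x = u0 x"
    "\<And>R. integrable lborel (\<lambda>x. indicator (cball 0 R) x * u0 x)" using L1_loc_borel[OF u] by blast
  obtain v0 where v0: "v0 \<in> borel_measurable borel" "AE x in lebesgue. v x = v0 x"
    "\<And>R. integrable lborel (\<lambda>x. indicator (cball 0 R) x * v0 x)" using L1_loc_borel[OF v] by blast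
  \<comment> \<open>The fields vanish beyond radius R and are mollified at a scale e \<le> 1, so u
    and v are never tested beyond radius R + 1. Cutting them there makes them integrable without
    changing any test.\<close>
  define f where "f x = indicator (cball 0 (R + 1)) x * u0 x" for x
  define g where "g x = indicator (cball 0 (R + 1)) x * v0 x" for x
  have fi: "integrable lborel f" and gi: "integrable lborel g"
    unfolding f_def[abs_def] g_def[abs_def] using u0 v0 by auto
  have [measurable]: "f \<in> borel_measurable borel" "g \<in> borel_measurable borel" using fi gi by auto
  have [measurable]: "u \<in> borel_measurable lebesgue" "v \<in> borel_measurable lebesgue"
    using u v L1_loc_measurable by auto
  have cMM: "continuous_on UNIV (\<lambda>p. M (fst p) (snd p))"
    by (intro continuous_at_imp_continuous_on ballI) (metis dM has_derivative_continuous surj_pair)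
  have mM [measurable]: "(\<lambda>x. M (h x) (k x)) \<in> borel_measurable N"
    if [measurable]: "h \<in> borel_measurable N" "k \<in> borel_measurable N" for h k and N :: "pt measure"
  proof -
    have "(\<lambda>p. M (fst p) (snd p)) \<in> borel_measurable borel" by (rule borel_measurable_continuous_onI[OF cMM])
    hence "(\<lambda>x. (\<lambda>p. M (fst p) (snd p)) (h x, k x)) \<in> borel_measurable N"
      by (rule measurable_compose[rotated]) (rule borel_measurable_Pair; fact)
    thus ?thesis by simp
  qed
  have fu: "AE x in lebesgue. norm x \<le> R + 1 \<longrightarrow> u x = f x" and gv: "AE x in lebesgue. norm x \<le> R + 1 \<longrightarrow> v x = g x"
    using u0(2) v0(2) by (eventually_elim, simp add: f_def g_def)+
  define I where "I = (\<integral>x. M (f x) (g x) * divergence \<phi> x \<partial>lborel) + (\<integral>x. (f x + g x - M (f x) (g x)) * divergence \<psi> x \<partial>lborel)"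
  have I: "(\<integral>x. M (u x) (v x) * divergence \<phi> x \<partial>lebesgue) + (\<integral>x. (u x + v x - M (u x) (v x)) * divergence \<psi> x \<partial>lebesgue) = I"
    unfolding I_def
  proof (intro arg_cong2[where f="(+)"] integral_cong_local[OF p far(3)] integral_cong_local[OF q far(4)])
    show "AE x in lebesgue. norm x \<le> R \<longrightarrow> M (u x) (v x) = M (f x) (g x)"
      using fu gv by eventually_elim auto
    show "AE x in lebesgue. norm x \<le> R \<longrightarrow> u x + v x - M (u x) (v x) = f x + g x - M (f x) (g x)"
      using fu gv by eventually_elim auto
  qed measurable
  define J where "J e = (\<integral>x. M (conv e f x) (conv e g x) * divergence \<phi> x \<partial>lborel) +
    (\<integral>x. (conv e f x + conv e g x - M (conv e f x) (conv e g x)) * divergence \<psi> x \<partial>lborel)" for e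
  have J1: "J e \<le> c"
    and J2: "integrable lborel (\<lambda>x. M (conv e f x) (conv e g x) * divergence \<phi> x)"
      "integrable lborel (\<lambda>x. (conv e f x + conv e g x - M (conv e f x) (conv e g x)) * divergence \<psi> x)"
    and J3 [measurable]: "conv e f \<in> borel_measurable borel" "conv e g \<in> borel_measurable borel"
    if e: "0 < e" "e \<le> 1" for e
  proof -
    define U where "U = conv e f"
    define V where "V = conv e g"
    note dU = conv_has_derivative[OF e(1) fi, folded U_def] and dV = conv_has_derivative[OF e(1) gi, folded V_def]
    have cU: "continuous_on UNIV U" and cV: "continuous_on UNIV V"
      by (intro continuous_at_imp_continuous_on ballI has_derivative_continuous[OF dU]
        has_derivative_continuous[OF dV])+
    thus "conv e f \<in> borel_measurable borel" "conv e g \<in> borel_measurable borel"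
      unfolding U_def V_def by (auto intro: borel_measurable_continuous_onI)
    note cU' = conv'_continuous[OF e(1) fi] and cV' = conv'_continuous[OF e(1) gi]
    define A where "A x = Ma (U x) (V x)" for x
    define B where "B x = Mb (U x) (V x)" for x
    have cA: "continuous_on UNIV A" and cB: "continuous_on UNIV B"
      unfolding A_def[abs_def] B_def[abs_def]
      using continuous_on_compose2[OF cM(1) continuous_on_Pair[OF cU cV]] continuous_on_compose2[OF cM(2) continuous_on_Pair[OF cU cV]] by auto
    define m' where "m' x w = A x * conv' e f x w + B x * conv' e g x w" for x w
    have dm: "((\<lambda>x. M (U x) (V x)) has_derivative m' x) (at x)" for x
      using has_derivative_compose[OF has_derivative_Pair[OF dU[of x] dV[of x]] dM[of "U x" "V x"]]
      unfolding m'_def[abs_def] A_def B_def by simp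
    define n' where "n' x w = conv' e f x w + conv' e g x w - m' x w" for x w
    have dn: "((\<lambda>x. U x + V x - M (U x) (V x)) has_derivative n' x) (at x)" for x
      unfolding n'_def[abs_def] by (intro has_derivative_diff has_derivative_add dU dV dm)
    have cm: "continuous_on UNIV (\<lambda>x. m' x w)" for w unfolding m'_def by (intro continuous_intros cA cB cU' cV')
    have cn: "continuous_on UNIV (\<lambda>x. n' x w)" for w unfolding n'_def by (intro continuous_intros cm cU' cV')
    \<comment> \<open>By the chain rule the gradient of M (U, V) is A DU + B DV, and that of U + V -
      M (U, V) is (1 - A) DU + (1 - B) DV. Collecting what multiplies DU gives the field F, and what
      multiplies DV gives G.\<close>
    define F where "F x = A x *\<^sub>R \<phi> x + (1 - A x) *\<^sub>R \<psi> x" for x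
    define G where "G x = B x *\<^sub>R \<phi> x + (1 - B x) *\<^sub>R \<psi> x" for x
    have cF: "continuous_on UNIV F" and cG: "continuous_on UNIV G"
      unfolding F_def[abs_def] G_def[abs_def] by (intro continuous_intros cA cB cP)+
    have F1: "norm (F x) \<le> 1" and G1: "norm (G x) \<le> 1" for x
      unfolding F_def G_def A_def B_def using P(3) Q(3) bM by (auto intro!: norm_convex_comb_le_1)
    have F0: "F x = 0" and G0: "G x = 0" if "R < norm x" for x
      using far[OF that] by (auto simp: F_def G_def)
    note bp1 = integral_by_parts[OF dm cm p] and bp2 = integral_by_parts[OF dn cn q]
    show "integrable lborel (\<lambda>x. M (conv e f x) (conv e g x) * divergence \<phi> x)"
      "integrable lborel (\<lambda>x. (conv e f x + conv e g x - M (conv e f x) (conv e g x)) * divergence \<psi> x)"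
      using bp1(2) bp2(2) by (auto simp: U_def V_def)
    have lf: "linear (conv' e f x)" and lg: "linear (conv' e g x)" for x
      using has_derivative_linear[OF dU] has_derivative_linear[OF dV] by auto
    have "integrable lborel (\<lambda>x. \<Sum>i\<in>UNIV. conv' e f x (axis i 1) * F x $ i)"
      by (rule C1c_integrable(1)[where R=R]) (use F0 in \<open>auto intro!: continuous_intros cF cU'\<close>)
    hence iF: "integrable lborel (\<lambda>x. conv' e f x (F x))"
      by (simp only: sum_axis_linear[OF lf])
    have "integrable lborel (\<lambda>x. \<Sum>i\<in>UNIV. conv' e g x (axis i 1) * G x $ i)"
      by (rule C1c_integrable(1)[where R=R]) (use G0 in \<open>auto intro!: continuous_intros cG cV'\<close>)
    hence iG: "integrable lborel (\<lambda>x. conv' e g x (G x))"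
      by (simp only: sum_axis_linear[OF lg])
    have alg: "m' x (\<phi> x) + n' x (\<psi> x) = conv' e f x (F x) + conv' e g x (G x)" for x
      unfolding m'_def n'_def F_def G_def
      by (simp only: linear_add[OF lf] linear_add[OF lg] linear_cmul[OF lf] linear_cmul[OF lg] real_scaleR_def)
        (simp add: algebra_simps)
    have "J e = - (\<integral>x. m' x (\<phi> x) \<partial>lborel) - (\<integral>x. n' x (\<psi> x) \<partial>lborel)"
      unfolding J_def using bp1(3) bp2(3) by (simp add: U_def V_def)
    also have "\<dots> = - (\<integral>x. m' x (\<phi> x) + n' x (\<psi> x) \<partial>lborel)"
      using bp1(1) bp2(1) by simp
    also have "\<dots> = - (\<integral>x. conv' e f x (F x) \<partial>lborel) - (\<integral>x. conv' e g x (G x) \<partial>lborel)"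
      unfolding alg using iF iG by simp
    also have "\<dots> = (\<integral>x. f x * divergence (conv e F) x \<partial>lborel) + (\<integral>x. g x * divergence (conv e G) x \<partial>lborel)"
      using conv_dual[OF e(1) cF F0 F1 fi] conv_dual[OF e(1) cG G0 G1 gi] by simp
    also have "(\<integral>x. f x * divergence (conv e F) x \<partial>lborel) = (\<integral>x. u x * divergence (conv e F) x \<partial>lebesgue)"
      by (rule integral_cong_local[symmetric, OF conv_field(1)[OF e(1) cF F0 F1], where R="R+1"])
        (use conv_field(3)[OF e(1) cF F0 F1] e fu in auto)
    also have "(\<integral>x. g x * divergence (conv e G) x \<partial>lborel) = (\<integral>x. v x * divergence (conv e G) x \<partial>lebesgue)"
      by (rule integral_cong_local[symmetric, OF conv_field(1)[OF e(1) cG G0 G1], where R="R+1"])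
        (use conv_field(3)[OF e(1) cG G0 G1] e gv in auto)
    finally have "ereal (J e) \<le> TV u + TV v"
      using add_mono[OF TV_upper[OF conv_field(1)[OF e(1) cF F0 F1], where u=u] TV_upper[OF conv_field(1)[OF e(1) cG G0 G1], where u=v]]
      by simp
    thus "J e \<le> c" using order_trans[OF _ c] by fastforce
  qed
  have fin: "integrable lborel (\<lambda>x. M (f x) (g x) * divergence \<phi> x)" "integrable lborel (\<lambda>x. (f x + g x - M (f x) (g x)) * divergence \<psi> x)"
  proof -
    note [measurable] = divergence_measurable[OF p] divergence_measurable[OF q]
    have Mb: "\<bar>M a b\<bar> \<le> \<bar>M 0 0\<bar> + \<bar>a\<bar> + \<bar>b\<bar>" for a b using lip[of a b 0 0] by simp
    define W where "W x = (\<bar>M 0 0\<bar> * indicator (cball 0 R) x + 2 * \<bar>f x\<bar> + 2 * \<bar>g x\<bar>) * (B1 + B2)" for x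
    have W: "integrable lborel W"
      unfolding W_def[abs_def] using fi gi emeasure_bounded_finite[of "cball (0::pt) R"]
      by (intro integrable_mult_left Bochner_Integration.integrable_add integrable_mult_right integrable_real_indicator integrable_abs) auto
    have aux: "\<bar>h * d\<bar> \<le> \<bar>W x\<bar>" if "\<bar>h\<bar> \<le> \<bar>M 0 0\<bar> + 2 * \<bar>f x\<bar> + 2 * \<bar>g x\<bar>" "\<bar>d\<bar> \<le> B1 + B2" "R < norm x \<Longrightarrow> d = 0" for h d x
    proof (cases "R < norm x")
      case False
      have "\<bar>h * d\<bar> \<le> (\<bar>M 0 0\<bar> + 2 * \<bar>f x\<bar> + 2 * \<bar>g x\<bar>) * (B1 + B2)"
        unfolding abs_mult using that by (intro mult_mono) auto
      thus ?thesis using False by (simp add: W_def)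
    qed (use that in simp)
    show "integrable lborel (\<lambda>x. M (f x) (g x) * divergence \<phi> x)"
    proof (rule Bochner_Integration.integrable_bound[OF W])
      show "AE x in lborel. norm (M (f x) (g x) * divergence \<phi> x) \<le> norm (W x)"
      proof (intro AE_I2, unfold real_norm_def, rule aux)
        show "\<bar>M (f x) (g x)\<bar> \<le> \<bar>M 0 0\<bar> + 2 * \<bar>f x\<bar> + 2 * \<bar>g x\<bar>" for x using Mb[of "f x" "g x"] by linarith
        show "\<bar>divergence \<phi> x\<bar> \<le> B1 + B2" for x using B1(2)[of x] B2(1) by linarith
      qed (use far in auto)
    qed measurable
    show "integrable lborel (\<lambda>x. (f x + g x - M (f x) (g x)) * divergence \<psi> x)"
    proof (rule Bochner_Integration.integrable_bound[OF W])
      show "AE x in lborel. norm ((f x + g x - M (f x) (g x)) * divergence \<psi> x) \<le> norm (W x)"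
      proof (intro AE_I2, unfold real_norm_def, rule aux)
        show "\<bar>f x + g x - M (f x) (g x)\<bar> \<le> \<bar>M 0 0\<bar> + 2 * \<bar>f x\<bar> + 2 * \<bar>g x\<bar>" for x using Mb[of "f x" "g x"] by linarith
        show "\<bar>divergence \<psi> x\<bar> \<le> B1 + B2" for x using B2(2)[of x] B1(1) by linarith
      qed (use far in auto)
    qed measurable
  qed
  have "I \<le> c + \<delta>" if "\<delta> > 0" for \<delta>
  proof -
    \<comment> \<open>If both mollification errors are at most \<epsilon>, the Lipschitz bound costs
      2 B1 \<epsilon> in the term with M and twice that rate, 4 B2 \<epsilon>, in the other one. The
      summand 1 keeps the denominator positive.\<close>
    define \<epsilon> where "\<epsilon> = \<delta> / (4 * (B1 + B2) + 1)"
    have ep: "\<epsilon> > 0" using that B1 B2 by (simp add: \<epsilon>_def add_nonneg_pos)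
    obtain d1 where d1: "d1 > 0" "\<And>e. 0 < e \<Longrightarrow> e \<le> d1 \<Longrightarrow> integrable lborel (\<lambda>x. conv e f x - f x) \<and> (\<integral>x. \<bar>conv e f x - f x\<bar> \<partial>lborel) \<le> \<epsilon>"
      using conv_L1[OF fi ep] by blast
    obtain d2 where d2: "d2 > 0" "\<And>e. 0 < e \<Longrightarrow> e \<le> d2 \<Longrightarrow> integrable lborel (\<lambda>x. conv e g x - g x) \<and> (\<integral>x. \<bar>conv e g x - g x\<bar> \<partial>lborel) \<le> \<epsilon>"
      using conv_L1[OF gi ep] by blast
    define e where "e = min 1 (min d1 d2)"
    have e: "0 < e" "e \<le> 1" "e \<le> d1" "e \<le> d2" using d1 d2 by (auto simp: e_def)
    note a1 = d1(2)[OF e(1) e(3)] and a2 = d2(2)[OF e(1) e(4)]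
    define S where "S x = \<bar>conv e f x - f x\<bar> + \<bar>conv e g x - g x\<bar>" for x
    have Si: "integrable lborel S" "(\<integral>x. S x \<partial>lborel) \<le> 2 * \<epsilon>" unfolding S_def[abs_def] using a1 a2 by auto
    have "(\<integral>x. M (f x) (g x) * divergence \<phi> x \<partial>lborel) - (\<integral>x. M (conv e f x) (conv e g x) * divergence \<phi> x \<partial>lborel) =
      (\<integral>x. M (f x) (g x) * divergence \<phi> x - M (conv e f x) (conv e g x) * divergence \<phi> x \<partial>lborel)"
      using fin J2[OF e(1,2)] by simp
    also have "\<dots> \<le> (\<integral>x. B1 * S x \<partial>lborel)"
    proof (rule integral_mono)
      fix x
      have "M (f x) (g x) * divergence \<phi> x - M (conv e f x) (conv e g x) * divergence \<phi> x
        \<le> \<bar>M (f x) (g x) - M (conv e f x) (conv e g x)\<bar> * \<bar>divergence \<phi> x\<bar>"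
        by (metis abs_ge_self abs_mult left_diff_distrib)
      also have "\<dots> \<le> S x * B1"
        using lip[of "f x" "g x" "conv e f x" "conv e g x"] B1 by (intro mult_mono) (auto simp: S_def abs_minus_commute)
      finally show "M (f x) (g x) * divergence \<phi> x - M (conv e f x) (conv e g x) * divergence \<phi> x \<le> B1 * S x"
        by (simp add: mult.commute)
    qed (use fin J2[OF e(1,2)] Si in auto)
    also have "\<dots> \<le> B1 * (2 * \<epsilon>)" using Si B1 by (simp add: mult_left_mono)
    finally have X1: "(\<integral>x. M (f x) (g x) * divergence \<phi> x \<partial>lborel) \<le> (\<integral>x. M (conv e f x) (conv e g x) * divergence \<phi> x \<partial>lborel) + B1 * (2 * \<epsilon>)" by simp
    have "(\<integral>x. (f x + g x - M (f x) (g x)) * divergence \<psi> x \<partial>lborel) - (\<integral>x. (conv e f x + conv e g x - M (conv e f x) (conv e g x)) * divergence \<psi> x \<partial>lborel) =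
      (\<integral>x. (f x + g x - M (f x) (g x)) * divergence \<psi> x - (conv e f x + conv e g x - M (conv e f x) (conv e g x)) * divergence \<psi> x \<partial>lborel)"
      using fin J2[OF e(1,2)] by simp
    also have "\<dots> \<le> (\<integral>x. B2 * (2 * S x) \<partial>lborel)"
    proof (rule integral_mono)
      fix x
      have "(f x + g x - M (f x) (g x)) * divergence \<psi> x - (conv e f x + conv e g x - M (conv e f x) (conv e g x)) * divergence \<psi> x
        \<le> \<bar>(f x + g x - M (f x) (g x)) - (conv e f x + conv e g x - M (conv e f x) (conv e g x))\<bar> * \<bar>divergence \<psi> x\<bar>"
        by (metis abs_ge_self abs_mult left_diff_distrib)
      also have "\<dots> \<le> (2 * S x) * B2"
      proof (intro mult_mono)
        have "\<bar>(f x + g x - M (f x) (g x)) - (conv e f x + conv e g x - M (conv e f x) (conv e g x))\<bar>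
          \<le> \<bar>conv e f x - f x\<bar> + \<bar>conv e g x - g x\<bar> + \<bar>M (f x) (g x) - M (conv e f x) (conv e g x)\<bar>" by linarith
        thus "\<bar>(f x + g x - M (f x) (g x)) - (conv e f x + conv e g x - M (conv e f x) (conv e g x))\<bar> \<le> 2 * S x"
          using lip[of "f x" "g x" "conv e f x" "conv e g x"] by (simp add: S_def abs_minus_commute)
      qed (use B2 in \<open>auto simp: S_def\<close>)
      finally show "(f x + g x - M (f x) (g x)) * divergence \<psi> x - (conv e f x + conv e g x - M (conv e f x) (conv e g x)) * divergence \<psi> x \<le> B2 * (2 * S x)"
        by (simp add: mult.commute)
    qed (use fin J2[OF e(1,2)] Si in auto)
    also have "\<dots> \<le> B2 * (2 * (2 * \<epsilon>))" using Si B2 by (simp add: mult_left_mono)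
    finally have X2: "(\<integral>x. (f x + g x - M (f x) (g x)) * divergence \<psi> x \<partial>lborel) \<le> (\<integral>x. (conv e f x + conv e g x - M (conv e f x) (conv e g x)) * divergence \<psi> x \<partial>lborel) + B2 * (2 * (2 * \<epsilon>))" by simp
    have "I \<le> J e + (2 * B1 + 4 * B2) * \<epsilon>" using X1 X2 by (simp add: I_def J_def algebra_simps)
    also have "(2 * B1 + 4 * B2) * \<epsilon> \<le> (4 * (B1 + B2) + 1) * \<epsilon>" using B1 ep by (intro mult_right_mono) auto
    also have "\<dots> = \<delta>" using B1 B2 by (simp add: \<epsilon>_def)
    finally show ?thesis using J1[OF e(1,2)] by simp
  qed
  thus "(\<integral>x. M (u x) (v x) * divergence \<phi> x \<partial>lebesgue) + (\<integral>x. (u x + v x - M (u x) (v x)) * divergence \<psi> x \<partial>lebesgue) \<le> c"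
    unfolding I by (rule field_le_epsilon)
qed

lemma sqrt_square_add_Lipschitz: "\<bar>sqrt (x\<^sup>2 + c\<^sup>2) - sqrt (y\<^sup>2 + c\<^sup>2)\<bar> \<le> \<bar>x - y\<bar>"
  using norm_triangle_ineq3[of "(x, c)" "(y, c)"] by (simp add: norm_Pair)

text \<open>The identity max a b = (a + b + |a - b|) / 2 with the absolute value smoothed at scale
  d.\<close>

definition smax :: "real \<Rightarrow> real \<Rightarrow> real \<Rightarrow> real" where
  "smax d a b = (a + b + sqrt ((a - b)\<^sup>2 + d\<^sup>2)) / 2"

lemma smax_Lipschitz: "\<bar>smax d a b - smax d a' b'\<bar> \<le> \<bar>a - a'\<bar> + \<bar>b - b'\<bar>"
proof -
  have gen: "\<bar>(a + b + A) / 2 - (a' + b' + B) / 2\<bar> \<le> \<bar>a - a'\<bar> + \<bar>b - b'\<bar>"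
    if "\<bar>A - B\<bar> \<le> \<bar>(a - b) - (a' - b')\<bar>" for A B
  proof -
    have e: "(a + b + A) / 2 - (a' + b' + B) / 2 = ((a - a') + (b - b') + (A - B)) / 2" by (simp add: field_simps)
    have "\<bar>(a - a') + (b - b') + (A - B)\<bar> \<le> \<bar>a - a'\<bar> + \<bar>b - b'\<bar> + \<bar>A - B\<bar>" by linarith
    moreover have "\<bar>A - B\<bar> \<le> \<bar>a - a'\<bar> + \<bar>b - b'\<bar>" using that by linarith
    ultimately show ?thesis unfolding e abs_divide by simp
  qed
  show ?thesis unfolding smax_def by (rule gen) (rule sqrt_square_add_Lipschitz)
qed

lemma smax_max: "\<bar>smax d a b - max a b\<bar> \<le> \<bar>d\<bar>"
proof -
  have "\<bar>sqrt (d\<^sup>2 + (a - b)\<^sup>2) - sqrt (0\<^sup>2 + (a - b)\<^sup>2)\<bar> \<le> \<bar>d - 0\<bar>"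
    by (rule sqrt_square_add_Lipschitz)
  hence *: "\<bar>sqrt ((a - b)\<^sup>2 + d\<^sup>2) - \<bar>a - b\<bar>\<bar> \<le> \<bar>d\<bar>" by (simp only: add.commute) simp
  have mx: "max a b = (a + b + \<bar>a - b\<bar>) / 2" by (simp add: max_def)
  have e: "smax d a b - max a b = (sqrt ((a - b)\<^sup>2 + d\<^sup>2) - \<bar>a - b\<bar>) / 2"
    unfolding smax_def mx by (simp add: field_simps)
  show ?thesis unfolding e abs_divide using * by simp
qed

text \<open>\<open>T\<close> is the derivative of the smoothed absolute value. Since it lies in
  [-1, 1], the partial derivatives (1 + T) / 2 and (1 - T) / 2 are weights of the kind that
  \<open>TV_lattice\<close> requires.\<close>

lemma smax_has_derivative:
  assumes d: "d > 0"
  defines "T \<equiv> \<lambda>a b. (a - b) / sqrt ((a - b)\<^sup>2 + d\<^sup>2)"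
  shows "((\<lambda>p. smax d (fst p) (snd p)) has_derivative (\<lambda>q. (1 + T a b) / 2 * fst q + (1 - T a b) / 2 * snd q)) (at (a, b))"
    "\<bar>T a b\<bar> \<le> 1" "continuous_on UNIV (\<lambda>p. T (fst p) (snd p))"
proof -
  have pos: "(a - b)\<^sup>2 + d\<^sup>2 > 0" for a b using d by (simp add: add_nonneg_pos)
  show "((\<lambda>p. smax d (fst p) (snd p)) has_derivative (\<lambda>q. (1 + T a b) / 2 * fst q + (1 - T a b) / 2 * snd q)) (at (a, b))"
  proof -
    define w where "w = (a - b)\<^sup>2 + d\<^sup>2"
    have w: "w > 0" using pos by (simp add: w_def)
    have 1: "((\<lambda>p. (fst p - snd p)\<^sup>2 + d\<^sup>2) has_derivative (\<lambda>q. 2 * (a - b) * (fst q - snd q))) (at (a, b))"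
      by (auto intro!: derivative_eq_intros simp: fun_eq_iff algebra_simps)
    have "(sqrt has_derivative (\<lambda>h. inverse (sqrt w) / 2 * h)) (at ((fst (a, b) - snd (a, b))\<^sup>2 + d\<^sup>2))"
      using DERIV_real_sqrt[OF w] by (simp only: has_field_derivative_def w_def fst_conv snd_conv)
    hence "((\<lambda>p. sqrt ((fst p - snd p)\<^sup>2 + d\<^sup>2)) has_derivative
      (\<lambda>q. inverse (sqrt w) / 2 * (2 * (a - b) * (fst q - snd q)))) (at (a, b))"
      by (rule has_derivative_compose[where f="\<lambda>p. (fst p - snd p)\<^sup>2 + d\<^sup>2" and g=sqrt, OF 1])
    moreover have T': "T a b = (a - b) * inverse (sqrt w)" by (simp only: T_def w_def divide_inverse)
    have gen: "i / 2 * (2 * x * t) = x * i * t" for i x t :: real by simp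
    have "inverse (sqrt w) / 2 * (2 * (a - b) * t) = T a b * t" for t unfolding T' by (rule gen)
    ultimately have 2: "((\<lambda>p. sqrt ((fst p - snd p)\<^sup>2 + d\<^sup>2)) has_derivative (\<lambda>q. T a b * (fst q - snd q))) (at (a, b))"
      by (simp only:)
    have 3: "((\<lambda>p. (1/2) * (fst p + snd p + sqrt ((fst p - snd p)\<^sup>2 + d\<^sup>2))) has_derivative
      (\<lambda>q. (1/2) * (fst q + snd q + T a b * (fst q - snd q)))) (at (a, b))"
      by (intro has_derivative_mult_right has_derivative_add 2 has_derivative_fst has_derivative_snd has_derivative_ident)
    have e1: "(1/2) * (fst q + snd q + T a b * (fst q - snd q)) = (1 + T a b) / 2 * fst q + (1 - T a b) / 2 * snd q" for q
      by (simp add: field_simps)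
    have e2: "(1/2) * (fst p + snd p + sqrt ((fst p - snd p)\<^sup>2 + d\<^sup>2)) = smax d (fst p) (snd p)" for p
      by (simp add: smax_def)
    show ?thesis using 3 unfolding e1 e2 .
  qed
  have "\<bar>a - b\<bar> \<le> sqrt ((a - b)\<^sup>2 + d\<^sup>2)" by (simp add: real_le_rsqrt)
  thus "\<bar>T a b\<bar> \<le> 1" using pos[of a b] by (simp add: T_def)
  have "sqrt ((fst p - snd p)\<^sup>2 + d\<^sup>2) \<noteq> 0" for p using pos[of "fst p" "snd p"] d by auto
  thus "continuous_on UNIV (\<lambda>p. T (fst p) (snd p))" unfolding T_def
    by (intro continuous_intros) auto
qed

text \<open>The maximum and the minimum of two indicators are the indicators of the union and the
  intersection. Their smoothed versions satisfy \<open>TV_lattice\<close>, converge uniformly, and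
  lower semicontinuity passes to the limit.\<close>

lemma Per_submodular:
  assumes [measurable]: "E \<in> sets lebesgue" "F \<in> sets lebesgue"
  shows "Per (E \<inter> F) + Per (E \<union> F) \<le> Per E + Per F"
proof (cases "Per E + Per F = \<infinity>")
  case False
  have "0 \<le> Per E + Per F" by simp
  with False obtain c where c: "Per E + Per F = ereal c" by (cases "Per E + Per F") auto
  define d where "d n = inverse (real (Suc n))" for n
  have d: "0 < d n" "d n \<le> 1" for n unfolding d_def by (auto simp: field_simps)
  have d0: "d \<longlonglongrightarrow> 0" unfolding d_def by (rule LIMSEQ_inverse_real_of_nat)
  define U where "U n x = smax (d n) (indicator E x) (indicator F x)" for n and x :: pt
  define V where "V n x = indicator E x + indicator F x - U n x" for n and x :: pt
  have W: "L1_loc (\<lambda>_. 4 :: real)"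
    by (rule L1_locI) (use emeasure_bounded_finite[of "cball (0::pt) _"] in auto)
  have b: "TV (V n) + TV (U n) \<le> ereal c" for n
  proof -
    let ?T = "\<lambda>a b. (a - b) / sqrt ((a - b)\<^sup>2 + (d n)\<^sup>2)"
    note T = smax_has_derivative[OF d(1)[of n]]
    have "TV (\<lambda>x. smax (d n) (indicator E x) (indicator F x)) + TV (\<lambda>x. indicator E x + indicator F x - smax (d n) (indicator E x) (indicator F x)) \<le> ereal c"
    proof (rule TV_lattice[OF L1_loc_indicator L1_loc_indicator T(1) _ _ _ _ _ _ smax_Lipschitz])
      show "continuous_on UNIV (\<lambda>p. (1 + ?T (fst p) (snd p)) / 2)" "continuous_on UNIV (\<lambda>p. (1 - ?T (fst p) (snd p)) / 2)"
        by (intro continuous_intros T(3); simp)+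
      show "0 \<le> (1 + ?T a b) / 2" "(1 + ?T a b) / 2 \<le> 1" "0 \<le> (1 - ?T a b) / 2" "(1 - ?T a b) / 2 \<le> 1" for a b
      proof -
        define t where "t = ?T a b"
        have "\<bar>t\<bar> \<le> 1" using T(2) by (simp only: t_def)
        hence "0 \<le> (1 + t) / 2" "(1 + t) / 2 \<le> 1" "0 \<le> (1 - t) / 2" "(1 - t) / 2 \<le> 1" by auto
        thus "0 \<le> (1 + ?T a b) / 2" "(1 + ?T a b) / 2 \<le> 1" "0 \<le> (1 - ?T a b) / 2" "(1 - ?T a b) / 2 \<le> 1"
          by (simp_all only: t_def)
      qed
      show "TV (indicator E) + TV (indicator F) \<le> ereal c" using c by (simp add: Per_def)
    qed fact+
    thus ?thesis by (simp add: U_def[abs_def] V_def[abs_def] add.commute)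
  qed
  have mx: "max (indicator E x) (indicator F x) = indicat_real (E \<union> F) x" for x by (auto simp: indicator_def)
  have dist: "\<bar>U n x - indicator (E \<union> F) x\<bar> \<le> d n" for n x
    using smax_max[of "d n" "indicator E x" "indicator F x"] d(1)[of n] unfolding U_def mx by simp
  have "(\<lambda>n. U n x - indicator (E \<union> F) x) \<longlonglongrightarrow> 0" for x
    by (rule Lim_null_comparison[OF _ d0]) (use dist in auto)
  hence lU: "(\<lambda>n. U n x) \<longlonglongrightarrow> indicator (E \<union> F) x" for x by (simp add: LIM_zero_iff)
  have "(\<lambda>n. V n x) \<longlonglongrightarrow> indicator E x + indicator F x - indicator (E \<union> F) x" for x
    unfolding V_def by (intro tendsto_intros lU)
  moreover have "indicator E x + indicator F x - indicator (E \<union> F) x = indicat_real (E \<inter> F) x" for x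
    by (auto simp: indicator_def)
  ultimately have lV: "(\<lambda>n. V n x) \<longlonglongrightarrow> indicator (E \<inter> F) x" for x by simp
  have i01: "0 \<le> indicat_real A x" "indicat_real A x \<le> 1" for A and x :: pt by (auto simp: indicator_def)
  have bU: "\<bar>U n x\<bar> \<le> 2" for n x using dist[of n x] d(2)[of n] i01[of "E \<union> F" x] by linarith
  have bV: "\<bar>V n x\<bar> \<le> 4" for n x using bU[of n x] i01[of E x] i01[of F x] unfolding V_def by linarith
  have mU[measurable]: "U n \<in> borel_measurable lebesgue" for n
    unfolding U_def[abs_def] smax_def by measurable
  have "TV (indicator (E \<inter> F)) + TV (indicator (E \<union> F)) \<le> ereal c"
  proof (rule TV_add_lsc[OF W _ _ _ _ _ _ _ _ b tendsto_const])
    show "V n \<in> borel_measurable lebesgue" for n unfolding V_def[abs_def] by measurable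
    show "AE x in lebesgue. \<bar>U n x\<bar> \<le> 4" for n
      by (rule AE_I2) (use bU[of n] in \<open>smt (verit)\<close>)
    show "AE x in lebesgue. \<bar>V n x\<bar> \<le> 4" for n by (rule AE_I2) (rule bV)
    show "AE x in lebesgue. (\<lambda>n. V n x) \<longlonglongrightarrow> indicator (E \<inter> F) x" by (rule AE_I2) (rule lV)
    show "AE x in lebesgue. (\<lambda>n. U n x) \<longlonglongrightarrow> indicator (E \<union> F) x" by (rule AE_I2) (rule lU)
  qed measurable
  thus ?thesis using c by (simp add: Per_def)
qed auto

lemma ramp_Lipschitz: assumes "0 < k" "k \<le> 1" shows "\<bar>ramp k s - ramp k t\<bar> \<le> \<bar>s - t\<bar>"
proof -
  have *: "ramp k y - ramp k x \<le> y - x" if "x \<le> y" for x y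
  proof -
    have "ramp k x - x \<ge> ramp k y - y"
    proof (rule DERIV_nonpos_imp_nonincreasing[OF that])
      fix z
      have "((\<lambda>t. ramp k t - t) has_real_derivative ramp' k z - 1) (at z)"
        by (intro DERIV_diff DERIV_ramp assms DERIV_ident)
      thus "\<exists>y. ((\<lambda>t. ramp k t - t) has_real_derivative y) (at z) \<and> y \<le> 0"
        using ramp'_bounds(2)[OF assms, of z] by (intro exI[of _ "ramp' k z - 1"]) auto
    qed
    thus ?thesis by simp
  qed
  show ?thesis using *[of s t] *[of t s] ramp_mono[OF assms, of s t] ramp_mono[OF assms, of t s]
    by (cases "s \<le> t") auto
qed

text \<open>An instance of \<open>TV_lattice\<close> with second function 0 and M depending on the
  first argument only: the rescaled ramp has slope between 0 and 1, so it divides the gradient of u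
  into two parallel parts.\<close>

lemma TV_chop:
  assumes u: "L1_loc u" and d: "d > 0" and c: "TV u \<le> ereal c"
  shows "TV (\<lambda>x. d * ramp 1 ((u x - s) / d)) + TV (\<lambda>x. u x - d * ramp 1 ((u x - s) / d)) \<le> ereal c"
proof -
  have z: "L1_loc (\<lambda>_. 0 :: real)" by (rule L1_locI) auto
  have "TV (\<lambda>x. d * ramp 1 ((u x - s) / d)) + TV (\<lambda>x. u x + 0 - d * ramp 1 ((u x - s) / d)) \<le> ereal c"
  proof (rule TV_lattice[OF u z, of "\<lambda>a b. d * ramp 1 ((a - s) / d)" "\<lambda>a b. ramp' 1 ((a - s) / d)" "\<lambda>a b. 0"])
    fix a b :: real
    have "((\<lambda>a. d * ramp 1 ((a - s) / d)) has_real_derivative ramp' 1 ((a - s) / d)) (at a)"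
      using d by (auto intro!: derivative_eq_intros DERIV_chain2[OF DERIV_ramp])
    hence "((\<lambda>a. d * ramp 1 ((a - s) / d)) has_derivative (\<lambda>h. ramp' 1 ((a - s) / d) * h)) (at (fst (a, b)))"
      by (simp add: has_field_derivative_def)
    from has_derivative_compose[OF has_derivative_fst[OF has_derivative_ident] this]
    show "((\<lambda>p. d * ramp 1 ((fst p - s) / d)) has_derivative (\<lambda>q. ramp' 1 ((a - s) / d) * fst q + 0 * snd q)) (at (a, b))"
      by simp
  next
    show "continuous_on UNIV (\<lambda>p::real\<times>real. ramp' 1 ((fst p - s) / d))"
      by (rule continuous_on_compose2[OF continuous_ramp']) (use d in \<open>auto intro!: continuous_intros\<close>)
    fix a b a' b' :: real
    have "\<bar>d * ramp 1 ((a - s) / d) - d * ramp 1 ((a' - s) / d)\<bar> = d * \<bar>ramp 1 ((a - s) / d) - ramp 1 ((a' - s) / d)\<bar>"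
      using d by (simp add: abs_mult right_diff_distrib[symmetric])
    also have "\<dots> \<le> d * \<bar>(a - s) / d - (a' - s) / d\<bar>"
      using d by (intro mult_left_mono ramp_Lipschitz) auto
    also have "\<dots> = \<bar>a - a'\<bar>" using d by (simp add: diff_divide_distrib[symmetric] abs_divide)
    finally show "\<bar>d * ramp 1 ((a - s) / d) - d * ramp 1 ((a' - s) / d)\<bar> \<le> \<bar>a - a'\<bar> + \<bar>b - b'\<bar>" by linarith
  qed (use ramp'_bounds[of 1] c in \<open>auto simp: TV_zero\<close>)
  thus ?thesis by simp
qed

text \<open>The translation argument of \<open>integral_derivative_zero\<close> along a single
  direction. It serves Knothe's field, for which only the diagonal partial derivatives are
  computed.\<close>

lemma integral_directional_derivative_zero:
  fixes f :: "pt \<Rightarrow> real"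
  assumes cf: "continuous_on UNIV f"
    and d: "\<And>x. ((\<lambda>s. f (x + s *\<^sub>R v)) has_real_derivative g x) (at 0)"
    and c: "continuous_on UNIV g"
    and z: "\<And>x. R < norm x \<Longrightarrow> f x = 0" and z': "\<And>x. R < norm x \<Longrightarrow> g x = 0"
  shows "(\<integral>x. g x \<partial>lborel) = 0"
proof -
  have [measurable]: "f \<in> borel_measurable borel" using cf by (rule borel_measurable_continuous_onI)
  obtain B where B: "B \<ge> 0" "\<And>x. \<bar>g x\<bar> \<le> B" using C1c_integrable(2)[OF c z'] by auto
  define t where "t n = inverse (real (Suc n))" for n
  have t: "t n > 0" "t n \<le> 1" for n unfolding t_def by (auto simp: field_simps)
  define h where "h n x = (f (t n *\<^sub>R v + x) - f x) / t n" for n x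
  have int: "integrable lborel f" by (rule C1c_integrable(1)[OF cf z])
  have ds: "((\<lambda>s. f (x + s *\<^sub>R v)) has_real_derivative g (x + s *\<^sub>R v)) (at s)" for x s
  proof -
    have "((\<lambda>t. f (x + (t + s) *\<^sub>R v)) has_real_derivative g (x + s *\<^sub>R v)) (at 0)"
      using d[of "x + s *\<^sub>R v"] by (simp add: algebra_simps)
    thus ?thesis using DERIV_shift[of "\<lambda>s. f (x + s *\<^sub>R v)" "g (x + s *\<^sub>R v)" 0 s] by simp
  qed
  have "(\<integral>x. h n x \<partial>lborel) = 0" for n
    unfolding h_def using integrable_translation_lborel[OF int] int
    by (simp add: integral_translation_lborel)
  moreover have "(\<lambda>n. \<integral>x. h n x \<partial>lborel) \<longlonglongrightarrow> (\<integral>x. g x \<partial>lborel)"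
  proof (rule integral_dominated_convergence[where w="\<lambda>x. B * indicator (cball 0 (R + norm v)) x"])
    show "g \<in> borel_measurable lborel"
      using borel_measurable_continuous_onI[OF c] by simp
    show "h n \<in> borel_measurable lborel" for n unfolding h_def by measurable
    show "integrable lborel (\<lambda>x. B * indicator (cball 0 (R + norm v)) x :: real)"
      by (intro integrable_mult_right integrable_real_indicator) (auto simp: emeasure_bounded_finite[unfolded infinity_ennreal_def])
    show "AE x in lborel. (\<lambda>n. h n x) \<longlonglongrightarrow> g x"
    proof (rule AE_I2)
      fix x
      have "((\<lambda>s. (f (x + s *\<^sub>R v) - f x) / s) \<longlongrightarrow> g x) (at 0)"
        using d[of x] by (simp add: DERIV_def)
      moreover have "filterlim t (at 0) sequentially"
        unfolding filterlim_at t_def using LIMSEQ_inverse_real_of_nat by (auto intro!: always_eventually)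
      ultimately have "((\<lambda>n. (f (x + t n *\<^sub>R v) - f x) / t n) \<longlonglongrightarrow> g x)"
        by (rule filterlim_compose)
      thus "(\<lambda>n. h n x) \<longlonglongrightarrow> g x" by (simp add: h_def add.commute)
    qed
    show "AE x in lborel. norm (h n x) \<le> B * indicator (cball 0 (R + norm v)) x" for n
    proof (rule AE_I2)
      fix x
      show "norm (h n x) \<le> B * indicator (cball 0 (R + norm v)) x"
      proof (cases "x \<in> cball 0 (R + norm v)")
        case True
        have "\<exists>s. 0 < s \<and> s < t n \<and> f (x + t n *\<^sub>R v) - f (x + 0 *\<^sub>R v) = (t n - 0) * g (x + s *\<^sub>R v)"
          by (rule MVT2[OF t(1)]) (rule ds)
        then obtain s where "f (x + t n *\<^sub>R v) - f x = t n * g (x + s *\<^sub>R v)" by auto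
        hence "h n x = g (x + s *\<^sub>R v)" using t(1)[of n] by (simp add: h_def add.commute)
        thus ?thesis using B True by simp
      next
        case False
        hence a: "R + norm v < norm x" by simp
        have "norm x \<le> norm (t n *\<^sub>R v + x) + norm (t n *\<^sub>R v)"
          by (metis add.commute add_diff_cancel_left' norm_triangle_sub norm_triangle_ineq4)
        also have "norm (t n *\<^sub>R v) \<le> norm v"
          using t[of n] by (simp add: mult_left_le_one_le)
        finally have "f (t n *\<^sub>R v + x) = 0" using a by (intro z) auto
        moreover have "f x = 0" using a by (intro z) (smt (verit) norm_ge_zero)
        ultimately show ?thesis by (simp add: h_def B)
      qed
    qed
  qed
  ultimately show "(\<integral>x. g x \<partial>lborel) = 0" using LIMSEQ_unique[of "\<lambda>_. 0::real"] by simp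
qed

text \<open>A divergence involves only the derivative of the i-th component along the i-th axis.
  Mollifying F gives a test field whose divergence is the mollified sum of the \<open>g i\<close>,
  and that sum converges in L1.\<close>

lemma Per_ge_weak_field:
  fixes F :: "pt \<Rightarrow> pt"
  assumes cF: "continuous_on UNIV F" and F0: "\<And>x. R < norm x \<Longrightarrow> F x = 0" and F1: "\<And>x. norm (F x) \<le> 1"
    and d: "\<And>i x. ((\<lambda>s. F (x + s *\<^sub>R axis i 1) $ i) has_real_derivative g i x) (at 0)"
    and cg: "\<And>i. continuous_on UNIV (g i)" and g0: "\<And>i x. R < norm x \<Longrightarrow> g i x = 0"
    and E: "E \<in> sets lebesgue"
  shows "ereal (\<integral>x. indicator E x * (\<Sum>i\<in>UNIV. g i x) \<partial>lebesgue) \<le> Per E"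
proof -
  define G where "G x = (\<Sum>i\<in>UNIV. g i x)" for x
  have cG: "continuous_on UNIV G" unfolding G_def[abs_def] by (intro continuous_intros cg)
  have Gi: "integrable lborel G" by (rule C1c_integrable(1)[OF cG, of R]) (simp add: G_def g0)
  have Fi: "integrable lborel F" by (rule C0c_field_integrable[OF cF F0 F1])
  have gi: "integrable lborel (g i)" for i by (rule C1c_integrable(1)[OF cg g0])
  have div: "divergence (conv e F) x = conv e G x" if e: "e > 0" for e x
  proof -
    have 1: "(\<integral>y. (kernd e (x - y) * ((x - y) \<bullet> axis i 1)) * F y $ i \<partial>lborel) = (\<integral>y. kern e (x - y) * g i y \<partial>lborel)"
      and 2: "integrable lborel (\<lambda>y. (kernd e (x - y) * ((x - y) \<bullet> axis i 1)) * F y $ i)"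
      and 3: "integrable lborel (\<lambda>y. kern e (x - y) * g i y)" for i
    proof -
      show 2: "integrable lborel (\<lambda>y. (kernd e (x - y) * ((x - y) \<bullet> axis i 1)) * F y $ i)"
        using integrable_bounded_linear[OF bounded_linear_vec_nth conv_integrable(2)[OF e Fi, of x "axis i 1"], of i] by simp
      show 3: "integrable lborel (\<lambda>y. kern e (x - y) * g i y)"
        using conv_integrable(1)[OF e gi] by simp
      \<comment> \<open>\<open>h\<close> is the derivative along axis i of the product of the
        shifted kernel and the i-th component of F, so its integral vanishes and the derivative
        moves from the kernel to F.\<close>
      define h where "h y = kern e (x - y) * g i y - (kernd e (x - y) * ((x - y) \<bullet> axis i 1)) * F y $ i" for y
      have "(\<integral>y. h y \<partial>lborel) = 0"
      proof (rule integral_directional_derivative_zero[where f="\<lambda>y. kern e (x - y) * F y $ i" and v="axis i 1" and R=R])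
        have ck: "continuous_on UNIV (\<lambda>y. kern e (x - y))" "continuous_on UNIV (\<lambda>y. kernd e (x - y))"
          by (intro continuous_on_compose2[OF kern_continuous(1)] continuous_on_compose2[OF kern_continuous(2)] continuous_intros; simp)+
        show "continuous_on UNIV (\<lambda>y. kern e (x - y) * F y $ i)" by (intro continuous_intros ck cF)
        show "continuous_on UNIV h" unfolding h_def[abs_def] by (intro continuous_intros ck cF cg)
        show "kern e (x - y) * F y $ i = 0" "h y = 0" if "R < norm y" for y
          using F0[OF that] g0[OF that] by (auto simp: h_def)
        show "((\<lambda>s. kern e (x - (y + s *\<^sub>R axis i 1)) * F (y + s *\<^sub>R axis i 1) $ i) has_real_derivative h y) (at 0)" for y
        proof -
          have "((\<lambda>s. x - (y + s *\<^sub>R axis i 1)) has_derivative (\<lambda>t. - (t *\<^sub>R axis i 1))) (at (0::real))"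
            by (auto intro!: derivative_eq_intros)
          from has_derivative_compose[OF this kern_has_derivative]
          have "((\<lambda>s. kern e (x - (y + s *\<^sub>R axis i 1))) has_derivative (\<lambda>t. kernd e (x - y) * ((x - y) \<bullet> - (t *\<^sub>R axis i 1)))) (at 0)"
            by simp
          hence "((\<lambda>s. kern e (x - (y + s *\<^sub>R axis i 1))) has_real_derivative - (kernd e (x - y) * ((x - y) \<bullet> axis i 1))) (at 0)"
            by (rule has_derivative_imp_has_field_derivative) simp
          from DERIV_mult[OF this d[of y i]] show ?thesis by (simp add: h_def algebra_simps)
        qed
      qed
      thus "(\<integral>y. (kernd e (x - y) * ((x - y) \<bullet> axis i 1)) * F y $ i \<partial>lborel) = (\<integral>y. kern e (x - y) * g i y \<partial>lborel)"
        unfolding h_def using 2 3 by simp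
    qed
    have "divergence (conv e F) x = (\<integral>y. kernd e (x - y) * ((x - y) \<bullet> F y) \<partial>lborel)"
      by (rule conv_field(2)[OF e cF F0 F1])
    also have "\<dots> = (\<integral>y. (\<Sum>i\<in>UNIV. (kernd e (x - y) * ((x - y) \<bullet> axis i 1)) * F y $ i) \<partial>lborel)"
      by (simp add: mult.assoc sum_distrib_left[symmetric] inner_sum_axis)
    also have "\<dots> = (\<Sum>i\<in>UNIV. (\<integral>y. kern e (x - y) * g i y \<partial>lborel))"
      using 1 2 by simp
    also have "\<dots> = (\<integral>y. (\<Sum>i\<in>UNIV. kern e (x - y) * g i y) \<partial>lborel)" using 3 by simp
    also have "\<dots> = conv e G x" by (simp add: conv_def G_def sum_distrib_left)
    finally show ?thesis .
  qed
  have "(indicator E :: pt \<Rightarrow> real) \<in> borel_measurable (completion lborel)" using E by simp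
  from completion_ex_borel_measurable_real[OF this] obtain E0 where
    E0': "E0 \<in> borel_measurable lborel" "AE x in lborel. indicat_real E x = E0 x" by blast
  have E0: "E0 \<in> borel_measurable borel" "AE x in lebesgue. indicat_real E x = E0 x"
    using E0'(1) AE_completion[OF E0'(2)] by simp_all
  \<comment> \<open>Clamping makes the Borel representative of the indicator bounded everywhere, not
    just almost everywhere.\<close>
  define E1 where "E1 x = max 0 (min 1 (E0 x))" for x
  have E1m: "E1 \<in> borel_measurable borel" unfolding E1_def[abs_def] by (intro borel_measurable_max borel_measurable_min borel_measurable_const E0(1))
  have E1b: "\<bar>E1 x\<bar> \<le> 1" for x unfolding E1_def by linarith
  note E1 = E1m E1b
  have E1ae: "AE x in lebesgue. indicat_real E x = E1 x"
    using E0(2)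
  proof eventually_elim
    case (elim x)
    hence "E0 x = 0 \<or> E0 x = 1" by (metis indicator_simps)
    thus ?case using elim by (auto simp: E1_def)
  qed
  have Em: "(indicator E :: pt \<Rightarrow> real) \<in> borel_measurable lebesgue" using E by simp
  note [measurable] = E1(1) Em
  have [measurable]: "E1 \<in> borel_measurable lebesgue" using E1 by (intro measurable_completion) auto
  have tr: "(\<integral>x. indicator E x * h x \<partial>lebesgue) = (\<integral>x. E1 x * h x \<partial>lborel)" if h: "h \<in> borel_measurable borel" for h
  proof -
    have [measurable]: "h \<in> borel_measurable lebesgue" using h by (intro measurable_completion) auto
    have "(\<integral>x. indicator E x * h x \<partial>lebesgue) = (\<integral>x. E1 x * h x \<partial>lebesgue)"
      by (rule integral_cong_AE) (use E1ae in auto)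
    also have "\<dots> = (\<integral>x. E1 x * h x \<partial>lborel)" using h E1 by (intro integral_lebesgue_lborel) auto
    finally show ?thesis .
  qed
  have [measurable]: "G \<in> borel_measurable borel" using Gi by auto
  have "ereal ((\<integral>x. indicator E x * G x \<partial>lebesgue) - \<epsilon>) \<le> Per E" if \<epsilon>: "\<epsilon> > 0" for \<epsilon>
  proof -
    obtain e where e: "e > 0" "integrable lborel (\<lambda>x. conv e G x - G x)" "(\<integral>x. \<bar>conv e G x - G x\<bar> \<partial>lborel) \<le> \<epsilon>"
      using conv_L1[OF Gi \<epsilon>] by blast
    have "integrable lborel (\<lambda>x. (conv e G x - G x) + G x)" using e(2) Gi by (intro Bochner_Integration.integrable_add)
    hence ci: "integrable lborel (conv e G)" by simp
    have i1: "integrable lborel (\<lambda>x. E1 x * G x)" using bounded_scaleR_integrable(1)[OF Gi E1(1) E1(2)] by simp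
    have i2: "integrable lborel (\<lambda>x. E1 x * conv e G x)" using bounded_scaleR_integrable(1)[OF ci E1(1) E1(2)] by simp
    have "(\<integral>x. E1 x * G x \<partial>lborel) - (\<integral>x. E1 x * conv e G x \<partial>lborel) = (\<integral>x. E1 x * G x - E1 x * conv e G x \<partial>lborel)"
      using i1 i2 by simp
    also have "\<dots> \<le> (\<integral>x. \<bar>conv e G x - G x\<bar> \<partial>lborel)"
    proof (rule integral_mono)
      fix x
      have "E1 x * G x - E1 x * conv e G x \<le> \<bar>E1 x * (G x - conv e G x)\<bar>" by (simp add: right_diff_distrib)
      also have "\<dots> \<le> 1 * \<bar>conv e G x - G x\<bar>" unfolding abs_mult using E1(2)[of x] by (intro mult_mono) auto
      finally show "E1 x * G x - E1 x * conv e G x \<le> \<bar>conv e G x - G x\<bar>" by simp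
    qed (use i1 i2 e in auto)
    also have "\<dots> \<le> \<epsilon>" by (rule e)
    finally have "(\<integral>x. indicator E x * G x \<partial>lebesgue) - \<epsilon> \<le> (\<integral>x. indicator E x * conv e G x \<partial>lebesgue)"
      using ci Gi by (simp add: tr)
    also have "(\<integral>x. indicator E x * conv e G x \<partial>lebesgue) = (\<integral>x. indicator E x * divergence (conv e F) x \<partial>lebesgue)"
      by (simp add: div[OF e(1)])
    finally have "ereal ((\<integral>x. indicator E x * G x \<partial>lebesgue) - \<epsilon>) \<le> ereal (\<integral>x. indicator E x * divergence (conv e F) x \<partial>lebesgue)" by simp
    also have "\<dots> \<le> Per E" unfolding Per_def by (rule TV_upper[OF conv_field(1)[OF e(1) cF F0 F1]])
    finally show ?thesis .
  qed
  note eps = this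
  have "ereal (\<integral>x. indicator E x * G x \<partial>lebesgue) \<le> Per E"
  proof (cases "Per E")
    case (real t)
    have "(\<integral>x. indicator E x * G x \<partial>lebesgue) \<le> t"
    proof (rule field_le_epsilon)
      fix \<epsilon> :: real assume "\<epsilon> > 0"
      from eps[OF this] show "(\<integral>x. indicator E x * G x \<partial>lebesgue) \<le> t + \<epsilon>" unfolding real by simp
    qed
    thus ?thesis by (simp add: real)
  qed auto
  thus ?thesis by (simp add: G_def)
qed

section \<open>The isoperimetric inequality\<close>

text \<open>Area of the part of the unit disc with first coordinate at most t. Its inverse gives the
  first component of Knothe's map.\<close>

definition disc_area :: "real \<Rightarrow> real" where
  "disc_area t = t * sqrt (1 - t\<^sup>2) + arcsin t + pi / 2"

lemma DERIV_disc_area: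
  assumes "-1 < t" "t < 1"
  shows "(disc_area has_real_derivative 2 * sqrt (1 - t\<^sup>2)) (at t)"
proof -
  have p: "1 - t\<^sup>2 > 0" using assms by (simp add: abs_square_less_1)
  define s where "s = sqrt (1 - t\<^sup>2)"
  have s: "s > 0" "s * s = 1 - t\<^sup>2" using p by (auto simp: s_def)
  have "((\<lambda>t. 1 - t\<^sup>2) has_real_derivative - (2 * t)) (at t)"
    by (auto intro!: derivative_eq_intros)
  from DERIV_chain2[OF DERIV_real_sqrt[OF p] this]
  have 1: "((\<lambda>t. sqrt (1 - t\<^sup>2)) has_real_derivative inverse s / 2 * - (2 * t)) (at t)" by (simp only: s_def)
  have "(disc_area has_real_derivative (1 * s + (inverse s / 2 * - (2 * t)) * t) + inverse s + 0) (at t)"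
    unfolding disc_area_def[abs_def]
    using DERIV_add[OF DERIV_add[OF DERIV_mult[OF DERIV_ident 1] DERIV_arcsin[OF assms]] DERIV_const[of "pi/2"]]
    by (simp add: s_def)
  moreover have "(1 * s + (inverse s / 2 * - (2 * t)) * t) + inverse s + 0 = (s * s + (1 - t\<^sup>2)) / s"
    using s(1) by (simp add: field_simps power2_eq_square)
  moreover have "(s * s + (1 - t\<^sup>2)) / s = 2 * s" unfolding s(2)[symmetric] using s(1) by simp
  ultimately show ?thesis by (simp add: s_def)
qed

lemma continuous_disc_area: "continuous_on {-1..1} disc_area"
  unfolding disc_area_def[abs_def] by (intro continuous_intros) auto

lemma disc_area_ends: "disc_area (-1) = 0" "disc_area 1 = pi"
  by (auto simp: disc_area_def)

lemma disc_area_less: assumes "-1 \<le> s" "s < t" "t \<le> 1" shows "disc_area s < disc_area t"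
proof (rule DERIV_pos_imp_increasing_open[OF assms(2)])
  fix x assume x: "s < x" "x < t"
  hence "1 - x\<^sup>2 > 0" using assms by (simp add: abs_square_less_1)
  thus "\<exists>y. (disc_area has_real_derivative y) (at x) \<and> 0 < y"
    using DERIV_disc_area[of x] x assms by (intro exI[of _ "2 * sqrt (1 - x\<^sup>2)"]) auto
qed (rule continuous_on_subset[OF continuous_disc_area], use assms in auto)

lemma disc_area_inverse:
  obtains g :: "real \<Rightarrow> real" where
    "\<And>a. 0 < a \<Longrightarrow> a < pi \<Longrightarrow> -1 < g a \<and> g a < 1"
    "\<And>a. 0 < a \<Longrightarrow> a < pi \<Longrightarrow> (g has_real_derivative inverse (2 * sqrt (1 - (g a)\<^sup>2))) (at a)"
proof -
  have inj: "inj_on disc_area {-1..1}"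
    by (rule linorder_inj_onI) (use disc_area_less in \<open>auto simp: less_imp_neq\<close>)
  have im: "a \<in> disc_area ` {-1..1}" if "0 \<le> a" "a \<le> pi" for a
    using IVT'[of disc_area "-1" a 1] that continuous_disc_area disc_area_ends by auto
  define g where "g = inv_into {-1..1} disc_area"
  have g: "g a \<in> {-1..1}" "disc_area (g a) = a" if "0 \<le> a" "a \<le> pi" for a
    using inv_into_into[OF im[OF that]] f_inv_into_f[OF im[OF that]] by (auto simp: g_def)
  have g1: "-1 < g a \<and> g a < 1" if "0 < a" "a < pi" for a
    using g[of a] that disc_area_ends by (smt (verit) atLeastAtMost_iff)
  have "continuous_on (disc_area ` {-1..1}) g"
    by (rule continuous_on_inv[OF continuous_disc_area]) (auto simp: g_def inv_into_f_f[OF inj])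
  hence cg: "continuous_on {0<..<pi} g" by (rule continuous_on_subset) (use im in auto)
  have "(g has_real_derivative inverse (2 * sqrt (1 - (g a)\<^sup>2))) (at a)" if a: "0 < a" "a < pi" for a
  proof (rule DERIV_inverse_function[where f=disc_area and a=0 and b=pi])
    show "(disc_area has_real_derivative 2 * sqrt (1 - (g a)\<^sup>2)) (at (g a))"
      using g1[OF a] by (intro DERIV_disc_area) auto
    show "2 * sqrt (1 - (g a)\<^sup>2) \<noteq> 0" using g1[OF a] abs_square_less_1[of "g a"] by auto
    show "isCont g a" using cg a by (simp add: continuous_on_eq_continuous_at)
  qed (use a g in auto)
  with g1 show ?thesis using that by blast
qed

section \<open>Integrals with a parameter and coordinates of the plane\<close>

lemma continuous_param_integral:
  fixes p :: "real \<Rightarrow> real \<Rightarrow> real"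
  assumes cp: "continuous_on UNIV (\<lambda>z. p (fst z) (snd z))"
  shows "continuous_on S (\<lambda>x. integral {a..b} (p x))"
proof -
  have "continuous_on S (\<lambda>x. integral (cbox a b) (p x))"
    by (rule integral_continuous_on_param) (use continuous_on_subset[OF cp] in \<open>auto simp: case_prod_unfold\<close>)
  thus ?thesis by simp
qed

lemma continuous_slice:
  fixes p :: "real \<Rightarrow> real \<Rightarrow> real"
  assumes cp: "continuous_on UNIV (\<lambda>z. p (fst z) (snd z))"
  shows "continuous_on S (p x)"
proof -
  have "continuous_on S (\<lambda>y. (x, y))" by (intro continuous_on_Pair continuous_on_const continuous_on_id)
  from continuous_on_compose2[OF cp this] show ?thesis by simp
qed

text \<open>Joint continuity: the primitive is Lipschitz in its upper limit uniformly in the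
  parameter, and continuous in the parameter for a fixed limit.\<close>

lemma continuous_primitive:
  fixes p :: "real \<Rightarrow> real \<Rightarrow> real"
  assumes cp: "continuous_on UNIV (\<lambda>z. p (fst z) (snd z))"
  shows "continuous_on ({-R..R} \<times> {-R..R}) (\<lambda>z. integral {-R..snd z} (p (fst z)))"
  unfolding continuous_on_def
proof
  fix z0 :: "real \<times> real" assume z0: "z0 \<in> {-R..R} \<times> {-R..R}"
  define S where "S = {-R..R} \<times> {-R..R}"
  define P where "P x y = integral {-R..y} (p x)" for x y
  have cS: "compact S" unfolding S_def by (intro compact_Times compact_Icc)
  have "compact ((\<lambda>z. p (fst z) (snd z)) ` S)"
    by (intro compact_continuous_image continuous_on_subset[OF cp] cS) auto
  then obtain B where B: "B > 0" "\<And>z. z \<in> S \<Longrightarrow> \<bar>p (fst z) (snd z)\<bar> \<le> B"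
    using compact_imp_bounded[of "(\<lambda>z. p (fst z) (snd z)) ` S"] unfolding bounded_pos by auto
  have int: "p x integrable_on {a..b}" for x a b
    by (intro integrable_continuous_interval continuous_slice[OF cp])
  have lip1: "\<bar>P x y' - P x y\<bar> \<le> B * (y' - y)" if "x \<in> {-R..R}" "-R \<le> y" "y \<le> y'" "y' \<le> R" for x y y'
  proof -
    have "P x y + integral {y..y'} (p x) = P x y'" unfolding P_def
      by (rule Henstock_Kurzweil_Integration.integral_combine) (use that int in auto)
    moreover have "norm (integral {y..y'} (p x)) \<le> B * (y' - y)"
      by (rule integral_bound) (use that B(2)[of "(x, _)"] continuous_slice[OF cp] in \<open>auto simp: S_def\<close>)
    ultimately show ?thesis by simp
  qed
  have lip: "\<bar>P x y - P x y'\<bar> \<le> B * \<bar>y - y'\<bar>" if "x \<in> {-R..R}" "y \<in> {-R..R}" "y' \<in> {-R..R}" for x y y'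
    using lip1[of x y y'] lip1[of x y' y] that by (cases "y \<le> y'") auto
  have "((\<lambda>z. (P (fst z) (snd z) - P (fst z) (snd z0)) + P (fst z) (snd z0)) \<longlongrightarrow> 0 + P (fst z0) (snd z0)) (at z0 within S)"
  proof (rule tendsto_add)
    show "((\<lambda>z. P (fst z) (snd z) - P (fst z) (snd z0)) \<longlongrightarrow> 0) (at z0 within S)"
    proof (rule Lim_null_comparison)
      show "\<forall>\<^sub>F z in at z0 within S. norm (P (fst z) (snd z) - P (fst z) (snd z0)) \<le> B * \<bar>snd z - snd z0\<bar>"
        unfolding eventually_at_topological by (intro exI[of _ UNIV]) (use lip z0 in \<open>auto simp: S_def\<close>)
      have "((\<lambda>z. B * \<bar>snd z - snd z0\<bar>) \<longlongrightarrow> B * \<bar>snd z0 - snd z0\<bar>) (at z0 within S)"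
        by (intro tendsto_intros)
      thus "((\<lambda>z. B * \<bar>snd z - snd z0\<bar>) \<longlongrightarrow> 0) (at z0 within S)" by simp
    qed
    have "continuous_on S (\<lambda>z. P (fst z) (snd z0))"
      unfolding P_def by (rule continuous_on_compose2[OF continuous_param_integral[OF cp, of UNIV] continuous_on_fst[OF continuous_on_id]]) auto
    thus "((\<lambda>z. P (fst z) (snd z0)) \<longlongrightarrow> P (fst z0) (snd z0)) (at z0 within S)"
      using z0 unfolding continuous_on_def S_def by blast
  qed
  thus "((\<lambda>z. integral {-R..snd z} (p (fst z))) \<longlongrightarrow> integral {-R..snd z0} (p (fst z0))) (at z0 within {-R..R} \<times> {-R..R})"
    by (simp add: P_def S_def)
qed

lemma DERIV_primitive:
  fixes f :: "real \<Rightarrow> real"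
  assumes c: "continuous_on {-R..R} f" and y: "-R < y" "y < R"
  shows "((\<lambda>y. integral {-R..y} f) has_real_derivative f y) (at y)"
proof -
  have "((\<lambda>y. integral {-R..y} f) has_real_derivative f y) (at y within {-R..R})"
    by (rule integral_has_real_derivative[OF c]) (use y in auto)
  moreover have "at y within {-R..R} = at y" by (rule at_within_interior) (use y in auto)
  ultimately show ?thesis by simp
qed

lemma integral_pos_continuous:
  fixes f :: "real \<Rightarrow> real"
  assumes c: "continuous_on {a..b} f" and "a < b" and p: "\<And>x. x \<in> {a..b} \<Longrightarrow> 0 < f x"
  shows "0 < integral {a..b} f"
proof -
  obtain x0 where x0: "x0 \<in> {a..b}" "\<And>x. x \<in> {a..b} \<Longrightarrow> f x0 \<le> f x"
    using continuous_attains_inf[OF compact_Icc _ c] assms(2) by auto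
  have "0 < (b - a) * f x0" using p[OF x0(1)] assms(2) by simp
  also have "\<dots> = integral {a..b} (\<lambda>_. f x0)" using assms(2) by simp
  also have "\<dots> \<le> integral {a..b} f"
    by (rule integral_le) (use x0 integrable_continuous_interval[OF c] in auto)
  finally show ?thesis .
qed

definition vec2 :: "real \<Rightarrow> real \<Rightarrow> pt" where "vec2 x y = (\<chi> i. if i = 1 then x else y)"

lemma vec2_nth [simp]: "vec2 x y $ 1 = x" "vec2 x y $ 2 = y" by (auto simp: vec2_def)

lemma vec2_eta [simp]: "vec2 (z $ 1) (z $ 2) = z"
  by (auto simp: vec2_def vec_eq_iff) (metis exhaust_2)

lemma continuous_vec2: "continuous_on S f \<Longrightarrow> continuous_on S g \<Longrightarrow> continuous_on S (\<lambda>x. vec2 (f x) (g x))"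
  unfolding vec2_def
proof (rule continuous_on_vec_lambda)
  fix i :: 2 assume "continuous_on S f" "continuous_on S g"
  thus "continuous_on S (\<lambda>x. if i = 1 then f x else g x)" by (cases "i = 1") auto
qed

lemma norm_vec2: "norm (vec2 x y) = sqrt (x\<^sup>2 + y\<^sup>2)"
  by (simp add: norm_eq_sqrt_inner inner_vec_def sum_2 power2_eq_square)

lemma lborel_vec2: "(lborel :: pt measure) = distr lborel borel (\<lambda>z. vec2 (fst z) (snd z))"
proof (rule lborel_eqI)
  have [measurable]: "(\<lambda>z. vec2 (fst z) (snd z)) \<in> borel_measurable borel"
    by (intro borel_measurable_continuous_onI continuous_vec2 continuous_intros)
  fix l u :: pt assume lu: "\<And>b. b \<in> Basis \<Longrightarrow> l \<bullet> b \<le> u \<bullet> b"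
  have lu': "l $ i \<le> u $ i" for i using lu[of "axis i 1"] by (auto simp: Basis_vec_def inner_axis)
  have "(\<lambda>z. vec2 (fst z) (snd z)) -` box l u = box (l $ 1, l $ 2) (u $ 1, u $ 2)"
    by (auto simp: mem_box_cart forall_2 mem_box Basis_prod_def)
  hence "emeasure (distr lborel borel (\<lambda>z. vec2 (fst z) (snd z))) (box l u) = emeasure lborel (box (l $ 1, l $ 2) (u $ 1, u $ 2))"
    by (subst emeasure_distr) auto
  also have "\<dots> = (u $ 1 - l $ 1) * (u $ 2 - l $ 2)"
    using lu' by (subst emeasure_lborel_box) (auto simp: Basis_prod_def)
  also have "\<dots> = (\<Prod>b\<in>Basis. (u - l) \<bullet> b)"
    using lu' by (simp add: Basis_vec_def prod.UNION_disjoint axis_eq_axis inner_axis UNIV_2)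
  finally show "emeasure (distr lborel borel (\<lambda>z. vec2 (fst z) (snd z))) (box l u) = (\<Prod>b\<in>Basis. (u - l) \<bullet> b)" .
qed simp

lemma integral_square_iterated:
  fixes h :: "pt \<Rightarrow> real"
  assumes c: "continuous_on UNIV h"
  shows "integral {-R..R} (\<lambda>x. integral {-R..R} (\<lambda>y. h (vec2 x y))) =
    (\<integral>z. indicator {z. \<bar>z $ 1\<bar> \<le> R \<and> \<bar>z $ 2\<bar> \<le> R} z * h z \<partial>lborel)"
proof -
  define Q where "Q = {z::pt. \<bar>z $ 1\<bar> \<le> R \<and> \<bar>z $ 2\<bar> \<le> R}"
  have "closed Q" unfolding Q_def by (intro closed_Collect_conj closed_Collect_le continuous_intros)
  hence [measurable]: "Q \<in> sets borel" by simp
  have [measurable]: "h \<in> borel_measurable borel" using c by (rule borel_measurable_continuous_onI)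
  have [measurable]: "(\<lambda>z. vec2 (fst z) (snd z)) \<in> borel_measurable borel"
    by (intro borel_measurable_continuous_onI continuous_vec2 continuous_intros)
  have ch: "continuous_on S (\<lambda>z. h (vec2 (fst z) (snd z)))" for S
    by (rule continuous_on_compose2[OF c]) (auto intro!: continuous_vec2 continuous_intros)
  have "(\<integral>z. indicator Q z * h z \<partial>lborel) = (\<integral>z. indicator Q (vec2 (fst z) (snd z)) * h (vec2 (fst z) (snd z)) \<partial>lborel)"
    by (subst lborel_vec2, subst integral_distr) auto
  also have "\<dots> = (\<integral>z. indicator (cbox (-R, -R) (R, R)) z *\<^sub>R h (vec2 (fst z) (snd z)) \<partial>lborel)"
    by (rule Bochner_Integration.integral_cong) (auto simp: Q_def indicator_def mem_box Basis_prod_def abs_le_iff)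
  also have "\<dots> = integral (cbox (-R, -R) (R, R)) (\<lambda>z. h (vec2 (fst z) (snd z)))"
  proof -
    have "set_integrable lborel (cbox (-R, -R) (R, R)) (\<lambda>z. h (vec2 (fst z) (snd z)))"
      unfolding set_integrable_def by (rule borel_integrable_compact) (auto intro: ch)
    from set_borel_integral_eq_integral(2)[OF this] show ?thesis by (simp add: set_lebesgue_integral_def)
  qed
  also have "\<dots> = integral (cbox (-R) R) (\<lambda>x. integral (cbox (-R) R) (\<lambda>y. h (vec2 x y)))"
    using integral_prod_continuous[of "-R" "-R" R R "\<lambda>z. h (vec2 (fst z) (snd z))"] ch by simp
  finally show ?thesis by (simp add: Q_def)
qed

text \<open>Knothe's triangular map T sends the density q^2 on the square to the uniform density on the unit
  disc. Its partial derivatives D1, D2 satisfy D1 D2 = c q^2, so div T is at least 2 sqrt c q by AM-GM,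
  and T, having norm at most 1, is an admissible field for the perimeter after a cutoff.\<close>

lemma knothe_perimeter:
  fixes q :: "pt \<Rightarrow> real"
  assumes cq: "continuous_on UNIV q" and q0: "\<And>z. 0 < q z" and \<rho>: "\<rho> > 0"
    and E: "E \<in> sets lebesgue" "E \<subseteq> ball 0 \<rho>"
  shows "ereal (2 * sqrt (pi / (\<integral>z. indicator {z. \<bar>z $ 1\<bar> \<le> \<rho> + 2 \<and> \<bar>z $ 2\<bar> \<le> \<rho> + 2} z * (q z)\<^sup>2 \<partial>lborel)) *
     (\<integral>z. indicator E z * q z \<partial>lebesgue)) \<le> Per E"
proof -
  \<comment> \<open>The field is cut off between the radii \<rho> and \<rho> + 1. The half-side
    \<rho> + 2 keeps the closed ball of radius \<rho> + 1 inside the open square, where the map is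
    differentiable in the required directions.\<close>
  define R where "R = \<rho> + 2"
  have R: "R > 0" using \<rho> by (simp add: R_def)
  define p where "p x y = (q (vec2 x y))\<^sup>2" for x y
  have p0: "p x y > 0" for x y unfolding p_def using q0[of "vec2 x y"] by simp
  have cp: "continuous_on UNIV (\<lambda>z. p (fst z) (snd z))" unfolding p_def
    by (intro continuous_intros continuous_on_compose2[OF cq] continuous_vec2) auto
  define P where "P x y = integral {-R..y} (p x)" for x y
  define m where "m x = integral {-R..R} (p x)" for x
  define M where "M x = integral {-R..x} m" for x
  define tot where "tot = M R"
  have cm: "continuous_on S m" for S unfolding m_def by (rule continuous_param_integral[OF cp])
  have ipx: "p x integrable_on {a..b}" for x a b
    by (intro integrable_continuous_interval continuous_slice[OF cp])
  have m0: "m x > 0" for x unfolding m_def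
    by (rule integral_pos_continuous[OF continuous_slice[OF cp]]) (use R p0 in auto)
  have P0: "0 \<le> P x y" for x y unfolding P_def
    by (rule Henstock_Kurzweil_Integration.integral_nonneg[OF ipx]) (use p0 in \<open>auto intro: less_imp_le\<close>)
  have Pm: "P x y \<le> m x" if "y \<le> R" for x y unfolding P_def m_def
    by (rule integral_subset_le) (use that ipx p0 in \<open>auto intro: less_imp_le\<close>)
  have Mless: "M x < M y" if "-R \<le> x" "x < y" for x y
  proof -
    have "M x + integral {x..y} m = M y" unfolding M_def
      by (rule Henstock_Kurzweil_Integration.integral_combine) (use that cm in \<open>auto intro: integrable_continuous_interval\<close>)
    moreover have "0 < integral {x..y} m" by (rule integral_pos_continuous[OF cm]) (use that m0 in auto)
    ultimately show ?thesis by simp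
  qed
  have M0: "M (-R) = 0" by (simp add: M_def)
  have tot: "tot > 0" using Mless[of "-R" R] R M0 by (simp add: tot_def)
  define c where "c = pi / tot"
  have c: "c > 0" using tot by (simp add: c_def)
  have cM: "0 < c * M x" "c * M x < pi" if "-R < x" "x < R" for x
  proof -
    show "0 < c * M x" using Mless[of "-R" x] M0 that c by simp
    have "c * M x < c * tot" using Mless[of x R] that c by (simp add: tot_def)
    thus "c * M x < pi" using tot by (simp add: c_def)
  qed
  obtain g :: "real \<Rightarrow> real" where g: "\<And>a. 0 < a \<Longrightarrow> a < pi \<Longrightarrow> -1 < g a \<and> g a < 1"
    "\<And>a. 0 < a \<Longrightarrow> a < pi \<Longrightarrow> (g has_real_derivative inverse (2 * sqrt (1 - (g a)\<^sup>2))) (at a)"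
    using disc_area_inverse by blast
  \<comment> \<open>\<open>T1\<close> sends x to the abscissa that cuts off from the unit disc the
    same proportion of area as x cuts off from the mass of the square. \<open>T2\<close> then
    spreads the mass on the vertical line over x uniformly along the chord of the disc at that
    abscissa, whose half-length is \<open>sg x\<close>.\<close>
  define T1 where "T1 x = g (c * M x)" for x
  define sg where "sg x = sqrt (1 - (T1 x)\<^sup>2)" for x
  define T2 where "T2 x y = sg x * (2 * P x y / m x - 1)" for x y
  define D1 where "D1 x = c * m x / (2 * sg x)" for x
  define D2 where "D2 x y = 2 * sg x * p x y / m x" for x y
  have T1b: "-1 < T1 x" "T1 x < 1" "0 < sg x" if "-R < x" "x < R" for x
    using g(1)[OF cM[OF that]] abs_square_less_1[of "T1 x"] by (auto simp: T1_def sg_def)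
  have dT1: "(T1 has_real_derivative D1 x) (at x)" if x: "-R < x" "x < R" for x
  proof -
    have "(M has_real_derivative m x) (at x)" unfolding M_def by (rule DERIV_primitive[OF cm x])
    hence "((\<lambda>x. c * M x) has_real_derivative c * m x) (at x)" by (rule DERIV_cmult)
    from DERIV_chain2[OF g(2)[OF cM[OF x]] this]
    have "(T1 has_real_derivative inverse (2 * sg x) * (c * m x)) (at x)" unfolding T1_def[abs_def] sg_def .
    moreover have "inverse (2 * sg x) * (c * m x) = D1 x" by (simp only: D1_def divide_inverse mult.commute)
    ultimately show ?thesis by simp
  qed
  have dT2: "(T2 x has_real_derivative D2 x y) (at y)" if y: "-R < y" "y < R" for x y
  proof -
    have "((\<lambda>y. P x y) has_real_derivative p x y) (at y)" unfolding P_def by (rule DERIV_primitive[OF continuous_slice[OF cp] y])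
    hence "((\<lambda>y. sg x * (P x y * (2 / m x) - 1)) has_real_derivative sg x * (p x y * (2 / m x) - 0)) (at y)"
      by (intro DERIV_cmult DERIV_diff DERIV_cmult_right DERIV_const)
    thus ?thesis unfolding T2_def[abs_def] D2_def by (simp add: mult_ac)
  qed
  have T2b: "(T1 x)\<^sup>2 + (T2 x y)\<^sup>2 \<le> 1" if "-R < x" "x < R" "-R < y" "y < R" for x y
  proof -
    define t where "t = 2 * P x y / m x - 1"
    have "-1 \<le> t" "t \<le> 1" using P0[of x y] Pm[of y x] m0[of x] that by (auto simp: t_def field_simps)
    hence "t\<^sup>2 \<le> 1" by (simp add: abs_square_le_1)
    have s: "(sg x)\<^sup>2 = 1 - (T1 x)\<^sup>2" using T1b[of x] that abs_square_less_1[of "T1 x"] by (simp add: sg_def)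
    have "(T2 x y)\<^sup>2 = (sg x)\<^sup>2 * t\<^sup>2" by (simp add: T2_def t_def power_mult_distrib)
    also have "\<dots> \<le> (sg x)\<^sup>2 * 1" using \<open>t\<^sup>2 \<le> 1\<close> by (intro mult_left_mono) auto
    finally show ?thesis using s by simp
  qed
  define O' where "O' = {z::pt. -R < z $ 1 \<and> z $ 1 < R \<and> -R < z $ 2 \<and> z $ 2 < R}"
  \<comment> \<open>With this scale \<open>s\<close> is 0 at radius \<rho> and 2 at radius \<rho> +
    1, the end points of the climb of \<open>ramp 1\<close>.\<close>
  define L where "L = 2 / ((\<rho> + 1)\<^sup>2 - \<rho>\<^sup>2)"
  have L: "L > 0" using \<rho> by (simp add: L_def power2_eq_square algebra_simps)
  define s where "s z = (z \<bullet> z - \<rho>\<^sup>2) * L" for z :: pt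
  define \<zeta> where "\<zeta> z = 1 - ramp 1 (s z)" for z
  define \<zeta>d where "\<zeta>d i z = - (ramp' 1 (s z) * (2 * z $ i * L))" for i and z :: pt
  have \<zeta>far: "\<zeta> z = 0" "\<zeta>d i z = 0" if "\<rho> + 1 < norm z" for z i
  proof -
    have "(\<rho> + 1)\<^sup>2 \<le> z \<bullet> z" using power_mono[of "\<rho> + 1" "norm z" 2] that \<rho> by (simp add: power2_norm_eq_inner)
    hence "((\<rho> + 1)\<^sup>2 - \<rho>\<^sup>2) * L \<le> s z" unfolding s_def using L by (intro mult_right_mono) auto
    moreover have "(\<rho> + 1)\<^sup>2 - \<rho>\<^sup>2 \<noteq> 0" using \<rho> by (simp add: power2_eq_square algebra_simps)
    moreover have "x * (2 / x) = 2" if "x \<noteq> 0" for x :: real using that by simp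
    ultimately have "((\<rho> + 1)\<^sup>2 - \<rho>\<^sup>2) * L = 2" unfolding L_def by blast
    with \<open>((\<rho> + 1)\<^sup>2 - \<rho>\<^sup>2) * L \<le> s z\<close> have "1 + 1 \<le> s z" by simp
    thus "\<zeta> z = 0" "\<zeta>d i z = 0" unfolding \<zeta>_def \<zeta>d_def using ramp_1[of 1 "s z"] ramp'_zero[of 1 "s z"] by auto
  qed
  have \<zeta>near: "\<zeta> z = 1" "\<zeta>d i z = 0" if "norm z < \<rho>" for z i
  proof -
    have "z \<bullet> z \<le> \<rho>\<^sup>2" using power_mono[of "norm z" \<rho> 2] that \<rho> by (simp add: power2_norm_eq_inner)
    hence "s z \<le> 0" unfolding s_def using L by (intro mult_nonpos_nonneg) auto
    thus "\<zeta> z = 1" "\<zeta>d i z = 0" unfolding \<zeta>_def \<zeta>d_def using ramp_0[of 1 "s z"] ramp'_zero[of 1 "s z"] by auto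
  qed
  have \<zeta>b: "0 \<le> \<zeta> z" "\<zeta> z \<le> 1" for z unfolding \<zeta>_def using ramp_bounds[of 1 "s z"] by auto
  have cs: "continuous_on S s" for S unfolding s_def by (intro continuous_intros)
  have c\<zeta>: "continuous_on S \<zeta>" for S unfolding \<zeta>_def
    by (intro continuous_intros continuous_on_compose2[OF continuous_ramp cs]) auto
  have c\<zeta>d: "continuous_on S (\<zeta>d i)" for S i unfolding \<zeta>d_def
    by (intro continuous_intros continuous_on_compose2[OF continuous_ramp' cs]) auto
  have d\<zeta>: "((\<lambda>t. \<zeta> (z + t *\<^sub>R axis i 1)) has_real_derivative \<zeta>d i z) (at 0)" for z i
  proof -
    have e: "(z + t *\<^sub>R axis i 1) \<bullet> (z + t *\<^sub>R axis i 1) = z \<bullet> z + 2 * t * z $ i + t\<^sup>2" for t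
      by (simp add: inner_add_left inner_add_right inner_axis inner_commute[of "axis i 1" z] power2_eq_square algebra_simps)
    have d1: "((\<lambda>t. s (z + t *\<^sub>R axis i 1)) has_real_derivative 2 * z $ i * L) (at 0)"
      unfolding s_def e by (auto intro!: derivative_eq_intros)
    have d2: "(ramp 1 has_real_derivative ramp' 1 (s z)) (at (s (z + 0 *\<^sub>R axis i 1)))"
      using DERIV_ramp[of 1 "s z"] by simp
    have "((\<lambda>t. ramp 1 (s (z + t *\<^sub>R axis i 1))) has_real_derivative ramp' 1 (s z) * (2 * z $ i * L)) (at 0)"
      by (rule DERIV_chain2[where f="ramp 1" and g="\<lambda>t. s (z + t *\<^sub>R axis i 1)" and x=0, OF d2 d1])
    from DERIV_diff[OF DERIV_const[of 1] this] show ?thesis by (simp add: \<zeta>_def \<zeta>d_def)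
  qed
  define F where "F z = \<zeta> z *\<^sub>R vec2 (T1 (z $ 1)) (T2 (z $ 1) (z $ 2))" for z
  define G where "G i z = (if i = 1 then \<zeta>d 1 z * T1 (z $ 1) + \<zeta> z * D1 (z $ 1)
     else \<zeta>d 2 z * T2 (z $ 1) (z $ 2) + \<zeta> z * D2 (z $ 1) (z $ 2))" for i :: 2 and z
  define W where "W = {z::pt. \<rho> + 1 < norm z}"
  have oO: "open O'" unfolding O'_def by (intro open_Collect_conj open_Collect_less continuous_intros)
  have oW: "open W" unfolding W_def by (intro open_Collect_less continuous_intros)
  have OW: "O' \<union> W = UNIV"
  proof -
    have "z \<in> O'" if "norm z \<le> \<rho> + 1" for z
      using that component_le_norm_cart[of z 1] component_le_norm_cart[of z 2] by (auto simp: O'_def R_def)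
    thus ?thesis unfolding W_def by (metis (mono_tags, lifting) UNIV_eq_I UnI1 UnI2 mem_Collect_eq not_le)
  qed
  have FW: "F z = 0" "G i z = 0" if "z \<in> W" for z i
    using that \<zeta>far[of z] by (auto simp: F_def G_def W_def)
  \<comment> \<open>The open square and the exterior of the ball of radius \<rho> + 1 cover the
    plane, so a function that vanishes on the exterior needs to be checked only on the
    square.\<close>
  have gl: "continuous_on UNIV h" if "continuous_on O' h" "\<And>z. z \<in> W \<Longrightarrow> h z = 0" for h :: "pt \<Rightarrow> 'z::real_normed_vector"
  proof -
    have "continuous_on W h" using continuous_on_cong[of W W h "\<lambda>_. 0"] that(2) by simp
    thus ?thesis using continuous_on_open_Un[OF oO oW that(1)] OW by simp
  qed
  have cTx: "continuous_on O' (\<lambda>z. T1 (z $ 1))"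
  proof -
    have "continuous_on {-R<..<R} T1"
      by (intro continuous_at_imp_continuous_on ballI) (use dT1 in \<open>auto intro: DERIV_isCont\<close>)
    thus ?thesis by (rule continuous_on_compose2) (auto simp: O'_def intro!: continuous_intros)
  qed
  have csx: "continuous_on O' (\<lambda>z. sg (z $ 1))" unfolding sg_def by (intro continuous_intros cTx)
  have cmx: "continuous_on O' (\<lambda>z. m (z $ 1))"
    by (rule continuous_on_compose2[OF cm[of UNIV]]) (auto intro!: continuous_intros)
  have m1: "m (z $ 1) \<noteq> 0" for z :: pt using m0[of "z $ 1"] by simp
  have cPx: "continuous_on O' (\<lambda>z. P (z $ 1) (z $ 2))"
  proof -
    have "continuous_on O' (\<lambda>z. (z $ 1, z $ 2))" by (intro continuous_intros)
    moreover have "(\<lambda>z. (z $ 1, z $ 2)) ` O' \<subseteq> {-R..R} \<times> {-R..R}" by (auto simp: O'_def)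
    ultimately show ?thesis
      unfolding P_def using continuous_on_compose2[OF continuous_primitive[OF cp, of R]] by fastforce
  qed
  have cpx: "continuous_on O' (\<lambda>z. p (z $ 1) (z $ 2))" unfolding p_def
    by (intro continuous_intros continuous_on_compose2[OF cq]) auto
  have cT2: "continuous_on O' (\<lambda>z. T2 (z $ 1) (z $ 2))" unfolding T2_def
    by (intro continuous_intros csx cPx cmx) (use m1 in auto)
  have cD1: "continuous_on O' (\<lambda>z. D1 (z $ 1))" unfolding D1_def
    by (intro continuous_intros csx cmx) (use T1b(3) in \<open>fastforce simp: O'_def\<close>)
  have cD2: "continuous_on O' (\<lambda>z. D2 (z $ 1) (z $ 2))" unfolding D2_def
    by (intro continuous_intros csx cmx cpx) (use m1 in auto)
  have cF: "continuous_on UNIV F"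
    by (rule gl) (use FW in \<open>auto simp: F_def[abs_def] intro!: continuous_intros c\<zeta> continuous_vec2 cTx cT2\<close>)
  have cG: "continuous_on UNIV (G i)" for i
  proof (rule gl)
    show "continuous_on O' (G i)"
    proof (cases "i = 1")
      case True thus ?thesis by (simp add: G_def[abs_def]) (intro continuous_intros c\<zeta> c\<zeta>d cTx cD1)
    next
      case False thus ?thesis by (simp add: G_def[abs_def]) (intro continuous_intros c\<zeta> c\<zeta>d cT2 cD2)
    qed
  qed (use FW in auto)
  have F1: "norm (F z) \<le> 1" for z
  proof (cases "z \<in> W")
    case False
    hence "z \<in> O'" using OW by auto
    hence "norm (vec2 (T1 (z $ 1)) (T2 (z $ 1) (z $ 2))) \<le> 1"
      using T2b[of "z $ 1" "z $ 2"] by (simp add: norm_vec2 O'_def)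
    thus ?thesis unfolding F_def using \<zeta>b[of z] by (simp add: mult_le_one)
  qed (simp add: FW)
  have dF: "((\<lambda>t. F (z + t *\<^sub>R axis i 1) $ i) has_real_derivative G i z) (at 0)" for i z
  proof (cases "z \<in> W")
    case True
    define N where "N = (\<lambda>t::real. z + t *\<^sub>R axis i 1) -` W"
    have n1: "open N" unfolding N_def by (intro open_vimage oW continuous_intros)
    have n2: "0 \<in> N" using True by (simp add: N_def)
    have n3: "((\<lambda>_. 0) has_real_derivative 0) (at (0::real))" by simp
    have n4: "0 = F (z + t *\<^sub>R axis i 1) $ i" if "t \<in> N" for t
      using that FW(1)[of "z + t *\<^sub>R axis i 1"] by (simp add: N_def)
    have "((\<lambda>t. F (z + t *\<^sub>R axis i 1) $ i) has_real_derivative 0) (at 0)"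
      by (rule has_field_derivative_transform_within_open[OF n3 n1 n2 n4])
    thus ?thesis using True by (simp add: FW)
  next
    case False
    hence z: "-R < z $ 1" "z $ 1 < R" "-R < z $ 2" "z $ 2 < R" using OW by (auto simp: O'_def)
    show ?thesis
    proof (cases "i = 1")
      case True
      have "((\<lambda>t. T1 (z $ 1 + t)) has_real_derivative D1 (z $ 1)) (at 0)"
        using dT1[OF z(1,2)] DERIV_shift[of T1 "D1 (z $ 1)" 0 "z $ 1"] by (simp add: add.commute)
      from DERIV_mult[OF d\<zeta>[of z 1] this]
      have "((\<lambda>t. \<zeta> (z + t *\<^sub>R axis 1 1) * T1 (z $ 1 + t)) has_real_derivative
        \<zeta>d 1 z * T1 (z $ 1 + 0) + D1 (z $ 1) * \<zeta> (z + 0 *\<^sub>R axis 1 1)) (at 0)" .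
      moreover have "F (z + t *\<^sub>R axis 1 1) $ 1 = \<zeta> (z + t *\<^sub>R axis 1 1) * T1 (z $ 1 + t)" for t
        by (simp add: F_def axis_def)
      moreover have "\<zeta>d 1 z * T1 (z $ 1 + 0) + D1 (z $ 1) * \<zeta> (z + 0 *\<^sub>R axis 1 1) = G 1 z"
        by (simp add: G_def)
      ultimately show ?thesis using True by simp
    next
      case False
      hence i: "i = 2" by (metis exhaust_2)
      have "((\<lambda>t. T2 (z $ 1) (z $ 2 + t)) has_real_derivative D2 (z $ 1) (z $ 2)) (at 0)"
        using dT2[OF z(3,4)] DERIV_shift[of "T2 (z $ 1)" "D2 (z $ 1) (z $ 2)" 0 "z $ 2"] by (simp add: add.commute)
      from DERIV_mult[OF d\<zeta>[of z 2] this]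
      have "((\<lambda>t. \<zeta> (z + t *\<^sub>R axis 2 1) * T2 (z $ 1) (z $ 2 + t)) has_real_derivative
        \<zeta>d 2 z * T2 (z $ 1) (z $ 2 + 0) + D2 (z $ 1) (z $ 2) * \<zeta> (z + 0 *\<^sub>R axis 2 1)) (at 0)" .
      moreover have "F (z + t *\<^sub>R axis 2 1) $ 2 = \<zeta> (z + t *\<^sub>R axis 2 1) * T2 (z $ 1) (z $ 2 + t)" for t
        by (simp add: F_def axis_def)
      moreover have "\<zeta>d 2 z * T2 (z $ 1) (z $ 2 + 0) + D2 (z $ 1) (z $ 2) * \<zeta> (z + 0 *\<^sub>R axis 2 1) = G 2 z"
        by (simp add: G_def)
      ultimately show ?thesis using i by simp
    qed
  qed
  have "ereal (\<integral>z. indicator E z * (\<Sum>i\<in>UNIV. G i z) \<partial>lebesgue) \<le> Per E"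
    by (rule Per_ge_weak_field[OF cF _ F1 dF cG, where R="\<rho> + 1"]) (use FW E in \<open>auto simp: W_def\<close>)
  moreover have "2 * sqrt c * (\<integral>z. indicator E z * q z \<partial>lebesgue) \<le> (\<integral>z. indicator E z * (\<Sum>i\<in>UNIV. G i z) \<partial>lebesgue)"
  proof -
    have iE: "integrable lebesgue (\<lambda>z. indicator E z * h z)" if h: "continuous_on UNIV h" for h :: "pt \<Rightarrow> real"
    proof -
      have [measurable]: "h \<in> borel_measurable lebesgue" using borel_measurable_continuous_onI[OF h] by (intro measurable_completion) auto
      have [measurable]: "E \<in> sets lebesgue" by (rule E)
      have "integrable lborel (\<lambda>x. indicator (cball 0 \<rho>) x *\<^sub>R h x)"
        by (rule borel_integrable_compact) (auto intro: continuous_on_subset[OF h])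
      hence "integrable lebesgue (\<lambda>x. indicator (cball 0 \<rho>) x *\<^sub>R h x)"
        by (subst integral_lebesgue_lborel(2)) auto
      thus ?thesis
      proof (rule Bochner_Integration.integrable_bound)
        have "norm (indicator E z * h z) \<le> norm (indicator (cball 0 \<rho>) z *\<^sub>R h z)" for z
          using E(2) by (cases "z \<in> E") auto
        thus "AE z in lebesgue. norm (indicator E z * h z) \<le> norm (indicator (cball 0 \<rho>) z *\<^sub>R h z)" by simp
      qed measurable
    qed
    have "(\<integral>z. indicator E z * ((2 * sqrt c) * q z) \<partial>lebesgue) \<le> (\<integral>z. indicator E z * (\<Sum>i\<in>UNIV. G i z) \<partial>lebesgue)"
    proof (rule integral_mono)
      show "integrable lebesgue (\<lambda>z. indicator E z * ((2 * sqrt c) * q z))" by (rule iE) (intro continuous_intros cq)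
      show "integrable lebesgue (\<lambda>z. indicator E z * (\<Sum>i\<in>UNIV. G i z))" by (rule iE) (intro continuous_intros cG)
      fix z :: pt
      show "indicator E z * ((2 * sqrt c) * q z) \<le> indicator E z * (\<Sum>i\<in>UNIV. G i z)"
      proof (cases "z \<in> E")
        case True
        hence nz: "norm z < \<rho>" using E by auto
        hence zO: "-R < z $ 1" "z $ 1 < R" using OW by (auto simp: O'_def W_def)
        have sp: "sg (z $ 1) > 0" using T1b(3)[OF zO] .
        have "(\<Sum>i\<in>UNIV. G i z) = D1 (z $ 1) + D2 (z $ 1) (z $ 2)"
          using \<zeta>near[OF nz] by (simp add: sum_2 G_def)
        moreover have "2 * sqrt c * q z \<le> D1 (z $ 1) + D2 (z $ 1) (z $ 2)"
        proof -
          have "D1 (z $ 1) * D2 (z $ 1) (z $ 2) = c * (q z)\<^sup>2"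
            using sp m1[of z] by (simp add: D1_def D2_def p_def)
          hence "sqrt (D1 (z $ 1) * D2 (z $ 1) (z $ 2)) = sqrt c * q z"
            using q0[of z] by (simp add: real_sqrt_mult)
          moreover have "0 \<le> D1 (z $ 1)" "0 \<le> D2 (z $ 1) (z $ 2)"
            using sp m0[of "z $ 1"] p0[of "z $ 1" "z $ 2"] c by (auto simp: D1_def D2_def)
          ultimately show ?thesis using arith_geo_mean_sqrt[of "D1 (z $ 1)" "D2 (z $ 1) (z $ 2)"] by simp
        qed
        ultimately show ?thesis using True by simp
      qed simp
    qed
    moreover have "indicator E z * ((2 * sqrt c) * q z) = (2 * sqrt c) * (indicator E z * q z)" for z by simp
    ultimately show ?thesis by (simp only: integral_mult_right_zero)
  qed
  moreover have "tot = (\<integral>z. indicator {z. \<bar>z $ 1\<bar> \<le> \<rho> + 2 \<and> \<bar>z $ 2\<bar> \<le> \<rho> + 2} z * (q z)\<^sup>2 \<partial>lborel)"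
  proof -
    have "tot = integral {-R..R} (\<lambda>x. integral {-R..R} (\<lambda>y. (q (vec2 x y))\<^sup>2))"
      by (simp add: tot_def M_def m_def[abs_def] p_def[abs_def])
    also have "\<dots> = (\<integral>z. indicator {z. \<bar>z $ 1\<bar> \<le> R \<and> \<bar>z $ 2\<bar> \<le> R} z * (q z)\<^sup>2 \<partial>lborel)"
      by (rule integral_square_iterated) (intro continuous_intros cq)
    finally show ?thesis by (simp only: R_def)
  qed
  ultimately have "ereal (2 * sqrt c * (\<integral>z. indicator E z * q z \<partial>lebesgue)) \<le> Per E" and t: "tot = (\<integral>z. indicator {z. \<bar>z $ 1\<bar> \<le> \<rho> + 2 \<and> \<bar>z $ 2\<bar> \<le> \<rho> + 2} z * (q z)\<^sup>2 \<partial>lborel)"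
    by (auto intro: order_trans[of _ "ereal (\<integral>z. indicator E z * (\<Sum>i\<in>UNIV. G i z) \<partial>lebesgue)"])
  thus ?thesis unfolding c_def t by simp
qed

lemma measure_ball_pt: "0 \<le> r \<Longrightarrow> measure lebesgue (ball (x::pt) r) = pi * r\<^sup>2"
  by (simp add: content_ball unit_ball_vol_2)

text \<open>Apply the Knothe bound to positive continuous approximations q of the indicator of E.\<close>

lemma isoperimetric_bounded:
  assumes E: "E \<in> sets lebesgue" "E \<subseteq> ball 0 \<rho>" and \<rho>: "\<rho> > 0"
  shows "ereal (2 * sqrt (pi * measure lebesgue E)) \<le> Per E"
proof (cases "Per E")
  case (real P)
  define a where "a = measure lebesgue E"
  have Em: "E \<in> lmeasurable" using E by (intro bounded_set_imp_lmeasurable) (auto intro: bounded_subset[OF bounded_ball])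
  have P: "P \<ge> 0" using Per_nonneg[of E] real by simp
  have "(indicat_real E) \<in> borel_measurable (completion lborel)" using E by simp
  from completion_ex_borel_measurable_real[OF this] obtain f0 where
    f0: "f0 \<in> borel_measurable lborel" "AE x in lborel. indicat_real E x = f0 x" by blast
  define f where "f x = indicator (ball 0 \<rho>) x * max 0 (min 1 (f0 x))" for x
  have fm: "f \<in> borel_measurable borel" unfolding f_def[abs_def] using f0(1)
    by (intro borel_measurable_times borel_measurable_max borel_measurable_min borel_measurable_indicator) auto
  have fb: "0 \<le> f x" "f x \<le> 1" for x by (auto simp: f_def indicator_def)
  have fae: "AE x in lebesgue. indicat_real E x = f x"
    using AE_completion[OF f0(2)]
  proof eventually_elim
    case (elim x)
    hence "f0 x = 0 \<or> f0 x = 1" by (metis indicator_simps)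
    thus ?case using elim E(2) by (auto simp: f_def indicator_def split: if_splits)
  qed
  have fi: "integrable lborel f"
  proof (rule Bochner_Integration.integrable_bound[where f="indicator (ball (0::pt) \<rho>) :: pt \<Rightarrow> real"])
    show "integrable lborel (indicator (ball (0::pt) \<rho>) :: pt \<Rightarrow> real)"
      using emeasure_bounded_finite[of "ball (0::pt) \<rho>"] by (intro integrable_real_indicator) auto
    show "AE x in lborel. norm (f x) \<le> norm (indicat_real (ball 0 \<rho>) x)" by (auto simp: f_def indicator_def)
  qed (use fm in auto)
  have fa: "(\<integral>x. f x \<partial>lborel) = a"
  proof -
    have [measurable]: "f \<in> borel_measurable lebesgue" using fm by (intro measurable_completion) auto
    have "(\<integral>x. f x \<partial>lebesgue) = (\<integral>x. indicat_real E x \<partial>lebesgue)"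
      by (rule integral_cong_AE) (use fae E in auto)
    thus ?thesis using Em fm by (simp add: integral_lebesgue_lborel a_def)
  qed
  define Q where "Q = {z::pt. \<bar>z $ 1\<bar> \<le> \<rho> + 2 \<and> \<bar>z $ 2\<bar> \<le> \<rho> + 2}"
  define K where "K = measure lborel Q"
  have Qc: "closed Q" unfolding Q_def by (intro closed_Collect_conj closed_Collect_le continuous_intros)
  have Qb: "bounded Q"
  proof -
    have "norm z \<le> 2 * (\<rho> + 2)" if "z \<in> Q" for z
      using norm_le_l1_cart[of z] that by (simp add: Q_def sum_2)
    thus ?thesis by (auto intro: boundedI)
  qed
  have [measurable]: "Q \<in> sets borel" using Qc by simp
  have iQ: "integrable lborel (indicat_real Q)"
    using emeasure_bounded_finite[OF Qb] by (intro integrable_real_indicator) auto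
  \<comment> \<open>The mollified indicator k takes values in [0, 1], so k^2 \<le> k and the mass of
    q^2 stays close to the area of E. The constant \<epsilon> added to k makes q positive, as the
    transport requires.\<close>
  have main: "2 * sqrt pi * (a - \<epsilon>) \<le> P * sqrt ((a + \<epsilon>) * (1 + 2 * \<epsilon>) + K * \<epsilon>\<^sup>2)" if \<epsilon>: "\<epsilon> > 0" for \<epsilon>
  proof -
    obtain e where e: "e > 0" "integrable lborel (\<lambda>x. conv e f x - f x)" "(\<integral>x. \<bar>conv e f x - f x\<bar> \<partial>lborel) \<le> \<epsilon>"
      using conv_L1[OF fi \<epsilon>] by blast
    define k where "k = conv e f"
    have "integrable lborel (\<lambda>x. (conv e f x - f x) + f x)" using e(2) fi by (intro Bochner_Integration.integrable_add)
    hence ki: "integrable lborel k" by (simp add: k_def)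
    have ck: "continuous_on UNIV k" unfolding k_def
      by (intro continuous_at_imp_continuous_on ballI has_derivative_continuous[OF conv_has_derivative[OF e(1) fi]])
    have kb: "0 \<le> k x" "k x \<le> 1" for x
    proof -
      show "0 \<le> k x" unfolding k_def conv_def
        by (rule Bochner_Integration.integral_nonneg) (use kern_nonneg[OF e(1)] fb in auto)
      have "k x \<le> (\<integral>y. kern e (x - y) \<partial>lborel)" unfolding k_def conv_def
        by (rule integral_mono[OF conv_integrable(1)[OF e(1) fi] kern_integral_shift(2)[OF e(1)]])
          (use kern_nonneg[OF e(1)] fb in \<open>auto intro: mult_left_le\<close>)
      thus "k x \<le> 1" using kern_integral_shift(1)[OF e(1)] by simp
    qed
    have k_int: "(\<integral>x. k x \<partial>lborel) \<le> a + \<epsilon>"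
    proof -
      have "(\<integral>x. k x \<partial>lborel) - (\<integral>x. f x \<partial>lborel) = (\<integral>x. conv e f x - f x \<partial>lborel)" using ki fi by (simp add: k_def)
      also have "\<dots> \<le> (\<integral>x. \<bar>conv e f x - f x\<bar> \<partial>lborel)" by (rule integral_mono) (use e in auto)
      finally show ?thesis using e(3) fa by simp
    qed
    define q where "q x = k x + \<epsilon>" for x
    have cq: "continuous_on UNIV q" unfolding q_def by (intro continuous_intros ck)
    have q0: "0 < q x" for x using kb[of x] \<epsilon> by (simp add: q_def)
    define tot where "tot = (\<integral>z. indicator Q z * (q z)\<^sup>2 \<partial>lborel)"
    have tot_le: "tot \<le> (a + \<epsilon>) * (1 + 2 * \<epsilon>) + K * \<epsilon>\<^sup>2"
    proof -
      have "tot \<le> (\<integral>z. (1 + 2 * \<epsilon>) * k z + \<epsilon>\<^sup>2 * indicator Q z \<partial>lborel)"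
        unfolding tot_def
      proof (rule Bochner_Integration.integral_mono_AE')
        show "integrable lborel (\<lambda>z. (1 + 2 * \<epsilon>) * k z + \<epsilon>\<^sup>2 * indicator Q z)" using ki iQ by simp
        show "AE z in lborel. indicator Q z * (q z)\<^sup>2 \<le> (1 + 2 * \<epsilon>) * k z + \<epsilon>\<^sup>2 * indicator Q z"
        proof (rule AE_I2)
          fix z
          have "(k z)\<^sup>2 \<le> k z" using kb[of z] by (simp add: power2_eq_square mult_left_le)
          hence "(q z)\<^sup>2 \<le> (1 + 2 * \<epsilon>) * k z + \<epsilon>\<^sup>2" by (simp add: q_def power2_sum algebra_simps)
          thus "indicator Q z * (q z)\<^sup>2 \<le> (1 + 2 * \<epsilon>) * k z + \<epsilon>\<^sup>2 * indicator Q z"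
            using kb[of z] \<epsilon> by (auto simp: indicator_def)
        qed
        show "AE z in lborel. 0 \<le> (1 + 2 * \<epsilon>) * k z + \<epsilon>\<^sup>2 * indicator Q z" using kb \<epsilon> by (intro AE_I2 add_nonneg_nonneg) auto
      qed
      also have "\<dots> = (1 + 2 * \<epsilon>) * (\<integral>z. k z \<partial>lborel) + \<epsilon>\<^sup>2 * K" using ki iQ by (simp add: K_def)
      also have "\<dots> \<le> (1 + 2 * \<epsilon>) * (a + \<epsilon>) + \<epsilon>\<^sup>2 * K" using k_int \<epsilon> by simp
      finally show ?thesis by (simp add: algebra_simps)
    qed
    have tot0: "tot > 0"
    proof -
      have "(\<integral>z. \<epsilon>\<^sup>2 * indicator (ball 0 1) z \<partial>(lborel :: pt measure)) \<le> tot" unfolding tot_def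
      proof (rule integral_mono)
        show "integrable lborel (\<lambda>z. \<epsilon>\<^sup>2 * indicat_real (ball (0::pt) 1) z)"
          using emeasure_bounded_finite[of "ball (0::pt) 1"] by (intro integrable_mult_right integrable_real_indicator) auto
        have "integrable lborel (\<lambda>z. indicator Q z *\<^sub>R (q z)\<^sup>2)"
          by (rule borel_integrable_compact) (use Qc Qb in \<open>auto simp: compact_eq_bounded_closed intro!: continuous_intros continuous_on_subset[OF cq]\<close>)
        thus "integrable lborel (\<lambda>z. indicator Q z * (q z)\<^sup>2)" by simp
        fix z :: pt
        have "z \<in> Q" if "z \<in> ball 0 1"
          using that component_le_norm_cart[of z 1] component_le_norm_cart[of z 2] \<rho> by (auto simp: Q_def)
        moreover have "\<epsilon>\<^sup>2 \<le> (q z)\<^sup>2" using kb[of z] \<epsilon> by (intro power_mono) (auto simp: q_def)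
        ultimately show "\<epsilon>\<^sup>2 * indicator (ball 0 1) z \<le> indicator Q z * (q z)\<^sup>2" by (auto simp: indicator_def)
      qed
      moreover have "(\<integral>z. \<epsilon>\<^sup>2 * indicator (ball 0 1) z \<partial>(lborel :: pt measure)) = \<epsilon>\<^sup>2 * pi"
        using measure_ball_pt[of 1 0] by simp
      ultimately show ?thesis using \<epsilon> by (smt (verit) pi_gt_zero zero_less_power mult_pos_pos)
    qed
    have "ereal (2 * sqrt (pi / tot) * (\<integral>z. indicator E z * q z \<partial>lebesgue)) \<le> Per E"
      using knothe_perimeter[OF cq q0 \<rho> E] by (simp add: tot_def Q_def)
    hence 1: "2 * sqrt (pi / tot) * (\<integral>z. indicator E z * q z \<partial>lebesgue) \<le> P" using real by simp
    have 2: "a - \<epsilon> \<le> (\<integral>z. indicator E z * q z \<partial>lebesgue)"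
    proof -
      have qm: "q \<in> borel_measurable borel" by (rule borel_measurable_continuous_onI[OF cq])
      have [measurable]: "q \<in> borel_measurable lebesgue" "f \<in> borel_measurable lebesgue" "E \<in> sets lebesgue"
        using qm fm E by (auto intro: measurable_completion)
      have "(\<integral>z. indicator E z * q z \<partial>lebesgue) = (\<integral>z. f z * q z \<partial>lebesgue)"
        by (rule integral_cong_AE) (use fae in auto)
      also have "\<dots> = (\<integral>z. f z * q z \<partial>lborel)" using fm qm by (intro integral_lebesgue_lborel) auto
      finally have eq: "(\<integral>z. indicator E z * q z \<partial>lebesgue) = (\<integral>z. f z * q z \<partial>lborel)" .
      have iff: "integrable lborel (\<lambda>z. f z * f z)"
        by (rule Bochner_Integration.integrable_bound[OF fi]) (use fm fb in \<open>auto simp: abs_mult mult_left_le\<close>)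
      have ifq: "integrable lborel (\<lambda>z. f z * q z)"
      proof (rule Bochner_Integration.integrable_bound)
        show "integrable lborel (\<lambda>z. (1 + \<epsilon>) * f z)" using fi by simp
        show "AE z in lborel. norm (f z * q z) \<le> norm ((1 + \<epsilon>) * f z)"
        proof (rule AE_I2)
          fix z
          have "q z * f z \<le> (1 + \<epsilon>) * f z" using kb[of z] fb[of z] by (intro mult_right_mono) (auto simp: q_def)
          thus "norm (f z * q z) \<le> norm ((1 + \<epsilon>) * f z)" using fb[of z] q0[of z] \<epsilon> by (simp add: abs_mult mult.commute)
        qed
      qed (use fm qm in auto)
      have "(\<integral>z. f z - \<bar>conv e f z - f z\<bar> \<partial>lborel) \<le> (\<integral>z. f z * q z \<partial>lborel)"
      proof (rule integral_mono_AE)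
        show "AE z in lborel. f z - \<bar>conv e f z - f z\<bar> \<le> f z * q z"
          using f0(2)
        proof eventually_elim
          case (elim z)
          hence "f0 z = 0 \<or> f0 z = 1" by (metis indicator_simps)
          hence "f z = 0 \<or> f z = 1" by (auto simp: f_def indicator_def)
          moreover have "k z \<ge> f z - \<bar>conv e f z - f z\<bar>" by (auto simp: k_def)
          ultimately show ?case using \<epsilon> by (auto simp: q_def)
        qed
      qed (use fi e ifq in auto)
      moreover have "(\<integral>z. f z - \<bar>conv e f z - f z\<bar> \<partial>lborel) = a - (\<integral>z. \<bar>conv e f z - f z\<bar> \<partial>lborel)" using fi e fa by simp
      ultimately show ?thesis using eq e(3) by simp
    qed
    have "2 * sqrt pi * (a - \<epsilon>) = (2 * sqrt (pi / tot) * (a - \<epsilon>)) * sqrt tot"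
      using tot0 by (simp add: real_sqrt_divide)
    also have "\<dots> \<le> (2 * sqrt (pi / tot) * (\<integral>z. indicator E z * q z \<partial>lebesgue)) * sqrt tot"
      using 2 tot0 by (intro mult_right_mono mult_left_mono) auto
    also have "\<dots> \<le> P * sqrt tot" using 1 tot0 by (intro mult_right_mono) auto
    also have "\<dots> \<le> P * sqrt ((a + \<epsilon>) * (1 + 2 * \<epsilon>) + K * \<epsilon>\<^sup>2)" using tot_le P by (intro mult_left_mono real_sqrt_le_mono) auto
    finally show ?thesis .
  qed
  \<comment> \<open>In the limit 2 sqrt pi a \<le> P sqrt a, and the claim follows on division by
    sqrt a; a = 0 is trivial.\<close>
  have "2 * sqrt pi * (a - 0) \<le> P * sqrt ((a + 0) * (1 + 2 * 0) + K * 0\<^sup>2)"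
  proof (rule tendsto_le[of "at_right (0::real)"])
    show "((\<lambda>\<epsilon>. P * sqrt ((a + \<epsilon>) * (1 + 2 * \<epsilon>) + K * \<epsilon>\<^sup>2)) \<longlongrightarrow> P * sqrt ((a + 0) * (1 + 2 * 0) + K * 0\<^sup>2)) (at_right 0)"
      by (intro tendsto_intros)
    show "((\<lambda>\<epsilon>. 2 * sqrt pi * (a - \<epsilon>)) \<longlongrightarrow> 2 * sqrt pi * (a - 0)) (at_right 0)" by (intro tendsto_intros)
    show "\<forall>\<^sub>F \<epsilon> in at_right 0. 2 * sqrt pi * (a - \<epsilon>) \<le> P * sqrt ((a + \<epsilon>) * (1 + 2 * \<epsilon>) + K * \<epsilon>\<^sup>2)"
      unfolding eventually_at_right_field using main by (intro exI[of _ 1]) auto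
  qed simp
  moreover have "sqrt a * sqrt a = a" by (simp add: a_def)
  ultimately have fin: "(2 * sqrt pi * sqrt a) * sqrt a \<le> P * sqrt a" by (simp add: mult.assoc)
  have "2 * sqrt (pi * a) \<le> P"
  proof (cases "a = 0")
    case False
    hence "a > 0" by (simp add: a_def order_le_less zero_less_measure_iff)
    hence "2 * sqrt pi * sqrt a \<le> P" using fin by (simp del: mult.assoc)
    thus ?thesis by (simp add: real_sqrt_mult)
  qed (use P in simp)
  thus ?thesis using real by (simp add: a_def)
qed auto

lemma content_ball_pt: "0 \<le> r \<Longrightarrow> measure lborel (ball (x::pt) r) = pi * r\<^sup>2"
  by (simp add: content_ball unit_ball_vol_2)

section \<open>Density of quasi-minimal sets\<close>

text \<open>Real induction: the initial segment on which h stays above h a is closed by continuity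
  and can always be prolonged to the right. The lemma integrates differential inequalities for areas
  in balls, which are controlled through right difference quotients.\<close>

lemma locally_nondecreasing_imp_le:
  fixes h :: "real \<Rightarrow> real"
  assumes c: "continuous_on {a..b} h" and ab: "a \<le> b"
    and loc: "\<And>x. a \<le> x \<Longrightarrow> x < b \<Longrightarrow> \<exists>d0>0. \<forall>d. 0 < d \<and> d < d0 \<longrightarrow> h x \<le> h (x + d)"
  shows "h a \<le> h b"
proof -
  define S where "S = {x \<in> {a..b}. \<forall>y. a \<le> y \<and> y \<le> x \<longrightarrow> h a \<le> h y}"
  have aS: "a \<in> S" using ab by (auto simp: S_def)
  have bdd: "bdd_above S" by (auto simp: S_def intro: bdd_aboveI[of _ b])
  define s where "s = Sup S"
  have as: "a \<le> s" unfolding s_def by (rule cSup_upper[OF aS bdd])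
  have sb: "s \<le> b" unfolding s_def by (rule cSup_least) (use aS in \<open>auto simp: S_def\<close>)
  have below: "h a \<le> h y" if "a \<le> y" "y < s" for y
  proof -
    have "S \<noteq> {}" using aS by blast
    hence "\<exists>x\<in>S. y < x" using that(2) less_cSup_iff[OF _ bdd, of y] by (simp add: s_def)
    then obtain x where "x \<in> S" "y < x" by blast
    thus ?thesis using that by (auto simp: S_def)
  qed
  have hs: "h a \<le> h s"
  proof (cases "a = s")
    case False
    hence as': "a < s" using as by simp
    have "(h \<longlongrightarrow> h s) (at s within {a..b})" using c as sb by (auto simp: continuous_on_def)
    hence "(h \<longlongrightarrow> h s) (at s within {a..s})" by (rule tendsto_within_subset) (use sb in auto)
    hence "(h \<longlongrightarrow> h s) (at_left s)" using as' by (simp add: at_within_Icc_at_left)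
    moreover have "\<forall>\<^sub>F x in at_left s. h a \<le> h x"
      by (rule eventually_at_leftI[OF _ as']) (use below in auto)
    ultimately show ?thesis by (rule tendsto_lowerbound) simp
  qed simp
  have "s = b"
  proof (rule ccontr)
    assume "s \<noteq> b"
    hence "s < b" using sb by simp
    from loc[OF as this] obtain d0 where d0: "d0 > 0" "\<And>d. 0 < d \<Longrightarrow> d < d0 \<Longrightarrow> h s \<le> h (s + d)" by blast
    define e where "e = min (d0 / 2) (b - s)"
    have e: "0 < e" "e < d0" "s + e \<le> b" using d0 \<open>s < b\<close> by (auto simp: e_def)
    have "s + e \<in> S"
    proof -
      have "h a \<le> h y" if "a \<le> y" "y \<le> s + e" for y
      proof (cases "y < s")
        case False
        thus ?thesis using d0(2)[of "y - s"] that e hs by (cases "y = s") auto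
      qed (use below that in auto)
      thus ?thesis using e as by (auto simp: S_def)
    qed
    hence "s + e \<le> s" unfolding s_def by (rule cSup_upper[OF _ bdd])
    thus False using e by simp
  qed
  thus ?thesis using hs by simp
qed

lemma ball_measure_growth:
  assumes E: "E \<in> sets lebesgue" and "0 \<le> r" "r \<le> s"
  shows "measure lebesgue (E \<inter> ball (x::pt) r) \<le> measure lebesgue (E \<inter> ball x s)"
    "measure lebesgue (E \<inter> ball x s) - measure lebesgue (E \<inter> ball x r) \<le> pi * (s\<^sup>2 - r\<^sup>2)"
proof -
  have sub: "ball x r \<subseteq> ball x s" using assms by auto
  note m = lmeasurable_Int_ball[OF E, of x]
  show "measure lebesgue (E \<inter> ball (x::pt) r) \<le> measure lebesgue (E \<inter> ball x s)"
    by (rule measure_mono_fmeasurable) (use m sub E in auto)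
  have "measure lebesgue (E \<inter> ball x s) - measure lebesgue (E \<inter> ball x r) = measure lebesgue (E \<inter> ball x s - E \<inter> ball x r)"
    by (rule measurable_measure_Diff[symmetric]) (use m sub E in auto)
  also have "\<dots> \<le> measure lebesgue (ball x s - ball x r)"
    by (rule measure_mono_fmeasurable) (use m[of s] m[of r] in \<open>auto intro!: fmeasurable.Diff\<close>)
  also have "\<dots> = measure lebesgue (ball x s) - measure lebesgue (ball x r)"
    by (rule measurable_measure_Diff) (use sub in auto)
  also have "\<dots> = pi * (s\<^sup>2 - r\<^sup>2)" using assms by (simp add: content_ball_pt right_diff_distrib)
  finally show "measure lebesgue (E \<inter> ball x s) - measure lebesgue (E \<inter> ball x r) \<le> pi * (s\<^sup>2 - r\<^sup>2)" .
qed

lemma continuous_ball_measure: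
  assumes E: "E \<in> sets lebesgue"
  shows "continuous_on {0..} (\<lambda>r. measure lebesgue (E \<inter> ball (x::pt) r))"
proof -
  have b: "\<bar>measure lebesgue (E \<inter> ball x r) - measure lebesgue (E \<inter> ball x s)\<bar> \<le> pi * \<bar>r\<^sup>2 - s\<^sup>2\<bar>" if "0 \<le> r" "0 \<le> s" for r s
  proof (cases "r \<le> s")
    case True
    thus ?thesis using ball_measure_growth[OF E that(1) True, of x] power_mono[OF True that(1), of 2] by simp
  next
    case False
    hence F: "s \<le> r" by simp
    thus ?thesis using ball_measure_growth[OF E that(2) F, of x] power_mono[OF F that(2), of 2] by simp
  qed
  show ?thesis unfolding continuous_on_def
  proof
    fix s :: real assume s: "s \<in> {0..}"
    have "((\<lambda>r. measure lebesgue (E \<inter> ball x r) - measure lebesgue (E \<inter> ball x s)) \<longlongrightarrow> 0) (at s within {0..})"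
    proof (rule Lim_null_comparison)
      show "\<forall>\<^sub>F r in at s within {0..}. norm (measure lebesgue (E \<inter> ball x r) - measure lebesgue (E \<inter> ball x s)) \<le> pi * \<bar>r\<^sup>2 - s\<^sup>2\<bar>"
        unfolding eventually_at_topological using b s by (intro exI[of _ UNIV]) auto
      have "((\<lambda>r. pi * \<bar>r\<^sup>2 - s\<^sup>2\<bar>) \<longlongrightarrow> pi * \<bar>s\<^sup>2 - s\<^sup>2\<bar>) (at s within {0..})" by (intro tendsto_intros)
      thus "((\<lambda>r. pi * \<bar>r\<^sup>2 - s\<^sup>2\<bar>) \<longlongrightarrow> 0) (at s within {0..})" by simp
    qed
    thus "((\<lambda>r. measure lebesgue (E \<inter> ball x r)) \<longlongrightarrow> measure lebesgue (E \<inter> ball x s)) (at s within {0..})"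
      by (rule LIM_zero_cancel)
  qed
qed

lemma measure_Int_balls_tendsto:
  assumes "E \<in> lmeasurable"
  shows "(\<lambda>n. measure lebesgue (E \<inter> ball (0::pt) (real n))) \<longlonglongrightarrow> measure lebesgue E"
proof -
  have U: "(\<Union>n. E \<inter> ball (0::pt) (real n)) = E" using reals_Archimedean2 by force
  have "(\<lambda>n. measure lebesgue (E \<inter> ball (0::pt) (real n))) \<longlonglongrightarrow> measure lebesgue (\<Union>n. E \<inter> ball (0::pt) (real n))"
  proof (rule Lim_measure_incseq)
    show "incseq (\<lambda>n. E \<inter> ball (0::pt) (real n))" by (auto simp: incseq_def)
    show "emeasure lebesgue (\<Union>n. E \<inter> ball (0::pt) (real n)) \<noteq> \<infinity>" unfolding U using fmeasurableD2[OF assms] by simp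
  qed (use assms in \<open>auto intro: fmeasurableD\<close>)
  thus ?thesis unfolding U .
qed

text \<open>Reduction to bounded sets by large balls. If from some radius on every annulus carried
  area at a rate above \<epsilon>, the area would grow without bound; hence beyond every n there is
  a radius at which cutting costs at most 2 \<epsilon>.\<close>

theorem isoperimetric:
  assumes E: "E \<in> lmeasurable"
  shows "ereal (2 * sqrt (pi * measure lebesgue E)) \<le> Per E"
proof (cases "Per E")
  case (real P)
  have Es: "E \<in> sets lebesgue" using E by (rule fmeasurableD)
  define m where "m r = measure lebesgue (E \<inter> ball 0 r)" for r
  have ex: "\<exists>R\<ge>real n. 0 < R \<and> 2 * sqrt (pi * m R) \<le> P + 2 * \<epsilon>" if \<epsilon>: "\<epsilon> > 0" for n \<epsilon>
  proof -
    define a where "a = real n + 1"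
    have "\<exists>R\<ge>a. \<forall>d0>0. \<exists>d>0. d < d0 \<and> m (R + d) - m R \<le> \<epsilon> * d"
    proof (rule ccontr)
      assume "\<not> ?thesis"
      hence *: "\<exists>d0>0. \<forall>d. 0 < d \<and> d < d0 \<longrightarrow> \<epsilon> * d < m (R + d) - m R" if "R \<ge> a" for R
        using that by (meson not_le)
      \<comment> \<open>Growth at rate \<epsilon> from a to b would gain |E| + 1, more than the
        whole area of E.\<close>
      define b where "b = a + (measure lebesgue E + 1) / \<epsilon>"
      have ab: "a \<le> b" using \<epsilon> by (simp add: b_def)
      have "m a - \<epsilon> * a \<le> m b - \<epsilon> * b"
      proof (rule locally_nondecreasing_imp_le[where h="\<lambda>x. m x - \<epsilon> * x", OF _ ab])
        show "continuous_on {a..b} (\<lambda>x. m x - \<epsilon> * x)" unfolding m_def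
          by (intro continuous_intros continuous_on_subset[OF continuous_ball_measure[OF Es]]) (auto simp: a_def)
        fix x assume x: "a \<le> x"
        obtain d0 where "d0 > 0" "\<And>d. 0 < d \<Longrightarrow> d < d0 \<Longrightarrow> \<epsilon> * d < m (x + d) - m x" using *[OF x] by blast
        thus "\<exists>d0>0. \<forall>d. 0 < d \<and> d < d0 \<longrightarrow> m x - \<epsilon> * x \<le> m (x + d) - \<epsilon> * (x + d)"
          by (intro exI[of _ d0]) (fastforce simp: algebra_simps)
      qed
      moreover have "\<epsilon> * (a + X / \<epsilon>) - \<epsilon> * a = X" for X using \<epsilon> by (simp add: distrib_left)
      hence "\<epsilon> * b - \<epsilon> * a = measure lebesgue E + 1" unfolding b_def .
      moreover have "m b \<le> measure lebesgue E" unfolding m_def by (rule measure_mono_fmeasurable) (use E Es in auto)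
      moreover have "0 \<le> m a" by (simp add: m_def)
      ultimately show False by linarith
    qed
    then obtain R where R: "R \<ge> a" "\<And>d0. d0 > 0 \<Longrightarrow> \<exists>d>0. d < d0 \<and> m (R + d) - m R \<le> \<epsilon> * d" by blast
    have R0: "R > 0" using R(1) by (simp add: a_def)
    have "Per (E \<inter> ball 0 R) + Per (E - ball 0 R) \<le> ereal (P + 2 * \<epsilon>)"
      by (rule Per_cut_ball[OF Es R0]) (use real R(2) in \<open>auto simp: m_def\<close>)
    moreover have "Per (E \<inter> ball 0 R) \<le> Per (E \<inter> ball 0 R) + Per (E - ball 0 R)"
      using add_left_mono[OF Per_nonneg[of "E - ball 0 R"], of "Per (E \<inter> ball 0 R)"] by simp
    moreover have "ereal (2 * sqrt (pi * m R)) \<le> Per (E \<inter> ball 0 R)"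
      unfolding m_def by (rule isoperimetric_bounded[OF _ _ R0]) (use Es in auto)
    ultimately have "ereal (2 * sqrt (pi * m R)) \<le> ereal (P + 2 * \<epsilon>)" by (meson order_trans)
    thus ?thesis using R R0 by (intro exI[of _ R]) (auto simp: a_def)
  qed
  have mono: "m r \<le> m s" if "0 \<le> r" "r \<le> s" for r s unfolding m_def using ball_measure_growth(1)[OF Es that] .
  have "2 * sqrt (pi * measure lebesgue E) \<le> P + \<epsilon>" if \<epsilon>: "\<epsilon> > 0" for \<epsilon>
  proof (rule LIMSEQ_le_const2)
    show "(\<lambda>n. 2 * sqrt (pi * m (real n))) \<longlonglongrightarrow> 2 * sqrt (pi * measure lebesgue E)"
      unfolding m_def by (intro tendsto_intros measure_Int_balls_tendsto E)
    have "2 * sqrt (pi * m (real n)) \<le> P + \<epsilon>" for n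
    proof -
      obtain R where R: "R \<ge> real n" "2 * sqrt (pi * m R) \<le> P + 2 * (\<epsilon> / 2)" using ex[of "\<epsilon> / 2" n] \<epsilon> by auto
      have "sqrt (pi * m (real n)) \<le> sqrt (pi * m R)"
        using mono[of "real n" R] R(1) by (intro real_sqrt_le_mono mult_left_mono) auto
      thus ?thesis using R(2) by linarith
    qed
    thus "\<exists>N. \<forall>n\<ge>N. 2 * sqrt (pi * m (real n)) \<le> P + \<epsilon>" by blast
  qed
  hence "2 * sqrt (pi * measure lebesgue E) \<le> P" by (rule field_le_epsilon)
  thus ?thesis using real by simp
qed auto

section \<open>Discs and sets of finite perimeter\<close>

lemma Per_UNIV: "Per UNIV = 0" and Per_empty: "Per {} = 0"
proof -
  have "indicat_real {} = (\<lambda>x::pt. 0)" by (rule ext) simp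
  thus "Per {} = 0" unfolding Per_def using TV_zero by (simp only:)
  thus "Per UNIV = 0" using Per_Compl[of "{}"] by simp
qed

text \<open>Cut the whole plane, which has perimeter 0, along the circle. The disc and its
  complement have the same perimeter, so the factor 2 in the cost of cutting cancels and the rate of
  growth of the area of the disc remains.\<close>

lemma Per_ball: assumes r: "r > 0" shows "Per (ball x r) \<le> ereal (2 * pi * r)"
proof -
  have "Per (ball x r) \<le> ereal c" if c: "2 * pi * r < c" for c
  proof -
    have "Per (UNIV \<inter> ball x r) + Per (UNIV - ball x r) \<le> ereal (0 + 2 * c)"
    proof (rule Per_cut_ball[OF _ r])
      fix d0 :: real assume d0: "d0 > 0"
      \<comment> \<open>The annulus has area pi (2 r + d) d, which is at most c d when d \<le> c /
        pi - 2 r.\<close>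
      define d where "d = min (d0 / 2) (c / pi - 2 * r)"
      have d: "0 < d" "d < d0" "d \<le> c / pi - 2 * r" using d0 c by (auto simp: d_def field_simps)
      have "measure lebesgue (UNIV \<inter> ball x (r + d)) - measure lebesgue (UNIV \<inter> ball x r) = pi * (2 * r + d) * d"
        using r d by (simp add: content_ball_pt power2_eq_square algebra_simps)
      also have "\<dots> \<le> c * d" using d by (intro mult_right_mono) (auto simp: field_simps)
      finally show "\<exists>d>0. d < d0 \<and> measure lebesgue (UNIV \<inter> ball x (r + d)) - measure lebesgue (UNIV \<inter> ball x r) \<le> c * d"
        using d by blast
    qed (auto simp: Per_UNIV)
    moreover have "Per (UNIV - ball x r) = Per (ball x r)" using Per_Compl[of "ball x r"] by (simp add: Compl_eq_Diff_UNIV)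
    ultimately show ?thesis by (cases "Per (ball x r)") auto
  qed
  note * = this
  show ?thesis
  proof (cases "Per (ball x r)")
    case (real P)
    have "P \<le> 2 * pi * r" by (rule dense_ge) (use * real in auto)
    thus ?thesis using real by simp
  qed (use *[of "2 * pi * r + 1"] in auto)
qed

text \<open>By submodularity it is enough that G \<union> B has at least the perimeter of the disc
  B. It has at least the area of B, so the isoperimetric inequality, with equality for discs, gives
  this.\<close>

lemma Per_Int_ball:
  assumes G: "G \<in> lmeasurable" and r: "r > 0"
  shows "Per (G \<inter> ball x r) \<le> Per G"
proof -
  have Gs: "G \<in> sets lebesgue" using G by (rule fmeasurableD)
  have 1: "Per (G \<inter> ball x r) + Per (G \<union> ball x r) \<le> Per G + Per (ball x r)"
    by (rule Per_submodular) (use Gs in auto)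
  have "measure lebesgue (ball x r) \<le> measure lebesgue (G \<union> ball x r)"
    by (rule measure_mono_fmeasurable) (use G in auto)
  hence "pi * r\<^sup>2 \<le> measure lebesgue (G \<union> ball x r)" using r by (simp add: content_ball_pt)
  hence "sqrt ((pi * r)\<^sup>2) \<le> sqrt (pi * measure lebesgue (G \<union> ball x r))"
    by (intro real_sqrt_le_mono) (simp add: power2_eq_square mult_ac)
  hence "ereal (2 * pi * r) \<le> ereal (2 * sqrt (pi * measure lebesgue (G \<union> ball x r)))" using r by simp
  also have "\<dots> \<le> Per (G \<union> ball x r)" by (rule isoperimetric) (use G in auto)
  finally have 2: "Per (ball x r) \<le> Per (G \<union> ball x r)" using Per_ball[OF r, of x] order_trans by blast
  obtain b where b: "Per (ball x r) = ereal b" using Per_ball[OF r, of x] Per_nonneg[of "ball x r"] by (cases "Per (ball x r)") auto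
  have "Per (G \<inter> ball x r) + ereal b \<le> Per G + ereal b"
    using order_trans[OF add_left_mono[OF 2] 1] b by simp
  thus ?thesis by (cases "Per (G \<inter> ball x r)"; cases "Per G") auto
qed

lemma infinite_measure_ball_large:
  assumes F: "F \<in> sets lebesgue" "F \<notin> lmeasurable"
  shows "\<exists>n0. \<forall>R\<ge>real n0. K < measure lebesgue (F \<inter> ball (0::pt) R)"
proof -
  have "\<exists>n. K < measure lebesgue (F \<inter> ball 0 (real n))"
  proof (rule ccontr)
    assume "\<not> ?thesis"
    hence *: "measure lebesgue (F \<inter> ball 0 (real n)) \<le> K" for n by (simp add: not_less)
    have U: "(\<Union>n. F \<inter> ball (0::pt) (real n)) = F" using reals_Archimedean2 by force
    have "(SUP n. emeasure lebesgue (F \<inter> ball (0::pt) (real n))) = emeasure lebesgue (\<Union>n. F \<inter> ball (0::pt) (real n))"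
      by (rule SUP_emeasure_incseq) (use F in \<open>auto simp: incseq_def\<close>)
    moreover have "(SUP n. emeasure lebesgue (F \<inter> ball (0::pt) (real n))) \<le> ennreal K"
    proof (rule SUP_least)
      fix n show "emeasure lebesgue (F \<inter> ball (0::pt) (real n)) \<le> ennreal K"
        using *[of n] lmeasurable_Int_ball[OF F(1), of 0 "real n"] by (simp add: emeasure_eq_measure2 ennreal_leI)
    qed
    ultimately have "emeasure lebesgue F \<le> ennreal K" unfolding U by simp
    hence "emeasure lebesgue F < \<infinity>" using le_less_trans by (metis ennreal_less_top infinity_ennreal_def)
    thus False using F by (simp add: fmeasurable_def)
  qed
  then obtain n where n: "K < measure lebesgue (F \<inter> ball 0 (real n))" ..
  show ?thesis
    by (rule exI[of _ n]) (use n ball_measure_growth(1)[OF F(1), of "real n"] in \<open>auto intro: less_le_trans\<close>)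
qed

text \<open>Otherwise F and its complement both have large area in a large disc B of radius R.
  Submodularity bounds Per (F \<inter> B) + Per (B - F) by 2 Per F + 2 pi R, while the isoperimetric
  inequality bounds it below by 2 sqrt (pi a) + 2 sqrt (pi b) with a + b = pi R^2. The square root
  is strictly concave, so a and b cannot both be large.\<close>

lemma finite_Per_dichotomy:
  assumes F: "F \<in> sets lebesgue" and P: "Per F < \<infinity>"
  shows "F \<in> lmeasurable \<or> - F \<in> lmeasurable"
proof (rule ccontr)
  assume n: "\<not> ?thesis"
  obtain p where p: "Per F = ereal p" "p \<ge> 0" using P Per_nonneg[of F] by (cases "Per F") auto
  have Fc: "- F \<in> sets lebesgue" using F by (rule lebesgue_sets_Compl)
  \<comment> \<open>The mixed product of the two roots is bounded by 3 pi p R below; its square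
    compared with K gives 2 K \<le> 9 p^2, which this K violates. The radius is at least p so that
    p^2 can be absorbed into p R.\<close>
  define K where "K = 9 * p\<^sup>2 + 1"
  obtain n1 where n1: "\<And>R. R \<ge> real n1 \<Longrightarrow> K < measure lebesgue (F \<inter> ball 0 R)"
    using infinite_measure_ball_large[OF F] n by blast
  obtain n2 where n2: "\<And>R. R \<ge> real n2 \<Longrightarrow> K < measure lebesgue (- F \<inter> ball 0 R)"
    using infinite_measure_ball_large[OF Fc] n by blast
  define R where "R = Max {real n1, real n2, p, 1}"
  have R: "R \<ge> real n1" "R \<ge> real n2" "R \<ge> p" "R \<ge> 1" by (auto simp: R_def)
  define B where "B = ball (0::pt) R"
  have R0: "R > 0" using R by simp
  have [measurable, simp]: "B \<in> sets lebesgue" by (simp add: B_def)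
  define a where "a = measure lebesgue (F \<inter> B)"
  define b where "b = measure lebesgue (- F \<inter> B)"
  have ab: "K < a" "K < b" using n1[OF R(1)] n2[OF R(2)] by (auto simp: a_def b_def B_def)
  have fin: "F \<inter> B \<in> lmeasurable" "- F \<inter> B \<in> lmeasurable" using lmeasurable_Int_ball F Fc by (auto simp: B_def)
  have sum: "a + b = pi * R\<^sup>2"
  proof -
    have "measure lebesgue ((F \<inter> B) \<union> (- F \<inter> B)) = a + b"
      unfolding a_def b_def by (rule measure_Union) (use fmeasurableD2[OF fin(1)] fmeasurableD2[OF fin(2)] F Fc in auto)
    moreover have "(F \<inter> B) \<union> (- F \<inter> B) = B" by auto
    ultimately show ?thesis using R0 by (simp add: B_def content_ball_pt)
  qed
  have s1: "Per (F \<inter> B) + Per (F \<union> B) \<le> Per F + Per B" by (rule Per_submodular) (use F in auto)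
  have s2: "Per (- F \<inter> B) + Per (- F \<union> B) \<le> Per (- F) + Per B" by (rule Per_submodular) (use Fc in auto)
  \<comment> \<open>The unions F \<union> B and - F \<union> B meet exactly in B and cover the
    plane, so their perimeters together are at least Per B. This removes one of the two copies of
    Per B in the sum of \<open>s1\<close> and \<open>s2\<close>.\<close>
  have s3: "Per ((F \<union> B) \<inter> (- F \<union> B)) + Per ((F \<union> B) \<union> (- F \<union> B)) \<le> Per (F \<union> B) + Per (- F \<union> B)"
    by (rule Per_submodular) (use F Fc in auto)
  have e: "(F \<union> B) \<inter> (- F \<union> B) = B" "(F \<union> B) \<union> (- F \<union> B) = UNIV" by auto
  have B2: "Per B \<le> ereal (2 * pi * R)" unfolding B_def by (rule Per_ball[OF R0])
  have "ereal (2 * sqrt (pi * measure lebesgue B)) \<le> Per B" by (rule isoperimetric) (simp add: B_def)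
  moreover have "sqrt (pi * measure lebesgue B) = pi * R"
  proof -
    have "pi * measure lebesgue B = (pi * R)\<^sup>2" using R0 by (simp add: B_def content_ball_pt power2_eq_square mult_ac)
    thus ?thesis using R0 by simp
  qed
  ultimately have B1: "ereal (2 * pi * R) \<le> Per B" by (simp add: mult.assoc)
  have i1: "ereal (2 * sqrt (pi * a)) \<le> Per (F \<inter> B)" unfolding a_def by (rule isoperimetric[OF fin(1)])
  have i2: "ereal (2 * sqrt (pi * b)) \<le> Per (- F \<inter> B)" unfolding b_def by (rule isoperimetric[OF fin(2)])
  have PB: "Per B = ereal (2 * pi * R)" using B1 B2 by (rule antisym[rotated])
  have pf: "Per (- F) = ereal p" using Per_Compl[OF F] p by simp
  obtain x1 where x1: "Per (F \<inter> B) = ereal x1" using s1 p PB Per_nonneg[of "F \<inter> B"] Per_nonneg[of "F \<union> B"] by (cases "Per (F \<inter> B)"; cases "Per (F \<union> B)") auto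
  obtain x2 where x2: "Per (F \<union> B) = ereal x2" using s1 p PB Per_nonneg[of "F \<inter> B"] Per_nonneg[of "F \<union> B"] by (cases "Per (F \<inter> B)"; cases "Per (F \<union> B)") auto
  obtain x3 where x3: "Per (- F \<inter> B) = ereal x3" using s2 pf PB Per_nonneg[of "- F \<inter> B"] Per_nonneg[of "- F \<union> B"] by (cases "Per (- F \<inter> B)"; cases "Per (- F \<union> B)") auto
  obtain x4 where x4: "Per (- F \<union> B) = ereal x4" using s2 pf PB Per_nonneg[of "- F \<inter> B"] Per_nonneg[of "- F \<union> B"] by (cases "Per (- F \<inter> B)"; cases "Per (- F \<union> B)") auto
  have key: "2 * sqrt (pi * a) + 2 * sqrt (pi * b) \<le> 2 * p + 2 * pi * R"
    using s1 s2 s3 i1 i2 unfolding e x1 x2 x3 x4 PB p(1) pf Per_UNIV by simp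
  define A where "A = sqrt (pi * a)"
  define C where "C = sqrt (pi * b)"
  have K0: "K > 0" by (simp add: K_def add_nonneg_pos)
  have AC: "A \<ge> 0" "C \<ge> 0" "A\<^sup>2 = pi * a" "C\<^sup>2 = pi * b" using ab K0 by (auto simp: A_def C_def)
  have AC2: "A\<^sup>2 + C\<^sup>2 = (pi * R)\<^sup>2" using AC sum by (simp add: power2_eq_square algebra_simps) (metis distrib_left mult.assoc mult.left_commute)
  have "(A + C)\<^sup>2 \<le> (p + pi * R)\<^sup>2" using key AC by (intro power_mono) (auto simp: A_def C_def)
  hence "2 * (A * C) \<le> p\<^sup>2 + 2 * p * (pi * R)" using AC2 by (simp add: power2_sum algebra_simps)
  also have "\<dots> \<le> p * R + 2 * p * (pi * R)" using R p by (simp add: power2_eq_square mult_left_mono)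
  also have "\<dots> \<le> (p * R) * (3 * pi)"
  proof -
    have "p * R * 1 \<le> p * R * pi" using R p pi_ge_two by (intro mult_left_mono mult_nonneg_nonneg) linarith+
    thus ?thesis by (simp add: algebra_simps)
  qed
  finally have up: "2 * (A * C) \<le> 3 * pi * p * R" by (simp add: algebra_simps)
  have low: "K * R\<^sup>2 * pi\<^sup>2 \<le> 2 * (pi * pi * (a * b))"
  proof -
    have "K * (a + b) \<le> 2 * (a * b)"
    proof -
      have "K * a \<le> b * a" "K * b \<le> a * b" using ab K0 by (auto intro!: mult_right_mono)
      thus ?thesis by (simp add: algebra_simps)
    qed
    hence "K * (pi * R\<^sup>2) \<le> 2 * (a * b)" using sum by simp
    moreover have "K * (1 * R\<^sup>2) \<le> K * (pi * R\<^sup>2)" using K0 pi_ge_two by (intro mult_left_mono mult_right_mono) auto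
    ultimately have "K * R\<^sup>2 \<le> 2 * (a * b)" by simp
    hence "(K * R\<^sup>2) * pi\<^sup>2 \<le> (2 * (a * b)) * pi\<^sup>2" by (intro mult_right_mono) auto
    thus ?thesis by (simp add: power2_eq_square algebra_simps)
  qed
  have "(2 * (A * C))\<^sup>2 = 4 * (pi * pi * (a * b))" using AC(3,4) by (simp add: power_mult_distrib algebra_simps)
  moreover have "(2 * (A * C))\<^sup>2 \<le> (3 * pi * p * R)\<^sup>2" using up AC by (intro power_mono) auto
  ultimately have "2 * (K * R\<^sup>2 * pi\<^sup>2) \<le> (9 * p\<^sup>2) * (R\<^sup>2 * pi\<^sup>2)" using low by (simp add: power_mult_distrib algebra_simps)
  hence "(2 * K) * (R\<^sup>2 * pi\<^sup>2) \<le> (9 * p\<^sup>2) * (R\<^sup>2 * pi\<^sup>2)" by (simp add: algebra_simps)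
  hence "2 * K \<le> 9 * p\<^sup>2" using R0 by (simp add: mult_le_cancel_right_pos)
  thus False using zero_le_power2[of p] by (simp add: K_def)
qed

text \<open>With m r = |E \<inter> B(x, r)|, cutting by the ball, quasi-minimality and the isoperimetric inequality
  give m' \<ge> (1 - \<theta>) sqrt (\<pi> m), that is (sqrt m)' \<ge> (1 - \<theta>) sqrt \<pi> / 2.\<close>

lemma lower_density:
  assumes E: "E \<in> sets lebesgue" and P: "Per E < \<infinity>" and \<theta>: "0 \<le> \<theta>" "\<theta> < 1"
    and qm: "\<And>r. 0 < r \<Longrightarrow> r \<le> r0 \<Longrightarrow> Per E \<le> Per (E - ball x r) + ereal \<theta> * Per (E \<inter> ball x r)"
    and pos: "\<And>r. 0 < r \<Longrightarrow> 0 < measure lebesgue (E \<inter> ball x r)"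
    and r: "0 < r" "r \<le> r0"
  shows "((1 - \<theta>) / 2)\<^sup>2 * (pi * r\<^sup>2) \<le> measure lebesgue (E \<inter> ball x r)"
proof -
  define m where "m r = measure lebesgue (E \<inter> ball x r)" for r
  obtain p where p: "Per E = ereal p" using P Per_nonneg[of E] by (cases "Per E") auto
  define k where "k = (1 - \<theta>) * sqrt pi"
  have k: "k > 0" using \<theta> by (simp add: k_def)
  \<comment> \<open>This is the differential inequality in terms of right difference quotients. It
    is used in contrapositive form: every c below k sqrt (m s) is exceeded by all quotients with a
    sufficiently small increment.\<close>
  have step: "k * sqrt (m s) \<le> c" if s: "0 < s" "s \<le> r0"
    and c: "\<And>d0. d0 > 0 \<Longrightarrow> \<exists>d>0. d < d0 \<and> m (s + d) - m s \<le> c * d" for s c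
  proof -
    have 1: "Per (E \<inter> ball x s) + Per (E - ball x s) \<le> ereal (p + 2 * c)"
      by (rule Per_cut_ball[OF E s(1)]) (use p c in \<open>auto simp: m_def\<close>)
    obtain y1 where y1: "Per (E \<inter> ball x s) = ereal y1" using 1 Per_nonneg[of "E \<inter> ball x s"] Per_nonneg[of "E - ball x s"]
      by (cases "Per (E \<inter> ball x s)"; cases "Per (E - ball x s)") auto
    obtain y2 where y2: "Per (E - ball x s) = ereal y2" using 1 Per_nonneg[of "E \<inter> ball x s"] Per_nonneg[of "E - ball x s"]
      by (cases "Per (E \<inter> ball x s)"; cases "Per (E - ball x s)") auto
    have a: "y1 + y2 \<le> p + 2 * c" using 1 y1 y2 by simp
    have b: "p \<le> y2 + \<theta> * y1" using qm[OF s] p y1 y2 by simp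
    have "ereal (2 * sqrt (pi * m s)) \<le> Per (E \<inter> ball x s)"
      unfolding m_def by (rule isoperimetric[OF lmeasurable_Int_ball[OF E]])
    hence i: "2 * sqrt pi * sqrt (m s) \<le> y1" using y1 by (simp add: real_sqrt_mult)
    have "(1 - \<theta>) * (2 * sqrt pi * sqrt (m s)) \<le> (1 - \<theta>) * y1" using i \<theta> by (intro mult_left_mono) auto
    also have "\<dots> \<le> 2 * c" using a b by (simp add: algebra_simps)
    finally show ?thesis by (simp add: k_def algebra_simps)
  qed
  have mpos: "0 < m s" if "0 < s" for s using pos[OF that] by (simp add: m_def)
  have cm: "continuous_on {0..} m" unfolding m_def by (rule continuous_ball_measure[OF E])
  \<comment> \<open>The comparison starts at a > 0, where m is positive and its root can be
    expanded. The midpoint c between 2 \<sigma> q and k q is a slope that m exceeds and that is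
    still steep enough for sqrt m to have slope \<sigma>.\<close>
  have main: "\<sigma> * (r - a) \<le> sqrt (m r)" if \<sigma>: "0 < \<sigma>" "\<sigma> < k / 2" and a: "0 < a" "a \<le> r" for \<sigma> a
  proof -
    have "sqrt (m a) - \<sigma> * a \<le> sqrt (m r) - \<sigma> * r"
    proof (rule locally_nondecreasing_imp_le[where h="\<lambda>s. sqrt (m s) - \<sigma> * s", OF _ a(2)])
      show "continuous_on {a..r} (\<lambda>s. sqrt (m s) - \<sigma> * s)"
        by (intro continuous_intros continuous_on_subset[OF cm]) (use a in auto)
      fix s assume s: "a \<le> s" "s < r"
      have s0: "0 < s" "s \<le> r0" using s a r by auto
      define q where "q = sqrt (m s)"
      have q: "q > 0" "q * q = m s" using mpos[OF s0(1)] by (auto simp: q_def)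
      define c where "c = (2 * \<sigma> + k) / 2 * q"
      have c1: "2 * \<sigma> * q < c" "c < k * q" using q \<sigma> by (auto simp: c_def)
      have "\<exists>d0>0. \<forall>d. 0 < d \<and> d < d0 \<longrightarrow> c * d < m (s + d) - m s"
        using step[OF s0, of c] c1(2) unfolding q_def by (meson not_le)
      then obtain d0 where d0: "d0 > 0" "\<And>d. 0 < d \<Longrightarrow> d < d0 \<Longrightarrow> c * d < m (s + d) - m s" by blast
      \<comment> \<open>The second bound on the increment lets the excess of c over 2 \<sigma> q
        absorb the quadratic term of (q + \<sigma> d)^2.\<close>
      define d1 where "d1 = min d0 ((c - 2 * \<sigma> * q) / \<sigma>\<^sup>2)"
      have "q - \<sigma> * s \<le> sqrt (m (s + d)) - \<sigma> * (s + d)" if d: "0 < d" "d < d1" for d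
      proof -
        have "d * \<sigma>\<^sup>2 \<le> c - 2 * \<sigma> * q" using d \<sigma> by (simp add: d1_def pos_less_divide_eq less_imp_le)
        hence "(d * \<sigma>\<^sup>2) * d \<le> (c - 2 * \<sigma> * q) * d" using d by (intro mult_right_mono) auto
        moreover have "(q + \<sigma> * d)\<^sup>2 = m s + 2 * \<sigma> * q * d + d * \<sigma>\<^sup>2 * d"
          using q(2) by (simp add: power2_eq_square algebra_simps)
        ultimately have "(q + \<sigma> * d)\<^sup>2 \<le> m s + c * d" by (simp add: algebra_simps)
        also have "\<dots> \<le> m (s + d)" using d0(2)[of d] d by (simp add: d1_def)
        finally have "q + \<sigma> * d \<le> sqrt (m (s + d))" by (rule real_le_rsqrt)
        thus ?thesis by (simp add: algebra_simps)
      qed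
      moreover have "d1 > 0" using d0 c1 \<sigma> by (simp add: d1_def)
      ultimately show "\<exists>d0>0. \<forall>d. 0 < d \<and> d < d0 \<longrightarrow> sqrt (m s) - \<sigma> * s \<le> sqrt (m (s + d)) - \<sigma> * (s + d)"
        unfolding q_def by blast
    qed
    moreover have "0 \<le> sqrt (m a)" by (simp add: m_def)
    ultimately show ?thesis unfolding right_diff_distrib by linarith
  qed
  have "\<sigma> * r \<le> sqrt (m r)" if \<sigma>: "0 < \<sigma>" "\<sigma> < k / 2" for \<sigma>
  proof (rule tendsto_le[of "at_right (0::real)"])
    show "((\<lambda>a. sqrt (m r)) \<longlongrightarrow> sqrt (m r)) (at_right 0)" by simp
    have "((\<lambda>a. \<sigma> * (r - a)) \<longlongrightarrow> \<sigma> * (r - 0)) (at_right 0)" by (intro tendsto_intros)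
    thus "((\<lambda>a. \<sigma> * (r - a)) \<longlongrightarrow> \<sigma> * r) (at_right 0)" by simp
    show "\<forall>\<^sub>F a in at_right 0. \<sigma> * (r - a) \<le> sqrt (m r)"
      unfolding eventually_at_right_field using main[OF \<sigma>] r by (intro exI[of _ r]) auto
  qed simp
  hence "\<sigma> \<le> sqrt (m r) / r" if "0 < \<sigma>" "\<sigma> < k / 2" for \<sigma> using that r by (simp add: field_simps)
  hence "k / 2 \<le> sqrt (m r) / r"
    using k by (intro dense_le_bounded[of 0 "k/2"]) auto
  hence "k / 2 * r \<le> sqrt (m r)" using r by (simp add: field_simps)
  hence "(k / 2 * r)\<^sup>2 \<le> (sqrt (m r))\<^sup>2" using k r by (intro power_mono) auto
  moreover have "(k / 2 * r)\<^sup>2 = ((1 - \<theta>) / 2)\<^sup>2 * (pi * r\<^sup>2)"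
    by (simp add: k_def power_mult_distrib power_divide mult_ac)
  ultimately show ?thesis by (simp add: m_def)
qed

section \<open>Duality for the ROF functional\<close>

lemma L2D: "u \<in> L2 \<Longrightarrow> u \<in> borel_measurable lebesgue" "u \<in> L2 \<Longrightarrow> integrable lebesgue (\<lambda>x. (u x)\<^sup>2)"
  by (auto simp: L2_def)

lemma L2I_bound:
  assumes [measurable]: "u \<in> borel_measurable lebesgue" and g: "integrable lebesgue g" and b: "\<And>x. (u x)\<^sup>2 \<le> g x"
  shows "u \<in> L2"
proof -
  have "integrable lebesgue (\<lambda>x. (u x)\<^sup>2)"
    by (rule Bochner_Integration.integrable_bound[OF g]) (use b in \<open>auto intro!: AE_I2 order_trans[OF b abs_ge_self]\<close>)
  thus ?thesis by (simp add: L2_def)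
qed

lemma two_mult_le_squares: "2 * \<bar>a * b\<bar> \<le> a\<^sup>2 + (b::real)\<^sup>2"
  using sum_squares_bound[of "\<bar>a\<bar>" "\<bar>b\<bar>"] by (simp add: abs_mult mult.assoc)

lemma L2_mult_integrable:
  assumes "u \<in> L2" "v \<in> L2" shows "integrable lebesgue (\<lambda>x. u x * v x)"
proof -
  note [measurable] = L2D(1)[OF assms(1)] L2D(1)[OF assms(2)]
  have "integrable lebesgue (\<lambda>x. (u x)\<^sup>2 + (v x)\<^sup>2)" using L2D(2) assms by auto
  thus ?thesis
  proof (rule Bochner_Integration.integrable_bound)
    have "norm (u x * v x) \<le> norm ((u x)\<^sup>2 + (v x)\<^sup>2)" for x
      using two_mult_le_squares[of "u x" "v x"] by simp
    thus "AE x in lebesgue. norm (u x * v x) \<le> norm ((u x)\<^sup>2 + (v x)\<^sup>2)" by simp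
  qed measurable
qed

lemma L2_scale: "u \<in> L2 \<Longrightarrow> (\<lambda>x. c * u x) \<in> L2"
  by (auto simp: L2_def power_mult_distrib)

lemma L2_add: assumes "u \<in> L2" "v \<in> L2" shows "(\<lambda>x. u x + v x) \<in> L2"
proof (rule L2I_bound)
  show "(\<lambda>x. u x + v x) \<in> borel_measurable lebesgue" using L2D(1)[OF assms(1)] L2D(1)[OF assms(2)] by measurable
  show "integrable lebesgue (\<lambda>x. 2 * (u x)\<^sup>2 + 2 * (v x)\<^sup>2)" using L2D(2) assms by auto
  fix x show "(u x + v x)\<^sup>2 \<le> 2 * (u x)\<^sup>2 + 2 * (v x)\<^sup>2"
    using two_mult_le_squares[of "u x" "v x"] by (simp add: power2_sum)
qed

lemma L2_minus: "u \<in> L2 \<Longrightarrow> (\<lambda>x. - u x) \<in> L2"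
  by (auto simp: L2_def)

lemma L2_diff: assumes "u \<in> L2" "v \<in> L2" shows "(\<lambda>x. u x - v x) \<in> L2"
  using L2_add[OF assms(1) L2_minus[OF assms(2)]] by simp

lemma L2_divide: "u \<in> L2 \<Longrightarrow> (\<lambda>x. u x / c) \<in> L2"
  by (auto simp: L2_def power_divide)

lemma L2_abs: "u \<in> L2 \<Longrightarrow> (\<lambda>x. \<bar>u x\<bar>) \<in> L2"
  by (auto simp: L2_def)

lemma L2_zero: "(\<lambda>x. 0) \<in> L2"
  by (auto simp: L2_def)

lemma L2_indicator: "E \<in> lmeasurable \<Longrightarrow> indicator E \<in> L2"
  by (rule L2I_bound[where g="indicator E"]) (auto simp: fmeasurable_def indicator_def intro!: integrable_real_indicator)

lemma L2_bounded_mult: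
  assumes u: "u \<in> L2" and [measurable]: "h \<in> borel_measurable lebesgue" and b: "\<And>x. \<bar>h x\<bar> \<le> 1"
  shows "(\<lambda>x. h x * u x) \<in> L2"
proof (rule L2I_bound)
  note [measurable] = L2D(1)[OF u]
  show "(\<lambda>x. h x * u x) \<in> borel_measurable lebesgue" by measurable
  show "integrable lebesgue (\<lambda>x. (u x)\<^sup>2)" by (rule L2D(2)[OF u])
  fix x
  have "(h x)\<^sup>2 \<le> 1" using b[of x] by (simp add: abs_square_le_1)
  thus "(h x * u x)\<^sup>2 \<le> (u x)\<^sup>2" by (simp add: power_mult_distrib mult_left_le_one_le)
qed

lemma L2_L1_loc: assumes u: "u \<in> L2" shows "L1_loc u"
proof (rule L1_locI[OF L2D(1)[OF u]])
  fix R
  have "cball (0::pt) R \<in> lmeasurable" by simp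
  from L2_mult_integrable[OF L2_indicator[OF this] u]
  show "integrable lebesgue (\<lambda>x. indicator (cball 0 R) x * u x)" .
qed

lemma L2_Cauchy_Schwarz:
  assumes u: "u \<in> L2" and v: "v \<in> L2"
  shows "(\<integral>x. u x * v x \<partial>lebesgue) \<le> L2_norm u * L2_norm v"
proof -
  define a where "a = (\<integral>x. (u x)\<^sup>2 \<partial>lebesgue)"
  define b where "b = (\<integral>x. u x * v x \<partial>lebesgue)"
  define c where "c = (\<integral>x. (v x)\<^sup>2 \<partial>lebesgue)"
  have ac: "a \<ge> 0" "c \<ge> 0" by (auto simp: a_def c_def)
  have q: "0 \<le> a - 2 * t * b + t\<^sup>2 * c" for t
  proof -
    have "(\<integral>x. (u x - t * v x)\<^sup>2 \<partial>lebesgue) = (\<integral>x. (u x)\<^sup>2 - 2 * t * (u x * v x) + t\<^sup>2 * (v x)\<^sup>2 \<partial>lebesgue)"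
      by (rule Bochner_Integration.integral_cong) (auto simp: power2_eq_square algebra_simps)
    also have "\<dots> = a - 2 * t * b + t\<^sup>2 * c"
      using L2D(2)[OF u] L2D(2)[OF v] L2_mult_integrable[OF u v] by (simp add: a_def b_def c_def)
    finally have "(\<integral>x. (u x - t * v x)\<^sup>2 \<partial>lebesgue) = a - 2 * t * b + t\<^sup>2 * c" .
    moreover have "0 \<le> (\<integral>x. (u x - t * v x)\<^sup>2 \<partial>lebesgue)" by (rule Bochner_Integration.integral_nonneg) simp
    ultimately show ?thesis by simp
  qed
  have "b\<^sup>2 \<le> a * c"
  proof (cases "c = 0")
    case True
    have "b = 0"
    proof (rule ccontr)
      assume "b \<noteq> 0"
      \<comment> \<open>For c = 0 the nonnegative quadratic is affine in t, and this t gives it the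
        value -1.\<close>
      thus False using q[of "(a + 1) / (2 * b)"] True by simp
    qed
    thus ?thesis using True by simp
  next
    case False
    have "0 \<le> (a - 2 * (b / c) * b + (b / c)\<^sup>2 * c) * c" using q[of "b / c"] ac by simp
    also have "\<dots> = a * c - b\<^sup>2" using False by (simp add: field_simps power2_eq_square)
    finally show ?thesis by simp
  qed
  hence "\<bar>b\<bar> \<le> sqrt (a * c)" using real_le_rsqrt[of "\<bar>b\<bar>" "a * c"] by simp
  thus ?thesis by (simp add: a_def b_def c_def L2_norm_def real_sqrt_mult)
qed

text \<open>By one-homogeneity of TV this says that v is a subgradient of TV at u.\<close>

definition dual_pair :: "(pt \<Rightarrow> real) \<Rightarrow> (pt \<Rightarrow> real) \<Rightarrow> bool" where
  "dual_pair u v \<longleftrightarrow> u \<in> L2 \<and> v \<in> L2 \<and> TV u < \<infinity> \<and> TV u \<le> ereal (\<integral>x. v x * u x \<partial>lebesgue) \<and>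
     (\<forall>\<phi>\<in>L2. ereal (\<integral>x. v x * \<phi> x \<partial>lebesgue) \<le> TV \<phi>)"

lemma dual_pair_minus: assumes "dual_pair u v" shows "dual_pair (\<lambda>x. - u x) (\<lambda>x. - v x)"
proof -
  have "ereal (\<integral>x. - v x * \<phi> x \<partial>lebesgue) \<le> TV \<phi>" if "\<phi> \<in> L2" for \<phi>
    using assms L2_minus[OF that] TV_minus[of \<phi>] unfolding dual_pair_def by fastforce
  thus ?thesis using assms L2_minus by (auto simp: dual_pair_def TV_minus)
qed

text \<open>\<open>real_of_ereal\<close> sends \<infinity> to 0, so the value is the energy only for
  functions of finite variation.\<close>

definition ROF_real :: "real \<Rightarrow> (pt \<Rightarrow> real) \<Rightarrow> (pt \<Rightarrow> real) \<Rightarrow> real" where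
  "ROF_real \<alpha> f u = (\<integral>x. (u x - f x)\<^sup>2 \<partial>lebesgue) / 2 + \<alpha> * real_of_ereal (TV u)"

lemma TV_real: "TV u < \<infinity> \<Longrightarrow> TV u = ereal (real_of_ereal (TV u))" "0 \<le> real_of_ereal (TV u)"
  using TV_nonneg[of u] by (cases "TV u"; auto)+

lemma real_TV_mono: assumes "TV u \<le> ereal c" shows "real_of_ereal (TV u) \<le> c"
  using assms TV_nonneg[of u] by (cases "TV u") auto

text \<open>Two first variations. Along u + t w the variation grows by at most t times that of w,
  which gives the inequality for all w; along (1 - t) u it shrinks by t times that of u, which gives
  the reverse inequality at u. The quadratic terms disappear after division by t.\<close>

lemma ROF_real_min_dual_pair:
  assumes \<alpha>: "\<alpha> > 0" and f: "f \<in> L2" and u: "u \<in> L2" "TV u < \<infinity>"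
    and min: "\<And>w. w \<in> L2 \<Longrightarrow> TV w < \<infinity> \<Longrightarrow> ROF_real \<alpha> f u \<le> ROF_real \<alpha> f w"
  shows "dual_pair u (\<lambda>x. (f x - u x) / \<alpha>)"
proof -
  define d where "d x = f x - u x" for x
  have d: "d \<in> L2" unfolding d_def[abs_def] by (rule L2_diff[OF f u(1)])
  obtain Tu where Tu: "TV u = ereal Tu" using TV_real(1)[OF u(2)] by blast
  have rTu: "real_of_ereal (TV u) = Tu" using Tu by simp
  have exp: "(\<integral>x. ((u x + t * w x) - f x)\<^sup>2 \<partial>lebesgue) =
    (\<integral>x. (u x - f x)\<^sup>2 \<partial>lebesgue) - 2 * (t * (\<integral>x. d x * w x \<partial>lebesgue)) + t\<^sup>2 * (\<integral>x. (w x)\<^sup>2 \<partial>lebesgue)"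
    if w: "w \<in> L2" for w t
  proof -
    have i: "integrable lebesgue (\<lambda>x. (u x - f x)\<^sup>2)" using L2D(2)[OF L2_diff[OF u(1) f]] .
    have "(\<integral>x. ((u x + t * w x) - f x)\<^sup>2 \<partial>lebesgue) = (\<integral>x. (u x - f x)\<^sup>2 - 2 * (t * (d x * w x)) + t\<^sup>2 * (w x)\<^sup>2 \<partial>lebesgue)"
      by (rule Bochner_Integration.integral_cong) (auto simp: power2_eq_square algebra_simps d_def)
    thus ?thesis using i L2_mult_integrable[OF d w] L2D(2)[OF w] by simp
  qed
  have arith1: "X \<le> s * (W / 2) + Y" if "A / 2 + p \<le> (A - 2 * X + s * W) / 2 + q" "q \<le> p + Y" for A X W Y p q s :: real
    using that by (simp add: field_simps)
  have lim: "B \<le> C" if "\<And>t. 0 < t \<Longrightarrow> t < 1 \<Longrightarrow> t * B \<le> t\<^sup>2 * A + t * C" for A B C :: real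
  proof (rule tendsto_le[of "at_right (0::real)"])
    have "((\<lambda>t. t * A + C) \<longlongrightarrow> 0 * A + C) (at_right 0)" by (intro tendsto_intros)
    thus "((\<lambda>t. t * A + C) \<longlongrightarrow> C) (at_right 0)" by simp
    have "B \<le> t * A + C" if t: "0 < t" "t < 1" for t
    proof -
      have "t * B \<le> t * (t * A + C)" using \<open>\<And>t. 0 < t \<Longrightarrow> t < 1 \<Longrightarrow> t * B \<le> t\<^sup>2 * A + t * C\<close>[OF t] by (simp add: power2_eq_square algebra_simps)
      thus ?thesis using t by simp
    qed
    thus "\<forall>\<^sub>F t in at_right 0. B \<le> t * A + C" unfolding eventually_at_right_field by (intro exI[of _ 1]) auto
  qed simp_all
  have 1: "ereal (\<integral>x. d x / \<alpha> * w x \<partial>lebesgue) \<le> TV w" if w: "w \<in> L2" for w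
  proof (cases "TV w")
    case (real T)
    have "(\<integral>x. d x * w x \<partial>lebesgue) \<le> \<alpha> * T"
    proof (rule lim)
      fix t :: real assume t: "0 < t" "t < 1"
      have "TV (\<lambda>x. t * w x) \<le> ereal t * ereal T" using TV_bound_scale[of w "TV w" t] real t by simp
      hence "TV u + TV (\<lambda>x. t * w x) \<le> ereal (Tu + t * T)" unfolding Tu by (cases "TV (\<lambda>x. t * w x)") auto
      hence le: "TV (\<lambda>x. u x + t * w x) \<le> ereal (Tu + t * T)"
        using TV_add[OF L2_L1_loc[OF u(1)] L2_L1_loc[OF L2_scale[OF w, of t]]] by (rule order_trans[rotated])
      have "ROF_real \<alpha> f u \<le> ROF_real \<alpha> f (\<lambda>x. u x + t * w x)"
      proof (rule min)
        show "(\<lambda>x. u x + t * w x) \<in> L2" by (intro L2_add u L2_scale w)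
        show "TV (\<lambda>x. u x + t * w x) < \<infinity>" using le by (cases "TV (\<lambda>x. u x + t * w x)") auto
      qed
      moreover have "\<alpha> * real_of_ereal (TV (\<lambda>x. u x + t * w x)) \<le> \<alpha> * Tu + t * (\<alpha> * T)"
        using mult_left_mono[OF real_TV_mono[OF le], of \<alpha>] \<alpha> by (simp add: algebra_simps)
      ultimately show "t * (\<integral>x. d x * w x \<partial>lebesgue) \<le> t\<^sup>2 * ((\<integral>x. (w x)\<^sup>2 \<partial>lebesgue) / 2) + t * (\<alpha> * T)"
        unfolding ROF_real_def exp[OF w] rTu by (rule arith1)
    qed
    thus ?thesis using real \<alpha> by (simp add: field_simps)
  qed auto
  have arith3: "X \<le> t\<^sup>2 * (W / 2) + t * Y" if "A / 2 + p \<le> B / 2 + q" "q \<le> p - X"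
    "B = A - 2 * ((- t) * Y) + (- t)\<^sup>2 * W" for A B X W Y p q t :: real
    using that by (simp add: field_simps)
  have "\<alpha> * Tu \<le> (\<integral>x. d x * u x \<partial>lebesgue)"
  proof (rule lim)
    fix t :: real assume t: "0 < t" "t < 1"
    have e: "u x + (- t) * u x = (1 - t) * u x" for x by (simp add: algebra_simps)
    have "TV (\<lambda>x. (1 - t) * u x) \<le> ereal (1 - t) * TV u" using t by (intro TV_bound_scale) auto
    hence le: "TV (\<lambda>x. (1 - t) * u x) \<le> ereal ((1 - t) * Tu)" by (simp add: Tu)
    have "ROF_real \<alpha> f u \<le> ROF_real \<alpha> f (\<lambda>x. (1 - t) * u x)"
    proof (rule min)
      show "(\<lambda>x. (1 - t) * u x) \<in> L2" by (intro L2_scale u)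
      show "TV (\<lambda>x. (1 - t) * u x) < \<infinity>" using le by (cases "TV (\<lambda>x. (1 - t) * u x)") auto
    qed
    moreover have "\<alpha> * real_of_ereal (TV (\<lambda>x. (1 - t) * u x)) \<le> \<alpha> * Tu - t * (\<alpha> * Tu)"
      using mult_left_mono[OF real_TV_mono[OF le], of \<alpha>] \<alpha> by (simp add: algebra_simps)
    moreover have "(\<integral>x. ((1 - t) * u x - f x)\<^sup>2 \<partial>lebesgue) =
      (\<integral>x. (u x - f x)\<^sup>2 \<partial>lebesgue) - 2 * ((- t) * (\<integral>x. d x * u x \<partial>lebesgue)) + (- t)\<^sup>2 * (\<integral>x. (u x)\<^sup>2 \<partial>lebesgue)"
      using exp[OF u(1), of "- t"] unfolding e .
    ultimately show "t * (\<alpha> * Tu) \<le> t\<^sup>2 * ((\<integral>x. (u x)\<^sup>2 \<partial>lebesgue) / 2) + t * (\<integral>x. d x * u x \<partial>lebesgue)"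
      unfolding ROF_real_def rTu by (rule arith3)
  qed
  hence "Tu \<le> (\<integral>x. d x / \<alpha> * u x \<partial>lebesgue)" using \<alpha> by (simp add: field_simps)
  hence "TV u \<le> ereal (\<integral>x. d x / \<alpha> * u x \<partial>lebesgue)" by (simp add: Tu)
  thus ?thesis unfolding dual_pair_def using u 1 L2_divide[OF d, of \<alpha>] by (auto simp: d_def)
qed

lemma ROF_energy_real:
  assumes \<alpha>: "\<alpha> > 0" and f: "f \<in> L2" and u: "u \<in> L2" "TV u < \<infinity>"
  shows "ROF_energy \<alpha> f u = ereal (ROF_real \<alpha> f u)"
proof -
  have i: "integrable lebesgue (\<lambda>x. (u x - f x)\<^sup>2 / 2)" using L2D(2)[OF L2_diff[OF u(1) f]] by simp
  have nn: "(\<integral>\<^sup>+ x. ennreal ((u x - f x)\<^sup>2 / 2) \<partial>lebesgue) = ennreal (\<integral>x. (u x - f x)\<^sup>2 / 2 \<partial>lebesgue)"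
    by (rule nn_integral_eq_integral[OF i]) auto
  have n0: "0 \<le> (\<integral>x. (u x - f x)\<^sup>2 / 2 \<partial>lebesgue)" by (rule Bochner_Integration.integral_nonneg) simp
  obtain T where T: "TV u = ereal T" using TV_real(1)[OF u(2)] by blast
  show ?thesis unfolding ROF_energy_def ROF_real_def nn T enn2ereal_ennreal[OF n0] by simp
qed

text \<open>Minimality is formulated over \<open>BV\<close>, whose members need not be
  square-integrable. Comparison with 0 shows that the energy of u is finite, hence u - f and u are
  in L2; conversely L2 functions of finite variation are admissible competitors.\<close>

lemma ROF_minimizer_dual_pair:
  assumes \<alpha>: "\<alpha> > 0" and f: "f \<in> L2" and m: "ROF_minimizer \<alpha> f u"
  shows "dual_pair u (\<lambda>x. (f x - u x) / \<alpha>)"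
proof -
  have BV: "w \<in> BV" if "w \<in> L2" "TV w < \<infinity>" for w using that L2_L1_loc by (auto simp: BV_def)
  have uBV: "L1_loc u" "TV u < \<infinity>" using m by (auto simp: ROF_minimizer_def BV_def)
  note [measurable] = L1_loc_measurable[OF uBV(1)] L2D(1)[OF f]
  have z: "TV (\<lambda>x. 0) < \<infinity>" by (simp add: TV_zero)
  have "ROF_energy \<alpha> f u \<le> ROF_energy \<alpha> f (\<lambda>x. 0)" using m BV[OF L2_zero z] by (auto simp: ROF_minimizer_def)
  also have "\<dots> < \<infinity>" using ROF_energy_real[OF \<alpha> f L2_zero z] by simp
  finally have fin: "ROF_energy \<alpha> f u < \<infinity>" .
  have "(\<integral>\<^sup>+ x. ennreal ((u x - f x)\<^sup>2 / 2) \<partial>lebesgue) < \<infinity>"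
  proof (rule ccontr)
    assume "\<not> ?thesis"
    hence "enn2ereal (\<integral>\<^sup>+ x. ennreal ((u x - f x)\<^sup>2 / 2) \<partial>lebesgue) = \<infinity>" unfolding infinity_ennreal_def top.not_eq_extremum[symmetric] by simp
    moreover have "0 \<le> ereal \<alpha> * TV u" using \<alpha> by simp
    ultimately have "ROF_energy \<alpha> f u = \<infinity>" unfolding ROF_energy_def by (cases "ereal \<alpha> * TV u") auto
    thus False using fin by simp
  qed
  hence "integrable lebesgue (\<lambda>x. (u x - f x)\<^sup>2 / 2)" by (intro integrableI_bounded) auto
  hence "integrable lebesgue (\<lambda>x. 2 * ((u x - f x)\<^sup>2 / 2))" by (rule integrable_mult_right)
  hence "(\<lambda>x. u x - f x) \<in> L2" by (simp add: L2_def)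
  from L2_add[OF this f] have u: "u \<in> L2" by simp
  show ?thesis
  proof (rule ROF_real_min_dual_pair[OF \<alpha> f u uBV(2)])
    fix w assume w: "w \<in> L2" "TV w < \<infinity>"
    have "ROF_energy \<alpha> f u \<le> ROF_energy \<alpha> f w" using m BV[OF w] by (auto simp: ROF_minimizer_def)
    thus "ROF_real \<alpha> f u \<le> ROF_real \<alpha> f w" using ROF_energy_real[OF \<alpha> f u uBV(2)] ROF_energy_real[OF \<alpha> f w] by simp
  qed
qed

text \<open>Needed for the noiseless problem and for the truncated data, whose minimizers are not
  given. The minimizing sequence is taken to converge so fast that it converges almost everywhere
  under a locally integrable majorant; then the variation is lower semicontinuous and Fatou's lemma
  handles the quadratic term.\<close>

lemma ROF_exists:
  assumes \<alpha>: "\<alpha> > 0" and f: "f \<in> L2"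
  shows "\<exists>u. dual_pair u (\<lambda>x. (f x - u x) / \<alpha>)"
proof -
  define A where "A = {u \<in> L2. TV u < \<infinity>}"
  define J where "J u = ROF_real \<alpha> f u" for u
  have J0: "0 \<le> J u" for u unfolding J_def ROF_real_def using \<alpha> TV_real(2)[of u] by simp
  have zA: "(\<lambda>x. 0) \<in> A" by (simp add: A_def L2_zero TV_zero)
  define I where "I = Inf (J ` A)"
  have bdd: "bdd_below (J ` A)" using J0 by (auto intro: bdd_belowI[of _ 0])
  have I: "I \<le> J u" if "u \<in> A" for u unfolding I_def by (rule cInf_lower) (use that bdd in auto)
  \<comment> \<open>With this rate consecutive terms differ by at most 8^-n in squared norm, so the
    squares remain summable after multiplication by 2^n.\<close>
  define \<epsilon> where "\<epsilon> n = (1/8) * (1/8::real)^n" for n :: nat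
  have \<epsilon>: "\<epsilon> n > 0" for n by (simp add: \<epsilon>_def)
  have "\<exists>u\<in>A. J u < I + \<epsilon> n" for n
    using cInf_lessD[of "J ` A" "I + \<epsilon> n"] zA \<epsilon>[of n] by (auto simp: I_def)
  then obtain U where U: "\<And>n. U n \<in> A" "\<And>n. J (U n) < I + \<epsilon> n" by metis
  have UL: "U n \<in> L2" "TV (U n) < \<infinity>" for n using U(1)[of n] by (auto simp: A_def)
  note [measurable] = L2D(1)[OF UL(1)] L2D(1)[OF f]
  (* strong convexity makes the minimizing sequence Cauchy in L2 *)
  have par: "(\<integral>x. (U m x - U n x)\<^sup>2 \<partial>lebesgue) \<le> 4 * (\<epsilon> m + \<epsilon> n)" for m n
  proof -
    define w where "w x = (1/2) * U m x + (1/2) * U n x" for x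
    have wL: "w \<in> L2" unfolding w_def[abs_def] by (intro L2_add L2_scale UL)
    have "TV w \<le> TV (\<lambda>x. (1/2) * U m x) + TV (\<lambda>x. (1/2) * U n x)"
      unfolding w_def[abs_def] by (intro TV_add L2_L1_loc L2_scale UL)
    also have "\<dots> \<le> ereal (1/2) * TV (U m) + ereal (1/2) * TV (U n)"
      by (intro add_mono TV_bound_scale) auto
    also have "\<dots> = ereal (real_of_ereal (TV (U m)) / 2 + real_of_ereal (TV (U n)) / 2)"
    proof -
      obtain s t where "TV (U m) = ereal s" "TV (U n) = ereal t" using TV_real(1)[OF UL(2)] by blast
      thus ?thesis by simp
    qed
    finally have TVw: "TV w \<le> ereal (real_of_ereal (TV (U m)) / 2 + real_of_ereal (TV (U n)) / 2)" .
    have arith1: "(1/2 * a + 1/2 * b - 1/4 * c) / 2 + y \<le> (a / 2 + p) / 2 + (b / 2 + q) / 2 - c / 8" if "y \<le> p / 2 + q / 2" for a b c y p q :: real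
      using that by (simp add: field_simps)
    have arith2: "c \<le> 4 * (a + b)" if "y \<le> p / 2 + q / 2 - c / 8" "i \<le> y" "p < i + a" "q < i + b" for a b c y p q i :: real
      using that by (simp add: field_simps)
    have wA: "w \<in> A" using wL TVw by (cases "TV w") (auto simp: A_def)
    have i: "integrable lebesgue (\<lambda>x. (U k x - f x)\<^sup>2)" for k using L2D(2)[OF L2_diff[OF UL(1) f]] .
    have i2: "integrable lebesgue (\<lambda>x. (U m x - U n x)\<^sup>2)" using L2D(2)[OF L2_diff[OF UL(1) UL(1)]] .
    have "(\<integral>x. (w x - f x)\<^sup>2 \<partial>lebesgue) = (\<integral>x. (1/2) * (U m x - f x)\<^sup>2 + (1/2) * (U n x - f x)\<^sup>2 - (1/4) * (U m x - U n x)\<^sup>2 \<partial>lebesgue)"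
      by (rule Bochner_Integration.integral_cong) (auto simp: w_def power2_eq_square field_simps)
    also have "\<dots> = (1/2) * (\<integral>x. (U m x - f x)\<^sup>2 \<partial>lebesgue) + (1/2) * (\<integral>x. (U n x - f x)\<^sup>2 \<partial>lebesgue) - (1/4) * (\<integral>x. (U m x - U n x)\<^sup>2 \<partial>lebesgue)"
      using i i2 by simp
    finally have sq: "(\<integral>x. (w x - f x)\<^sup>2 \<partial>lebesgue) = (1/2) * (\<integral>x. (U m x - f x)\<^sup>2 \<partial>lebesgue) + (1/2) * (\<integral>x. (U n x - f x)\<^sup>2 \<partial>lebesgue) - (1/4) * (\<integral>x. (U m x - U n x)\<^sup>2 \<partial>lebesgue)" .
    have "\<alpha> * real_of_ereal (TV w) \<le> \<alpha> * (real_of_ereal (TV (U m)) / 2 + real_of_ereal (TV (U n)) / 2)"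
      using real_TV_mono[OF TVw] \<alpha> by (intro mult_left_mono) auto
    hence "\<alpha> * real_of_ereal (TV w) \<le> \<alpha> * real_of_ereal (TV (U m)) / 2 + \<alpha> * real_of_ereal (TV (U n)) / 2"
      by (simp add: distrib_left)
    hence "J w \<le> J (U m) / 2 + J (U n) / 2 - (\<integral>x. (U m x - U n x)\<^sup>2 \<partial>lebesgue) / 8"
      unfolding J_def ROF_real_def sq by (rule arith1)
    thus ?thesis by (rule arith2[OF _ I[OF wA] U(2)[of m] U(2)[of n]])
  qed
  define d where "d n x = U (Suc n) x - U n x" for n x
  have dL: "d n \<in> L2" for n unfolding d_def[abs_def] by (intro L2_diff UL)
  note [measurable] = L2D(1)[OF dL]
  have d2: "(\<integral>x. (d n x)\<^sup>2 \<partial>lebesgue) \<le> (1/8)^n" for n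
  proof -
    have "4 * (\<epsilon> (Suc n) + \<epsilon> n) = (9/16) * (1/8)^n" by (simp add: \<epsilon>_def)
    also have "\<dots> \<le> 1 * (1/8)^n" by (intro mult_right_mono) auto
    finally have e: "4 * (\<epsilon> (Suc n) + \<epsilon> n) \<le> (1/8)^n" by simp
    show ?thesis unfolding d_def by (rule order_trans[OF par e])
  qed
  \<comment> \<open>By the inequality of means |d n| \<le> (2^-n + 2^n (d n)^2) / 2. Finiteness of
    \<open>S\<close> therefore makes the telescoping series converge absolutely, with sum at most 1
    + S / 2, which is the origin of the majorant \<open>W\<close>.\<close>
  define S where "S x = (\<Sum>n. 2^n * (d n x)\<^sup>2)" for x
  have norms: "(\<integral>x. norm (2^n * (d n x)\<^sup>2) \<partial>lebesgue) \<le> (1/4)^n" for n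
  proof -
    have "(\<integral>x. norm (2^n * (d n x)\<^sup>2) \<partial>lebesgue) = 2^n * (\<integral>x. (d n x)\<^sup>2 \<partial>lebesgue)" by simp
    also have "\<dots> \<le> 2^n * (1/8)^n" using d2[of n] by (intro mult_left_mono) auto
    also have "\<dots> = (1/4)^n" by (simp flip: power_mult_distrib)
    finally show ?thesis .
  qed
  have int: "integrable lebesgue (\<lambda>x. 2^n * (d n x)\<^sup>2)" for n using L2D(2)[OF dL] by simp
  have sumn: "summable (\<lambda>n. (\<integral>x. norm (2^n * (d n x)\<^sup>2) \<partial>lebesgue))"
    by (rule summable_comparison_test'[OF summable_geometric[of "1/4::real"]]) (use norms in auto)
  have summ: "AE x in lebesgue. summable (\<lambda>n. norm (2^n * (d n x)\<^sup>2))"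
  proof -
    have fin: "(\<integral>\<^sup>+ x. (\<Sum>n. ennreal (norm (2^n * (d n x)\<^sup>2))) \<partial>lebesgue) \<noteq> \<infinity>"
    proof -
      have "(\<integral>\<^sup>+ x. (\<Sum>n. ennreal (norm (2^n * (d n x)\<^sup>2))) \<partial>lebesgue) = (\<Sum>n. \<integral>\<^sup>+ x. ennreal (norm (2^n * (d n x)\<^sup>2)) \<partial>lebesgue)"
        by (rule nn_integral_suminf) measurable
      also have "\<dots> = (\<Sum>n. ennreal (\<integral>x. norm (2^n * (d n x)\<^sup>2) \<partial>lebesgue))"
        by (intro suminf_cong nn_integral_eq_integral) (use int in auto)
      also have "\<dots> = ennreal (\<Sum>n. (\<integral>x. norm (2^n * (d n x)\<^sup>2) \<partial>lebesgue))"
        by (rule suminf_ennreal2[OF _ sumn]) auto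
      finally show ?thesis by simp
    qed
    have "AE x in lebesgue. (\<Sum>n. ennreal (norm (2^n * (d n x)\<^sup>2))) \<noteq> \<infinity>"
      by (rule nn_integral_PInf_AE[OF _ fin]) measurable
    thus ?thesis
      by eventually_elim (auto intro: summable_suminf_not_top)
  qed
  have Si: "integrable lebesgue S" unfolding S_def[abs_def] by (rule integrable_suminf[OF int summ sumn])
  define W where "W x = \<bar>U 0 x\<bar> + 1 + S x / 2" for x
  have W: "L1_loc W"
  proof (rule L1_locI)
    have [measurable]: "S \<in> borel_measurable lebesgue" using Si by auto
    show "W \<in> borel_measurable lebesgue" unfolding W_def[abs_def] by measurable
    fix R
    have c: "cball (0::pt) R \<in> lmeasurable" by simp
    have [measurable]: "cball (0::pt) R \<in> sets lebesgue" by simp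
    have "integrable lebesgue (\<lambda>x. indicator (cball 0 R) x * \<bar>U 0 x\<bar>)"
      using L2_mult_integrable[OF L2_indicator[OF c] L2_abs[OF UL(1)]] .
    moreover have "integrable lebesgue (indicat_real (cball (0::pt) R))" using c by (intro integrable_real_indicator) (auto simp: fmeasurable_def)
    moreover have "integrable lebesgue (\<lambda>x. indicator (cball 0 R) x * (S x / 2))"
      by (rule Bochner_Integration.integrable_bound[OF Si]) (measurable, auto simp: indicator_def)
    ultimately have "integrable lebesgue (\<lambda>x. indicator (cball 0 R) x * \<bar>U 0 x\<bar> + indicator (cball 0 R) x + indicator (cball 0 R) x * (S x / 2))" by auto
    thus "integrable lebesgue (\<lambda>x. indicator (cball 0 R) x * W x)" by (simp add: W_def algebra_simps)
  qed
  have ptw: "AE x in lebesgue. (\<forall>n. \<bar>U n x\<bar> \<le> W x) \<and> convergent (\<lambda>n. U n x)"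
    using summ
  proof eventually_elim
    case (elim x)
    hence s2: "summable (\<lambda>n. 2^n * (d n x)\<^sup>2)" by simp
    have sg: "summable (\<lambda>n. (1/2::real)^n)" by (rule summable_geometric) simp
    have dle: "\<bar>d n x\<bar> \<le> (1/2) * (1/2)^n + (1/2) * (2^n * (d n x)\<^sup>2)" for n
    proof -
      have p: "(2::real)^n > 0" by simp
      have "2 * (2^n * \<bar>d n x\<bar>) \<le> 1 + (2^n * \<bar>d n x\<bar>)\<^sup>2" using two_mult_le_squares[of 1 "2^n * \<bar>d n x\<bar>"] by (simp add: abs_mult)
      also have "\<dots> = 2^n * ((1/2)^n + 2^n * (d n x)\<^sup>2)" by (simp add: power2_eq_square power_divide algebra_simps abs_mult_self_eq)
      finally have "2^n * (2 * \<bar>d n x\<bar>) \<le> 2^n * ((1/2)^n + 2^n * (d n x)\<^sup>2)" by simp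
      hence "2 * \<bar>d n x\<bar> \<le> (1/2)^n + 2^n * (d n x)\<^sup>2" using p by (simp only: mult_le_cancel_left_pos)
      thus ?thesis by simp
    qed
    have ss: "summable (\<lambda>n. (1/2) * (1/2::real)^n + (1/2) * (2^n * (d n x)\<^sup>2))" by (intro summable_add summable_mult sg s2)
    have sd: "summable (\<lambda>n. \<bar>d n x\<bar>)" by (rule summable_comparison_test'[OF ss]) (use dle in auto)
    have tele: "U n x = U 0 x + (\<Sum>k<n. d k x)" for n unfolding d_def by (induction n) auto
    have tot: "(\<Sum>k<n. \<bar>d k x\<bar>) \<le> 1 + S x / 2" for n
    proof -
      have "(\<Sum>k<n. \<bar>d k x\<bar>) \<le> (\<Sum>k. \<bar>d k x\<bar>)" by (rule sum_le_suminf[OF sd]) auto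
      also have "\<dots> \<le> (\<Sum>k. (1/2) * (1/2::real)^k + (1/2) * (2^k * (d k x)\<^sup>2))" by (rule suminf_le[OF dle sd ss])
      also have "\<dots> = (\<Sum>k. (1/2) * (1/2::real)^k) + (\<Sum>k. (1/2) * (2^k * (d k x)\<^sup>2))"
        by (rule suminf_add[symmetric]) (intro summable_mult sg s2)+
      also have "\<dots> = (1/2) * (\<Sum>k. (1/2::real)^k) + (1/2) * S x"
        unfolding S_def using suminf_mult[OF sg, of "1/2"] suminf_mult[OF s2, of "1/2"] by simp
      also have "(\<Sum>k. (1/2::real)^k) = 2" by (subst suminf_geometric) auto
      finally show ?thesis by simp
    qed
    show ?case
    proof (intro conjI allI)
      fix n
      have "\<bar>U n x\<bar> \<le> \<bar>U 0 x\<bar> + \<bar>\<Sum>k<n. d k x\<bar>" using tele[of n] by linarith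
      also have "\<bar>\<Sum>k<n. d k x\<bar> \<le> (\<Sum>k<n. \<bar>d k x\<bar>)" by (rule sum_abs)
      finally show "\<bar>U n x\<bar> \<le> W x" using tot[of n] by (simp add: W_def)
    next
      have "summable (\<lambda>n. d n x)" using sd by (rule summable_rabs_cancel)
      hence "(\<lambda>n. \<Sum>k<n. d k x) \<longlonglongrightarrow> (\<Sum>k. d k x)" by (rule summable_LIMSEQ)
      hence "(\<lambda>n. U 0 x + (\<Sum>k<n. d k x)) \<longlonglongrightarrow> U 0 x + (\<Sum>k. d k x)" by (intro tendsto_intros)
      thus "convergent (\<lambda>n. U n x)" unfolding convergent_def tele[symmetric] by blast
    qed
  qed
  define u where "u x = lim (\<lambda>n. U n x)" for x
  have um[measurable]: "u \<in> borel_measurable lebesgue" unfolding u_def[abs_def] by measurable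
  have ul: "AE x in lebesgue. (\<lambda>n. U n x) \<longlonglongrightarrow> u x"
    using ptw by eventually_elim (simp add: u_def convergent_LIMSEQ_iff)
  define a where "a n = (\<integral>x. (U n x - f x)\<^sup>2 \<partial>lebesgue) / 2" for n
  have aJ: "a n + \<alpha> * real_of_ereal (TV (U n)) < I + \<epsilon> n" for n using U(2)[of n] by (simp add: J_def ROF_real_def a_def)
  have a_range: "a n \<in> {0..I + 1}" for n
  proof -
    have "(1/8::real) ^ n \<le> 1" by (rule power_le_one) auto
    hence "\<epsilon> n \<le> 1" unfolding \<epsilon>_def by simp
    moreover have "0 \<le> \<alpha> * real_of_ereal (TV (U n))" using \<alpha> TV_real(2)[of "U n"] by simp
    moreover have "0 \<le> a n" by (simp add: a_def)
    ultimately show ?thesis using aJ[of n] by auto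
  qed
  \<comment> \<open>The two parts of the energy are separated: along a subsequence the quadratic
    terms converge to a0, so the variations are asymptotically at most (I - a0) / \<alpha>. The two
    lower semicontinuity bounds then add up to I.\<close>
  obtain a0 \<sigma> where \<sigma>: "strict_mono \<sigma>" "(a \<circ> \<sigma>) \<longlonglongrightarrow> a0"
    using compact_Icc[of 0 "I + 1"] a_range unfolding compact_def by blast
  have e0: "(\<lambda>n. \<epsilon> (\<sigma> n)) \<longlonglongrightarrow> 0"
  proof -
    have "(\<lambda>n. (1/8) * (1/8::real)^n) \<longlonglongrightarrow> (1/8) * 0" by (intro tendsto_mult tendsto_const LIMSEQ_power_zero) simp
    hence "\<epsilon> \<longlonglongrightarrow> 0" by (simp add: \<epsilon>_def[abs_def])
    thus ?thesis using LIMSEQ_subseq_LIMSEQ[OF _ \<sigma>(1)] by (auto simp: o_def)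
  qed
  have TVu: "TV u \<le> ereal ((I - a0) / \<alpha>)"
  proof (rule TV_lsc[OF W, where U="\<lambda>n. U (\<sigma> n)" and c="\<lambda>n. (I + \<epsilon> (\<sigma> n) - a (\<sigma> n)) / \<alpha>"])
    show "AE x in lebesgue. (\<lambda>n. U (\<sigma> n) x) \<longlonglongrightarrow> u x"
      using ul by eventually_elim (use LIMSEQ_subseq_LIMSEQ[OF _ \<sigma>(1)] in \<open>auto simp: o_def\<close>)
    show "AE x in lebesgue. \<bar>U (\<sigma> n) x\<bar> \<le> W x" for n using ptw by eventually_elim auto
    show "TV (U (\<sigma> n)) \<le> ereal ((I + \<epsilon> (\<sigma> n) - a (\<sigma> n)) / \<alpha>)" for n
    proof -
      have "real_of_ereal (TV (U (\<sigma> n))) \<le> (I + \<epsilon> (\<sigma> n) - a (\<sigma> n)) / \<alpha>"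
        using aJ[of "\<sigma> n"] \<alpha> by (simp add: field_simps)
      moreover obtain T where "TV (U (\<sigma> n)) = ereal T" using TV_real(1)[OF UL(2)] by blast
      ultimately show ?thesis by simp
    qed
    have "(\<lambda>n. (I + \<epsilon> (\<sigma> n) - (a \<circ> \<sigma>) n) / \<alpha>) \<longlonglongrightarrow> (I + 0 - a0) / \<alpha>"
      by (intro tendsto_intros e0 \<sigma>(2)) (use \<alpha> in auto)
    thus "(\<lambda>n. (I + \<epsilon> (\<sigma> n) - a (\<sigma> n)) / \<alpha>) \<longlonglongrightarrow> (I - a0) / \<alpha>" by simp
  qed measurable
  have nn: "(\<integral>\<^sup>+ x. ennreal ((u x - f x)\<^sup>2) \<partial>lebesgue) \<le> ennreal (2 * a0)"
  proof -
    have "(\<integral>\<^sup>+ x. ennreal ((u x - f x)\<^sup>2) \<partial>lebesgue) = (\<integral>\<^sup>+ x. liminf (\<lambda>n. ennreal ((U (\<sigma> n) x - f x)\<^sup>2)) \<partial>lebesgue)"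
    proof (rule nn_integral_cong_AE)
      show "AE x in lebesgue. ennreal ((u x - f x)\<^sup>2) = liminf (\<lambda>n. ennreal ((U (\<sigma> n) x - f x)\<^sup>2))"
        using ul
      proof eventually_elim
        case (elim x)
        have "(\<lambda>n. U (\<sigma> n) x) \<longlonglongrightarrow> u x" using LIMSEQ_subseq_LIMSEQ[OF elim \<sigma>(1)] by (simp add: o_def)
        hence "(\<lambda>n. ennreal ((U (\<sigma> n) x - f x)\<^sup>2)) \<longlonglongrightarrow> ennreal ((u x - f x)\<^sup>2)" by (intro tendsto_intros tendsto_ennrealI)
        thus ?case by (intro lim_imp_Liminf[symmetric]) auto
      qed
    qed
    also have "\<dots> \<le> liminf (\<lambda>n. \<integral>\<^sup>+ x. ennreal ((U (\<sigma> n) x - f x)\<^sup>2) \<partial>lebesgue)"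
      by (rule nn_integral_liminf) measurable
    also have "(\<lambda>n. \<integral>\<^sup>+ x. ennreal ((U (\<sigma> n) x - f x)\<^sup>2) \<partial>lebesgue) = (\<lambda>n. ennreal (2 * (a \<circ> \<sigma>) n))"
    proof
      fix n
      have "(\<integral>\<^sup>+ x. ennreal ((U (\<sigma> n) x - f x)\<^sup>2) \<partial>lebesgue) = ennreal (\<integral>x. (U (\<sigma> n) x - f x)\<^sup>2 \<partial>lebesgue)"
        by (rule nn_integral_eq_integral) (use L2D(2)[OF L2_diff[OF UL(1) f]] in auto)
      thus "(\<integral>\<^sup>+ x. ennreal ((U (\<sigma> n) x - f x)\<^sup>2) \<partial>lebesgue) = ennreal (2 * (a \<circ> \<sigma>) n)" by (simp add: a_def)
    qed
    also have "liminf (\<lambda>n. ennreal (2 * (a \<circ> \<sigma>) n)) = ennreal (2 * a0)"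
      by (intro lim_imp_Liminf tendsto_ennrealI tendsto_intros \<sigma>(2)) auto
    finally show ?thesis .
  qed
  have a00: "0 \<le> a0" by (rule LIMSEQ_le_const[OF \<sigma>(2)]) (use a_range in auto)
  have iuf: "integrable lebesgue (\<lambda>x. (u x - f x)\<^sup>2)"
    by (rule integrableI_bounded) (use nn le_less_trans in \<open>auto simp: less_top[symmetric] top_unique\<close>)
  hence "(\<lambda>x. u x - f x) \<in> L2" by (simp add: L2_def)
  from L2_add[OF this f] have uL: "u \<in> L2" by simp
  have TVf: "TV u < \<infinity>" using TVu by (cases "TV u") auto
  have "ennreal (\<integral>x. (u x - f x)\<^sup>2 \<partial>lebesgue) \<le> ennreal (2 * a0)"
    using nn nn_integral_eq_integral[OF iuf] by simp
  hence "(\<integral>x. (u x - f x)\<^sup>2 \<partial>lebesgue) \<le> 2 * a0" using a00 by simp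
  moreover have "\<alpha> * real_of_ereal (TV u) \<le> I - a0" using real_TV_mono[OF TVu] \<alpha> by (simp add: field_simps)
  ultimately have "J u \<le> I" by (simp add: J_def ROF_real_def)
  show ?thesis
  proof (rule exI, rule ROF_real_min_dual_pair[OF \<alpha> f uL TVf])
    fix w assume "w \<in> L2" "TV w < \<infinity>"
    hence "I \<le> J w" by (intro I) (simp add: A_def)
    thus "ROF_real \<alpha> f u \<le> ROF_real \<alpha> f w" using \<open>J u \<le> I\<close> by (simp add: J_def)
  qed
qed

lemma dual_pairD:
  assumes "dual_pair u v"
  shows "u \<in> L2" "v \<in> L2" "TV u < \<infinity>" "TV u \<le> ereal (\<integral>x. v x * u x \<partial>lebesgue)"
    "\<And>\<phi>. \<phi> \<in> L2 \<Longrightarrow> ereal (\<integral>x. v x * \<phi> x \<partial>lebesgue) \<le> TV \<phi>"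
  using assms by (auto simp: dual_pair_def)

lemma dual_pair_set:
  assumes "dual_pair u v" "F \<in> lmeasurable"
  shows "integrable lebesgue (\<lambda>x. v x * indicator F x)" "ereal (\<integral>x. v x * indicator F x \<partial>lebesgue) \<le> Per F"
  using L2_mult_integrable[OF dual_pairD(2)[OF assms(1)] L2_indicator[OF assms(2)]]
    dual_pairD(5)[OF assms(1) L2_indicator[OF assms(2)]] by (auto simp: Per_def)

lemma super_level_lmeasurable:
  assumes u: "u \<in> L2" and s: "s > 0"
  shows "{x. s < u x} \<in> lmeasurable"
proof -
  note [measurable] = L2D(1)[OF u]
  have "{x \<in> space lebesgue. s < u x} \<in> sets lebesgue" by measurable
  hence E: "{x. s < u x} \<in> sets lebesgue" by simp
  have i: "integrable lebesgue (\<lambda>x. (u x)\<^sup>2 / s\<^sup>2)" using L2D(2)[OF u] by simp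
  have "integrable lebesgue (indicat_real {x. s < u x})"
  proof (rule Bochner_Integration.integrable_bound[OF i])
    have "norm (indicat_real {x. s < u x} x) \<le> norm ((u x)\<^sup>2 / s\<^sup>2)" for x
    proof (cases "s < u x")
      case True
      hence "s\<^sup>2 \<le> (u x)\<^sup>2" using s by (intro power_mono) auto
      thus ?thesis using True s by (simp add: field_simps)
    qed simp
    thus "AE x in lebesgue. norm (indicat_real {x. s < u x} x) \<le> norm ((u x)\<^sup>2 / s\<^sup>2)" by simp
  qed (use E in auto)
  thus ?thesis using E by (simp add: integrable_indicator_iff fmeasurable_def)
qed

text \<open>Chopping u at height s splits TV additively, so v is also a subgradient at the chopped function;
  rescaled, the latter converges to the indicator of the level set.\<close>

lemma dual_pair_level_set:
  assumes dp: "dual_pair u v" and s: "s > 0"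
  shows "Per {x. s < u x} = ereal (\<integral>x. v x * indicator {x. s < u x} x \<partial>lebesgue)"
proof (rule antisym)
  define E where "E = {x. s < u x}"
  note D = dual_pairD[OF dp]
  note [measurable] = L2D(1)[OF D(1)] L2D(1)[OF D(2)]
  have El: "E \<in> lmeasurable" unfolding E_def by (rule super_level_lmeasurable[OF D(1) s])
  have Em[measurable]: "E \<in> sets lebesgue" using El by (rule fmeasurableD)
  show "ereal (\<integral>x. v x * indicator {x. s < u x} x \<partial>lebesgue) \<le> Per {x. s < u x}"
    using dual_pair_set(2)[OF dp El] by (simp add: E_def)
  obtain T where T: "TV u = ereal T" using TV_real(1)[OF D(3)] by blast
  define q where "q d x = ramp 1 ((u x - s) / d)" for d x
  have q01: "0 \<le> q d x" "q d x \<le> 1" for d x unfolding q_def using ramp_bounds[of 1] by auto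
  have q0: "q d x = 0" if "x \<notin> E" "d > 0" for d x
    unfolding q_def by (rule ramp_0) (use that in \<open>auto simp: E_def divide_nonpos_pos\<close>)
  have rm: "ramp 1 \<in> borel_measurable borel" by (rule borel_measurable_continuous_onI[OF continuous_ramp]) simp
  have qm[measurable]: "q d \<in> borel_measurable lebesgue" for d
    unfolding q_def[abs_def] by (rule measurable_compose[OF _ rm]) measurable
  have step: "TV (q d) \<le> ereal (\<integral>x. v x * q d x \<partial>lebesgue)" if d: "d > 0" for d
  proof -
    have pL: "(\<lambda>x. d * q d x) \<in> L2"
    proof (rule L2I_bound[OF _ L2D(2)[OF D(1)]])
      fix x
      have "\<bar>d * q d x\<bar> \<le> \<bar>u x\<bar>"
      proof (cases "x \<in> E")
        case True
        hence "q d x \<le> (u x - s) / d" unfolding q_def using d by (intro ramp_le) (auto simp: E_def)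
        hence "d * q d x \<le> u x - s" using d by (simp add: field_simps)
        thus ?thesis using q01[of d x] d s True by (simp add: E_def)
      qed (use q0[of x d] d in simp)
      thus "(d * q d x)\<^sup>2 \<le> (u x)\<^sup>2" by (simp only: abs_le_square_iff)
    qed measurable
    have rL: "(\<lambda>x. u x - d * q d x) \<in> L2" by (rule L2_diff[OF D(1) pL])
    have ch: "TV (\<lambda>x. d * q d x) + TV (\<lambda>x. u x - d * q d x) \<le> ereal T"
      using TV_chop[OF L2_L1_loc[OF D(1)] d, of T s] T by (simp add: q_def)
    obtain a where a: "TV (\<lambda>x. d * q d x) = ereal a" using ch TV_nonneg[of "\<lambda>x. d * q d x"] TV_nonneg[of "\<lambda>x. u x - d * q d x"]
      by (cases "TV (\<lambda>x. d * q d x)"; cases "TV (\<lambda>x. u x - d * q d x)") auto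
    obtain b where b: "TV (\<lambda>x. u x - d * q d x) = ereal b" using ch TV_nonneg[of "\<lambda>x. d * q d x"] TV_nonneg[of "\<lambda>x. u x - d * q d x"]
      by (cases "TV (\<lambda>x. d * q d x)"; cases "TV (\<lambda>x. u x - d * q d x)") auto
    have 1: "a + b \<le> T" using ch a b by simp
    have 2: "T \<le> (\<integral>x. v x * u x \<partial>lebesgue)" using D(4) T by simp
    have 3: "(\<integral>x. v x * (u x - d * q d x) \<partial>lebesgue) \<le> b" using D(5)[OF rL] b by simp
    have 4: "(\<integral>x. v x * (u x - d * q d x) \<partial>lebesgue) = (\<integral>x. v x * u x \<partial>lebesgue) - (\<integral>x. v x * (d * q d x) \<partial>lebesgue)"
      unfolding right_diff_distrib by (rule Bochner_Integration.integral_diff[OF L2_mult_integrable[OF D(2,1)] L2_mult_integrable[OF D(2) pL]])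
    \<comment> \<open>The subgradient inequality is an equality at u, and u is the sum of the
      chopped part and the remainder. Subtracting the inequality for the remainder leaves the
      missing direction for the chopped part.\<close>
    have "a \<le> (\<integral>x. v x * (d * q d x) \<partial>lebesgue)" using 1 2 3 unfolding 4 by simp
    also have "\<dots> = d * (\<integral>x. v x * q d x \<partial>lebesgue)"
      by (subst integral_mult_right_zero[symmetric], rule Bochner_Integration.integral_cong) auto
    finally have "TV (\<lambda>x. d * q d x) \<le> ereal (d * (\<integral>x. v x * q d x \<partial>lebesgue))" using a by simp
    from TV_bound_scale[OF this, of "1 / d"] show ?thesis using d by simp
  qed
  define d where "d n = inverse (real (Suc n))" for n
  have d: "d n > 0" for n by (simp add: d_def)
  have ql: "(\<lambda>n. q (d n) x) \<longlonglongrightarrow> indicator E x" for x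
  proof (cases "x \<in> E")
    case True
    hence p: "u x - s > 0" by (simp add: E_def)
    have "\<forall>\<^sub>F n in sequentially. d n < (u x - s) / 2"
      using LIMSEQ_inverse_real_of_nat p unfolding d_def by (intro order_tendstoD) auto
    hence "\<forall>\<^sub>F n in sequentially. q (d n) x = indicator E x"
    proof eventually_elim
      case (elim n)
      hence "1 + 1 \<le> (u x - s) / d n" using d[of n] by (simp add: field_simps)
      thus ?case unfolding q_def using True ramp_1[of 1 "(u x - s) / d n"] by simp
    qed
    thus ?thesis by (rule tendsto_eventually)
  qed (use q0 d in simp)
  have "TV (indicat_real E) \<le> ereal (\<integral>x. v x * indicator E x \<partial>lebesgue)"
  proof (rule TV_lsc[where U="\<lambda>n. q (d n)" and W="\<lambda>_. 1" and c="\<lambda>n. \<integral>x. v x * q (d n) x \<partial>lebesgue"])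
    show "L1_loc (\<lambda>_. 1 :: real)" using L1_loc_indicator[of UNIV] by simp
    show "AE x in lebesgue. \<bar>q (d n) x\<bar> \<le> 1" for n using q01 by (intro AE_I2) (simp add: abs_le_iff order_trans[OF _ q01(1)])
    show "(\<lambda>n. \<integral>x. v x * q (d n) x \<partial>lebesgue) \<longlonglongrightarrow> (\<integral>x. v x * indicator E x \<partial>lebesgue)"
    proof (rule integral_dominated_convergence[where w="\<lambda>x. \<bar>v x * indicator E x\<bar>"])
      show "integrable lebesgue (\<lambda>x. \<bar>v x * indicator E x\<bar>)" using dual_pair_set(1)[OF dp El] by (rule integrable_abs)
      show "AE x in lebesgue. norm (v x * q (d n) x) \<le> \<bar>v x * indicator E x\<bar>" for n
      proof (rule AE_I2)
        fix x show "norm (v x * q (d n) x) \<le> \<bar>v x * indicator E x\<bar>"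
          using q0[of x "d n"] d[of n] q01[of "d n" x] by (cases "x \<in> E") (auto simp: abs_mult mult_left_le)
      qed
      show "AE x in lebesgue. (\<lambda>n. v x * q (d n) x) \<longlonglongrightarrow> v x * indicator E x" by (intro AE_I2 tendsto_mult tendsto_const ql)
    qed measurable
  qed (use ql step d in auto)
  thus "Per {x. s < u x} \<le> ereal (\<integral>x. v x * indicator {x. s < u x} x \<partial>lebesgue)" by (simp add: Per_def E_def)
qed

text \<open>Subgradients are monotone: the integral of (v1 - v2) (u1 - u2) is nonnegative. In the
  square of f1 - f2 = (u1 - u2) + \<alpha> (v1 - v2) the mixed term is therefore nonnegative, and
  each of the two squares is bounded by the whole.\<close>

lemma dual_pair_nonexpansive:
  assumes \<alpha>: "\<alpha> > 0" and f: "f1 \<in> L2" "f2 \<in> L2"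
    and p1: "dual_pair u1 (\<lambda>x. (f1 x - u1 x) / \<alpha>)" and p2: "dual_pair u2 (\<lambda>x. (f2 x - u2 x) / \<alpha>)"
  shows "(\<integral>x. (u1 x - u2 x)\<^sup>2 \<partial>lebesgue) \<le> (\<integral>x. (f1 x - f2 x)\<^sup>2 \<partial>lebesgue)"
    "(\<integral>x. ((f1 x - u1 x) / \<alpha> - (f2 x - u2 x) / \<alpha>)\<^sup>2 \<partial>lebesgue) \<le> (\<integral>x. (f1 x - f2 x)\<^sup>2 \<partial>lebesgue) / \<alpha>\<^sup>2"
proof -
  define d where "d x = f1 x - f2 x" for x
  define e where "e x = u1 x - u2 x" for x
  define v1 where "v1 x = (f1 x - u1 x) / \<alpha>" for x
  define v2 where "v2 x = (f2 x - u2 x) / \<alpha>" for x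
  note D1 = dual_pairD[OF p1, folded v1_def] and D2 = dual_pairD[OF p2, folded v2_def]
  have dL: "d \<in> L2" and eL: "e \<in> L2" unfolding d_def[abs_def] e_def[abs_def] by (intro L2_diff f D1 D2)+
  have v1L: "v1 \<in> L2" and v2L: "v2 \<in> L2" using D1(2) D2(2) by (auto simp: v1_def[abs_def] v2_def[abs_def])
  have "ereal (\<integral>x. v2 x * u1 x \<partial>lebesgue) \<le> ereal (\<integral>x. v1 x * u1 x \<partial>lebesgue)"
    using D2(5)[OF D1(1)] D1(4) by (rule order_trans)
  hence a: "(\<integral>x. v2 x * u1 x \<partial>lebesgue) \<le> (\<integral>x. v1 x * u1 x \<partial>lebesgue)" by simp
  have "ereal (\<integral>x. v1 x * u2 x \<partial>lebesgue) \<le> ereal (\<integral>x. v2 x * u2 x \<partial>lebesgue)"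
    using D1(5)[OF D2(1)] D2(4) by (rule order_trans)
  hence b: "(\<integral>x. v1 x * u2 x \<partial>lebesgue) \<le> (\<integral>x. v2 x * u2 x \<partial>lebesgue)" by simp
  note i = L2_mult_integrable[OF v1L D1(1)] L2_mult_integrable[OF v1L D2(1)] L2_mult_integrable[OF v2L D1(1)] L2_mult_integrable[OF v2L D2(1)]
  have "(\<integral>x. (v1 x - v2 x) * e x \<partial>lebesgue) = (\<integral>x. (v1 x * u1 x - v2 x * u1 x) - (v1 x * u2 x - v2 x * u2 x) \<partial>lebesgue)"
    by (rule Bochner_Integration.integral_cong) (auto simp: e_def algebra_simps)
  also have "\<dots> = ((\<integral>x. v1 x * u1 x \<partial>lebesgue) - (\<integral>x. v2 x * u1 x \<partial>lebesgue)) - ((\<integral>x. v1 x * u2 x \<partial>lebesgue) - (\<integral>x. v2 x * u2 x \<partial>lebesgue))"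
    using i by simp
  also have "\<dots> \<ge> 0" using a b by simp
  finally have mono: "0 \<le> (\<integral>x. (v1 x - v2 x) * e x \<partial>lebesgue)" .
  define g where "g x = d x - e x" for x
  have gL: "g \<in> L2" unfolding g_def[abs_def] by (rule L2_diff[OF dL eL])
  have v12: "v1 x - v2 x = g x / \<alpha>" for x by (simp add: v1_def v2_def g_def d_def e_def diff_divide_distrib)
  have "(\<integral>x. (v1 x - v2 x) * e x \<partial>lebesgue) = (\<integral>x. g x * e x \<partial>lebesgue) / \<alpha>" unfolding v12 by simp
  hence ge: "0 \<le> (\<integral>x. g x * e x \<partial>lebesgue)" using mono \<alpha> by (simp add: zero_le_divide_iff)
  have "(\<integral>x. (d x)\<^sup>2 \<partial>lebesgue) = (\<integral>x. (g x)\<^sup>2 + 2 * (g x * e x) + (e x)\<^sup>2 \<partial>lebesgue)"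
    by (rule Bochner_Integration.integral_cong) (auto simp: g_def power2_eq_square algebra_simps)
  also have "\<dots> = (\<integral>x. (g x)\<^sup>2 \<partial>lebesgue) + 2 * (\<integral>x. g x * e x \<partial>lebesgue) + (\<integral>x. (e x)\<^sup>2 \<partial>lebesgue)"
    using L2D(2)[OF gL] L2D(2)[OF eL] L2_mult_integrable[OF gL eL] by simp
  finally have s: "(\<integral>x. (d x)\<^sup>2 \<partial>lebesgue) = (\<integral>x. (g x)\<^sup>2 \<partial>lebesgue) + 2 * (\<integral>x. g x * e x \<partial>lebesgue) + (\<integral>x. (e x)\<^sup>2 \<partial>lebesgue)" .
  have nn: "0 \<le> (\<integral>x. (g x)\<^sup>2 \<partial>lebesgue)" "0 \<le> (\<integral>x. (e x)\<^sup>2 \<partial>lebesgue)" by simp_all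
  have "(\<integral>x. (e x)\<^sup>2 \<partial>lebesgue) \<le> (\<integral>x. (d x)\<^sup>2 \<partial>lebesgue)" unfolding s using nn ge by simp
  thus "(\<integral>x. (u1 x - u2 x)\<^sup>2 \<partial>lebesgue) \<le> (\<integral>x. (f1 x - f2 x)\<^sup>2 \<partial>lebesgue)" by (simp add: e_def d_def)
  have "(\<integral>x. (g x)\<^sup>2 \<partial>lebesgue) \<le> (\<integral>x. (d x)\<^sup>2 \<partial>lebesgue)" unfolding s using nn ge by simp
  hence "(\<integral>x. (g x / \<alpha>)\<^sup>2 \<partial>lebesgue) \<le> (\<integral>x. (d x)\<^sup>2 \<partial>lebesgue) / \<alpha>\<^sup>2"
    using \<alpha> by (simp add: power_divide divide_right_mono)
  thus "(\<integral>x. ((f1 x - u1 x) / \<alpha> - (f2 x - u2 x) / \<alpha>)\<^sup>2 \<partial>lebesgue) \<le> (\<integral>x. (f1 x - f2 x)\<^sup>2 \<partial>lebesgue) / \<alpha>\<^sup>2"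
    unfolding v12[symmetric] by (simp add: v1_def v2_def d_def)
qed

lemma null_if_negative_integral:
  fixes v :: "pt \<Rightarrow> real" and c :: real
  assumes A: "A \<in> lmeasurable" and i: "integrable lebesgue (\<lambda>x. v x * indicator A x)"
    and c: "c > 0" and le: "\<And>x. x \<in> A \<Longrightarrow> v x \<le> - c" and ge: "0 \<le> (\<integral>x. v x * indicator A x \<partial>lebesgue)"
  shows "A \<in> null_sets lebesgue"
proof -
  have iA: "integrable lebesgue (indicat_real A)" using A by (intro integrable_real_indicator) (auto simp: fmeasurable_def)
  have "(\<integral>x. v x * indicator A x \<partial>lebesgue) \<le> (\<integral>x. - c * indicator A x \<partial>lebesgue)"
  proof (rule integral_mono[OF i])
    show "integrable lebesgue (\<lambda>x. - c * indicat_real A x)" using iA by (rule integrable_mult_right)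
    show "v x * indicator A x \<le> - c * indicat_real A x" for x using le[of x] by (cases "x \<in> A") auto
  qed
  also have "\<dots> = - c * measure lebesgue A" using A by (simp add: fmeasurableD)
  finally have "c * measure lebesgue A \<le> 0" using ge by simp
  hence "measure lebesgue A = 0" using c measure_nonneg[of lebesgue A] by (simp add: mult_le_0_iff)
  thus ?thesis using A by (intro null_setsI) (auto simp: emeasure_eq_measure2 fmeasurableD)
qed

lemma AE_le_if_null_levels:
  fixes u :: "pt \<Rightarrow> real" and c :: real
  assumes "\<And>s. s > c \<Longrightarrow> {x. x \<notin> B \<and> s < u x} \<in> null_sets lebesgue"
  shows "AE x in lebesgue. x \<notin> B \<longrightarrow> u x \<le> c"
proof -
  have "AE x in lebesgue. \<forall>n. x \<notin> {x. x \<notin> B \<and> c + inverse (real (Suc n)) < u x}"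
    unfolding AE_all_countable by (intro allI AE_not_in assms) simp
  thus ?thesis
  proof eventually_elim
    case (elim x)
    show ?case
    proof (intro impI, rule ccontr)
      assume x: "x \<notin> B" "\<not> u x \<le> c"
      then obtain n where "inverse (real (Suc n)) < u x - c" using reals_Archimedean[of "u x - c"] by auto
      thus False using elim x by (auto simp: algebra_simps)
    qed
  qed
qed

text \<open>Intersecting a superlevel set E with the ball does not increase the perimeter, so the
  dual variable has nonnegative integral over the part of E outside the ball. There it equals - u /
  \<alpha> < - s / \<alpha>, hence this part is null. Negating the pair treats negative
  values.\<close>

lemma dual_pair_support:
  assumes \<alpha>: "\<alpha> > 0" and R: "R > 0" and z: "\<And>x. x \<notin> ball 0 R \<Longrightarrow> f x = 0"
    and p: "dual_pair u (\<lambda>x. (f x - u x) / \<alpha>)"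
  shows "AE x in lebesgue. x \<notin> ball 0 R \<longrightarrow> u x = 0"
proof -
  have one: "AE x in lebesgue. x \<notin> ball 0 R \<longrightarrow> u x \<le> 0"
    if z: "\<And>x. x \<notin> ball 0 R \<Longrightarrow> f x = 0" and p: "dual_pair u (\<lambda>x. (f x - u x) / \<alpha>)" for f u
  proof (rule AE_le_if_null_levels)
    fix s :: real assume s: "s > 0"
    define v where "v x = (f x - u x) / \<alpha>" for x
    note p' = p[folded v_def]
    define E where "E = {x. s < u x}"
    define A where "A = E - ball 0 R"
    have El: "E \<in> lmeasurable" unfolding E_def by (rule super_level_lmeasurable[OF dual_pairD(1)[OF p] s])
    have Al: "A \<in> lmeasurable" unfolding A_def using El by (intro fmeasurable.Diff) auto
    have Bl: "E \<inter> ball 0 R \<in> lmeasurable" using El by (intro fmeasurable_Int_fmeasurable) auto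
    have "ereal (\<integral>x. v x * indicator (E \<inter> ball 0 R) x \<partial>lebesgue) \<le> Per (E \<inter> ball 0 R)" by (rule dual_pair_set(2)[OF p' Bl])
    also have "\<dots> \<le> Per E" by (rule Per_Int_ball[OF El R])
    also have "\<dots> = ereal (\<integral>x. v x * indicator E x \<partial>lebesgue)" unfolding E_def by (rule dual_pair_level_set[OF p' s])
    finally have le: "(\<integral>x. v x * indicator (E \<inter> ball 0 R) x \<partial>lebesgue) \<le> (\<integral>x. v x * indicator E x \<partial>lebesgue)" by simp
    have "(\<integral>x. v x * indicator A x \<partial>lebesgue) = (\<integral>x. v x * indicator E x - v x * indicator (E \<inter> ball 0 R) x \<partial>lebesgue)"
      by (rule Bochner_Integration.integral_cong) (auto simp: A_def indicator_def)
    also have "\<dots> \<ge> 0" using le dual_pair_set(1)[OF p' El] dual_pair_set(1)[OF p' Bl] by simp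
    finally have ge: "0 \<le> (\<integral>x. v x * indicator A x \<partial>lebesgue)" .
    have "A \<in> null_sets lebesgue"
    proof (rule null_if_negative_integral[OF Al dual_pair_set(1)[OF p' Al] _ _ ge])
      show "0 < s / \<alpha>" using s \<alpha> by simp
      show "v x \<le> - (s / \<alpha>)" if "x \<in> A" for x
        using that z[of x] \<alpha> by (simp add: A_def E_def v_def divide_right_mono less_imp_le)
    qed
    moreover have "A = {x. x \<notin> ball 0 R \<and> s < u x}" by (auto simp: A_def E_def)
    ultimately show "{x. x \<notin> ball 0 R \<and> s < u x} \<in> null_sets lebesgue" by simp
  qed
  have e: "(\<lambda>x. - ((f x - u x) / \<alpha>)) = (\<lambda>x. (- f x - - u x) / \<alpha>)" by (rule ext) (simp add: minus_divide_left)
  have "AE x in lebesgue. x \<notin> ball 0 R \<longrightarrow> - u x \<le> 0"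
    by (rule one[where f="\<lambda>x. - f x"]) (use z dual_pair_minus[OF p] e in auto)
  moreover have "AE x in lebesgue. x \<notin> ball 0 R \<longrightarrow> u x \<le> 0"
    by (rule one[where f=f]) (use z p in auto)
  ultimately show ?thesis by eventually_elim auto
qed

text \<open>On a superlevel set above height 1 the dual variable is strictly negative, while its
  integral is a perimeter. The same holds for -u at positive heights.\<close>

lemma dual_pair_indicator_bounds:
  assumes \<alpha>: "\<alpha> > 0" and p: "dual_pair u (\<lambda>x. (indicator D x - u x) / \<alpha>)"
  shows "AE x in lebesgue. 0 \<le> u x \<and> u x \<le> 1"
proof -
  define v where "v x = (indicator D x - u x) / \<alpha>" for x
  note p' = p[folded v_def]
  have "AE x in lebesgue. x \<notin> {} \<longrightarrow> u x \<le> 1"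
  proof (rule AE_le_if_null_levels)
    fix s :: real assume s: "s > 1"
    define E where "E = {x. s < u x}"
    have El: "E \<in> lmeasurable" unfolding E_def by (rule super_level_lmeasurable[OF dual_pairD(1)[OF p]]) (use s in simp)
    have "Per E = ereal (\<integral>x. v x * indicator E x \<partial>lebesgue)" unfolding E_def by (rule dual_pair_level_set[OF p']) (use s in simp)
    hence ge: "0 \<le> (\<integral>x. v x * indicator E x \<partial>lebesgue)" using Per_nonneg[of E] by simp
    have "E \<in> null_sets lebesgue"
    proof (rule null_if_negative_integral[OF El dual_pair_set(1)[OF p' El] _ _ ge])
      show "0 < (s - 1) / \<alpha>" using s \<alpha> by simp
      show "v x \<le> - ((s - 1) / \<alpha>)" if "x \<in> E" for x
      proof -
        have "indicator D x - u x \<le> 1 - s" using that by (auto simp: E_def indicator_def)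
        thus ?thesis unfolding v_def minus_divide_left using \<alpha> by (intro divide_right_mono) auto
      qed
    qed
    thus "{x. x \<notin> {} \<and> s < u x} \<in> null_sets lebesgue" by (simp add: E_def)
  qed
  moreover have "AE x in lebesgue. x \<notin> {} \<longrightarrow> - u x \<le> 0"
  proof (rule AE_le_if_null_levels)
    fix s :: real assume s: "s > 0"
    note pm = dual_pair_minus[OF p']
    define E where "E = {x. s < - u x}"
    have El: "E \<in> lmeasurable" unfolding E_def by (rule super_level_lmeasurable[OF dual_pairD(1)[OF pm] s])
    have "Per E = ereal (\<integral>x. - v x * indicator E x \<partial>lebesgue)" unfolding E_def by (rule dual_pair_level_set[OF pm s])
    hence ge: "0 \<le> (\<integral>x. - v x * indicator E x \<partial>lebesgue)" using Per_nonneg[of E] by simp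
    have "E \<in> null_sets lebesgue"
    proof (rule null_if_negative_integral[OF El dual_pair_set(1)[OF pm El] _ _ ge])
      show "0 < s / \<alpha>" using s \<alpha> by simp
      show "- v x \<le> - (s / \<alpha>)" if "x \<in> E" for x
      proof -
        have "s \<le> indicator D x - u x" using that by (auto simp: E_def indicator_def)
        thus ?thesis unfolding v_def using \<alpha> by (simp add: divide_right_mono)
      qed
    qed
    thus "{x. x \<notin> {} \<and> s < - u x} \<in> null_sets lebesgue" by (simp add: E_def)
  qed
  ultimately show ?thesis by eventually_elim auto
qed

section \<open>Comparison with the curvature of D\<close>

text \<open>A form of the density theorem obtained from L1 convergence: averages over small discs of
  the indicator of the complement of Z converge almost everywhere along a subsequence, and at points
  of Z the limit is 0.\<close>

lemma AE_not_density_point: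
  assumes Z: "Z \<in> sets lebesgue" and c: "c > 0"
  shows "AE x::pt in lebesgue. x \<in> Z \<longrightarrow>
    \<not> (\<exists>r1>0. \<forall>r. 0 < r \<and> r < r1 \<longrightarrow> c * (pi * r\<^sup>2) \<le> measure lebesgue (ball x r - Z))"
proof -
  have "AE x::pt in lebesgue. x \<in> Z \<and> norm x < real K \<longrightarrow>
    \<not> (\<exists>r1>0. \<forall>r. 0 < r \<and> r < r1 \<longrightarrow> c * (pi * r\<^sup>2) \<le> measure lebesgue (ball x r - Z))" for K :: nat
  proof -
    \<comment> \<open>The truncation makes the indicator integrable. All radii used are at most 1,
      so discs centred at points of norm below K do not notice it.\<close>
    define C where "C = ball (0::pt) (real K + 1) - Z"
    have Cm: "C \<in> sets lebesgue" using Z by (auto simp: C_def)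
    have "(indicat_real C) \<in> borel_measurable (completion lborel)" using Cm by simp
    from completion_ex_borel_measurable_real[OF this] obtain f0 where
      f0: "f0 \<in> borel_measurable lborel" "AE x in lborel. indicat_real C x = f0 x" by blast
    define f where "f x = indicator (ball 0 (real K + 1)) x * max 0 (min 1 (f0 x))" for x
    have fm: "f \<in> borel_measurable borel" unfolding f_def[abs_def] using f0(1)
      by (intro borel_measurable_times borel_measurable_max borel_measurable_min borel_measurable_indicator) auto
    have fae: "AE x in lebesgue. indicat_real C x = f x"
      using AE_completion[OF f0(2)]
    proof eventually_elim
      case (elim x)
      hence "f0 x = 0 \<or> f0 x = 1" by (metis indicator_simps)
      thus ?case using elim by (auto simp: f_def C_def indicator_def split: if_splits)
    qed
    have fi: "integrable lborel f"
    proof (rule Bochner_Integration.integrable_bound[where f="indicator (ball (0::pt) (real K + 1)) :: pt \<Rightarrow> real"])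
      show "integrable lborel (indicator (ball (0::pt) (real K + 1)) :: pt \<Rightarrow> real)"
        using emeasure_bounded_finite[of "ball (0::pt) (real K + 1)"] by (intro integrable_real_indicator) auto
      show "AE x in lborel. norm (f x) \<le> norm (indicat_real (ball 0 (real K + 1)) x)" by (auto simp: f_def indicator_def)
    qed (use fm in auto)
    have "\<forall>n. \<exists>d>0. \<forall>z. norm z < d \<longrightarrow> (\<integral>x. \<bar>f (x + z) - f x\<bar> \<partial>lborel) < inverse (real (Suc n))"
      using L1_translation[OF fi] by simp
    then obtain d where d: "\<And>n. d n > 0" "\<And>n z. norm z < d n \<Longrightarrow> (\<integral>x. \<bar>f (x + z) - f x\<bar> \<partial>lborel) < inverse (real (Suc n))"
      by metis
    define r where "r n = min (d n) (inverse (real (Suc n)))" for n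
    have r: "r n > 0" "r n \<le> d n" "r n \<le> inverse (real (Suc n))" for n using d(1)[of n] by (auto simp: r_def)
    have r1: "r n \<le> 1" for n by (rule order_trans[OF r(3)]) (simp add: field_simps)
    have r0: "r \<longlonglongrightarrow> 0"
      by (rule tendsto_sandwich[OF _ _ tendsto_const LIMSEQ_inverse_real_of_nat]) (use r in \<open>auto intro!: always_eventually less_imp_le\<close>)
    define k where "k n y = indicator (ball 0 (r n)) y / (pi * (r n)\<^sup>2)" for n and y :: pt
    define h where "h n x = (\<integral>y. k n y * f (x + y) \<partial>lborel) - f x" for n x
    have kp: "pi * (r n)\<^sup>2 > 0" for n using r(1)[of n] by simp
    have ib: "integrable lborel (indicat_real (ball (0::pt) (r n)))" for n
      using emeasure_bounded_finite[of "ball (0::pt) (r n)"] by (intro integrable_real_indicator) auto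
    have h: "integrable lborel (h n)" "(\<integral>x. \<bar>h n x\<bar> \<partial>lborel) \<le> inverse (real (Suc n))" for n
    proof -
      have 1: "(\<integral>x. \<bar>f (x + z) - f x\<bar> \<partial>lborel) \<le> inverse (real (Suc n))" if "norm z < r n" for z
        using d(2)[of z n] that r(2)[of n] by simp
      have k1: "integrable lborel (k n)" unfolding k_def[abs_def] using ib by simp
      have k2: "(\<integral>x. k n x \<partial>lborel) = 1" unfolding k_def using kp[of n] r(1)[of n] by (simp add: content_ball_pt)
      have k3: "0 \<le> k n z" "k n z \<le> 1 / (pi * (r n)\<^sup>2)" for z using kp[of n] by (auto simp: k_def indicator_def)
      have k4: "k n z = 0" if "r n \<le> norm z" for z using that by (auto simp: k_def)
      show "integrable lborel (h n)" "(\<integral>x. \<bar>h n x\<bar> \<partial>lborel) \<le> inverse (real (Suc n))"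
        unfolding h_def[abs_def] using mollify_L1[OF fi 1 k1 k2 k3 k4] by auto
    qed
    have "(\<lambda>n. \<integral>x. norm (h n x) \<partial>lborel) \<longlonglongrightarrow> 0"
      by (rule tendsto_sandwich[OF _ _ tendsto_const LIMSEQ_inverse_real_of_nat]) (use h in auto)
    from tendsto_L1_AE_subseq[OF h(1) this] obtain s where s: "strict_mono s" "AE x in lborel. (\<lambda>n. h (s n) x) \<longlonglongrightarrow> 0" by blast
    have hval: "h n x = measure lebesgue (C \<inter> ball x (r n)) / (pi * (r n)\<^sup>2) - f x" for n x
    proof -
      have "(\<integral>y. k n y * f (x + y) \<partial>lborel) = (\<integral>y. indicator (ball x (r n)) (x + y) / (pi * (r n)\<^sup>2) * f (x + y) \<partial>lborel)"
        by (rule Bochner_Integration.integral_cong) (auto simp: k_def indicator_def dist_norm)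
      also have "\<dots> = (\<integral>y. indicator (ball x (r n)) y / (pi * (r n)\<^sup>2) * f y \<partial>lborel)"
      proof (rule integral_translation_lborel)
        note [measurable] = fm
        have [measurable]: "ball x (r n) \<in> sets borel" by simp
        show "(\<lambda>y. indicator (ball x (r n)) y / (pi * (r n)\<^sup>2) * f y) \<in> borel_measurable borel" by measurable
      qed
      also have "\<dots> = (\<integral>y. indicator (ball x (r n)) y * f y \<partial>lborel) / (pi * (r n)\<^sup>2)" by simp
      also have "(\<integral>y. indicator (ball x (r n)) y * f y \<partial>lborel) = (\<integral>y. indicator (ball x (r n)) y * f y \<partial>lebesgue)"
      proof (rule integral_lebesgue_lborel(1)[symmetric])
        note [measurable] = fm
        have [measurable]: "ball x (r n) \<in> sets borel" by simp
        show "(\<lambda>y. indicator (ball x (r n)) y * f y) \<in> borel_measurable borel" by measurable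
      qed
      also have "\<dots> = (\<integral>y. indicator (C \<inter> ball x (r n)) y \<partial>lebesgue)"
      proof (rule integral_cong_AE)
        have [measurable]: "f \<in> borel_measurable lebesgue" using fm by (intro measurable_completion) auto
        have [measurable]: "ball x (r n) \<in> sets lebesgue" by simp
        show "(\<lambda>y. indicator (ball x (r n)) y * f y) \<in> borel_measurable lebesgue" by measurable
        show "indicat_real (C \<inter> ball x (r n)) \<in> borel_measurable lebesgue" using Cm by simp
        show "AE y in lebesgue. indicator (ball x (r n)) y * f y = indicat_real (C \<inter> ball x (r n)) y"
          using fae by eventually_elim (simp add: indicator_inter_arith)
      qed
      also have "\<dots> = measure lebesgue (C \<inter> ball x (r n))" using Cm by simp
      finally show ?thesis by (simp add: h_def)
    qed
    show ?thesis
      using fae AE_completion[OF s(2)]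
    proof eventually_elim
      case (elim x)
      show ?case
      proof (intro impI notI)
        assume x: "x \<in> Z \<and> norm x < real K"
          and ex: "\<exists>r1>0. \<forall>r. 0 < r \<and> r < r1 \<longrightarrow> c * (pi * r\<^sup>2) \<le> measure lebesgue (ball x r - Z)"
        from ex obtain r2 where r2: "r2 > 0" "\<And>r. 0 < r \<Longrightarrow> r < r2 \<Longrightarrow> c * (pi * r\<^sup>2) \<le> measure lebesgue (ball x r - Z)" by blast
        have "x \<notin> C" using x by (simp add: C_def)
        hence fx: "f x = 0" using elim(1) by simp
        have "(\<lambda>n. r (s n)) \<longlonglongrightarrow> 0" using LIMSEQ_subseq_LIMSEQ[OF r0 s(1)] by (simp add: o_def)
        hence "\<forall>\<^sub>F n in sequentially. r (s n) < r2" using r2(1) by (rule order_tendstoD)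
        hence "\<forall>\<^sub>F n in sequentially. c \<le> h (s n) x"
        proof eventually_elim
          case (elim n)
          have "C \<inter> ball x (r (s n)) = ball x (r (s n)) - Z"
          proof -
            have "y \<in> ball 0 (real K + 1)" if "y \<in> ball x (r (s n))" for y
            proof -
              have "norm y \<le> norm x + norm (y - x)" by (metis add.commute diff_add_cancel norm_triangle_ineq)
              thus ?thesis using that x r1[of "s n"] by (simp add: dist_norm norm_minus_commute)
            qed
            thus ?thesis by (auto simp: C_def)
          qed
          hence "c * (pi * (r (s n))\<^sup>2) \<le> measure lebesgue (C \<inter> ball x (r (s n)))" using r2(2)[OF r(1) elim] by simp
          thus ?case unfolding hval fx using kp[of "s n"] by (simp add: pos_le_divide_eq)
        qed
        moreover have "\<forall>\<^sub>F n in sequentially. h (s n) x < c" using elim(2) c by (rule order_tendstoD)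
        ultimately have "\<forall>\<^sub>F n in sequentially. False" by eventually_elim simp
        thus False by simp
      qed
    qed
  qed
  hence "AE x::pt in lebesgue. \<forall>K::nat. x \<in> Z \<and> norm x < real K \<longrightarrow>
    \<not> (\<exists>r1>0. \<forall>r. 0 < r \<and> r < r1 \<longrightarrow> c * (pi * r\<^sup>2) \<le> measure lebesgue (ball x r - Z))"
    unfolding AE_all_countable by blast
  thus ?thesis by eventually_elim (use reals_Archimedean2 in blast)
qed

text \<open>Here the convention on representatives enters: a point of E is interior or lies on the
  topological boundary, which for a normalized set is the measure-theoretic one. Without it
  membership of a point would carry no information about areas.\<close>

lemma normalized_measure_pos:
  assumes E: "normalized E" and x: "x \<in> E" and r: "r > 0"
  shows "0 < measure lebesgue (E \<inter> ball x r)"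
proof (cases "x \<in> interior E")
  case True
  then obtain e where e: "e > 0" "ball x e \<subseteq> E" unfolding mem_interior by blast
  have El: "E \<in> sets lebesgue" using E by (simp add: normalized_def)
  have "0 < measure lebesgue (ball x (min e r))" using e r by (simp add: content_ball_pos)
  also have "\<dots> \<le> measure lebesgue (E \<inter> ball x r)"
    by (rule measure_mono_fmeasurable) (use e lmeasurable_Int_ball[OF El] in auto)
  finally show ?thesis .
next
  case False
  hence "x \<in> frontier E" using x closure_subset by (auto simp: frontier_def)
  hence "x \<in> mboundary E" using E by (simp add: normalized_def)
  hence "0 < measure lebesgue (E \<inter> ball x r) / measure lebesgue (ball x r)" using r unfolding mboundary_def by blast
  thus ?thesis by (simp add: zero_less_divide_iff)
qed

section \<open>Minimizers of the constrained problems\<close>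

lemma set_LINT_indicator: "(LINT x:E|lebesgue. g x) = (\<integral>x. g x * indicator E x \<partial>lebesgue)" for g :: "pt \<Rightarrow> real"
  by (simp add: set_lebesgue_integral_def mult.commute)

lemma integrable_mult_indicator_lebesgue:
  fixes g :: "pt \<Rightarrow> real"
  assumes "integrable lebesgue g" "E \<in> sets lebesgue"
  shows "integrable lebesgue (\<lambda>x. g x * indicator E x)"
  using integrable_mult_indicator[OF assms(2,1)] by (simp add: mult.commute)

lemma constrained_min_finite_Per:
  assumes "constrained_min g S lam E"
  shows "Per E < \<infinity>"
proof -
  have "Per E - ereal (lam * (LINT x:E|lebesgue. g x)) \<le> Per {} - ereal (lam * (LINT x:{}|lebesgue. g x))"
    using assms by (auto simp: constrained_min_def)
  also have "\<dots> = 0" by (simp add: Per_empty set_lebesgue_integral_def zero_ereal_def[symmetric])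
  finally show ?thesis by (cases "Per E") auto
qed

lemma constrained_min_subset:
  assumes m: "constrained_min g S lam E" and g: "integrable lebesgue g" and lam: "lam > 0"
    and A: "A \<in> sets lebesgue"
  shows "Per E \<le> Per (E - A) + ereal (lam * (\<integral>x. g x * indicator (E \<inter> A) x \<partial>lebesgue))"
proof -
  have E: "E \<in> sets lebesgue" "E \<subseteq> S" using m by (auto simp: constrained_min_def)
  obtain p where p: "Per E = ereal p" using constrained_min_finite_Per[OF m] Per_nonneg[of E] by (cases "Per E") auto
  have "Per E - ereal (lam * (LINT x:E|lebesgue. g x)) \<le> Per (E - A) - ereal (lam * (LINT x:(E - A)|lebesgue. g x))"
  proof -
    have "E - A \<in> sets lebesgue" "E - A \<subseteq> S" using E A by auto
    thus ?thesis using m unfolding constrained_min_def by blast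
  qed
  moreover have "(\<integral>x. g x * indicator E x \<partial>lebesgue) = (\<integral>x. g x * indicator (E - A) x \<partial>lebesgue) + (\<integral>x. g x * indicator (E \<inter> A) x \<partial>lebesgue)"
  proof -
    have "(\<integral>x. g x * indicator E x \<partial>lebesgue) = (\<integral>x. g x * indicator (E - A) x + g x * indicator (E \<inter> A) x \<partial>lebesgue)"
      by (rule Bochner_Integration.integral_cong) (auto simp: indicator_def)
    thus ?thesis using integrable_mult_indicator_lebesgue[OF g, of "E - A"] integrable_mult_indicator_lebesgue[OF g, of "E \<inter> A"] E A by simp
  qed
  ultimately show ?thesis unfolding set_LINT_indicator p by (cases "Per (E - A)") (auto simp: algebra_simps)
qed

text \<open>For r \<le> 1 / lam the area term is a small perturbation of the perimeter: with a the
  area of E in the disc, lam a \<le> lam sqrt pi r sqrt a \<le> sqrt (pi a), at most half the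
  perimeter of the piece by the isoperimetric inequality. Thus E is quasi-minimal with \<theta> =
  1/2, and ((1 - 1/2) / 2)^2 = 1/16.\<close>

lemma constrained_min_density:
  assumes m: "constrained_min g S lam E" and n: "normalized E" and g: "integrable lebesgue g" "\<And>x. g x \<le> 1" and lam: "lam > 0"
    and x: "x \<in> E" and r: "0 < r" "r \<le> 1 / lam"
  shows "1 / 16 * (pi * r\<^sup>2) \<le> measure lebesgue (E \<inter> ball x r)"
proof -
  have E: "E \<in> sets lebesgue" "E \<subseteq> S" using m by (auto simp: constrained_min_def)
  have "((1 - 1/2) / 2)\<^sup>2 * (pi * r\<^sup>2) \<le> measure lebesgue (E \<inter> ball x r)"
  proof (rule lower_density[OF E(1) constrained_min_finite_Per[OF m] _ _ _ normalized_measure_pos[OF n x] r])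
    fix r :: real assume r: "0 < r" "r \<le> 1 / lam"
    have Bl: "E \<inter> ball x r \<in> lmeasurable" by (rule lmeasurable_Int_ball[OF E(1)])
    define a where "a = measure lebesgue (E \<inter> ball x r)"
    have iB: "integrable lebesgue (indicat_real (E \<inter> ball x r))" using Bl by (intro integrable_real_indicator) (auto simp: fmeasurable_def)
    have "(\<integral>x'. g x' * indicator (E \<inter> ball x r) x' \<partial>lebesgue) \<le> (\<integral>x'. indicator (E \<inter> ball x r) x' \<partial>lebesgue)"
    proof (rule integral_mono[OF _ iB])
      show "integrable lebesgue (\<lambda>x'. g x' * indicator (E \<inter> ball x r) x')" by (rule integrable_mult_indicator_lebesgue[OF g(1)]) (use E in auto)
      show "g x' * indicator (E \<inter> ball x r) x' \<le> indicator (E \<inter> ball x r) x'" for x' using g(2)[of x'] by (auto simp: indicator_def)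
    qed
    also have "\<dots> = a" using Bl by (simp add: a_def fmeasurableD)
    finally have "lam * (\<integral>x'. g x' * indicator (E \<inter> ball x r) x' \<partial>lebesgue) \<le> lam * a" using lam by simp
    hence 1: "Per E \<le> Per (E - ball x r) + ereal (lam * a)"
      using order_trans[OF constrained_min_subset[OF m g(1) lam, of "ball x r"] add_left_mono] by simp
    have "a \<le> measure lebesgue (ball x r)" unfolding a_def by (rule measure_mono_fmeasurable) (use Bl in auto)
    hence "a \<le> pi * r\<^sup>2" using r by (simp add: content_ball_pt)
    hence "sqrt a \<le> sqrt (pi * r\<^sup>2)" by (rule real_sqrt_le_mono)
    hence sa: "sqrt a \<le> sqrt pi * r" using r by (simp add: real_sqrt_mult)
    have a0: "a \<ge> 0" by (simp add: a_def)
    have "lam * a = lam * (sqrt a * sqrt a)" using a0 by simp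
    also have "\<dots> \<le> lam * ((sqrt pi * r) * sqrt a)" using sa lam a0 by (intro mult_left_mono mult_right_mono) auto
    also have "\<dots> = (lam * r) * (sqrt pi * sqrt a)" by simp
    also have "\<dots> \<le> 1 * (sqrt pi * sqrt a)" using r lam a0 by (intro mult_right_mono) (auto simp: field_simps)
    finally have "lam * a \<le> 1/2 * (2 * sqrt (pi * a))" by (simp add: real_sqrt_mult)
    hence "ereal (lam * a) \<le> ereal (1/2) * ereal (2 * sqrt (pi * a))" by simp
    also have "\<dots> \<le> ereal (1/2) * Per (E \<inter> ball x r)"
      unfolding a_def by (intro ereal_mult_left_mono isoperimetric[OF Bl]) auto
    finally have "Per (E - ball x r) + ereal (lam * a) \<le> Per (E - ball x r) + ereal (1/2) * Per (E \<inter> ball x r)"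
      by (rule add_left_mono)
    with 1 show "Per E \<le> Per (E - ball x r) + ereal (1/2) * Per (E \<inter> ball x r)" by (rule order_trans)
  qed auto
  thus ?thesis by (simp add: power2_eq_square)
qed

text \<open>Where (indicator D - u) / \<alpha> exceeds lam, the minimizer E could be improved by removing the part
  outside a superlevel set of u.\<close>

lemma inner_min_bound:
  assumes \<alpha>: "\<alpha> > 0" and p: "dual_pair u (\<lambda>x. (indicator D x - u x) / \<alpha>)"
    and D: "D \<in> lmeasurable" and g: "integrable lebesgue g" "\<And>x. x \<in> D \<Longrightarrow> g x = 1"
    and lam: "lam > 0" and m: "constrained_min g D lam E"
  shows "AE x in lebesgue. x \<in> E \<longrightarrow> (indicator D x - u x) / \<alpha> \<le> lam"
proof -
  define v where "v x = (indicator D x - u x) / \<alpha>" for x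
  note p' = p[folded v_def]
  note [measurable] = L2D(1)[OF dual_pairD(1)[OF p]] L2D(1)[OF dual_pairD(2)[OF p']]
  have E: "E \<in> sets lebesgue" "E \<subseteq> D" using m by (auto simp: constrained_min_def)
  have El: "E \<in> lmeasurable" using fmeasurable_Int_fmeasurable[OF D E(1)] E(2) by (simp add: Int_absorb1)
  have "AE x in lebesgue. x \<notin> - E \<longrightarrow> v x \<le> lam"
  proof (rule AE_le_if_null_levels)
    fix t assume t: "t > lam"
    define A0 where "A0 = {x. x \<notin> - E \<and> t < v x}"
    have "{x \<in> space lebesgue. t < v x} \<in> sets lebesgue" by measurable
    hence A0m: "A0 \<in> sets lebesgue" using E(1) unfolding A0_def by (simp add: Collect_conj_eq sets.Int)
    have A0: "u x < 1 - \<alpha> * t" if "x \<in> A0" for x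
      using that E(2) \<alpha> by (auto simp: A0_def v_def field_simps)
    show "A0 \<in> null_sets lebesgue"
    \<comment> \<open>Where the dual variable exceeds t, u lies below the height 1 - \<alpha> t. A
      superlevel set at that height is available for comparison only if the height is positive;
      otherwise u would be negative there.\<close>
    proof (cases "1 - \<alpha> * t \<le> 0")
      case True
      have "AE x in lebesgue. x \<notin> A0"
        using dual_pair_indicator_bounds[OF \<alpha> p] by eventually_elim (use A0 True in force)
      thus ?thesis using A0m by (simp add: AE_iff_null_sets)
    next
      case False
      define s where "s = 1 - \<alpha> * t"
      have s: "s > 0" using False by (simp add: s_def)
      define G where "G = {x. s < u x}"
      have Gl: "G \<in> lmeasurable" unfolding G_def by (rule super_level_lmeasurable[OF dual_pairD(1)[OF p] s])
      have Gm: "G \<in> sets lebesgue" using Gl by (rule fmeasurableD)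
      define A where "A = E - G"
      have Al: "A \<in> lmeasurable" unfolding A_def by (rule fmeasurable_Diff[OF El Gm])
      have sub: "Per (E \<inter> G) + Per (E \<union> G) \<le> Per E + Per G" by (rule Per_submodular[OF E(1) Gm])
      have mn: "Per E \<le> Per (E - (- G)) + ereal (lam * (\<integral>x. g x * indicator (E \<inter> - G) x \<partial>lebesgue))"
        by (rule constrained_min_subset[OF m g(1) lam lebesgue_sets_Compl[OF Gm]])
      have PG: "Per G = ereal (\<integral>x. v x * indicator G x \<partial>lebesgue)" unfolding G_def by (rule dual_pair_level_set[OF p' s])
      have PU: "ereal (\<integral>x. v x * indicator (E \<union> G) x \<partial>lebesgue) \<le> Per (E \<union> G)"
        by (rule dual_pair_set(2)[OF p']) (use El Gl in auto)
      obtain e where e: "Per E = ereal e" using constrained_min_finite_Per[OF m] Per_nonneg[of E] by (cases "Per E") auto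
      obtain x1 where x1: "Per (E \<inter> G) = ereal x1" using sub e PG Per_nonneg[of "E \<inter> G"] Per_nonneg[of "E \<union> G"]
        by (cases "Per (E \<inter> G)"; cases "Per (E \<union> G)") auto
      obtain x2 where x2: "Per (E \<union> G) = ereal x2" using sub e PG Per_nonneg[of "E \<inter> G"] Per_nonneg[of "E \<union> G"]
        by (cases "Per (E \<inter> G)"; cases "Per (E \<union> G)") auto
      have set: "E - (- G) = E \<inter> G" "E \<inter> - G = A" by (auto simp: A_def)
      \<comment> \<open>Submodularity, minimality of E against E \<inter> G, and duality for E
        \<union> G. Since E \<union> G is the disjoint union of G and A, the integral of v over A is
        at most lam times that of g, although v \<ge> t > lam and g = 1 there.\<close>
      have le: "(\<integral>x. v x * indicator (E \<union> G) x \<partial>lebesgue) \<le> (\<integral>x. v x * indicator G x \<partial>lebesgue) + lam * (\<integral>x. g x * indicator A x \<partial>lebesgue)"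
        using sub mn PU unfolding set e x1 x2 PG by simp
      have split: "(\<integral>x. v x * indicator (E \<union> G) x \<partial>lebesgue) = (\<integral>x. v x * indicator G x \<partial>lebesgue) + (\<integral>x. v x * indicator A x \<partial>lebesgue)"
      proof -
        have "(\<integral>x. v x * indicator (E \<union> G) x \<partial>lebesgue) = (\<integral>x. v x * indicator G x + v x * indicator A x \<partial>lebesgue)"
          by (rule Bochner_Integration.integral_cong) (auto simp: A_def indicator_def)
        thus ?thesis using dual_pair_set(1)[OF p' Gl] dual_pair_set(1)[OF p' Al] by simp
      qed
      have iv: "integrable lebesgue (\<lambda>x. v x * indicator A x)" by (rule dual_pair_set(1)[OF p' Al])
      have ig: "integrable lebesgue (\<lambda>x. g x * indicator A x)" by (rule integrable_mult_indicator_lebesgue[OF g(1) fmeasurableD[OF Al]])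
      have eq: "(lam * g x - v x) * indicator A x = lam * (g x * indicator A x) - v x * indicator A x" for x by (simp add: algebra_simps)
      have "A \<in> null_sets lebesgue"
      proof (rule null_if_negative_integral[OF Al, where v="\<lambda>x. lam * g x - v x" and c="t - lam"])
        show "integrable lebesgue (\<lambda>x. (lam * g x - v x) * indicator A x)" unfolding eq using iv ig by simp
        have "(\<integral>x. (lam * g x - v x) * indicator A x \<partial>lebesgue) = lam * (\<integral>x. g x * indicator A x \<partial>lebesgue) - (\<integral>x. v x * indicator A x \<partial>lebesgue)"
          unfolding eq using iv ig by simp
        thus "0 \<le> (\<integral>x. (lam * g x - v x) * indicator A x \<partial>lebesgue)" using le split by simp
        show "lam * g x - v x \<le> - (t - lam)" if "x \<in> A" for x
        proof -
          have x: "x \<in> D" "u x \<le> s" using that E(2) by (auto simp: A_def G_def)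
          hence "t \<le> v x" using \<alpha> by (simp add: v_def s_def field_simps)
          thus ?thesis using g(2)[OF x(1)] by simp
        qed
      qed (use t in simp)
      moreover have "A0 \<subseteq> A" using A0 by (force simp: A0_def A_def G_def s_def)
      ultimately show ?thesis using null_sets_subset A0m by blast
    qed
  qed
  thus ?thesis by eventually_elim (simp add: v_def)
qed

lemma outer_min_bound:
  assumes \<alpha>: "\<alpha> > 0" and p: "dual_pair u (\<lambda>x. (indicator D x - u x) / \<alpha>)"
    and g: "integrable lebesgue g" "\<And>x. g x \<le> 1"
    and lam: "lam > 0" and m: "constrained_min g (- D) lam F"
  shows "AE x in lebesgue. x \<in> F \<longrightarrow> u x \<le> \<alpha> * lam"
proof -
  define v where "v x = (indicator D x - u x) / \<alpha>" for x
  note p' = p[folded v_def]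
  have F: "F \<in> sets lebesgue" "F \<subseteq> - D" using m by (auto simp: constrained_min_def)
  have "AE x in lebesgue. x \<notin> - F \<longrightarrow> u x \<le> \<alpha> * lam"
  proof (rule AE_le_if_null_levels)
    fix s assume sl: "s > \<alpha> * lam"
    have "\<alpha> * lam > 0" using \<alpha> lam by simp
    hence s: "s > 0" using sl by simp
    define G where "G = {x. s < u x}"
    have Gl: "G \<in> lmeasurable" unfolding G_def by (rule super_level_lmeasurable[OF dual_pairD(1)[OF p] s])
    have Gm: "G \<in> sets lebesgue" using Gl by (rule fmeasurableD)
    define A where "A = F \<inter> G"
    have Al: "A \<in> lmeasurable" unfolding A_def using F(1) Gl by (metis fmeasurable_Int_fmeasurable inf_commute)
    have Bl: "G - F \<in> lmeasurable" by (rule fmeasurable_Diff[OF Gl F(1)])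
    have "Per (F \<inter> - G) + Per (F \<union> - G) \<le> Per F + Per (- G)" by (rule Per_submodular[OF F(1) lebesgue_sets_Compl[OF Gm]])
    moreover have "F \<inter> - G = F - G" "F \<union> - G = - (G - F)" by auto
    ultimately have sub: "Per (F - G) + Per (G - F) \<le> Per F + Per G"
      using Per_Compl[OF Gm] Per_Compl[OF fmeasurableD[OF Bl]] by simp
    have mn: "Per F \<le> Per (F - G) + ereal (lam * (\<integral>x. g x * indicator A x \<partial>lebesgue))"
      using constrained_min_subset[OF m g(1) lam Gm] by (simp add: A_def)
    have PG: "Per G = ereal (\<integral>x. v x * indicator G x \<partial>lebesgue)" unfolding G_def by (rule dual_pair_level_set[OF p' s])
    have PU: "ereal (\<integral>x. v x * indicator (G - F) x \<partial>lebesgue) \<le> Per (G - F)"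
      by (rule dual_pair_set(2)[OF p' Bl])
    obtain e where e: "Per F = ereal e" using constrained_min_finite_Per[OF m] Per_nonneg[of F] by (cases "Per F") auto
    obtain x1 where x1: "Per (F - G) = ereal x1" using sub e PG Per_nonneg[of "F - G"] Per_nonneg[of "G - F"]
      by (cases "Per (F - G)"; cases "Per (G - F)") auto
    obtain x2 where x2: "Per (G - F) = ereal x2" using sub e PG Per_nonneg[of "F - G"] Per_nonneg[of "G - F"]
      by (cases "Per (F - G)"; cases "Per (G - F)") auto
    have le: "(\<integral>x. v x * indicator (G - F) x \<partial>lebesgue) \<le> (\<integral>x. v x * indicator G x \<partial>lebesgue) + lam * (\<integral>x. g x * indicator A x \<partial>lebesgue)"
      using sub mn PU unfolding e x1 x2 PG by simp
    have split: "(\<integral>x. v x * indicator G x \<partial>lebesgue) = (\<integral>x. v x * indicator (G - F) x \<partial>lebesgue) + (\<integral>x. v x * indicator A x \<partial>lebesgue)"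
    proof -
      have "(\<integral>x. v x * indicator G x \<partial>lebesgue) = (\<integral>x. v x * indicator (G - F) x + v x * indicator A x \<partial>lebesgue)"
        by (rule Bochner_Integration.integral_cong) (auto simp: A_def indicator_def)
      thus ?thesis using dual_pair_set(1)[OF p' Bl] dual_pair_set(1)[OF p' Al] by simp
    qed
    have iv: "integrable lebesgue (\<lambda>x. v x * indicator A x)" by (rule dual_pair_set(1)[OF p' Al])
    have ig: "integrable lebesgue (\<lambda>x. g x * indicator A x)" by (rule integrable_mult_indicator_lebesgue[OF g(1) fmeasurableD[OF Al]])
    have eq: "(lam * g x + v x) * indicator A x = lam * (g x * indicator A x) + v x * indicator A x" for x by (simp add: algebra_simps)
    have "A \<in> null_sets lebesgue"
    proof (rule null_if_negative_integral[OF Al, where v="\<lambda>x. lam * g x + v x" and c="s / \<alpha> - lam"])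
      show "integrable lebesgue (\<lambda>x. (lam * g x + v x) * indicator A x)" unfolding eq using iv ig by simp
      have "(\<integral>x. (lam * g x + v x) * indicator A x \<partial>lebesgue) = lam * (\<integral>x. g x * indicator A x \<partial>lebesgue) + (\<integral>x. v x * indicator A x \<partial>lebesgue)"
        unfolding eq using iv ig by simp
      thus "0 \<le> (\<integral>x. (lam * g x + v x) * indicator A x \<partial>lebesgue)" using le split by simp
      show "0 < s / \<alpha> - lam" using sl \<alpha> by (simp add: field_simps)
      show "lam * g x + v x \<le> - (s / \<alpha> - lam)" if "x \<in> A" for x
      proof -
        have x: "x \<notin> D" "s < u x" using that F(2) by (auto simp: A_def G_def)
        hence "v x \<le> - (s / \<alpha>)" using \<alpha> by (simp add: v_def divide_right_mono less_imp_le)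
        moreover have "lam * g x \<le> lam" using g(2)[of x] lam by simp
        ultimately show ?thesis by simp
      qed
    qed
    moreover have "A = {x. x \<notin> - F \<and> s < u x}" by (auto simp: A_def G_def)
    ultimately show "{x. x \<notin> - F \<and> s < u x} \<in> null_sets lebesgue" by simp
  qed
  thus ?thesis by eventually_elim simp
qed

text \<open>Each minimizer gives h \<le> lam almost everywhere on it, but uncountably many
  minimizers are involved, and the one that contains x says nothing about h at x itself. It does
  fill a fixed fraction of all small discs around x with points where h \<le> lam < q, so x is not a
  density point of {h > q}; by the density theorem h x > q is then exceptional. Rational q keep the
  exceptional set null.\<close>

lemma density_excludes_level:
  fixes h :: "pt \<Rightarrow> real" and k :: "pt \<Rightarrow> ereal" and P :: "pt \<Rightarrow> bool"
  assumes u: "h \<in> borel_measurable lebesgue"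
    and ex: "\<And>x q. P x \<Longrightarrow> 0 < q \<Longrightarrow> k x < ereal q \<Longrightarrow>
      \<exists>E lam. lam < q \<and> lam > 0 \<and> E \<in> sets lebesgue \<and> (AE y in lebesgue. y \<in> E \<longrightarrow> h y \<le> lam) \<and>
        (\<forall>r. 0 < r \<and> r \<le> 1 / lam \<longrightarrow> 1 / 16 * (pi * r\<^sup>2) \<le> measure lebesgue (E \<inter> ball x r))"
    and k: "\<And>x. P x \<Longrightarrow> 0 \<le> k x"
  shows "AE x in lebesgue. P x \<longrightarrow> ereal (h x) \<le> k x"
proof -
  note [measurable] = u
  have "AE x in lebesgue. \<forall>q::rat. h x > of_rat q \<longrightarrow>
    \<not> (\<exists>r1>0. \<forall>r. 0 < r \<and> r < r1 \<longrightarrow> 1/16 * (pi * r\<^sup>2) \<le> measure lebesgue (ball x r - {x. h x > of_rat q}))"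
    unfolding AE_all_countable
  proof
    fix q :: rat
    have "{x \<in> space lebesgue. h x > of_rat q} \<in> sets lebesgue" by measurable
    hence "{x. h x > of_rat q} \<in> sets lebesgue" by simp
    from AE_not_density_point[OF this, of "1/16"]
    show "AE x in lebesgue. h x > of_rat q \<longrightarrow>
      \<not> (\<exists>r1>0. \<forall>r. 0 < r \<and> r < r1 \<longrightarrow> 1/16 * (pi * r\<^sup>2) \<le> measure lebesgue (ball x r - {x. h x > of_rat q}))"
      by simp
  qed
  thus ?thesis
  proof eventually_elim
    case (elim x)
    show ?case
    proof (intro impI, rule ccontr)
      assume P: "P x" and "\<not> ereal (h x) \<le> k x"
      hence lt: "k x < ereal (h x)" by simp
      obtain t where t: "k x < ereal t" "ereal t < ereal (h x)" using ereal_dense2[OF lt] by blast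
      \<comment> \<open>A rational level strictly between k x and h x selects one of the countably
        many exceptional sets.\<close>
      obtain q :: rat where q: "t < of_rat q" "of_rat q < h x" using of_rat_dense[of t "h x"] t(2) by auto
      have kq: "k x < ereal (of_rat q)" using t(1) q(1) by (meson ereal_less(2) less_ereal.simps(1) less_trans)
      have q0: "0 < (of_rat q :: real)" using le_less_trans[OF k[OF P] kq] by simp
      obtain E lam where E: "lam < of_rat q" "lam > 0" "E \<in> sets lebesgue" "AE y in lebesgue. y \<in> E \<longrightarrow> h y \<le> lam"
        "\<And>r. 0 < r \<Longrightarrow> r \<le> 1 / lam \<Longrightarrow> 1 / 16 * (pi * r\<^sup>2) \<le> measure lebesgue (E \<inter> ball x r)"
        using ex[OF P q0 kq] by blast
      define Z where "Z = {x. h x > of_rat q}"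
      have "{x \<in> space lebesgue. h x > of_rat q} \<in> sets lebesgue" by measurable
      hence Zm: "Z \<in> sets lebesgue" by (simp add: Z_def)
      have "1/16 * (pi * r\<^sup>2) \<le> measure lebesgue (ball x r - Z)" if r: "0 < r" "r < 1 / lam" for r
      proof -
        have "1 / 16 * (pi * r\<^sup>2) \<le> measure lebesgue (E \<inter> ball x r)" using E(5)[of r] r by simp
        also have "\<dots> = measure lebesgue (E \<inter> ball x r - Z)"
        proof (rule measure_eq_AE)
          show "AE y in lebesgue. y \<in> E \<inter> ball x r \<longleftrightarrow> y \<in> E \<inter> ball x r - Z"
            using E(4) by eventually_elim (use E(1) in \<open>auto simp: Z_def\<close>)
        qed (use lmeasurable_Int_ball[OF E(3), of x r] Zm in \<open>auto intro!: sets.Diff fmeasurableD\<close>)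
        also have "\<dots> \<le> measure lebesgue (ball x r - Z)"
        proof (rule measure_mono_fmeasurable)
          show "E \<inter> ball x r - Z \<in> sets lebesgue" by (rule sets.Diff[OF fmeasurableD[OF lmeasurable_Int_ball[OF E(3)]] Zm])
          show "ball x r - Z \<in> lmeasurable" by (rule fmeasurable_Diff[OF _ Zm]) simp
        qed auto
        finally show ?thesis .
      qed
      hence "\<exists>r1>0. \<forall>r. 0 < r \<and> r < r1 \<longrightarrow> 1/16 * (pi * r\<^sup>2) \<le> measure lebesgue (ball x r - Z)"
        using E(2) by (intro exI[of _ "1 / lam"]) auto
      thus False using elim q(2) by (auto simp: Z_def)
    qed
  qed
qed

text \<open>Since g is 1 near the unit ball, \<open>lam * g x\<close> is lam at the points that
  matter. Inside D the interior minimizers give the bound, in the rest of the unit ball the exterior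
  ones, and beyond it u vanishes. The dual variable is nonnegative in D and nonpositive outside
  because 0 \<le> u \<le> 1, so each of the two inequalities is trivial on one side. At a point
  contained in no minimizer the infimum is infinite.\<close>

lemma kappa_bounds:
  assumes g: "admissible_g2 g" and D: "D \<in> sets lebesgue" "D \<subseteq> ball 0 1"
    and \<alpha>: "\<alpha> > 0" and p: "dual_pair u (\<lambda>x. (indicator D x - u x) / \<alpha>)"
  shows "AE x in lebesgue. ennreal ((indicator D x - u x) / \<alpha>) \<le> kappa_plus g D x \<and>
    ennreal (- ((indicator D x - u x) / \<alpha>)) \<le> kappa_minus g D x"
proof -
  define v where "v x = (indicator D x - u x) / \<alpha>" for x
  note p' = p[folded v_def]
  have Dl: "D \<in> lmeasurable" by (rule bounded_set_imp_lmeasurable[OF bounded_subset[OF bounded_ball D(2)] D(1)])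
  have gi: "integrable lebesgue g" and g1: "\<And>x. norm x < 1 \<Longrightarrow> g x = 1" and gb: "\<And>x. g x \<le> 1" "\<And>x. 0 < g x"
    using g by (auto simp: admissible_g2_def)
  have gD: "x \<in> D \<Longrightarrow> g x = 1" for x using D(2) g1 by auto
  note um = L2D(1)[OF dual_pairD(1)[OF p]] and vm = L2D(1)[OF dual_pairD(2)[OF p']]
  define S1 where "S1 x = {ereal (lam * g x) | lam. lam > 0 \<and> (\<exists>E. normalized E \<and> constrained_min g D lam E \<and> x \<in> E)}" for x
  define S2 where "S2 x = {ereal (lam * g x) | lam. lam > 0 \<and> (\<exists>F. normalized F \<and> constrained_min g (- D) lam F \<and> x \<in> F)}" for x
  have nn1: "0 \<le> Inf (S1 x)" for x by (rule Inf_greatest) (use gb(2)[of x] in \<open>auto simp: S1_def less_imp_le\<close>)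
  have nn2: "0 \<le> Inf (S2 x)" for x by (rule Inf_greatest) (use gb(2)[of x] in \<open>auto simp: S2_def less_imp_le\<close>)
  have A1: "AE x in lebesgue. x \<in> D \<longrightarrow> ereal (v x) \<le> Inf (S1 x)"
  proof (rule density_excludes_level[OF vm])
    fix x q assume x: "x \<in> D" and q: "Inf (S1 x) < ereal q"
    then obtain lam E where E: "ereal (lam * g x) < ereal q" "lam > 0" "normalized E" "constrained_min g D lam E" "x \<in> E"
      unfolding Inf_less_iff S1_def by blast
    have "E \<in> sets lebesgue" using E(4) by (simp add: constrained_min_def)
    moreover have "AE y in lebesgue. y \<in> E \<longrightarrow> v y \<le> lam"
      using inner_min_bound[OF \<alpha> p Dl gi gD E(2,4)] by (simp add: v_def)
    ultimately show "\<exists>E lam. lam < q \<and> lam > 0 \<and> E \<in> sets lebesgue \<and> (AE y in lebesgue. y \<in> E \<longrightarrow> v y \<le> lam) \<and>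
        (\<forall>r. 0 < r \<and> r \<le> 1 / lam \<longrightarrow> 1 / 16 * (pi * r\<^sup>2) \<le> measure lebesgue (E \<inter> ball x r))"
      using E gD[OF x] constrained_min_density[OF E(4,3) gi gb(1) E(2,5)] by (intro exI[of _ E] exI[of _ lam]) auto
  qed (use nn1 in auto)
  have um': "(\<lambda>x. u x / \<alpha>) \<in> borel_measurable lebesgue" using um by measurable
  have A2: "AE x in lebesgue. x \<notin> D \<and> norm x < 1 \<longrightarrow> ereal (u x / \<alpha>) \<le> Inf (S2 x)"
  proof (rule density_excludes_level[OF um'])
    fix x q assume x: "x \<notin> D \<and> norm x < 1" and q: "Inf (S2 x) < ereal q"
    then obtain lam E where E: "ereal (lam * g x) < ereal q" "lam > 0" "normalized E" "constrained_min g (- D) lam E" "x \<in> E"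
      unfolding Inf_less_iff S2_def by blast
    have "E \<in> sets lebesgue" using E(4) by (simp add: constrained_min_def)
    moreover have "AE y in lebesgue. y \<in> E \<longrightarrow> u y / \<alpha> \<le> lam"
      using outer_min_bound[OF \<alpha> p gi gb(1) E(2,4)] by eventually_elim (use \<alpha> in \<open>simp add: pos_divide_le_eq mult.commute\<close>)
    ultimately show "\<exists>E lam. lam < q \<and> lam > 0 \<and> E \<in> sets lebesgue \<and> (AE y in lebesgue. y \<in> E \<longrightarrow> u y / \<alpha> \<le> lam) \<and>
        (\<forall>r. 0 < r \<and> r \<le> 1 / lam \<longrightarrow> 1 / 16 * (pi * r\<^sup>2) \<le> measure lebesgue (E \<inter> ball x r))"
      using E g1 x constrained_min_density[OF E(4,3) gi gb(1) E(2,5)] by (intro exI[of _ E] exI[of _ lam]) auto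
  qed (use nn2 in auto)
  have A3: "AE x in lebesgue. x \<notin> ball 0 1 \<longrightarrow> u x = 0"
    by (rule dual_pair_support[OF \<alpha> _ _ p]) (use D(2) in \<open>auto simp: indicator_def\<close>)
  have pos: "ennreal a \<le> e2ennreal k" if "ereal a \<le> k" for a k
    using e2ennreal_mono[OF that] by (simp add: e2ennreal_ereal)
  from A1 A2 A3 dual_pair_indicator_bounds[OF \<alpha> p]
  have "AE x in lebesgue. ennreal (v x) \<le> kappa_plus g D x \<and> ennreal (- v x) \<le> kappa_minus g D x"
  proof eventually_elim
    case (elim x)
    show ?case
    proof (cases "x \<in> D")
      case True
      have k: "kappa_D g D x = Inf (S1 x)" using True by (simp add: kappa_D_def S1_def)
      have "ereal (v x) \<le> max (kappa_D g D x) 0" unfolding k using elim(1) True by (simp add: le_max_iff_disj)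
      moreover have "- v x \<le> 0" using elim(4) True \<alpha> by (simp add: v_def)
      ultimately show ?thesis unfolding kappa_plus_def kappa_minus_def using pos by (simp add: ennreal_neg)
    next
      case False
      have k: "kappa_D g D x = - Inf (S2 x)" using False by (simp add: kappa_D_def S2_def)
      have v: "v x = - (u x / \<alpha>)" using False by (simp add: v_def)
      have "- min (kappa_D g D x) 0 = Inf (S2 x)" unfolding k using nn2[of x] by (simp add: min_def)
      moreover have "ereal (- v x) \<le> Inf (S2 x)" using elim(2,3) False nn2[of x] by (cases "norm x < 1") (auto simp: v zero_ereal_def[symmetric])
      moreover have "v x \<le> 0" using elim(4) \<alpha> by (simp add: v)
      ultimately show ?thesis unfolding kappa_plus_def kappa_minus_def using pos by (simp add: ennreal_neg)
    qed
  qed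
  thus ?thesis by (simp add: v_def)
qed

section \<open>Variational mean curvature of level sets\<close>

text \<open>The curvature of E is going to be V inside E and -k outside, where k is the negative
  part of V plus the indicator of a ball. Against a set F of finite measure the bound for V
  suffices, because -k \<le> V. If F has infinite measure, its complement has finite measure as soon
  as the perimeter is finite, and the ball in k decides.\<close>

lemma curvature_competitor:
  assumes E: "E \<in> lmeasurable" and V: "V \<in> L2"
    and sub: "\<And>F. F \<in> lmeasurable \<Longrightarrow> ereal (\<integral>x. V x * indicator F x \<partial>lebesgue) \<le> Per F"
  shows "\<exists>L. \<forall>F\<in>sets lebesgue.
    integrable lebesgue (\<lambda>x. (max (- V x) 0 + indicator (ball 0 L) x) * indicator (F - E) x) \<longrightarrow>
    ereal ((\<integral>x. V x * indicator (E \<inter> F) x \<partial>lebesgue) -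
      (\<integral>x. (max (- V x) 0 + indicator (ball 0 L) x) * indicator (F - E) x \<partial>lebesgue)) \<le> Per F"
proof -
  note [measurable] = L2D(1)[OF V]
  have Em: "E \<in> sets lebesgue" using E by (rule fmeasurableD)
  have Vi: "integrable lebesgue (\<lambda>x. V x * indicator A x)" if "A \<in> lmeasurable" for A
    by (rule L2_mult_integrable[OF V L2_indicator[OF that]])
  define M where "M = (\<integral>x. \<bar>V x * indicator E x\<bar> \<partial>lebesgue)"
  have M0: "M \<ge> 0" by (simp add: M_def)
  (* a competitor of infinite measure and perimeter below M misses measure at most M^2 of the ball of
     radius L, so the unit penalty on that ball outweighs M *)
  define L where "L = M + measure lebesgue E + M\<^sup>2 + 1"
  have L1: "L \<ge> 1" using M0 by (simp add: L_def)
  define k where "k x = max (- V x) 0 + indicator (ball 0 L) x" for x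
  have k0: "0 \<le> k x" for x by (simp add: k_def)
  have "ereal ((\<integral>x. V x * indicator (E \<inter> F) x \<partial>lebesgue) - (\<integral>x. k x * indicator (F - E) x \<partial>lebesgue)) \<le> Per F"
    if F: "F \<in> sets lebesgue" and ki: "integrable lebesgue (\<lambda>x. k x * indicator (F - E) x)" for F
  proof -
    have EF: "E \<inter> F \<in> lmeasurable" using E F by (rule fmeasurable_Int_fmeasurable)
    have kn: "0 \<le> (\<integral>x. k x * indicator (F - E) x \<partial>lebesgue)"
      by (rule Bochner_Integration.integral_nonneg) (use k0 in auto)
    show ?thesis
    proof (cases "F \<in> lmeasurable")
      case True
      have FE: "F - E \<in> lmeasurable" using True Em by (rule fmeasurable_Diff)
      have "(\<integral>x. V x * indicator (E \<inter> F) x \<partial>lebesgue) - (\<integral>x. k x * indicator (F - E) x \<partial>lebesgue)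
        = (\<integral>x. V x * indicator (E \<inter> F) x - k x * indicator (F - E) x \<partial>lebesgue)" using Vi[OF EF] ki by simp
      also have "\<dots> \<le> (\<integral>x. V x * indicator F x \<partial>lebesgue)"
      proof (rule integral_mono)
        show "integrable lebesgue (\<lambda>x. V x * indicator (E \<inter> F) x - k x * indicator (F - E) x)" using Vi[OF EF] ki by simp
        show "integrable lebesgue (\<lambda>x. V x * indicator F x)" by (rule Vi[OF True])
        fix x
        have "- k x \<le> V x" by (auto simp: k_def indicator_def)
        thus "V x * indicator (E \<inter> F) x - k x * indicator (F - E) x \<le> V x * indicator F x"
          by (cases "x \<in> E"; cases "x \<in> F") auto
      qed
      finally show ?thesis using sub[OF True] by (meson ereal_less_eq(3) order_trans)
    next
      case inf: False
      show ?thesis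
      proof (cases "Per F")
        case (real P)
        have fc: "- F \<in> lmeasurable" using finite_Per_dichotomy[OF F] inf real by simp
        have VM: "(\<integral>x. V x * indicator (E \<inter> F) x \<partial>lebesgue) \<le> M" unfolding M_def
        proof (rule integral_mono[OF Vi[OF EF]])
          show "integrable lebesgue (\<lambda>x. \<bar>V x * indicator E x\<bar>)" using Vi[OF E] by (rule integrable_abs)
          show "V x * indicator (E \<inter> F) x \<le> \<bar>V x * indicator E x\<bar>" for x by (auto simp: indicator_def)
        qed
        show ?thesis
        proof (cases "P \<ge> M")
          case True
          thus ?thesis using real VM kn by simp
        next
          case False
          have P0: "P \<ge> 0" using Per_nonneg[of F] real by simp
          define f where "f = measure lebesgue (- F)"
          have "ereal (2 * sqrt (pi * f)) \<le> Per (- F)" unfolding f_def by (rule isoperimetric[OF fc])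
          hence "2 * sqrt (pi * f) \<le> P" using Per_Compl[OF F] real by simp
          moreover have "sqrt f \<le> 2 * sqrt (pi * f)"
          proof -
            have f0: "0 \<le> f" by (simp add: f_def)
            have "1 * f \<le> pi * f" using f0 pi_ge_two by (intro mult_right_mono) auto
            hence "sqrt f \<le> sqrt (pi * f)" by (intro real_sqrt_le_mono) simp
            thus ?thesis using f0 by (smt (verit) real_sqrt_ge_zero mult_nonneg_nonneg pi_ge_zero)
          qed
          ultimately have "sqrt f \<le> M" using False by simp
          hence "(sqrt f)\<^sup>2 \<le> M\<^sup>2" by (intro power_mono) (auto simp: f_def)
          hence fM: "f \<le> M\<^sup>2" by (simp add: f_def)
          define B where "B = ball (0::pt) L"
          have Bl: "B \<in> lmeasurable" by (simp add: B_def)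
          define A where "A = B \<inter> (F - E)"
          have Al: "A \<in> lmeasurable" unfolding A_def using Bl F Em by (intro fmeasurable_Int_fmeasurable) auto
          have "L * 1 \<le> L * L" using L1 by (intro mult_left_mono) auto
          also have "\<dots> \<le> pi * L\<^sup>2" using pi_ge_two L1 by (simp add: power2_eq_square mult_right_mono[of 1 pi])
          also have "\<dots> = measure lebesgue B" using L1 by (simp add: B_def content_ball_pt)
          also have "\<dots> \<le> measure lebesgue (A \<union> (E \<union> - F))"
            by (rule measure_mono_fmeasurable) (use Al E fc Bl in \<open>auto simp: A_def intro!: fmeasurable.Un\<close>)
          also have "\<dots> \<le> measure lebesgue A + measure lebesgue (E \<union> - F)"
            by (rule measure_Un_le) (use Al E fc in \<open>auto intro: fmeasurableD\<close>)
          also have "measure lebesgue (E \<union> - F) \<le> measure lebesgue E + f"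
            unfolding f_def by (rule measure_Un_le) (use E fc in \<open>auto intro: fmeasurableD\<close>)
          finally have "M \<le> measure lebesgue A" using fM by (simp add: L_def)
          also have "\<dots> = (\<integral>x. indicator A x \<partial>lebesgue)" using Al by (simp add: fmeasurableD)
          also have "\<dots> \<le> (\<integral>x. k x * indicator (F - E) x \<partial>lebesgue)"
          proof (rule integral_mono[OF _ ki])
            show "integrable lebesgue (indicat_real A)" using Al by (intro integrable_real_indicator) (auto simp: fmeasurable_def)
            show "indicat_real A x \<le> k x * indicator (F - E) x" for x by (auto simp: A_def B_def k_def indicator_def)
          qed
          finally have "(\<integral>x. V x * indicator (E \<inter> F) x \<partial>lebesgue) - (\<integral>x. k x * indicator (F - E) x \<partial>lebesgue) \<le> 0" using VM by simp
          thus ?thesis using real P0 by simp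
        qed
      qed auto
    qed
  qed
  thus ?thesis unfolding k_def by blast
qed

text \<open>Passing to complements changes the functional with curvature -\<kappa> into the one with
  curvature \<kappa> up to the integral of \<kappa> over the plane. That constant must be finite,
  which explains the integrability condition for the second claim.\<close>

lemma var_mean_curv_exists:
  assumes E: "E \<in> lmeasurable" and V: "V \<in> L2" and PE: "Per E = ereal (\<integral>x. V x * indicator E x \<partial>lebesgue)"
    and sub: "\<And>F. F \<in> lmeasurable \<Longrightarrow> ereal (\<integral>x. V x * indicator F x \<partial>lebesgue) \<le> Per F"
  shows "\<exists>\<kappa>. \<kappa> \<in> L2 \<and> has_var_mean_curv E \<kappa> \<and>
    (integrable lebesgue (\<lambda>x. max (- V x) 0) \<longrightarrow> has_var_mean_curv (- E) (\<lambda>x. - \<kappa> x))"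
proof -
  note [measurable] = L2D(1)[OF V]
  have Em[measurable]: "E \<in> sets lebesgue" using E by (rule fmeasurableD)
  obtain L where L: "\<And>F. F \<in> sets lebesgue \<Longrightarrow>
    integrable lebesgue (\<lambda>x. (max (- V x) 0 + indicator (ball 0 L) x) * indicator (F - E) x) \<Longrightarrow>
    ereal ((\<integral>x. V x * indicator (E \<inter> F) x \<partial>lebesgue) -
      (\<integral>x. (max (- V x) 0 + indicator (ball 0 L) x) * indicator (F - E) x \<partial>lebesgue)) \<le> Per F"
    using curvature_competitor[OF E V sub] by blast
  define k where "k x = max (- V x) 0 + indicator (ball 0 L) x" for x
  have [measurable]: "ball (0::pt) L \<in> sets lebesgue" by simp
  have km[measurable]: "k \<in> borel_measurable lebesgue" unfolding k_def[abs_def] by measurable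
  define \<kappa> where "\<kappa> x = (if x \<in> E then V x else - k x)" for x
  have Vi: "integrable lebesgue (\<lambda>x. V x * indicator A x)" if "A \<in> lmeasurable" for A
    by (rule L2_mult_integrable[OF V L2_indicator[OF that]])
  have kL2: "k \<in> L2"
  proof -
    have "(\<lambda>x. max (- V x) 0) \<in> L2" by (rule L2I_bound[OF _ L2D(2)[OF V]]) (measurable, auto simp: max_def)
    moreover have "indicat_real (ball (0::pt) L) \<in> L2" by (rule L2_indicator) simp
    ultimately show ?thesis unfolding k_def[abs_def] by (rule L2_add)
  qed
  have \<kappa>e: "\<kappa> x = indicator E x * V x + indicator (- E) x * (- k x)" for x by (simp add: \<kappa>_def)
  have nE[measurable]: "- E \<in> sets lebesgue" by (rule lebesgue_sets_Compl[OF Em])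
  have \<kappa>L2: "\<kappa> \<in> L2"
  proof -
    have "(\<lambda>x. indicator E x * V x) \<in> L2" by (rule L2_bounded_mult[OF V borel_measurable_indicator[OF Em]]) (simp add: indicator_def)
    moreover have "(\<lambda>x. indicator (- E) x * (- k x)) \<in> L2" by (rule L2_bounded_mult[OF L2_minus[OF kL2] borel_measurable_indicator[OF nE]]) (simp add: indicator_def)
    ultimately show ?thesis using L2_add unfolding \<kappa>e[abs_def] by blast
  qed
  have \<kappa>E: "(\<integral>x. \<kappa> x * indicator E x \<partial>lebesgue) = (\<integral>x. V x * indicator E x \<partial>lebesgue)"
    by (rule Bochner_Integration.integral_cong) (auto simp: \<kappa>_def indicator_def)
  have comp: "ereal (\<integral>x. \<kappa> x * indicator F x \<partial>lebesgue) \<le> Per F"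
    if F: "F \<in> sets lebesgue" and i: "integrable lebesgue (\<lambda>x. \<kappa> x * indicator F x)" for F
  proof -
    have EF: "E \<inter> F \<in> lmeasurable" using E F by (rule fmeasurable_Int_fmeasurable)
    have e1: "k x * indicator (F - E) x = V x * indicator (E \<inter> F) x - \<kappa> x * indicator F x" for x
      by (auto simp: \<kappa>_def indicator_def)
    have ki: "integrable lebesgue (\<lambda>x. k x * indicator (F - E) x)" unfolding e1 using Vi[OF EF] i by simp
    have "(\<integral>x. k x * indicator (F - E) x \<partial>lebesgue) = (\<integral>x. V x * indicator (E \<inter> F) x \<partial>lebesgue) - (\<integral>x. \<kappa> x * indicator F x \<partial>lebesgue)"
      unfolding e1 using Vi[OF EF] i by simp
    thus ?thesis using L[OF F ki[unfolded k_def]] unfolding k_def[symmetric] by simp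
  qed
  have 1: "has_var_mean_curv E \<kappa>"
    unfolding has_var_mean_curv_def
  proof (intro conjI ballI impI)
    have "(\<lambda>x. indicator E x *\<^sub>R \<kappa> x) = (\<lambda>x. V x * indicator E x)" by (auto simp: \<kappa>_def indicator_def fun_eq_iff)
    thus "set_integrable lebesgue E \<kappa>" unfolding set_integrable_def using Vi[OF E] by simp
    fix F assume F: "F \<in> sets lebesgue" and i: "set_integrable lebesgue F \<kappa>"
    have i': "integrable lebesgue (\<lambda>x. \<kappa> x * indicator F x)" using i by (simp add: set_integrable_def mult.commute)
    show "Per E - ereal (LINT x:E|lebesgue. \<kappa> x) \<le> Per F - ereal (LINT x:F|lebesgue. \<kappa> x)"
      unfolding set_LINT_indicator \<kappa>E PE using comp[OF F i'] by (cases "Per F") auto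
  qed (rule Em)
  have 2: "has_var_mean_curv (- E) (\<lambda>x. - \<kappa> x)" if iV: "integrable lebesgue (\<lambda>x. max (- V x) 0)"
  proof -
    have ib: "integrable lebesgue (indicat_real (ball (0::pt) L))"
      using emeasure_bounded_finite[of "ball (0::pt) L"] by (intro integrable_real_indicator) auto
    have kI: "integrable lebesgue k" unfolding k_def[abs_def] using iV ib by (rule Bochner_Integration.integrable_add)
    have "integrable lebesgue (\<lambda>x. V x * indicator E x - k x * indicator (- E) x)"
      using Vi[OF E] integrable_mult_indicator_lebesgue[OF kI nE] by simp
    moreover have "V x * indicator E x - k x * indicator (- E) x = \<kappa> x" for x by (simp add: \<kappa>_def)
    ultimately have \<kappa>I: "integrable lebesgue \<kappa>" by simp
    have split: "(\<integral>x. \<kappa> x * indicator F x \<partial>lebesgue) = (\<integral>x. \<kappa> x \<partial>lebesgue) - (\<integral>x. \<kappa> x * indicator (- F) x \<partial>lebesgue)"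
      if F: "F \<in> sets lebesgue" for F :: "pt set"
    proof -
      have "(\<integral>x. \<kappa> x * indicator F x \<partial>lebesgue) = (\<integral>x. \<kappa> x - \<kappa> x * indicator (- F) x \<partial>lebesgue)"
        by (rule Bochner_Integration.integral_cong) (auto simp: indicator_def)
      thus ?thesis using \<kappa>I integrable_mult_indicator_lebesgue[OF \<kappa>I lebesgue_sets_Compl[OF F]] by simp
    qed
    show ?thesis unfolding has_var_mean_curv_def
    proof (intro conjI ballI impI)
      show "set_integrable lebesgue (- E) (\<lambda>x. - \<kappa> x)" unfolding set_integrable_def
        using integrable_mult_indicator[OF nE integrable_minus[OF \<kappa>I]] by simp
      fix F :: "pt set" assume F: "F \<in> sets lebesgue"
      have cF: "- F \<in> sets lebesgue" by (rule lebesgue_sets_Compl[OF F])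
      have i: "integrable lebesgue (\<lambda>x. \<kappa> x * indicator (- F) x)" by (rule integrable_mult_indicator_lebesgue[OF \<kappa>I cF])
      have a: "(\<integral>x. - \<kappa> x * indicator F x \<partial>lebesgue) = (\<integral>x. \<kappa> x * indicator (- F) x \<partial>lebesgue) - (\<integral>x. \<kappa> x \<partial>lebesgue)"
        using split[OF F] by simp
      have b: "(\<integral>x. - \<kappa> x * indicator (- E) x \<partial>lebesgue) = (\<integral>x. V x * indicator E x \<partial>lebesgue) - (\<integral>x. \<kappa> x \<partial>lebesgue)"
        using split[OF nE] \<kappa>E by simp
      show "Per (- E) - ereal (LINT x:(- E)|lebesgue. - \<kappa> x) \<le> Per F - ereal (LINT x:F|lebesgue. - \<kappa> x)"
        unfolding set_LINT_indicator a b using comp[OF cF i] Per_Compl[OF Em] Per_Compl[OF F] PE by (cases "Per F") auto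
    qed (rule nE)
  qed
  show ?thesis using \<kappa>L2 1 2 by blast
qed

text \<open>Split W into w and the error W - w. The positive part of w is dominated by k, to which
  the assumption applies; for the error, Cauchy-Schwarz gives \<eta> times the root of the area, and
  the isoperimetric inequality turns this into \<eta> / (2 sqrt pi) times the perimeter.\<close>

lemma curvature_piece_bound:
  assumes S: "S \<in> lmeasurable" and W: "W \<in> L2" and w: "w \<in> L2"
    and \<eta>: "L2_norm (\<lambda>x. W x - w x) \<le> \<eta>" "0 \<le> \<eta>"
    and k: "AE x in lebesgue. ennreal (w x) \<le> k x"
    and hyp: "enn2ereal (\<integral>\<^sup>+ y\<in>S. k y \<partial>lebesgue) \<le> ereal \<xi> * Per S" and \<xi>: "0 \<le> \<xi>"
  shows "ereal (\<integral>x. W x * indicator S x \<partial>lebesgue) \<le> ereal (\<xi> + \<eta> / (2 * sqrt pi)) * Per S"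
proof -
  note [measurable] = L2D(1)[OF W] L2D(1)[OF w]
  have Sm[measurable]: "S \<in> sets lebesgue" using S by (rule fmeasurableD)
  define d where "d x = W x - w x" for x
  have dL: "d \<in> L2" unfolding d_def[abs_def] by (rule L2_diff[OF W w])
  have ind: "indicat_real S \<in> L2" by (rule L2_indicator[OF S])
  define wp where "wp x = max (w x) 0" for x
  have wpL: "wp \<in> L2" unfolding wp_def[abs_def] by (rule L2I_bound[OF _ L2D(2)[OF w]]) (measurable, auto simp: max_def)
  note iw = L2_mult_integrable[OF wpL ind] and id = L2_mult_integrable[OF dL ind]
  have "(\<integral>x. W x * indicator S x \<partial>lebesgue) \<le> (\<integral>x. wp x * indicator S x + d x * indicator S x \<partial>lebesgue)"
    by (rule integral_mono[OF L2_mult_integrable[OF W ind]]) (use iw id in \<open>auto simp: wp_def d_def indicator_def\<close>)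
  also have "\<dots> = (\<integral>x. wp x * indicator S x \<partial>lebesgue) + (\<integral>x. d x * indicator S x \<partial>lebesgue)" using iw id by simp
  finally have 1: "(\<integral>x. W x * indicator S x \<partial>lebesgue) \<le> (\<integral>x. wp x * indicator S x \<partial>lebesgue) + (\<integral>x. d x * indicator S x \<partial>lebesgue)" .
  have n: "L2_norm (indicat_real S) = sqrt (measure lebesgue S)"
  proof -
    have "(\<integral>x. (indicat_real S x)\<^sup>2 \<partial>lebesgue) = (\<integral>x. indicat_real S x \<partial>lebesgue)"
      by (rule Bochner_Integration.integral_cong) (auto simp: indicator_def)
    thus ?thesis by (simp add: L2_norm_def)
  qed
  have "(\<integral>x. d x * indicator S x \<partial>lebesgue) \<le> L2_norm d * sqrt (measure lebesgue S)"
    using L2_Cauchy_Schwarz[OF dL ind] n by simp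
  also have "\<dots> \<le> \<eta> * sqrt (measure lebesgue S)" using \<eta>(1) by (intro mult_right_mono) (auto simp: d_def[abs_def])
  also have "\<dots> = \<eta> / (2 * sqrt pi) * (2 * sqrt (pi * measure lebesgue S))" by (simp add: real_sqrt_mult)
  finally have "ereal (\<integral>x. d x * indicator S x \<partial>lebesgue) \<le> ereal (\<eta> / (2 * sqrt pi)) * ereal (2 * sqrt (pi * measure lebesgue S))" by simp
  also have "\<dots> \<le> ereal (\<eta> / (2 * sqrt pi)) * Per S"
    using \<eta>(2) by (intro ereal_mult_left_mono isoperimetric[OF S]) auto
  finally have 2: "ereal (\<integral>x. d x * indicator S x \<partial>lebesgue) \<le> ereal (\<eta> / (2 * sqrt pi)) * Per S" .
  have w0: "0 \<le> (\<integral>x. wp x * indicator S x \<partial>lebesgue)" by (rule Bochner_Integration.integral_nonneg) (simp add: wp_def)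
  have "ennreal (\<integral>x. wp x * indicator S x \<partial>lebesgue) = (\<integral>\<^sup>+ x. ennreal (wp x * indicator S x) \<partial>lebesgue)"
    by (rule nn_integral_eq_integral[OF iw, symmetric]) (simp add: wp_def)
  also have "\<dots> \<le> (\<integral>\<^sup>+ y\<in>S. k y \<partial>lebesgue)"
  proof (rule nn_integral_mono_AE)
    show "AE x in lebesgue. ennreal (wp x * indicator S x) \<le> k x * indicator S x"
      using k
    proof eventually_elim
      case (elim x)
      have "ennreal (wp x) = ennreal (w x)" by (simp add: wp_def max_def ennreal_neg)
      thus ?case using elim by (auto simp: indicator_def)
    qed
  qed
  finally have "enn2ereal (ennreal (\<integral>x. wp x * indicator S x \<partial>lebesgue)) \<le> enn2ereal (\<integral>\<^sup>+ y\<in>S. k y \<partial>lebesgue)"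
    by (simp add: less_eq_ennreal.rep_eq)
  hence 3: "ereal (\<integral>x. wp x * indicator S x \<partial>lebesgue) \<le> ereal \<xi> * Per S"
    using hyp w0 by (simp add: enn2ereal_ennreal)
  have "ereal (\<integral>x. W x * indicator S x \<partial>lebesgue) \<le> ereal (\<integral>x. wp x * indicator S x \<partial>lebesgue) + ereal (\<integral>x. d x * indicator S x \<partial>lebesgue)"
    using 1 by simp
  also have "\<dots> \<le> ereal \<xi> * Per S + ereal (\<eta> / (2 * sqrt pi)) * Per S" using 3 2 by (rule add_mono)
  also have "\<dots> = ereal (\<xi> + \<eta> / (2 * sqrt pi)) * Per S"
    using \<xi> \<eta>(2) by (subst ereal_left_distrib[symmetric]) auto
  finally show ?thesis .
qed

text \<open>Compare with E - B and with E \<union> B. Both have finite measure, so the complement of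
  E is handled without integrating over a set of infinite measure.\<close>

lemma curvature_quasi_minimal:
  assumes E: "E \<in> lmeasurable" and V: "V \<in> L2" and PE: "Per E = ereal (\<integral>x. V x * indicator E x \<partial>lebesgue)"
    and sub: "\<And>F. F \<in> lmeasurable \<Longrightarrow> ereal (\<integral>x. V x * indicator F x \<partial>lebesgue) \<le> Per F"
    and B: "B \<in> lmeasurable"
  shows "Per E \<le> Per (E - B) + ereal (\<integral>x. V x * indicator (B \<inter> E) x \<partial>lebesgue)"
    "Per (- E) \<le> Per (- E - B) + ereal (\<integral>x. - V x * indicator (B \<inter> - E) x \<partial>lebesgue)"
proof -
  have Em: "E \<in> sets lebesgue" and Bm: "B \<in> sets lebesgue" using E B by (auto dest: fmeasurableD)
  have Vi: "integrable lebesgue (\<lambda>x. V x * indicator A x)" if "A \<in> lmeasurable" for A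
    by (rule L2_mult_integrable[OF V L2_indicator[OF that]])
  have l: "E - B \<in> lmeasurable" "B \<inter> E \<in> lmeasurable" "E \<union> B \<in> lmeasurable" "B \<inter> - E \<in> lmeasurable"
    using E B Em Bm by (auto intro: fmeasurable.Diff fmeasurable_Int_fmeasurable lebesgue_sets_Compl)
  have "(\<integral>x. V x * indicator E x \<partial>lebesgue) = (\<integral>x. V x * indicator (E - B) x + V x * indicator (B \<inter> E) x \<partial>lebesgue)"
    by (rule Bochner_Integration.integral_cong) (auto simp: indicator_def)
  hence "(\<integral>x. V x * indicator E x \<partial>lebesgue) = (\<integral>x. V x * indicator (E - B) x \<partial>lebesgue) + (\<integral>x. V x * indicator (B \<inter> E) x \<partial>lebesgue)"
    using Vi[OF l(1)] Vi[OF l(2)] by simp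
  thus "Per E \<le> Per (E - B) + ereal (\<integral>x. V x * indicator (B \<inter> E) x \<partial>lebesgue)"
    unfolding PE using sub[OF l(1)] by (cases "Per (E - B)") auto
  have "(\<integral>x. V x * indicator E x \<partial>lebesgue) = (\<integral>x. V x * indicator (E \<union> B) x - V x * indicator (B \<inter> - E) x \<partial>lebesgue)"
    by (rule Bochner_Integration.integral_cong) (auto simp: indicator_def)
  hence e: "(\<integral>x. V x * indicator E x \<partial>lebesgue) = (\<integral>x. V x * indicator (E \<union> B) x \<partial>lebesgue) - (\<integral>x. V x * indicator (B \<inter> - E) x \<partial>lebesgue)"
    using Vi[OF l(3)] Vi[OF l(4)] by simp
  have "- E - B = - (E \<union> B)" by auto
  hence "Per (- E - B) = Per (E \<union> B)" using Per_Compl[OF fmeasurableD[OF l(3)]] by simp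
  thus "Per (- E) \<le> Per (- E - B) + ereal (\<integral>x. - V x * indicator (B \<inter> - E) x \<partial>lebesgue)"
    unfolding Per_Compl[OF Em] PE using sub[OF l(3)] e by (cases "Per (E \<union> B)") auto
qed

section \<open>Density of level sets\<close>

text \<open>Otherwise countably many discs in which S is null would cover S \<inter> B(x, r), by
  Lindelof's theorem. The point y replaces x for an approximating set that need not have positive
  measure in all discs around x.\<close>

lemma support_point_exists:
  assumes S: "S \<in> sets lebesgue" and p: "0 < measure lebesgue (S \<inter> ball (x::pt) r)"
  shows "\<exists>y\<in>ball x r. \<forall>r'>0. 0 < measure lebesgue (S \<inter> ball y r')"
proof (rule ccontr)
  assume "\<not> ?thesis"
  hence "\<forall>y\<in>ball x r. \<exists>r'>0. measure lebesgue (S \<inter> ball y r') = 0"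
    by (metis measure_nonneg order_le_less)
  then obtain R where R: "\<And>y. y \<in> ball x r \<Longrightarrow> R y > 0" "\<And>y. y \<in> ball x r \<Longrightarrow> measure lebesgue (S \<inter> ball y (R y)) = 0"
    by metis
  define \<F> where "\<F> = (\<lambda>y. ball y (R y)) ` ball x r"
  obtain \<F>' where F: "\<F>' \<subseteq> \<F>" "countable \<F>'" "\<Union>\<F>' = \<Union>\<F>"
    using Lindelof[of \<F>] by (auto simp: \<F>_def)
  have "(\<Union>T\<in>\<F>'. S \<inter> T) \<in> null_sets lebesgue"
  proof (rule null_sets_UN')
    fix T assume "T \<in> \<F>'"
    then obtain y where y: "y \<in> ball x r" "T = ball y (R y)" using F(1) by (auto simp: \<F>_def)
    thus "S \<inter> T \<in> null_sets lebesgue" using R(2)[OF y(1)] lmeasurable_Int_ball[OF S, of y "R y"]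
      by (intro null_setsI) (auto simp: emeasure_eq_measure2 fmeasurableD)
  qed (rule F(2))
  moreover have "S \<inter> ball x r \<subseteq> (\<Union>T\<in>\<F>'. S \<inter> T)"
  proof
    fix y assume y: "y \<in> S \<inter> ball x r"
    hence "y \<in> \<Union>\<F>" using R(1)[of y] by (auto simp: \<F>_def intro!: bexI[of _ y])
    thus "y \<in> (\<Union>T\<in>\<F>'. S \<inter> T)" using F(3) y by auto
  qed
  ultimately have "S \<inter> ball x r \<in> null_sets lebesgue"
    using lmeasurable_Int_ball[OF S, of x r] null_sets_subset by (meson fmeasurableD)
  hence "measure lebesgue (S \<inter> ball x r) = 0" by (simp add: null_sets_def measure_def)
  thus False using p by simp
qed

text \<open>For large n the exceptional set is smaller than S \<inter> B(x, \<rho>), so T n still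
  charges that disc and has a support point y in it. The density at y in the disc of radius r -
  \<rho> is seen from x, since that disc lies in B(x, r). Two sets S and S' are allowed because
  level sets at different heights enclose T n.\<close>

lemma density_limit:
  fixes T N :: "nat \<Rightarrow> pt set"
  assumes S: "S \<in> sets lebesgue" and S': "S' \<in> sets lebesgue" and T: "\<And>n. T n \<in> sets lebesgue"
    and N: "\<And>n. N n \<in> lmeasurable" "(\<lambda>n. measure lebesgue (N n)) \<longlonglongrightarrow> 0"
    and inc: "\<And>n. S \<subseteq> T n \<union> N n" "\<And>n. T n \<subseteq> S' \<union> N n"
    and dens: "\<And>n y \<rho>. (\<And>r'. r' > 0 \<Longrightarrow> 0 < measure lebesgue (T n \<inter> ball y r')) \<Longrightarrow> 0 < \<rho> \<Longrightarrow> \<rho> \<le> r0 \<Longrightarrow>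
      C * (pi * \<rho>\<^sup>2) \<le> measure lebesgue (T n \<inter> ball y \<rho>)"
    and p: "0 < measure lebesgue (S \<inter> ball x \<rho>)" and \<rho>: "0 < \<rho>" "\<rho> < r" "r \<le> r0"
  shows "C * (pi * (r - \<rho>)\<^sup>2) \<le> measure lebesgue (S' \<inter> ball x r)"
proof -
  have Nm: "N n \<in> sets lebesgue" for n using N(1) by (rule fmeasurableD)
  have "\<forall>\<^sub>F n in sequentially. measure lebesgue (N n) < measure lebesgue (S \<inter> ball x \<rho>)" using N(2) p by (rule order_tendstoD)
  hence "\<forall>\<^sub>F n in sequentially. C * (pi * (r - \<rho>)\<^sup>2) \<le> measure lebesgue (S' \<inter> ball x r) + measure lebesgue (N n)"
  proof eventually_elim
    case (elim n)
    have TB: "T n \<inter> ball z t \<in> lmeasurable" for z t by (rule lmeasurable_Int_ball[OF T])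
    have "measure lebesgue (S \<inter> ball x \<rho>) \<le> measure lebesgue ((T n \<inter> ball x \<rho>) \<union> N n)"
      by (rule measure_mono_fmeasurable) (use S inc(1)[of n] N(1)[of n] TB in \<open>auto intro!: fmeasurable.Un\<close>)
    also have "\<dots> \<le> measure lebesgue (T n \<inter> ball x \<rho>) + measure lebesgue (N n)"
      by (rule measure_Un_le) (use T Nm in auto)
    finally have "0 < measure lebesgue (T n \<inter> ball x \<rho>)" using elim by simp
    then obtain y where y: "y \<in> ball x \<rho>" "\<And>r'. r' > 0 \<Longrightarrow> 0 < measure lebesgue (T n \<inter> ball y r')"
      using support_point_exists[OF T] by blast
    have "C * (pi * (r - \<rho>)\<^sup>2) \<le> measure lebesgue (T n \<inter> ball y (r - \<rho>))"
      by (rule dens[OF y(2)]) (use \<rho> in auto)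
    also have "\<dots> \<le> measure lebesgue ((S' \<inter> ball x r) \<union> N n)"
    proof (rule measure_mono_fmeasurable)
      have "z \<in> ball x r" if "z \<in> ball y (r - \<rho>)" for z
        using that y(1) dist_triangle[of x z y] by (simp add: dist_commute)
      thus "T n \<inter> ball y (r - \<rho>) \<subseteq> (S' \<inter> ball x r) \<union> N n" using inc(2)[of n] by auto
      show "(S' \<inter> ball x r) \<union> N n \<in> lmeasurable" using lmeasurable_Int_ball[OF S'] N(1) by (intro fmeasurable.Un) auto
    qed (use T in auto)
    also have "\<dots> \<le> measure lebesgue (S' \<inter> ball x r) + measure lebesgue (N n)"
      by (rule measure_Un_le) (use S' Nm in auto)
    finally show ?case .
  qed
  moreover have "(\<lambda>n. measure lebesgue (S' \<inter> ball x r) + measure lebesgue (N n)) \<longlonglongrightarrow> measure lebesgue (S' \<inter> ball x r) + 0"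
    by (intro tendsto_intros N(2))
  ultimately show ?thesis using tendsto_lowerbound[of _ "measure lebesgue (S' \<inter> ball x r) + 0" sequentially] by force
qed

text \<open>Integrability of v gives both a curvature \<kappa> of the superlevel set E and the
  curvature -\<kappa> of its complement, so the assumption may be used for both. For the complement
  v, w and the two bounds exchange signs and roles; either way the set is quasi-minimal with the
  same \<theta>.\<close>

lemma level_set_density:
  fixes k1 k2 :: "pt \<Rightarrow> ennreal"
  assumes p: "dual_pair u v" and t: "t > 0"
    and w: "w \<in> L2" and \<eta>: "L2_norm (\<lambda>x. v x - w x) \<le> \<eta>" "0 \<le> \<eta>"
    and k: "AE x in lebesgue. ennreal (w x) \<le> k1 x \<and> ennreal (- w x) \<le> k2 x"
    and iv: "integrable lebesgue v"
    and hyp: "\<And>A \<kappa> x r. has_var_mean_curv A \<kappa> \<Longrightarrow> \<kappa> \<in> L2 \<Longrightarrow> 0 < r \<Longrightarrow> r \<le> r0 \<Longrightarrow>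
        enn2ereal (\<integral>\<^sup>+ y\<in>A \<inter> ball x r. k1 y \<partial>lebesgue) \<le> ereal \<xi> * Per (ball x r \<inter> A) \<and>
        enn2ereal (\<integral>\<^sup>+ y\<in>A \<inter> ball x r. k2 y \<partial>lebesgue) \<le> ereal \<xi> * Per (ball x r \<inter> A)"
    and \<xi>: "0 \<le> \<xi>" "\<xi> + \<eta> / (2 * sqrt pi) < 1"
    and F: "F = {x. t < u x} \<or> F = {x. u x \<le> t}"
    and pos: "\<And>r. 0 < r \<Longrightarrow> 0 < measure lebesgue (F \<inter> ball x r)" and r: "0 < r" "r \<le> r0"
  shows "((1 - (\<xi> + \<eta> / (2 * sqrt pi))) / 2)\<^sup>2 * (pi * r\<^sup>2) \<le> measure lebesgue (F \<inter> ball x r)"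
proof -
  define \<theta> where "\<theta> = \<xi> + \<eta> / (2 * sqrt pi)"
  have \<theta>: "0 \<le> \<theta>" "\<theta> < 1" using \<xi> \<eta>(2) by (auto simp: \<theta>_def)
  define E where "E = {x. t < u x}"
  have E: "E \<in> lmeasurable" unfolding E_def by (rule super_level_lmeasurable[OF dual_pairD(1)[OF p] t])
  have Em: "E \<in> sets lebesgue" using E by (rule fmeasurableD)
  have PE: "Per E = ereal (\<integral>x. v x * indicator E x \<partial>lebesgue)" unfolding E_def by (rule dual_pair_level_set[OF p t])
  note sub = dual_pair_set(2)[OF p] and v = dual_pairD(2)[OF p]
  have "integrable lebesgue (\<lambda>x. max (- v x) 0)" using iv by (intro integrable_max) auto
  then obtain \<kappa> where \<kappa>: "\<kappa> \<in> L2" "has_var_mean_curv E \<kappa>" "has_var_mean_curv (- E) (\<lambda>x. - \<kappa> x)"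
    using var_mean_curv_exists[OF E v PE sub] by blast
  have cE: "- E \<in> sets lebesgue" by (rule lebesgue_sets_Compl[OF Em])
  have qm1: "Per E \<le> Per (E - ball x q) + ereal \<theta> * Per (E \<inter> ball x q)" if q: "0 < q" "q \<le> r0" for q
  proof -
    have S: "E \<inter> ball x q \<in> lmeasurable" by (rule lmeasurable_Int_ball[OF Em])
    have bound: "ereal (\<integral>y. v y * indicator (E \<inter> ball x q) y \<partial>lebesgue) \<le> ereal \<theta> * Per (E \<inter> ball x q)"
      unfolding \<theta>_def
    proof (rule curvature_piece_bound[OF S v w \<eta> _ _ \<xi>(1)])
      show "AE x in lebesgue. ennreal (w x) \<le> k1 x" using k by eventually_elim simp
      show "enn2ereal (\<integral>\<^sup>+ y\<in>E \<inter> ball x q. k1 y \<partial>lebesgue) \<le> ereal \<xi> * Per (E \<inter> ball x q)"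
        using hyp[OF \<kappa>(2,1) q, of x] by (simp add: Int_commute)
    qed
    note c = Int_commute[of E "ball x q"]
    show ?thesis unfolding c
      by (rule order_trans[OF curvature_quasi_minimal(1)[OF E v PE sub lmeasurable_ball] add_left_mono[OF bound[unfolded c]]])
  qed
  have qm2: "Per (- E) \<le> Per (- E - ball x q) + ereal \<theta> * Per (- E \<inter> ball x q)" if q: "0 < q" "q \<le> r0" for q
  proof -
    have S: "- E \<inter> ball x q \<in> lmeasurable" by (rule lmeasurable_Int_ball[OF cE])
    have n: "L2_norm (\<lambda>x. - v x - - w x) \<le> \<eta>" using \<eta>(1) by (simp add: L2_norm_def power2_commute)
    have bound: "ereal (\<integral>y. - v y * indicator (- E \<inter> ball x q) y \<partial>lebesgue) \<le> ereal \<theta> * Per (- E \<inter> ball x q)"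
      unfolding \<theta>_def
    proof (rule curvature_piece_bound[OF S L2_minus[OF v] L2_minus[OF w] n \<eta>(2) _ _ \<xi>(1)])
      show "AE x in lebesgue. ennreal (- w x) \<le> k2 x" using k by eventually_elim simp
      show "enn2ereal (\<integral>\<^sup>+ y\<in>- E \<inter> ball x q. k2 y \<partial>lebesgue) \<le> ereal \<xi> * Per (- E \<inter> ball x q)"
        using hyp[OF \<kappa>(3) L2_minus[OF \<kappa>(1)] q, of x] by (simp add: Int_commute)
    qed
    note c = Int_commute[of "- E" "ball x q"]
    show ?thesis unfolding c
      by (rule order_trans[OF curvature_quasi_minimal(2)[OF E v PE sub lmeasurable_ball] add_left_mono[OF bound[unfolded c]]])
  qed
  have fin: "Per E < \<infinity>" "Per (- E) < \<infinity>" using PE Per_Compl[OF Em] by auto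
  have "- E = {x. u x \<le> t}" by (auto simp: E_def)
  with F consider "F = E" | "F = - E" by (auto simp: E_def)
  hence "((1 - \<theta>) / 2)\<^sup>2 * (pi * r\<^sup>2) \<le> measure lebesgue (F \<inter> ball x r)"
  proof cases
    case 1
    show ?thesis unfolding 1 by (rule lower_density[OF Em fin(1) \<theta> qm1 pos[unfolded 1] r])
  next
    case 2
    show ?thesis unfolding 2 by (rule lower_density[OF cE fin(2) \<theta> qm2 pos[unfolded 2] r])
  qed
  thus ?thesis by (simp add: \<theta>_def)
qed

text \<open>The truncation of w to balls makes V n integrable, which is what allows the negated curvature
  to be a curvature of the complement of a level set.\<close>

lemma ROF_approximation:
  assumes \<alpha>: "\<alpha> > 0" and g: "g \<in> L2" "\<And>x. x \<notin> ball 0 1 \<Longrightarrow> g x = 0" and w: "w \<in> L2"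
    and p: "dual_pair u (\<lambda>x. (g x + w x - u x) / \<alpha>)" and p0: "dual_pair u0 (\<lambda>x. (g x - u0 x) / \<alpha>)"
  shows "\<exists>U V. (\<forall>n. dual_pair (U n) (V n) \<and> integrable lebesgue (V n) \<and>
      L2_norm (\<lambda>x. V n x - (g x - u0 x) / \<alpha>) \<le> L2_norm w / \<alpha>) \<and>
    (\<lambda>n::nat. \<integral>x. (U n x - u x)\<^sup>2 \<partial>lebesgue) \<longlonglongrightarrow> 0"
proof -
  define wn where "wn n x = indicator (ball 0 (real n + 1)) x * w x" for n and x :: pt
  note [measurable] = L2D(1)[OF w]
  have wn: "wn n \<in> L2" for n
    unfolding wn_def[abs_def] by (rule L2_bounded_mult[OF w borel_measurable_indicator]) (auto simp: indicator_def)
  note [measurable] = L2D(1)[OF wn]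
  have fn: "(\<lambda>x. g x + wn n x) \<in> L2" for n by (rule L2_add[OF g(1) wn])
  have f: "(\<lambda>x. g x + w x) \<in> L2" by (rule L2_add[OF g(1) w])
  have "\<forall>n. \<exists>u. dual_pair u (\<lambda>x. (g x + wn n x - u x) / \<alpha>)" using ROF_exists[OF \<alpha> fn] by blast
  then obtain U where U: "\<And>n. dual_pair (U n) (\<lambda>x. (g x + wn n x - U n x) / \<alpha>)" by metis
  define V where "V n x = (g x + wn n x - U n x) / \<alpha>" for n x
  note UV = U[folded V_def]
  have "L2_norm (\<lambda>x. V n x - (g x - u0 x) / \<alpha>) \<le> L2_norm w / \<alpha>" for n
  proof -
    have "(\<integral>x. (wn n x)\<^sup>2 \<partial>lebesgue) \<le> (\<integral>x. (w x)\<^sup>2 \<partial>lebesgue)"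
      by (rule integral_mono[OF L2D(2)[OF wn] L2D(2)[OF w]]) (auto simp: wn_def indicator_def)
    hence "(\<integral>x. (V n x - (g x - u0 x) / \<alpha>)\<^sup>2 \<partial>lebesgue) \<le> (\<integral>x. (w x)\<^sup>2 \<partial>lebesgue) / \<alpha>\<^sup>2"
      using order_trans[OF dual_pair_nonexpansive(2)[OF \<alpha> fn g(1) U p0] divide_right_mono[of _ "\<integral>x. (w x)\<^sup>2 \<partial>lebesgue" "\<alpha>\<^sup>2"]]
      unfolding V_def by simp
    hence "sqrt (\<integral>x. (V n x - (g x - u0 x) / \<alpha>)\<^sup>2 \<partial>lebesgue) \<le> sqrt ((\<integral>x. (w x)\<^sup>2 \<partial>lebesgue) / \<alpha>\<^sup>2)"
      by (rule real_sqrt_le_mono)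
    thus ?thesis using \<alpha> by (simp add: L2_norm_def real_sqrt_divide)
  qed
  \<comment> \<open>The truncated data vanish off a ball, hence so does the minimizer, and a
    square-integrable function with bounded support is integrable.\<close>
  moreover have "integrable lebesgue (V n)" for n
  proof (rule integrable_cong_AE_imp)
    have "(\<lambda>x. g x + wn n x) x = 0" if "x \<notin> ball 0 (real n + 1)" for x
      using that g(2)[of x] by (simp add: wn_def)
    hence "AE x in lebesgue. x \<notin> ball 0 (real n + 1) \<longrightarrow> U n x = 0"
      by (intro dual_pair_support[OF \<alpha> _ _ U]) auto
    thus "AE x in lebesgue. V n x * indicator (ball 0 (real n + 1)) x = V n x"
      by eventually_elim (use g(2) in \<open>auto simp: V_def wn_def indicator_def\<close>)
    show "integrable lebesgue (\<lambda>x. V n x * indicator (ball 0 (real n + 1)) x)"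
      by (rule dual_pair_set(1)[OF UV]) simp
    show "V n \<in> borel_measurable lebesgue" by (rule L2D(1)[OF dual_pairD(2)[OF UV]])
  qed
  moreover have "(\<lambda>n. \<integral>x. (U n x - u x)\<^sup>2 \<partial>lebesgue) \<longlonglongrightarrow> 0"
  proof (rule tendsto_sandwich[OF _ _ tendsto_const])
    have "(\<lambda>n. \<integral>x. (wn n x - w x)\<^sup>2 \<partial>lebesgue) \<longlonglongrightarrow> (\<integral>x. 0 \<partial>(lebesgue :: pt measure))"
    proof (rule integral_dominated_convergence[where w="\<lambda>x. (w x)\<^sup>2"])
      show "AE x in lebesgue. (\<lambda>n. (wn n x - w x)\<^sup>2) \<longlonglongrightarrow> 0"
      proof (rule AE_I2)
        fix x :: pt
        obtain n0 where "norm x < real n0" using reals_Archimedean2 by blast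
        hence "\<forall>\<^sub>F n in sequentially. (wn n x - w x)\<^sup>2 = 0"
          by (intro eventually_sequentiallyI[of n0]) (auto simp: wn_def indicator_def)
        thus "(\<lambda>n. (wn n x - w x)\<^sup>2) \<longlonglongrightarrow> 0" by (rule tendsto_eventually)
      qed
      show "(\<lambda>x. (wn n x - w x)\<^sup>2) \<in> borel_measurable lebesgue" for n by measurable
      show "AE x in lebesgue. norm ((wn n x - w x)\<^sup>2) \<le> (w x)\<^sup>2" for n by (auto simp: wn_def indicator_def)
    qed (use L2D(2)[OF w] in auto)
    thus "(\<lambda>n. \<integral>x. (wn n x - w x)\<^sup>2 \<partial>lebesgue) \<longlonglongrightarrow> 0" by simp
    have "(\<integral>x. (U n x - u x)\<^sup>2 \<partial>lebesgue) \<le> (\<integral>x. (wn n x - w x)\<^sup>2 \<partial>lebesgue)" for n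
      using dual_pair_nonexpansive(1)[OF \<alpha> fn f U p] by simp
    thus "\<forall>\<^sub>F n in sequentially. (\<integral>x. (U n x - u x)\<^sup>2 \<partial>lebesgue) \<le> (\<integral>x. (wn n x - w x)\<^sup>2 \<partial>lebesgue)" by simp
  qed auto
  ultimately show ?thesis using UV by blast
qed

lemma measure_deviation_tendsto_zero:
  assumes u: "u \<in> L2" and U: "\<And>n. U n \<in> L2" and lim: "(\<lambda>n::nat. \<integral>x. (U n x - u x)\<^sup>2 \<partial>lebesgue) \<longlonglongrightarrow> 0"
    and \<delta>: "\<delta> > 0"
  shows "{x. \<delta> < \<bar>U n x - u x\<bar>} \<in> lmeasurable" "(\<lambda>n. measure lebesgue {x. \<delta> < \<bar>U n x - u x\<bar>}) \<longlonglongrightarrow> 0"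
proof -
  define N where "N n = {x. \<delta> < \<bar>U n x - u x\<bar>}" for n
  have N: "N n \<in> lmeasurable" for n
    unfolding N_def by (rule super_level_lmeasurable[OF L2_abs[OF L2_diff[OF U u]] \<delta>])
  thus "{x. \<delta> < \<bar>U n x - u x\<bar>} \<in> lmeasurable" by (simp add: N_def)
  have le: "measure lebesgue (N n) \<le> (\<integral>x. (U n x - u x)\<^sup>2 \<partial>lebesgue) / \<delta>\<^sup>2" for n
  proof -
    have "(\<integral>x. \<delta>\<^sup>2 * indicator (N n) x \<partial>lebesgue) \<le> (\<integral>x. (U n x - u x)\<^sup>2 \<partial>lebesgue)"
    proof (rule integral_mono[OF _ L2D(2)[OF L2_diff[OF U u]]])
      show "integrable lebesgue (\<lambda>x. \<delta>\<^sup>2 * indicat_real (N n) x)"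
        using N[of n] by (intro integrable_mult_right integrable_real_indicator) (auto simp: fmeasurable_def)
      show "\<delta>\<^sup>2 * indicator (N n) x \<le> (U n x - u x)\<^sup>2" for x
        using \<delta> power_mono[of \<delta> "\<bar>U n x - u x\<bar>" 2] by (auto simp: N_def indicator_def)
    qed
    thus ?thesis using N[of n] \<delta> by (simp add: field_simps fmeasurableD)
  qed
  show "(\<lambda>n. measure lebesgue {x. \<delta> < \<bar>U n x - u x\<bar>}) \<longlonglongrightarrow> 0" unfolding N_def[symmetric]
  proof (rule tendsto_sandwich[OF _ _ tendsto_const])
    show "(\<lambda>n. (\<integral>x. (U n x - u x)\<^sup>2 \<partial>lebesgue) / \<delta>\<^sup>2) \<longlonglongrightarrow> 0"
      using tendsto_divide[OF lim tendsto_const[of "\<delta>\<^sup>2"]] \<delta> by simp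
  qed (use le in auto)
qed

lemma disc_bound_radius_limit:
  assumes "\<And>\<rho>. 0 < \<rho> \<Longrightarrow> \<rho> < r \<Longrightarrow> C * (pi * (r - \<rho>)\<^sup>2) \<le> m" and r: "0 < r"
  shows "C * (pi * r\<^sup>2) \<le> (m::real)"
proof -
  have "((\<lambda>\<rho>. C * (pi * (r - \<rho>)\<^sup>2)) \<longlongrightarrow> C * (pi * (r - 0)\<^sup>2)) (at_right 0)" by (intro tendsto_intros)
  moreover have "\<forall>\<^sub>F \<rho> in at_right 0. C * (pi * (r - \<rho>)\<^sup>2) \<le> m"
    using r by (intro eventually_at_rightI[of 0 r]) (auto intro: assms(1))
  ultimately have "C * (pi * (r - 0)\<^sup>2) \<le> m" by (rule tendsto_upperbound) simp
  thus ?thesis by simp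
qed

text \<open>L2 convergence says nothing about a fixed level, so levels are shifted: up to a set of
  vanishing measure {u > s + 2 \<delta>} is contained in {U n > s + \<delta>}, which is contained in
  {u > s}, and similarly for the sublevel sets. The approximating density therefore holds at every
  level s, with a loss of \<delta> that is removed differently in the two claims.\<close>

lemma limit_level_set_density:
  assumes u: "u \<in> L2" and U: "\<And>n. U n \<in> L2" and lim: "(\<lambda>n::nat. \<integral>x. (U n x - u x)\<^sup>2 \<partial>lebesgue) \<longlonglongrightarrow> 0"
    and dens: "\<And>n t F y \<rho>. t > 0 \<Longrightarrow> F = {x. t < U n x} \<or> F = {x. U n x \<le> t} \<Longrightarrow>
      (\<And>r'. r' > 0 \<Longrightarrow> 0 < measure lebesgue (F \<inter> ball y r')) \<Longrightarrow> 0 < \<rho> \<Longrightarrow> \<rho> \<le> r0 \<Longrightarrow>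
      C * (pi * \<rho>\<^sup>2) \<le> measure lebesgue (F \<inter> ball y \<rho>)"
    and s: "s > 0" and x: "x \<in> mboundary {x. s < u x}" and r: "0 < r" "r \<le> r0"
  shows "C * (pi * r\<^sup>2) \<le> measure lebesgue ({x. s < u x} \<inter> ball x r)"
    "C * (pi * r\<^sup>2) \<le> measure lebesgue (ball x r - {x. s < u x})"
proof -
  have sup: "{x. t < h x} \<in> sets lebesgue" "{x. h x \<le> t} \<in> sets lebesgue" if "h \<in> L2" for h :: "pt \<Rightarrow> real" and t
  proof -
    note [measurable] = L2D(1)[OF that]
    have "{x \<in> space lebesgue. t < h x} \<in> sets lebesgue" "{x \<in> space lebesgue. h x \<le> t} \<in> sets lebesgue" by measurable
    thus "{x. t < h x} \<in> sets lebesgue" "{x. h x \<le> t} \<in> sets lebesgue" by auto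
  qed
  define E where "E = {x. s < u x}"
  have Em: "E \<in> sets lebesgue" unfolding E_def by (rule sup[OF u])
  have b: "0 < measure lebesgue (ball x \<rho>)" if "\<rho> > 0" for \<rho> using that by (simp add: content_ball_pt)
  have q: "0 < measure lebesgue (E \<inter> ball x \<rho>) / measure lebesgue (ball x \<rho>)"
    "measure lebesgue (E \<inter> ball x \<rho>) / measure lebesgue (ball x \<rho>) < 1" if "\<rho> > 0" for \<rho>
    using x that unfolding mboundary_def E_def by blast+
  have p1: "0 < measure lebesgue (E \<inter> ball x \<rho>)" if "\<rho> > 0" for \<rho>
    using q(1)[OF that] b[OF that] by (simp add: zero_less_divide_iff)
  have p2: "0 < measure lebesgue ({x. u x \<le> s} \<inter> ball x \<rho>)" if \<rho>: "\<rho> > 0" for \<rho>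
  proof -
    have "measure lebesgue (E \<inter> ball x \<rho>) < measure lebesgue (ball x \<rho>)"
      using q(2)[OF \<rho>] b[OF \<rho>] by (simp only: pos_divide_less_eq mult_1)
    moreover have "ball x \<rho> - E \<inter> ball x \<rho> = {x. u x \<le> s} \<inter> ball x \<rho>" by (auto simp: E_def)
    moreover have "measure lebesgue (ball x \<rho> - E \<inter> ball x \<rho>) = measure lebesgue (ball x \<rho>) - measure lebesgue (E \<inter> ball x \<rho>)"
      by (rule measurable_measure_Diff) (use lmeasurable_Int_ball[OF Em, of x \<rho>] in \<open>auto simp: fmeasurableD\<close>)
    ultimately show ?thesis by simp
  qed
  show "C * (pi * r\<^sup>2) \<le> measure lebesgue ({x. s < u x} \<inter> ball x r)"
  proof (rule disc_bound_radius_limit[OF _ r(1)])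
    fix \<rho> assume \<rho>: "0 < \<rho>" "\<rho> < r"
    \<comment> \<open>The set {u > s} is the increasing union of the sets {u > s + 2 / (n + 1)}, so
      one of them already charges the disc and provides the \<delta>.\<close>
    have "\<exists>n. 0 < measure lebesgue ({x. s + 2 * inverse (real (Suc n)) < u x} \<inter> ball x \<rho>)"
    proof (rule ccontr)
      assume "\<not> ?thesis"
      hence z: "measure lebesgue ({x. s + 2 * inverse (real (Suc n)) < u x} \<inter> ball x \<rho>) = 0" for n
        by (meson measure_nonneg order_antisym not_le)
      have "(\<Union>n. {x. s + 2 * inverse (real (Suc n)) < u x} \<inter> ball x \<rho>) \<in> null_sets lebesgue"
      proof (rule null_sets_UN)
        fix n
        have "{x. s + 2 * inverse (real (Suc n)) < u x} \<inter> ball x \<rho> \<in> lmeasurable"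
          by (rule lmeasurable_Int_ball[OF sup(1)[OF u]])
        thus "{x. s + 2 * inverse (real (Suc n)) < u x} \<inter> ball x \<rho> \<in> null_sets lebesgue"
          using z[of n] by (intro null_setsI) (auto simp: emeasure_eq_measure2 fmeasurableD)
      qed
      moreover have "E \<inter> ball x \<rho> \<subseteq> (\<Union>n. {x. s + 2 * inverse (real (Suc n)) < u x} \<inter> ball x \<rho>)"
      proof
        fix y assume y: "y \<in> E \<inter> ball x \<rho>"
        hence "0 < (u y - s) / 2" by (simp add: E_def)
        then obtain n where "inverse (real (Suc n)) < (u y - s) / 2" using reals_Archimedean by blast
        thus "y \<in> (\<Union>n. {x. s + 2 * inverse (real (Suc n)) < u x} \<inter> ball x \<rho>)"
          using y by (intro UN_I[of n]) auto
      qed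
      ultimately have "E \<inter> ball x \<rho> \<in> null_sets lebesgue"
        using null_sets_subset fmeasurableD[OF lmeasurable_Int_ball[OF Em]] by blast
      hence "measure lebesgue (E \<inter> ball x \<rho>) = 0" by (simp add: null_sets_def measure_def)
      thus False using p1[OF \<rho>(1)] by simp
    qed
    then obtain n :: nat where n: "0 < measure lebesgue ({x. s + 2 * inverse (real (Suc n)) < u x} \<inter> ball x \<rho>)" by blast
    define \<delta> where "\<delta> = inverse (real (Suc n))"
    have \<delta>: "\<delta> > 0" by (simp add: \<delta>_def)
    show "C * (pi * (r - \<rho>)\<^sup>2) \<le> measure lebesgue ({x. s < u x} \<inter> ball x r)"
    proof (rule density_limit[OF sup(1)[OF u] sup(1)[OF u] sup(1)[OF U] measure_deviation_tendsto_zero[OF u U lim \<delta>]])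
      show "{x. s + 2 * \<delta> < u x} \<subseteq> {x. s + \<delta> < U n x} \<union> {x. \<delta> < \<bar>U n x - u x\<bar>}" for n by auto
      show "{x. s + \<delta> < U n x} \<subseteq> {x. s < u x} \<union> {x. \<delta> < \<bar>U n x - u x\<bar>}" for n by auto
      show "0 < measure lebesgue ({x. s + 2 * \<delta> < u x} \<inter> ball x \<rho>)" using n by (simp add: \<delta>_def)
      show "C * (pi * q\<^sup>2) \<le> measure lebesgue ({x. s + \<delta> < U n x} \<inter> ball y q)"
        if "\<And>r'. r' > 0 \<Longrightarrow> 0 < measure lebesgue ({x. s + \<delta> < U n x} \<inter> ball y r')" "0 < q" "q \<le> r0" for n y q
        by (rule dens[where n=n and t="s + \<delta>"]) (use that s \<delta> in auto)
    qed (use \<rho> r in auto)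
  qed
  \<comment> \<open>For sublevel sets the shift enlarges the set on the right-hand side. The sets {u
    \<le> s + 2 \<delta>} decrease to {u \<le> s}, and continuity of the measure from above removes
    \<delta>.\<close>
  have le: "C * (pi * r\<^sup>2) \<le> measure lebesgue ({x. u x \<le> s + 2 * \<delta>} \<inter> ball x r)" if \<delta>: "\<delta> > 0" for \<delta>
  proof (rule disc_bound_radius_limit[OF _ r(1)])
    fix \<rho> assume \<rho>: "0 < \<rho>" "\<rho> < r"
    show "C * (pi * (r - \<rho>)\<^sup>2) \<le> measure lebesgue ({x. u x \<le> s + 2 * \<delta>} \<inter> ball x r)"
    proof (rule density_limit[OF sup(2)[OF u] sup(2)[OF u] sup(2)[OF U] measure_deviation_tendsto_zero[OF u U lim \<delta>]])
      show "{x. u x \<le> s} \<subseteq> {x. U n x \<le> s + \<delta>} \<union> {x. \<delta> < \<bar>U n x - u x\<bar>}" for n by auto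
      show "{x. U n x \<le> s + \<delta>} \<subseteq> {x. u x \<le> s + 2 * \<delta>} \<union> {x. \<delta> < \<bar>U n x - u x\<bar>}" for n by auto
      show "0 < measure lebesgue ({x. u x \<le> s} \<inter> ball x \<rho>)" by (rule p2[OF \<rho>(1)])
      show "C * (pi * q\<^sup>2) \<le> measure lebesgue ({x. U n x \<le> s + \<delta>} \<inter> ball y q)"
        if "\<And>r'. r' > 0 \<Longrightarrow> 0 < measure lebesgue ({x. U n x \<le> s + \<delta>} \<inter> ball y r')" "0 < q" "q \<le> r0" for n y q
        by (rule dens[where n=n and t="s + \<delta>"]) (use that s \<delta> in auto)
    qed (use \<rho> r in auto)
  qed
  define A where "A n = {x. u x \<le> s + 2 * inverse (real (Suc n))} \<inter> ball x r" for n
  have Al: "A n \<in> lmeasurable" for n unfolding A_def by (rule lmeasurable_Int_ball[OF sup(2)[OF u]])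
  have "(\<Inter>n. A n) = ball x r - {x. s < u x}"
  proof (intro equalityI subsetI)
    fix y assume y: "y \<in> (\<Inter>n. A n)"
    have "u y \<le> s"
    proof (rule ccontr)
      assume "\<not> u y \<le> s"
      hence "0 < (u y - s) / 2" by simp
      then obtain n where "inverse (real (Suc n)) < (u y - s) / 2" using reals_Archimedean by blast
      moreover have "y \<in> A n" using y by blast
      ultimately show False by (simp add: A_def)
    qed
    thus "y \<in> ball x r - {x. s < u x}" using y by (auto simp: A_def)
  next
    fix y assume y: "y \<in> ball x r - {x. s < u x}"
    have "u y \<le> s + 2 * inverse (real (Suc n))" for n
    proof -
      have "0 \<le> inverse (real (Suc n))" by simp
      moreover have "u y \<le> s" using y by auto
      ultimately show ?thesis by linarith
    qed
    thus "y \<in> (\<Inter>n. A n)" using y unfolding A_def by blast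
  qed
  moreover have "(\<lambda>n. measure lebesgue (A n)) \<longlonglongrightarrow> measure lebesgue (\<Inter>n. A n)"
  proof (rule Lim_measure_decseq)
    show "decseq A"
    proof (rule decseq_SucI)
      fix n
      have "inverse (real (Suc (Suc n))) \<le> inverse (real (Suc n))" by (intro le_imp_inverse_le) auto
      hence "s + 2 * inverse (real (Suc (Suc n))) \<le> s + 2 * inverse (real (Suc n))" by linarith
      thus "A (Suc n) \<subseteq> A n" unfolding A_def by (blast intro: order_trans)
    qed
    show "emeasure lebesgue (A n) \<noteq> \<infinity>" for n using Al[of n] by (auto simp: fmeasurable_def)
  qed (use Al fmeasurableD in blast)
  ultimately have tA: "(\<lambda>n. measure lebesgue (A n)) \<longlonglongrightarrow> measure lebesgue (ball x r - {x. s < u x})" by simp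
  have "C * (pi * r\<^sup>2) \<le> measure lebesgue (A n)" for n unfolding A_def by (rule le) simp
  hence "\<forall>\<^sub>F n in sequentially. C * (pi * r\<^sup>2) \<le> measure lebesgue (A n)" by (rule always_eventually[OF allI])
  thus "C * (pi * r\<^sup>2) \<le> measure lebesgue (ball x r - {x. s < u x})" by (rule tendsto_lowerbound[OF tA]) simp
qed

text \<open>The indicator of D and the two curvature bounds are replaced by arbitrary g, k1, k2, so
  that the same statement applies to the data and to the negated data.\<close>

lemma ROF_level_set_density:
  fixes k1 k2 :: "pt \<Rightarrow> ennreal"
  assumes \<alpha>: "\<alpha> > 0" and g: "g \<in> L2" "\<And>x. x \<notin> ball 0 1 \<Longrightarrow> g x = 0" and w: "w \<in> L2"
    and p: "dual_pair u (\<lambda>x. (g x + w x - u x) / \<alpha>)" and p0: "dual_pair u0 (\<lambda>x. (g x - u0 x) / \<alpha>)"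
    and \<eta>: "L2_norm w / \<alpha> \<le> \<eta>" "0 \<le> \<eta>"
    and k: "AE x in lebesgue. ennreal ((g x - u0 x) / \<alpha>) \<le> k1 x \<and> ennreal (- ((g x - u0 x) / \<alpha>)) \<le> k2 x"
    and hyp: "\<And>A \<kappa> x r. has_var_mean_curv A \<kappa> \<Longrightarrow> \<kappa> \<in> L2 \<Longrightarrow> 0 < r \<Longrightarrow> r \<le> r0 \<Longrightarrow>
        enn2ereal (\<integral>\<^sup>+ y\<in>A \<inter> ball x r. k1 y \<partial>lebesgue) \<le> ereal \<xi> * Per (ball x r \<inter> A) \<and>
        enn2ereal (\<integral>\<^sup>+ y\<in>A \<inter> ball x r. k2 y \<partial>lebesgue) \<le> ereal \<xi> * Per (ball x r \<inter> A)"
    and \<xi>: "0 \<le> \<xi>" "\<xi> + \<eta> / (2 * sqrt pi) < 1"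
    and s: "s > 0" and x: "x \<in> mboundary {x. s < u x}" and r: "0 < r" "r \<le> r0"
  shows "((1 - (\<xi> + \<eta> / (2 * sqrt pi))) / 2)\<^sup>2 \<le> measure lebesgue ({x. s < u x} \<inter> ball x r) / measure lebesgue (ball x r)"
    "((1 - (\<xi> + \<eta> / (2 * sqrt pi))) / 2)\<^sup>2 \<le> measure lebesgue (ball x r - {x. s < u x}) / measure lebesgue (ball x r)"
proof -
  obtain U V where UV: "\<And>n. dual_pair (U n) (V n)" "\<And>n. integrable lebesgue (V n)"
    "\<And>n. L2_norm (\<lambda>x. V n x - (g x - u0 x) / \<alpha>) \<le> L2_norm w / \<alpha>"
    and lim: "(\<lambda>n::nat. \<integral>x. (U n x - u x)\<^sup>2 \<partial>lebesgue) \<longlonglongrightarrow> 0"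
    using ROF_approximation[OF \<alpha> g w p p0] by blast
  have dens: "((1 - (\<xi> + \<eta> / (2 * sqrt pi))) / 2)\<^sup>2 * (pi * \<rho>\<^sup>2) \<le> measure lebesgue (F \<inter> ball y \<rho>)"
    if "t > 0" "F = {x. t < U n x} \<or> F = {x. U n x \<le> t}"
      "\<And>r'. r' > 0 \<Longrightarrow> 0 < measure lebesgue (F \<inter> ball y r')" "0 < \<rho>" "\<rho> \<le> r0" for n t F y \<rho>
    by (rule level_set_density[OF UV(1) that(1) dual_pairD(2)[OF p0] order_trans[OF UV(3) \<eta>(1)] \<eta>(2) k UV(2) hyp \<xi> that(2-5)])
  have b: "measure lebesgue (ball x r) = pi * r\<^sup>2" "0 < pi * r\<^sup>2" using r(1) by (auto simp: content_ball_pt)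
  note l = limit_level_set_density[OF dual_pairD(1)[OF p] dual_pairD(1)[OF UV(1)] lim dens s x r]
  show "((1 - (\<xi> + \<eta> / (2 * sqrt pi))) / 2)\<^sup>2 \<le> measure lebesgue ({x. s < u x} \<inter> ball x r) / measure lebesgue (ball x r)"
    unfolding b(1) pos_le_divide_eq[OF b(2)] by (rule l(1))
  show "((1 - (\<xi> + \<eta> / (2 * sqrt pi))) / 2)\<^sup>2 \<le> measure lebesgue (ball x r - {x. s < u x}) / measure lebesgue (ball x r)"
    unfolding b(1) pos_le_divide_eq[OF b(2)] by (rule l(2))
qed

theorem theorem6p5:
  fixes g2 :: "pt \<Rightarrow> real" and D :: "pt set" and \<xi>D r0 \<eta> :: real
  assumes g2: "admissible_g2 g2"
    and D_meas: "D \<in> sets lebesgue" and D_norm: "normalized D"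
    and D_sub: "D \<subseteq> ball 0 1" and D_per: "Per D < \<infinity>"
    and xi: "0 < \<xi>D" "\<xi>D < 1" and r0: "r0 > 0"
    and hyp: "\<And>A \<kappa> x r. has_var_mean_curv A \<kappa> \<Longrightarrow> \<kappa> \<in> L2 \<Longrightarrow> 0 < r \<Longrightarrow> r \<le> r0 \<Longrightarrow>
               enn2ereal (\<integral>\<^sup>+ y\<in>A \<inter> ball x r. kappa_plus g2 D y \<partial>lebesgue) \<le> ereal \<xi>D * Per (ball x r \<inter> A)
             \<and> enn2ereal (\<integral>\<^sup>+ y\<in>A \<inter> ball x r. kappa_minus g2 D y \<partial>lebesgue) \<le> ereal \<xi>D * Per (ball x r \<inter> A)"
    and eta: "0 \<le> \<eta>" "\<eta> < 2 * sqrt pi * (1 - \<xi>D)"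
  shows "\<exists>C0. 0 < C0 \<and> C0 < 1 \<and>
    (\<forall>\<alpha> w u. \<alpha> > 0 \<longrightarrow> w \<in> L2 \<longrightarrow> L2_norm w / \<alpha> \<le> \<eta> \<longrightarrow>
       ROF_minimizer \<alpha> (\<lambda>x. indicator D x + w x) u \<longrightarrow>
       (AE s in lborel. s \<noteq> 0 \<longrightarrow>
          (\<forall>x\<in>mboundary (level_set u s). \<forall>r. 0 < r \<and> r \<le> r0 \<longrightarrow>
             measure lebesgue (level_set u s \<inter> ball x r) / measure lebesgue (ball x r) \<ge> C0 \<and>
             measure lebesgue (ball x r - level_set u s) / measure lebesgue (ball x r) \<ge> C0)))"
proof (intro exI conjI allI impI)
  \<comment> \<open>The constant ((1 - \<theta>) / 2)^2 is the one of \<open>lower_density\<close>,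
    and the upper bound on \<eta> is equivalent to \<theta> < 1.\<close>
  define \<theta> where "\<theta> = \<xi>D + \<eta> / (2 * sqrt pi)"
  have \<theta>1: "\<xi>D + \<eta> / (2 * sqrt pi) < 1" using eta(2) by (simp add: field_simps)
  have \<theta>: "0 < \<theta>" "\<theta> < 1" using \<theta>1 xi eta(1) by (auto simp: \<theta>_def intro: add_pos_nonneg)
  have h: "0 < (1 - \<theta>) / 2" "(1 - \<theta>) / 2 < 1" using \<theta> by auto
  show "0 < ((1 - (\<xi>D + \<eta> / (2 * sqrt pi))) / 2)\<^sup>2" using h unfolding \<theta>_def[symmetric] by simp
  show "((1 - (\<xi>D + \<eta> / (2 * sqrt pi))) / 2)\<^sup>2 < 1"
    unfolding \<theta>_def[symmetric] by (rule power_less_one_iff[THEN iffD2]) (use h in auto)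
  fix \<alpha> w u assume \<alpha>: "\<alpha> > 0" and w: "w \<in> L2" and \<eta>: "L2_norm w / \<alpha> \<le> \<eta>"
    and m: "ROF_minimizer \<alpha> (\<lambda>x. indicator D x + w x) u"
  have Dl: "D \<in> lmeasurable" by (rule bounded_set_imp_lmeasurable[OF bounded_subset[OF bounded_ball D_sub] D_meas])
  have gL: "indicat_real D \<in> L2" by (rule L2_indicator[OF Dl])
  have gz: "indicat_real D x = 0" if "x \<notin> ball 0 1" for x using that D_sub by (auto simp: indicator_def)
  have p: "dual_pair u (\<lambda>x. (indicat_real D x + w x - u x) / \<alpha>)"
    by (rule ROF_minimizer_dual_pair[OF \<alpha> L2_add[OF gL w] m])
  obtain u0 where p0: "dual_pair u0 (\<lambda>x. (indicat_real D x - u0 x) / \<alpha>)" using ROF_exists[OF \<alpha> gL] by blast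
  note k = kappa_bounds[OF g2 D_meas D_sub \<alpha> p0]
  \<comment> \<open>For s < 0 the set {u < s} is the superlevel set of -u at height -s. Negating u,
    w and the indicator of D gives a problem of the same form in which the bounds by
    \<open>kappa_plus\<close> and \<open>kappa_minus\<close> are exchanged.\<close>
  have p': "dual_pair (\<lambda>x. - u x) (\<lambda>x. (- indicat_real D x + - w x - - u x) / \<alpha>)"
    using dual_pair_minus[OF p] by (simp add: minus_divide_left algebra_simps)
  have p0': "dual_pair (\<lambda>x. - u0 x) (\<lambda>x. (- indicat_real D x - - u0 x) / \<alpha>)"
    using dual_pair_minus[OF p0] by (simp add: minus_divide_left algebra_simps)
  have k': "AE x in lebesgue. ennreal ((- indicat_real D x - - u0 x) / \<alpha>) \<le> kappa_minus g2 D x \<and>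
      ennreal (- ((- indicat_real D x - - u0 x) / \<alpha>)) \<le> kappa_plus g2 D x"
    using k by eventually_elim (simp add: minus_divide_left algebra_simps)
  have \<eta>': "L2_norm (\<lambda>x. - w x) / \<alpha> \<le> \<eta>" using \<eta> by (simp add: L2_norm_def)
  have hyp': "enn2ereal (\<integral>\<^sup>+ y\<in>A \<inter> ball x r. kappa_minus g2 D y \<partial>lebesgue) \<le> ereal \<xi>D * Per (ball x r \<inter> A)
      \<and> enn2ereal (\<integral>\<^sup>+ y\<in>A \<inter> ball x r. kappa_plus g2 D y \<partial>lebesgue) \<le> ereal \<xi>D * Per (ball x r \<inter> A)"
    if "has_var_mean_curv A \<kappa>" "\<kappa> \<in> L2" "0 < r" "r \<le> r0" for A \<kappa> x r
    using hyp[OF that, of x] by blast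
  have xi0: "0 \<le> \<xi>D" using xi(1) by simp
  have gz': "- indicat_real D x = 0" if "x \<notin> ball 0 1" for x using gz[OF that] by simp
  show "AE s in lborel. s \<noteq> 0 \<longrightarrow>
    (\<forall>x\<in>mboundary (level_set u s). \<forall>r. 0 < r \<and> r \<le> r0 \<longrightarrow>
       measure lebesgue (level_set u s \<inter> ball x r) / measure lebesgue (ball x r) \<ge> ((1 - (\<xi>D + \<eta> / (2 * sqrt pi))) / 2)\<^sup>2 \<and>
       measure lebesgue (ball x r - level_set u s) / measure lebesgue (ball x r) \<ge> ((1 - (\<xi>D + \<eta> / (2 * sqrt pi))) / 2)\<^sup>2)"
  \<comment> \<open>The estimate is obtained for every nonzero s, which is more than almost every
    s.\<close>
  proof (intro AE_I2 impI ballI allI)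
    fix s :: real and x r assume s: "s \<noteq> 0" and x: "x \<in> mboundary (level_set u s)" and r: "0 < r \<and> r \<le> r0"
    show "measure lebesgue (level_set u s \<inter> ball x r) / measure lebesgue (ball x r) \<ge> ((1 - (\<xi>D + \<eta> / (2 * sqrt pi))) / 2)\<^sup>2 \<and>
       measure lebesgue (ball x r - level_set u s) / measure lebesgue (ball x r) \<ge> ((1 - (\<xi>D + \<eta> / (2 * sqrt pi))) / 2)\<^sup>2"
    proof (cases "s > 0")
      case True
      hence e: "level_set u s = {x. s < u x}" by (simp add: level_set_def)
      note l = ROF_level_set_density[OF \<alpha> gL gz w p p0 \<eta> eta(1) k hyp xi0 \<theta>1 True x[unfolded e] r[THEN conjunct1] r[THEN conjunct2]]
      show ?thesis unfolding e by (rule conjI[OF l(1) l(2)])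
    next
      case False
      hence s': "- s > 0" using s by simp
      have e: "level_set u s = {x. - s < - u x}" using False by (simp add: level_set_def)
      note l = ROF_level_set_density[OF \<alpha> L2_minus[OF gL] gz' L2_minus[OF w] p' p0' \<eta>' eta(1) k' hyp' xi0 \<theta>1 s' x[unfolded e] r[THEN conjunct1] r[THEN conjunct2]]
      show ?thesis unfolding e by (rule conjI[OF l(1) l(2)])
    qed
  qed
qed

end
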